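(* Let $\alpha_1,\beta_1\in\mathbb R$, $\mu_1\in\mathbb C$, and consider on $\mathbb T$ the equation $$ i\partial_t\phi+|\phi|^2\partial_{xx}\phi+\alpha_1\phi|\partial_x\phi|^2+\beta_1\overline{\phi}(\partial_x\phi)^2+\mu_1|\phi|^2\phi=0. \qquad (\ast)$$ Let $\sigma_c=-(\frac{\alpha_1}{2}+\beta_1-1)$ and $s_c=\max\{2,\lfloor\sigma_c-\frac12\rfloor+1\}$. For any $\epsilon>0$ and $s_0\ge s_c+2$, there exists initial data $\phi_0\in C^\infty(\mathbb T)$ with $\|\phi_0\|_{C^{s_0}}<\epsilon$ for which there is no solution of $(\ast)$ with $\phi(t=0)=\phi_0$ belonging to $L^\infty([0,\delta];C^{s_c+2}(\mathbb T))$, for any $\delta>0$.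
   Context: $\mathbb T$ is the one-dimensional torus; $C^{s}$ for integer $s$ denotes the space of $s$ times continuously differentiable functions with its usual norm. *)

theory Defs
  imports "HOL-Analysis.Analysis"
begin

text \<open>Functions on the torus T = R / 2 pi Z are represented as 2 pi-periodic
  functions real => complex.\<close>

definition tper :: "(real \<Rightarrow> complex) \<Rightarrow> bool" where
  "tper f \<longleftrightarrow> (\<forall>x. f (x + 2 * pi) = f x)"

definition Dx :: "(real \<Rightarrow> complex) \<Rightarrow> real \<Rightarrow> complex" where
  "Dx f = (\<lambda>x. vector_derivative f (at x))"

definition Ck :: "nat \<Rightarrow> (real \<Rightarrow> complex) \<Rightarrow> bool" where
  "Ck k f \<longleftrightarrow> tper f \<and>
     (\<forall>j<k. \<forall>x. ((Dx ^^ j) f) differentiable (at x)) \<and>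
     continuous_on UNIV ((Dx ^^ k) f)"

definition Cinf :: "(real \<Rightarrow> complex) \<Rightarrow> bool" where
  "Cinf f \<longleftrightarrow> (\<forall>k. Ck k f)"

definition Cnorm :: "nat \<Rightarrow> (real \<Rightarrow> complex) \<Rightarrow> real" where
  "Cnorm k f = (\<Sum>j\<le>k. (SUP x. norm ((Dx ^^ j) f x)))"

definition sigma_c :: "real \<Rightarrow> real \<Rightarrow> real" where
  "sigma_c \<alpha> \<beta> = - (\<alpha> / 2 + \<beta> - 1)"

definition s_c :: "real \<Rightarrow> real \<Rightarrow> int" where
  "s_c \<alpha> \<beta> = max 2 (\<lfloor>sigma_c \<alpha> \<beta> - 1/2\<rfloor> + 1)"

text \<open>Nonlinearity L(u)(x), so that the equation reads i phi_t + L(phi) = 0,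
  i.e. phi_t = i * L(phi).\<close>
definition NL :: "real \<Rightarrow> real \<Rightarrow> complex \<Rightarrow> (real \<Rightarrow> complex) \<Rightarrow> real \<Rightarrow> complex" where
  "NL \<alpha> \<beta> \<mu> u x =
     complex_of_real ((cmod (u x))\<^sup>2) * Dx (Dx u) x
     + complex_of_real \<alpha> * u x * complex_of_real ((cmod (Dx u x))\<^sup>2)
     + complex_of_real \<beta> * cnj (u x) * (Dx u x)\<^sup>2
     + \<mu> * complex_of_real ((cmod (u x))\<^sup>2) * u x"

definition is_Linf_Ck_solution ::
  "real \<Rightarrow> real \<Rightarrow> complex \<Rightarrow> nat \<Rightarrow> real \<Rightarrow> (real \<Rightarrow> complex) \<Rightarrow> (real \<Rightarrow> real \<Rightarrow> complex) \<Rightarrow> bool" where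
  "is_Linf_Ck_solution \<alpha> \<beta> \<mu> k \<delta> \<phi>0 \<phi> \<longleftrightarrow>
     (\<forall>t\<in>{0..\<delta>}. tper (\<phi> t)) \<and>
     (\<exists>M. AE t in lborel. t \<in> {0..\<delta>} \<longrightarrow> Ck k (\<phi> t) \<and> Cnorm k (\<phi> t) \<le> M) \<and>
     (\<forall>t\<in>{0..\<delta>}. \<forall>x.
        ((\<lambda>\<tau>. \<i> * NL \<alpha> \<beta> \<mu> (\<phi> \<tau>) x) has_integral (\<phi> t x - \<phi>0 x)) {0..t})"

end

(* Take the data eta * sin x plus a small perturbation that is flat at 0 and pi. A C^k solution keeps
   vanishing at these two points, where |phi|^2 is about eta^2 x^2, so the linearised equation is
   i w_t + eta^2 x^2 w_xx + ...; in y = ln x this is a Schroedinger equation with first order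
   terms, and packets of frequency l in y travel into the zero at speed 2 eta^2 l.

   For a set S of naturals let phi_S = eta sin x + Sum_{j in S} exp(-nu_j) packet_j, where
   nu_j = 8^(j+J) and packet_j has frequency nu_j^5 in y; this is smooth and small. Let S and S' first
   differ at m, suppose that both data have solutions with the same bound M and the same life span,
   and write nu = nu_m. The difference w of the solutions is O(sin^k x), and the energy
   int |v|^(-2 sigma) |w|^2, v being the average of the two solutions, stays comparable to its
   initial value, since with this weight the top order terms form an exact flux. The pairing of w with an
   explicit approximate solution of the adjoint equation is therefore almost conserved for a time
   nu^(-3). By then the packet has moved so close to the zero that w = O(sin^k x) makes the
   pairing at most C exp(-2 eta^2 nu^2), far below its initial size, which is of order exp(-nu). So m is
   bounded in terms of M and the life span. If every phi_S had a solution, the sets S would thus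
   split into countably many finite classes, which is absurd. *)

theory Submission
  imports Defs "HOL-Real_Asymp.Real_Asymp"
begin

section \<open>Classical solutions\<close>

text \<open>No exact solution is at hand to perturb around, not even for the data
  \<open>\<eta> * sin x\<close>; so two hypothetical solutions are compared with each other, and the
  contradiction comes from counting sets rather than from one explicit datum. The critical
  regularity enters through \<open>\<sigma> + 3 / 2 < k\<close>. The adjoint waves grow like
  \<open>sin x powr (- (\<sigma> + 1 / 2))\<close> at a zero, and against a difference of size
  \<open>sin x ^ k\<close> their pairing and its boundary flux must still be O(sin x). The number
  floor(sigma - 1/2) + 3 is the least integer above sigma + 3/2. The linearised equation is only
  real linear: the alpha term couples w to the conjugate of w_x. A single wave is therefore no
  approximate solution; a reflected wave of relative size 1/l is added. For amplitude a = exp(-nu),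
  frequency l = nu^5 and time tau = nu^(-3), the drift of the pairing relative to a is tau (1 + tau
  l) = nu^(-3) + nu^(-1), while l tau = nu^2 makes exp(-2 eta^2 l tau) beat a. The weights are
  singular at the zeros, so all integrals are cut off at a distance kappa, which tends to 0 only at
  the end.\<close>

lemma vector_derivative_bound:
  fixes f :: "real \<Rightarrow> 'a::real_normed_vector"
  assumes "convex S"
    and "\<And>z. z \<in> S \<Longrightarrow> (f has_vector_derivative f' z) (at z within S)"
    and "\<And>z. z \<in> S \<Longrightarrow> norm (f' z) \<le> B"
    and "x \<in> S" "y \<in> S"
  shows "norm (f x - f y) \<le> B * \<bar>x - y\<bar>"
proof -
  have "norm (f x - f y) \<le> B * norm (x - y)"
  proof (rule differentiable_bound[OF assms(1) _ _ assms(4,5)])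
    show "(f has_derivative (\<lambda>h. h *\<^sub>R f' z)) (at z within S)" if "z \<in> S" for z
      using assms(2)[OF that] by (simp add: has_vector_derivative_def)
    show "onorm (\<lambda>h. h *\<^sub>R f' z) \<le> B" if "z \<in> S" for z
    proof (rule onorm_le)
      fix h :: real
      show "norm (h *\<^sub>R f' z) \<le> B * norm h"
        using mult_left_mono[OF assms(3)[OF that] abs_ge_zero[of h]] by (simp add: mult.commute)
    qed
  qed
  then show ?thesis by simp
qed

text \<open>With a uniform \<open>L\<close>, a remainder bound of this form passes to pointwise
  limits and to series. Derivatives of limits in time and of the sum of packets are obtained in this
  way.\<close>

lemma has_vector_derivative_of_quadratic_remainder:
  fixes f :: "real \<Rightarrow> 'a::real_normed_vector"
  assumes "\<And>y. norm (f y - f x - (y - x) *\<^sub>R d) \<le> L * (y - x)\<^sup>2"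
  shows "(f has_vector_derivative d) (at x)"
  unfolding has_vector_derivative_def
proof (rule has_derivativeI_sandwich[where e=1 and s=UNIV and H="\<lambda>y. \<bar>L\<bar> * \<bar>y - x\<bar>"])
  show "bounded_linear (\<lambda>h::real. h *\<^sub>R d)"
    by (rule bounded_linear_scaleR_left)
  show "((\<lambda>y. \<bar>L\<bar> * \<bar>y - x\<bar>) \<longlongrightarrow> 0) (at x within UNIV)"
    by (auto intro!: tendsto_eq_intros)
  fix y :: real assume "y \<noteq> x"
  then have pos: "0 < norm (y - x)" by simp
  have "norm (f y - f x - (y - x) *\<^sub>R d) \<le> \<bar>L\<bar> * (y - x)\<^sup>2"
    using assms[of y] mult_right_mono[OF abs_ge_self[of L] zero_le_power2[of "y - x"]] by linarith
  also have "\<dots> = (\<bar>L\<bar> * \<bar>y - x\<bar>) * norm (y - x)"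
    by (simp add: power2_eq_square)
  finally show "norm (f y - f x - (y - x) *\<^sub>R d) / norm (y - x) \<le> \<bar>L\<bar> * \<bar>y - x\<bar>"
    using pos_divide_le_eq[OF pos] by blast
qed simp_all

text \<open>The estimate for the shifted family bounds the derivative of the remainder, and the mean
  value inequality on the segment from \<open>x0\<close> to \<open>x\<close> raises the exponent by
  one. A Lipschitz bound on \<open>F n\<close> replaces the derivative of order
  \<open>n + 1\<close>.\<close>

lemma taylor_lipschitz:
  fixes F :: "nat \<Rightarrow> real \<Rightarrow> complex"
  assumes "\<And>i x. i < n \<Longrightarrow> (F i has_vector_derivative F (Suc i) x) (at x)"
    and "\<And>x y. norm (F n x - F n y) \<le> L * \<bar>x - y\<bar>"
    and "\<And>i. i < n \<Longrightarrow> F i x0 = 0"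
  shows "norm (F 0 x - ((x - x0) ^ n / fact n) *\<^sub>R F n x0) \<le> L * \<bar>x - x0\<bar> ^ (n + 1)"
  using assms
proof (induction n arbitrary: F x)
  case 0
  then show ?case by simp
next
  case (Suc n)
  have L: "0 \<le> L"
    using Suc.prems(2)[of 1 0] order_trans[OF norm_ge_zero] by fastforce
  let ?c = "F (Suc n) x0"
  have IH: "norm (F 1 y - ((y - x0) ^ n / fact n) *\<^sub>R ?c) \<le> L * \<bar>y - x0\<bar> ^ (n + 1)" for y
    using Suc.IH[of "\<lambda>i. F (Suc i)" y] Suc.prems by auto
  define G where "G = (\<lambda>y. F 0 y - ((y - x0) ^ Suc n / fact (Suc n)) *\<^sub>R ?c)"
  have G0: "G x0 = 0" using Suc.prems(3)[of 0] by (simp add: G_def)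
  have dG: "(G has_vector_derivative (F 1 y - ((y - x0) ^ n / fact n) *\<^sub>R ?c)) (at y within S)" for y S
  proof -
    have 1: "(F 0 has_vector_derivative F 1 y) (at y within S)"
      using Suc.prems(1)[of 0 y] has_vector_derivative_at_within by auto
    have 2: "((\<lambda>y. ((y - x0) ^ Suc n / fact (Suc n))) has_real_derivative ((y - x0) ^ n / fact n)) (at y within S)"
    proof -
      have "((\<lambda>y. (y - x0) ^ Suc n) has_real_derivative (1 + real n) * (y - x0) ^ n) (at y within S)"
      proof -
        have "((\<lambda>y. y - x0) has_real_derivative 1) (at y within S)" by (auto intro!: derivative_eq_intros)
        from DERIV_power_Suc[OF this] show ?thesis by simp
      qed
      from DERIV_cdivide[OF this, of "fact (Suc n)"]
      have 3: "((\<lambda>y. (y - x0) ^ Suc n / fact (Suc n)) has_real_derivative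
        (1 + real n) * (y - x0) ^ n / fact (Suc n)) (at y within S)" .
      have 4: "(1 + real n) * (y - x0) ^ n / fact (Suc n) = (y - x0) ^ n / fact n"
      proof -
        have "1 + real n \<noteq> 0" by linarith
        then show ?thesis by (simp add: divide_simps del: of_nat_Suc)
      qed
      show ?thesis using 3 unfolding 4 .
    qed
    show ?thesis unfolding G_def
      by (rule has_vector_derivative_diff[OF 1])
         (use has_vector_derivative_scaleR[OF 2 has_vector_derivative_const[of ?c]] in simp)
  qed
  have "norm (G x - G x0) \<le> (L * \<bar>x - x0\<bar> ^ (n + 1)) * \<bar>x - x0\<bar>"
  proof (rule vector_derivative_bound[of "closed_segment x0 x"])
    fix z assume z: "z \<in> closed_segment x0 x"
    show "(G has_vector_derivative (F 1 z - ((z - x0) ^ n / fact n) *\<^sub>R ?c)) (at z within closed_segment x0 x)"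
      by (rule dG)
    have "\<bar>z - x0\<bar> \<le> \<bar>x - x0\<bar>"
      using z by (auto simp: closed_segment_eq_real_ivl split: if_splits)
    then have "\<bar>z - x0\<bar> ^ (n + 1) \<le> \<bar>x - x0\<bar> ^ (n + 1)" by (intro power_mono) auto
    then show "norm (F 1 z - ((z - x0) ^ n / fact n) *\<^sub>R ?c) \<le> L * \<bar>x - x0\<bar> ^ (n + 1)"
      using IH[of z] mult_left_mono[OF _ L] by fastforce
  qed auto
  then show ?case using G0 by (simp add: G_def mult_ac)
qed

text \<open>One Taylor step of length \<open>h\<close>, to be optimised by the user: it turns
  uniform smallness of a function into uniform smallness of its derivative.\<close>

lemma landau_interpolation:
  fixes f :: "real \<Rightarrow> complex"
  assumes "\<And>x. (f has_vector_derivative f' x) (at x)"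
    and "\<And>x y. norm (f' x - f' y) \<le> L * \<bar>x - y\<bar>"
    and "\<And>x. norm (f x) \<le> e" and "h > 0"
  shows "norm (f' x) \<le> 2 * e / h + L * h"
proof -
  define F where "F = (\<lambda>i::nat. if i = 0 then (\<lambda>y. f y - f x) else f')"
  have "norm (F 0 (x + h) - ((x + h - x) ^ 1 / fact 1) *\<^sub>R F 1 x) \<le> L * \<bar>x + h - x\<bar> ^ (1 + 1)"
  proof (rule taylor_lipschitz)
    fix i :: nat and y :: real assume "i < 1"
    then show "(F i has_vector_derivative F (Suc i) y) (at y)"
      using assms(1)[of y] by (auto simp: F_def intro!: derivative_eq_intros)
  qed (use assms(2) in \<open>auto simp: F_def\<close>)
  then have 1: "norm (f (x + h) - f x - h *\<^sub>R f' x) \<le> L * h\<^sup>2"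
    using \<open>h > 0\<close> by (simp add: F_def power2_eq_square)
  have "norm (h *\<^sub>R f' x) \<le> norm (f (x + h)) + norm (f x) + norm (f (x + h) - f x - h *\<^sub>R f' x)"
    using norm_triangle_ineq4[of "f (x + h) - f x" "f (x + h) - f x - h *\<^sub>R f' x"]
      norm_triangle_ineq4[of "f (x + h)" "f x"] by simp
  also have "\<dots> \<le> e + e + L * h\<^sup>2" using 1 assms(3) by (intro add_mono) auto
  finally have "h * norm (f' x) \<le> 2 * e + L * h\<^sup>2" using \<open>h > 0\<close> by simp
  then have "norm (f' x) \<le> (2 * e + L * h\<^sup>2) / h" using \<open>h > 0\<close> by (simp add: field_simps)
  also have "\<dots> = 2 * e / h + L * h" using \<open>h > 0\<close> by (simp add: field_simps power2_eq_square)
  finally show ?thesis .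
qed

text \<open>The nonlinearity as a polynomial in three numbers, so that it applies to limits of
  derivatives that are not literally iterates of \<open>Dx\<close>.\<close>

definition nl :: "real \<Rightarrow> real \<Rightarrow> complex \<Rightarrow> complex \<Rightarrow> complex \<Rightarrow> complex \<Rightarrow> complex" where
  "nl \<alpha> \<beta> \<mu> u p q = of_real ((cmod u)\<^sup>2) * q + of_real \<alpha> * u * of_real ((cmod p)\<^sup>2)
     + of_real \<beta> * cnj u * p\<^sup>2 + \<mu> * of_real ((cmod u)\<^sup>2) * u"

lemma NL_eq_nl: "NL \<alpha> \<beta> \<mu> u x = nl \<alpha> \<beta> \<mu> (u x) (Dx u x) (Dx (Dx u) x)"
  by (simp add: NL_def nl_def)

definition bigA :: "real \<Rightarrow> real \<Rightarrow> complex \<Rightarrow> real" where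
  "bigA \<alpha> \<beta> \<mu> = 1 + \<bar>\<alpha>\<bar> + \<bar>\<beta>\<bar> + cmod \<mu>"

lemma bigA_ge_1: "bigA \<alpha> \<beta> \<mu> \<ge> 1"
  by (simp add: bigA_def)

text \<open>Every term contains an undifferentiated factor \<open>u\<close> or its conjugate. The
  bound linear in \<open>cmod u\<close> is what keeps zeros of the data in place.\<close>

lemma norm_nl_le:
  assumes "cmod u \<le> M" "cmod p \<le> M" "cmod q \<le> M"
  shows "cmod (nl \<alpha> \<beta> \<mu> u p q) \<le> bigA \<alpha> \<beta> \<mu> * M\<^sup>2 * cmod u"
proof -
  have M: "0 \<le> M" using assms(1) norm_ge_zero order_trans by blast
  have 1: "cmod (of_real ((cmod u)\<^sup>2) * q) \<le> M\<^sup>2 * cmod u"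
  proof -
    have "cmod u * cmod q \<le> M * M" using assms M by (intro mult_mono) auto
    then show ?thesis using mult_right_mono[of "cmod u * cmod q" "M*M" "cmod u"]
      by (simp add: norm_mult power2_eq_square mult_ac)
  qed
  have p: "(cmod p)\<^sup>2 \<le> M\<^sup>2" and u: "(cmod u)\<^sup>2 \<le> M\<^sup>2" using assms by (auto intro: power_mono)
  have 2: "cmod (of_real \<alpha> * u * of_real ((cmod p)\<^sup>2)) \<le> \<bar>\<alpha>\<bar> * (M\<^sup>2 * cmod u)"
    using mult_left_mono[OF mult_right_mono[OF p norm_ge_zero[of u]], of "\<bar>\<alpha>\<bar>"]
    by (simp add: norm_mult mult_ac norm_power)
  have 3: "cmod (of_real \<beta> * cnj u * p\<^sup>2) \<le> \<bar>\<beta>\<bar> * (M\<^sup>2 * cmod u)"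
    using mult_left_mono[OF mult_right_mono[OF p norm_ge_zero[of u]], of "\<bar>\<beta>\<bar>"]
    by (simp add: norm_mult mult_ac norm_power)
  have 4: "cmod (\<mu> * of_real ((cmod u)\<^sup>2) * u) \<le> cmod \<mu> * (M\<^sup>2 * cmod u)"
    using mult_left_mono[OF mult_right_mono[OF u norm_ge_zero[of u]], of "cmod \<mu>"]
    by (simp add: norm_mult mult_ac norm_power)
  have "cmod (nl \<alpha> \<beta> \<mu> u p q) \<le> M\<^sup>2 * cmod u + \<bar>\<alpha>\<bar> * (M\<^sup>2 * cmod u) + \<bar>\<beta>\<bar> * (M\<^sup>2 * cmod u) + cmod \<mu> * (M\<^sup>2 * cmod u)"
    unfolding nl_def by (intro norm_triangle_le add_mono 1 2 3 4)
  then show ?thesis by (simp add: bigA_def algebra_simps)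
qed

text \<open>\<open>U j t\<close> stands for the \<open>j\<close>-th space derivative of the solution at time \<open>t\<close>; the
  derivative of order \<open>m + 1\<close> is replaced by a Lipschitz condition on \<open>U m t\<close>.\<close>

definition csol :: "real \<Rightarrow> real \<Rightarrow> complex \<Rightarrow> nat \<Rightarrow> real \<Rightarrow> real \<Rightarrow> (nat \<Rightarrow> real \<Rightarrow> real \<Rightarrow> complex) \<Rightarrow> bool" where
  "csol \<alpha> \<beta> \<mu> m M T U \<longleftrightarrow>
     (\<forall>t\<in>{0..T}. \<forall>x. \<forall>j<m. (U j t has_vector_derivative U (Suc j) t x) (at x)) \<and>
     (\<forall>t\<in>{0..T}. \<forall>x. \<forall>j\<le>m. norm (U j t x) \<le> M) \<and>
     (\<forall>t\<in>{0..T}. \<forall>x y. norm (U m t x - U m t y) \<le> M * \<bar>x - y\<bar>) \<and>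
     (\<forall>j\<le>m. continuous_on ({0..T} \<times> UNIV) (\<lambda>(t, x). U j t x)) \<and>
     (\<forall>t\<in>{0..T}. \<forall>x. ((\<lambda>t. U 0 t x) has_vector_derivative
        \<i> * nl \<alpha> \<beta> \<mu> (U 0 t x) (U 1 t x) (U 2 t x)) (at t within {0..T}))"

lemma csol_mono:
  assumes "csol \<alpha> \<beta> \<mu> m M T U" "M \<le> M'" "T' \<le> T"
  shows "csol \<alpha> \<beta> \<mu> m M' T' U"
proof -
  have sub: "{0..T'} \<subseteq> {0..T}" using assms by auto
  have "norm (U m t x - U m t y) \<le> M' * \<bar>x - y\<bar>" if "t \<in> {0..T'}" for t x y
  proof -
    have "norm (U m t x - U m t y) \<le> M * \<bar>x - y\<bar>" using assms(1) sub that by (auto simp: csol_def)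
    also have "\<dots> \<le> M' * \<bar>x - y\<bar>" using assms by (intro mult_right_mono) auto
    finally show ?thesis .
  qed
  moreover have "norm (U j t x) \<le> M'" if "t \<in> {0..T'}" "j \<le> m" for t x j
    using assms sub that unfolding csol_def by (meson order_trans subsetD)
  moreover have "continuous_on ({0..T'} \<times> UNIV) (\<lambda>(t, x). U j t x)" if "j \<le> m" for j
    using assms sub that unfolding csol_def
    by (auto intro: continuous_on_subset[of "{0..T} \<times> UNIV"])
  moreover have "((\<lambda>t. U 0 t x) has_vector_derivative
        \<i> * nl \<alpha> \<beta> \<mu> (U 0 t x) (U 1 t x) (U 2 t x)) (at t within {0..T'})" if "t \<in> {0..T'}" for t x
  proof (rule has_vector_derivative_within_subset[OF _ sub])
    show "((\<lambda>t. U 0 t x) has_vector_derivative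
        \<i> * nl \<alpha> \<beta> \<mu> (U 0 t x) (U 1 t x) (U 2 t x)) (at t within {0..T})"
      using assms sub that unfolding csol_def by blast
  qed
  moreover have "(U j t has_vector_derivative U (Suc j) t x) (at x)" if "t \<in> {0..T'}" "j < m" for t x j
    using assms(1) sub that unfolding csol_def by blast
  ultimately show ?thesis unfolding csol_def by simp
qed

section \<open>Periodic functions and the C^k norm\<close>

lemma has_vector_derivative_translate:
  fixes f :: "real \<Rightarrow> complex"
  shows "((\<lambda>x. f (x + c)) has_vector_derivative D) (at x) \<longleftrightarrow> (f has_vector_derivative D) (at (x + c))"
proof -
  have *: "((\<lambda>x. f (x + c)) has_vector_derivative D) (at x)"
    if "(f has_vector_derivative D) (at (x + c))" for f :: "real \<Rightarrow> complex" and x c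
  proof -
    have "((\<lambda>x. x + c) has_vector_derivative 1) (at x)" by (auto intro!: derivative_eq_intros)
    from vector_diff_chain_at[OF this that] show ?thesis by (simp add: o_def)
  qed
  show ?thesis using *[of f x c] *[of "\<lambda>x. f (x + c)" "x + c" "- c"] by auto
qed

lemma tper_Dx: "tper (Dx f)" if "tper f"
proof -
  from that have "(f has_vector_derivative D) (at (x + 2 * pi)) \<longleftrightarrow> (f has_vector_derivative D) (at x)" for x D
    using has_vector_derivative_translate[of f "2 * pi" D x] by (simp add: tper_def)
  then show ?thesis by (simp add: tper_def Dx_def vector_derivative_def)
qed

lemma tper_Dx_pow: "tper f \<Longrightarrow> tper ((Dx ^^ j) f)"
  by (induction j) (auto intro: tper_Dx)

lemma bounded_of_tper:
  assumes "tper f" "continuous_on UNIV f"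
  shows "bounded (range f)"
proof -
  have per: "f (x + 2 * pi * of_int n) = f x" for x n
  proof (induction n rule: int_induct[where k=0])
    case (step1 i)
    have "f (x + 2 * pi * of_int (i + 1)) = f (x + 2 * pi * of_int i + 2 * pi)" by (simp add: algebra_simps)
    then show ?case using step1 assms(1) by (simp add: tper_def)
  next
    case (step2 i)
    have "f (x + 2 * pi * of_int i) = f (x + 2 * pi * of_int (i - 1) + 2 * pi)" by (simp add: algebra_simps)
    then show ?case using step2 assms(1) by (simp add: tper_def)
  qed simp
  have "range f \<subseteq> f ` {0..2 * pi}"
  proof
    fix z assume "z \<in> range f"
    then obtain x where z: "z = f x" by auto
    let ?n = "\<lfloor>x / (2 * pi)\<rfloor>"
    have "of_int ?n \<le> x / (2 * pi)" "x / (2 * pi) \<le> of_int ?n + 1" by linarith+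
    then have "of_int ?n * (2 * pi) \<le> x" "x \<le> (of_int ?n + 1) * (2 * pi)"
      using pos_le_divide_eq[of "2 * pi" "of_int ?n" x] pos_divide_le_eq[of "2 * pi" x "of_int ?n + 1"] pi_gt_zero
      by linarith+
    then have "x - 2 * pi * of_int ?n \<in> {0..2 * pi}"
      by (auto simp: algebra_simps)
    moreover have "z = f (x - 2 * pi * of_int ?n)" using per[of x "- ?n"] z by simp
    ultimately show "z \<in> f ` {0..2 * pi}" by blast
  qed
  moreover have "compact (f ` {0..2 * pi})"
    using assms(2) by (intro compact_continuous_image) (auto intro: continuous_on_subset)
  ultimately show ?thesis using bounded_subset compact_imp_bounded by blast
qed

lemma Ck_derivative:
  assumes "Ck k f" "j < k"
  shows "((Dx ^^ j) f has_vector_derivative (Dx ^^ Suc j) f x) (at x)"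
  using assms vector_derivative_works[of "(Dx ^^ j) f" "at x"] by (simp add: Ck_def Dx_def)

text \<open>A real-valued \<open>SUP\<close> says something only about a bounded set; periodicity
  and continuity of the derivatives provide the bounds.\<close>

lemma Ck_norm_le:
  assumes "Ck k f" "j \<le> k"
  shows "norm ((Dx ^^ j) f x) \<le> Cnorm k f"
proof -
  have "bounded (range (\<lambda>x. norm ((Dx ^^ i) f x)))" if "i \<le> k" for i
  proof -
    have "continuous_on UNIV ((Dx ^^ i) f)"
    proof (cases "i = k")
      case False
      then have "i < k" using that by simp
      then show ?thesis using Ck_derivative[OF assms(1)]
        by (meson continuous_at_imp_continuous_on has_vector_derivative_continuous)
    qed (use assms in \<open>simp add: Ck_def\<close>)
    then have "bounded (range ((Dx ^^ i) f))"
      using assms by (intro bounded_of_tper tper_Dx_pow) (auto simp: Ck_def)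
    then show ?thesis by (simp add: bounded_norm_comp)
  qed
  then have bdd: "bdd_above (range (\<lambda>x. norm ((Dx ^^ i) f x)))" if "i \<le> k" for i
    using bounded_imp_bdd_above that by (metis (no_types, lifting))
  have "norm ((Dx ^^ j) f x) \<le> (SUP x. norm ((Dx ^^ j) f x))"
    using bdd[OF assms(2)] by (intro cSUP_upper) auto
  also have "\<dots> \<le> Cnorm k f" unfolding Cnorm_def
  proof (rule member_le_sum)
    fix i assume "i \<in> {..k} - {j}"
    then show "0 \<le> (SUP x. norm ((Dx ^^ i) f x))"
      using cSUP_upper2[OF bdd[of i], of 0 0] by auto
  qed (use assms in auto)
  finally show ?thesis .
qed

text \<open>The \<open>C^k\<close> bound is given only for almost every time, the integral equation
  for every time. The latter makes the solution Lipschitz in time; interpolation between this and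
  the bounded derivatives makes the derivatives of order up to \<open>k - 1\<close> uniformly Cauchy
  over the good times, and their limits define \<open>U\<close> at all times. The derivative of
  order \<open>k\<close> survives as a Lipschitz bound.\<close>

lemma solution_is_classical:
  assumes sol: "is_Linf_Ck_solution \<alpha> \<beta> \<mu> k \<delta> \<phi>0 \<phi>" and k: "k \<ge> 4" and \<delta>: "\<delta> > 0"
  shows "\<exists>U M. csol \<alpha> \<beta> \<mu> (k - 1) M \<delta> U \<and> U 0 0 = \<phi>0"
proof -
  let ?D = "\<lambda>j t x. (Dx ^^ j) (\<phi> t) x"
  obtain M0 where M0: "AE t in lborel. t \<in> {0..\<delta>} \<longrightarrow> Ck k (\<phi> t) \<and> Cnorm k (\<phi> t) \<le> M0"
    using sol unfolding is_Linf_Ck_solution_def by blast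
  define M where "M = max M0 1"
  have M1: "M \<ge> 1" by (simp add: M_def)
  define Good where "Good = {t\<in>{0..\<delta>}. Ck k (\<phi> t) \<and> Cnorm k (\<phi> t) \<le> M0}"
  obtain Bad where Bad: "Bad \<in> null_sets lborel"
    "{t \<in> space lborel. \<not> (t \<in> {0..\<delta>} \<longrightarrow> Ck k (\<phi> t) \<and> Cnorm k (\<phi> t) \<le> M0)} \<subseteq> Bad"
    using AE_E[OF M0] by (metis (no_types, lifting) null_setsI)
  have negBad: "negligible Bad"
    using Bad(1) by (simp add: negligible_iff_null_sets null_sets_completionI)
  have good: "t \<in> Good" if "t \<in> {0..\<delta>}" "t \<notin> Bad" for t
    using that Bad(2) by (auto simp: Good_def)
  have Dbound: "norm (?D j t x) \<le> M" if "t \<in> Good" "j \<le> k" for j t x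
    using Ck_norm_le[of k "\<phi> t" j x] that by (auto simp: Good_def M_def)
  have Dder: "(?D j t has_vector_derivative ?D (Suc j) t x) (at x)" if "t \<in> Good" "j < k" for j t x
    using Ck_derivative[of k "\<phi> t" j x] that by (auto simp: Good_def)
  have Dlip: "norm (?D j t x - ?D j t y) \<le> M * \<bar>x - y\<bar>" if "t \<in> Good" "j < k" for j t x y
    using vector_derivative_bound[of UNIV "?D j t" "?D (Suc j) t" M x y] Dder[OF that] Dbound[OF that(1), of "Suc j"] that(2) by auto
  define K where "K = bigA \<alpha> \<beta> \<mu> * M\<^sup>2 * M"
  have K0: "K > 0" unfolding K_def using bigA_ge_1[of \<alpha> \<beta> \<mu>] M1
    by (intro mult_pos_pos) (auto intro: zero_less_power)
  have NLb: "norm (\<i> * NL \<alpha> \<beta> \<mu> (\<phi> t) x) \<le> K" if "t \<in> Good" for t x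
  proof -
    have "norm (NL \<alpha> \<beta> \<mu> (\<phi> t) x) \<le> bigA \<alpha> \<beta> \<mu> * M\<^sup>2 * norm (\<phi> t x)"
      unfolding NL_eq_nl using Dbound[OF that, of 0 x] Dbound[OF that, of 1 x] Dbound[OF that, of 2 x] k
      by (intro norm_nl_le) (simp_all add: numeral_2_eq_2)
    also have "\<dots> \<le> K" unfolding K_def
      using Dbound[OF that, of 0 x] bigA_ge_1[of \<alpha> \<beta> \<mu>] by (intro mult_left_mono) auto
    finally show ?thesis by (simp add: norm_mult)
  qed
  \<comment> \<open>Keeps \<open>Dx ^^ Suc j\<close> folded, in the form in which the facts about
    \<open>?D (Suc j)\<close> are stated.\<close>
  note funpow.simps(2) [simp del]
  have int: "((\<lambda>\<tau>. \<i> * NL \<alpha> \<beta> \<mu> (\<phi> \<tau>) x) has_integral (\<phi> t x - \<phi>0 x)) {0..t}" if "t \<in> {0..\<delta>}" for t x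
    using sol that unfolding is_Linf_Ck_solution_def by blast
  have lip1: "norm (\<phi> t x - \<phi> s x) \<le> K * (t - s)" if "0 \<le> s" "s \<le> t" "t \<le> \<delta>" for s t x
  proof -
    let ?f = "\<lambda>\<tau>. \<i> * NL \<alpha> \<beta> \<mu> (\<phi> \<tau>) x"
    have it: "?f integrable_on {0..t}" and It: "integral {0..t} ?f = \<phi> t x - \<phi>0 x"
      using int[of t x] that by (auto simp: has_integral_iff)
    have Is: "integral {0..s} ?f = \<phi> s x - \<phi>0 x"
      using int[of s x] that by (auto simp: has_integral_iff)
    have "integral {0..s} ?f + integral {s..t} ?f = integral {0..t} ?f"
      using that it by (intro Henstock_Kurzweil_Integration.integral_combine) auto
    then have "integral {s..t} ?f = integral {0..t} ?f - integral {0..s} ?f" by (metis add_diff_cancel_left')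
    also have "\<dots> = \<phi> t x - \<phi> s x" unfolding It Is by simp
    finally have eq: "integral {s..t} ?f = \<phi> t x - \<phi> s x" .
    have "?f integrable_on {s..t}" using integrable_subinterval_real[OF it, of s t] that by auto
    then have hi: "(?f has_integral (\<phi> t x - \<phi> s x)) {s..t}" using eq by (simp add: has_integral_iff)
    \<comment> \<open>\<open>NLb\<close> holds at good times only. Setting the integrand to 0 on the
      null set of bad times makes the bound global without changing the integral.\<close>
    define g where "g = (\<lambda>\<tau>. if \<tau> \<in> Good then ?f \<tau> else 0)"
    have "(g has_integral (\<phi> t x - \<phi> s x)) {s..t}"
      by (rule has_integral_spike[OF negBad _ hi]) (use good that in \<open>auto simp: g_def\<close>)
    then have "(g has_integral (\<phi> t x - \<phi> s x)) (cbox s t)" by simp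
    then have "norm (\<phi> t x - \<phi> s x) \<le> K * measure lborel (cbox s t)"
      using has_integral_bound[of K g _ s t] K0 NLb by (auto simp: g_def)
    then show ?thesis using that by simp
  qed
  have lip: "norm (\<phi> t x - \<phi> s x) \<le> K * \<bar>t - s\<bar>" if "s \<in> {0..\<delta>}" "t \<in> {0..\<delta>}" for s t x
    using lip1[of s t x] lip1[of t s x] that by (cases "s \<le> t") (auto simp: norm_minus_commute)
  have cauchy: "\<exists>d>0. \<forall>s\<in>Good. \<forall>s'\<in>Good. \<bar>s - s'\<bar> < d \<longrightarrow> (\<forall>x. norm (?D j s x - ?D j s' x) \<le> e)"
    if "j \<le> k - 1" "e > 0" for j e
    using that
  proof (induction j arbitrary: e)
    case 0
    have "norm (\<phi> s x - \<phi> s' x) \<le> e" if "s \<in> Good" "s' \<in> Good" "\<bar>s - s'\<bar> < e / K" for s s' x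
    proof -
      have "norm (\<phi> s x - \<phi> s' x) \<le> K * \<bar>s - s'\<bar>" using that by (intro lip) (auto simp: Good_def)
      also have "\<dots> \<le> e" using that(3) K0 by (simp add: field_simps)
      finally show ?thesis .
    qed
    then show ?case using K0 0 by (intro exI[of _ "e / K"]) auto
  next
    case (Suc j)
    \<comment> \<open>With this step length the two terms \<open>2 * (e * h / 4) / h\<close> and
      \<open>2 * M * h\<close> of the interpolation are \<open>e / 2\<close> each.\<close>
    define h where "h = e / (4 * M)"
    have h: "h > 0" using Suc M1 by (simp add: h_def)
    have "e * h / 4 > 0" using h Suc by simp
    from Suc.IH[OF _ this] Suc.prems obtain d where d: "d > 0"
      "\<And>s s' x. s \<in> Good \<Longrightarrow> s' \<in> Good \<Longrightarrow> \<bar>s - s'\<bar> < d \<Longrightarrow> norm (?D j s x - ?D j s' x) \<le> e * h / 4"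
      by fastforce
    have "norm (?D (Suc j) s x - ?D (Suc j) s' x) \<le> e" if ss: "s \<in> Good" "s' \<in> Good" "\<bar>s - s'\<bar> < d" for s s' x
    proof -
      have "norm (?D (Suc j) s x - ?D (Suc j) s' x) \<le> 2 * (e * h / 4) / h + (2 * M) * h"
      proof (rule landau_interpolation[OF _ _ _ h])
        show "((\<lambda>x. ?D j s x - ?D j s' x) has_vector_derivative (?D (Suc j) s x - ?D (Suc j) s' x)) (at x)" for x
          using Dder[OF ss(1), of j x] Dder[OF ss(2), of j x] Suc.prems by (intro has_vector_derivative_diff) auto
        show "norm (?D (Suc j) s x - ?D (Suc j) s' x - (?D (Suc j) s y - ?D (Suc j) s' y)) \<le> 2 * M * \<bar>x - y\<bar>" for x y
        proof -
          have "norm (?D (Suc j) s x - ?D (Suc j) s y) \<le> M * \<bar>x - y\<bar>"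
            "norm (?D (Suc j) s' x - ?D (Suc j) s' y) \<le> M * \<bar>x - y\<bar>"
            using Dlip ss Suc.prems k by auto
          then show ?thesis
            using norm_triangle_ineq4[of "?D (Suc j) s x - ?D (Suc j) s y" "?D (Suc j) s' x - ?D (Suc j) s' y"]
            by (simp add: algebra_simps)
        qed
        show "norm (?D j s x - ?D j s' x) \<le> e * h / 4" for x using d ss by auto
      qed
      also have "\<dots> = e" using h M1 by (simp add: h_def field_simps)
      finally show ?thesis .
    qed
    then show ?case using d(1) by blast
  qed
  have dense: "\<exists>s\<in>Good. \<bar>s - t\<bar> < e" if "t \<in> {0..\<delta>}" "e > 0" for t e
  proof (rule ccontr)
    assume no: "\<not> (\<exists>s\<in>Good. \<bar>s - t\<bar> < e)"
    let ?a = "max 0 (t - e / 2)" and ?b = "min \<delta> (t + e / 2)"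
    have ab: "?a < ?b" using that \<delta> by auto
    have "{?a..?b} \<subseteq> Bad"
    proof
      fix s assume s: "s \<in> {?a..?b}"
      then have "\<bar>s - t\<bar> < e" using that by auto
      then show "s \<in> Bad" using no good[of s] s by auto
    qed
    then have "negligible (cbox ?a ?b)" using negBad negligible_subset by auto
    then show False using ab by (simp only: negligible_interval) auto
  qed
  \<comment> \<open>Good times converging to \<open>t\<close>: limits along them replace derivatives
    at times where \<open>\<phi> t\<close> is not known to be smooth.\<close>
  define \<tau> where "\<tau> = (\<lambda>t n. SOME s. s \<in> Good \<and> \<bar>s - t\<bar> < 1 / real (Suc n))"
  have \<tau>: "\<tau> t n \<in> Good \<and> \<bar>\<tau> t n - t\<bar> < 1 / real (Suc n)" if "t \<in> {0..\<delta>}" for t n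
  proof -
    have "\<exists>s. s \<in> Good \<and> \<bar>s - t\<bar> < 1 / real (Suc n)"
      using dense[OF that, of "1 / real (Suc n)"] by auto
    then show ?thesis unfolding \<tau>_def by (rule someI_ex)
  qed
  have \<tau>lim: "(\<lambda>n. \<tau> t n) \<longlonglongrightarrow> t" if "t \<in> {0..\<delta>}" for t
  proof (rule LIMSEQ_I)
    fix r :: real assume "0 < r"
    then obtain N where N: "1 / real (Suc N) < r" by (meson nat_approx_posE)
    have "norm (\<tau> t n - t) < r" if n: "N \<le> n" for n
    proof -
      have "1 / real (Suc n) \<le> 1 / real (Suc N)" using n by (intro divide_left_mono) auto
      then show ?thesis using N \<tau>[OF \<open>t \<in> {0..\<delta>}\<close>, of n] by (simp only: real_norm_def) linarith
    qed
    then show "\<exists>no. \<forall>n\<ge>no. norm (\<tau> t n - t) < r" by blast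
  qed
  define U where "U = (\<lambda>j t x. lim (\<lambda>n. ?D j (\<tau> t n) x))"
  have Ulim: "(\<lambda>n. ?D j (\<tau> t n) x) \<longlonglongrightarrow> U j t x" if t: "t \<in> {0..\<delta>}" and j: "j \<le> k - 1" for j t x
  proof -
    have "Cauchy (\<lambda>n. ?D j (\<tau> t n) x)"
    proof (rule CauchyI)
      fix e :: real assume e: "0 < e"
      then obtain d where d: "d > 0" "\<And>s s' x. s \<in> Good \<Longrightarrow> s' \<in> Good \<Longrightarrow> \<bar>s - s'\<bar> < d \<Longrightarrow> norm (?D j s x - ?D j s' x) \<le> e / 2"
        using cauchy[OF j, of "e / 2"] by auto
      have "Cauchy (\<lambda>n. \<tau> t n)" using \<tau>lim[OF t] by (rule LIMSEQ_imp_Cauchy)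
      then obtain N where N: "\<And>m n. m \<ge> N \<Longrightarrow> n \<ge> N \<Longrightarrow> norm (\<tau> t m - \<tau> t n) < d"
        using CauchyD d(1) by blast
      have "norm (?D j (\<tau> t m) x - ?D j (\<tau> t n) x) < e" if "m \<ge> N" "n \<ge> N" for m n
      proof -
        have "norm (?D j (\<tau> t m) x - ?D j (\<tau> t n) x) \<le> e / 2"
          using N[OF that] \<tau>[OF t] by (intro d(2)) auto
        then show ?thesis using e by simp
      qed
      then show "\<exists>M. \<forall>m\<ge>M. \<forall>n\<ge>M. norm (?D j (\<tau> t m) x - ?D j (\<tau> t n) x) < e" by blast
    qed
    then show ?thesis unfolding U_def by (simp add: Cauchy_convergent convergent_LIMSEQ_iff[symmetric])
  qed
  have tG: "\<tau> t n \<in> Good" if "t \<in> {0..\<delta>}" for t n using \<tau>[OF that] by blast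
  have Ub: "norm (U j t x) \<le> M" if "t \<in> {0..\<delta>}" "j \<le> k - 1" for j t x
    by (rule LIMSEQ_le_const2[OF tendsto_norm[OF Ulim[OF that]]])
      (use Dbound tG that in auto)
  have Ulip: "norm (U j t x - U j t y) \<le> M * \<bar>x - y\<bar>" if "t \<in> {0..\<delta>}" "j \<le> k - 1" for j t x y
    by (rule LIMSEQ_le_const2[OF tendsto_norm[OF tendsto_diff[OF Ulim[OF that] Ulim[OF that]]]])
      (use Dlip tG that k in auto)
  have Uder: "(U j t has_vector_derivative U (Suc j) t x) (at x)" if t: "t \<in> {0..\<delta>}" and j: "j < k - 1" for j t x
  proof (rule has_vector_derivative_of_quadratic_remainder)
    fix y
    have j1: "j \<le> k - 1" "Suc j \<le> k - 1" using j by auto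
    have "norm (?D j (\<tau> t n) y - ?D j (\<tau> t n) x - (y - x) *\<^sub>R ?D (Suc j) (\<tau> t n) x) \<le> M * (y - x)\<^sup>2" for n
    proof -
      define F where "F = (\<lambda>i::nat. if i = 0 then (\<lambda>y. ?D j (\<tau> t n) y - ?D j (\<tau> t n) x) else ?D (Suc j) (\<tau> t n))"
      have "norm (F 0 y - ((y - x) ^ 1 / fact 1) *\<^sub>R F 1 x) \<le> M * \<bar>y - x\<bar> ^ (1 + 1)"
      proof (rule taylor_lipschitz)
        fix i :: nat and z :: real assume "i < 1"
        then show "(F i has_vector_derivative F (Suc i) z) (at z)"
          using Dder[OF tG[OF t], of j n z] j by (auto simp: F_def intro!: derivative_eq_intros)
      qed (use Dlip[OF tG[OF t], of "Suc j"] j k in \<open>auto simp: F_def\<close>)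
      then show ?thesis by (simp add: F_def power2_eq_square)
    qed
    then show "norm (U j t y - U j t x - (y - x) *\<^sub>R U (Suc j) t x) \<le> M * (y - x)\<^sup>2"
      by (intro LIMSEQ_le_const2[OF tendsto_norm[OF tendsto_diff[OF tendsto_diff[OF Ulim[OF t j1(1)] Ulim[OF t j1(1)]]
          tendsto_scaleR[OF tendsto_const Ulim[OF t j1(2)]]]]]) auto
  qed
  have Ucont: "continuous_on ({0..\<delta>} \<times> UNIV) (\<lambda>(t, x). U j t x)" if j: "j \<le> k - 1" for j
    unfolding continuous_on_iff
  proof (intro ballI allI impI)
    fix p :: "real \<times> real" and e :: real
    assume p: "p \<in> {0..\<delta>} \<times> UNIV" and e: "0 < e"
    obtain t x where px: "p = (t, x)" by (cases p)
    obtain d where d: "d > 0" "\<And>s s' x. s \<in> Good \<Longrightarrow> s' \<in> Good \<Longrightarrow> \<bar>s - s'\<bar> < d \<Longrightarrow> norm (?D j s x - ?D j s' x) \<le> e / 4"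
      using cauchy[OF j, of "e / 4"] e by auto
    define r where "r = min d (e / (4 * M))"
    have r: "r > 0" using d e M1 by (simp add: r_def)
    have "dist (U j t' x') (U j t x) < e" if t': "t' \<in> {0..\<delta>}" and close: "dist (t', x') (t, x) < r" for t' x'
    proof -
      have tt: "\<bar>t' - t\<bar> < r" "\<bar>x' - x\<bar> < r"
        using close dist_fst_le[of "(t', x')" "(t, x)"] dist_snd_le[of "(t', x')" "(t, x)"]
        by (auto simp: dist_real_def)
      have t: "t \<in> {0..\<delta>}" using p px by auto
      have "(\<lambda>n. \<bar>\<tau> t' n - \<tau> t n\<bar>) \<longlonglongrightarrow> \<bar>t' - t\<bar>"
        by (intro tendsto_intros \<tau>lim t t')
      then have "eventually (\<lambda>n. \<bar>\<tau> t' n - \<tau> t n\<bar> < d) sequentially"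
        using tt by (intro order_tendstoD(2)) (auto simp: r_def)
      then have ev: "eventually (\<lambda>n. norm (?D j (\<tau> t' n) x - ?D j (\<tau> t n) x) \<le> e / 4) sequentially"
        by eventually_elim (use d(2) tG t t' in auto)
      have "norm (U j t' x - U j t x) \<le> e / 4"
        by (rule tendsto_upperbound[OF tendsto_norm[OF tendsto_diff[OF Ulim[OF t' j] Ulim[OF t j]]] ev]) auto
      moreover have "norm (U j t' x' - U j t' x) \<le> M * \<bar>x' - x\<bar>" by (rule Ulip[OF t' j])
      moreover have "M * \<bar>x' - x\<bar> \<le> e / 4"
      proof -
        have "\<bar>x' - x\<bar> \<le> e / (4 * M)" using tt by (auto simp: r_def)
        then have "M * \<bar>x' - x\<bar> \<le> M * (e / (4 * M))" using M1 by (intro mult_left_mono) auto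
        then show ?thesis using M1 by simp
      qed
      ultimately have "norm (U j t' x' - U j t x) \<le> e / 4 + e / 4"
        using norm_triangle_ineq[of "U j t' x' - U j t' x" "U j t' x - U j t x"] by simp
      then show ?thesis using e by (simp add: dist_norm)
    qed
    then show "\<exists>r>0. \<forall>q\<in>{0..\<delta>} \<times> UNIV. dist q p < r \<longrightarrow>
        dist (case q of (t, x) \<Rightarrow> U j t x) (case p of (t, x) \<Rightarrow> U j t x) < e"
      using r px by (intro exI[of _ r]) auto
  qed
  \<comment> \<open>This includes the bad times, because \<open>\<phi>\<close> is Lipschitz in time
    at every point; hence the integral equation can be rewritten in terms of \<open>U\<close> for
    all times.\<close>
  have U0: "U 0 t = \<phi> t" if t: "t \<in> {0..\<delta>}" for t
  proof
    fix x
    have "(\<lambda>n. \<phi> (\<tau> t n) x - \<phi> t x) \<longlonglongrightarrow> 0"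
    proof (rule Lim_null_comparison)
      show "eventually (\<lambda>n. norm (\<phi> (\<tau> t n) x - \<phi> t x) \<le> K * \<bar>\<tau> t n - t\<bar>) sequentially"
        using lip[of t _ x] tG[OF t] t by (auto simp: Good_def)
      have "(\<lambda>n. K * \<bar>\<tau> t n - t\<bar>) \<longlonglongrightarrow> K * \<bar>t - t\<bar>"
        by (intro tendsto_intros \<tau>lim t)
      then show "(\<lambda>n. K * \<bar>\<tau> t n - t\<bar>) \<longlonglongrightarrow> 0" by simp
    qed
    then have "(\<lambda>n. \<phi> (\<tau> t n) x) \<longlonglongrightarrow> \<phi> t x" by (rule LIM_zero_cancel)
    moreover have "(\<lambda>n. \<phi> (\<tau> t n) x) \<longlonglongrightarrow> U 0 t x" using Ulim[OF t, of 0 x] by simp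
    ultimately show "U 0 t x = \<phi> t x" using LIMSEQ_unique by blast
  qed
  have DU: "Dx (U j t) = U (Suc j) t" if "t \<in> {0..\<delta>}" "j < k - 1" for j t
    unfolding Dx_def using vector_derivative_at[OF Uder[OF that]] by auto
  have NLU: "NL \<alpha> \<beta> \<mu> (\<phi> t) x = nl \<alpha> \<beta> \<mu> (U 0 t x) (U 1 t x) (U 2 t x)" if "t \<in> {0..\<delta>}" for t x
    using DU[OF that, of 0] DU[OF that, of 1] k U0[OF that] by (simp add: NL_eq_nl numeral_2_eq_2)
  have Uc1: "continuous_on {0..\<delta>} (\<lambda>t. U j t x)" if "j \<le> k - 1" for j x
  proof -
    have "continuous_on {0..\<delta>} (\<lambda>t. case (t, x) of (t, x) \<Rightarrow> U j t x)"
      by (rule continuous_on_compose2[OF Ucont[OF that]]) (auto intro!: continuous_intros)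
    then show ?thesis by simp
  qed
  have Utime: "((\<lambda>t. U 0 t x) has_vector_derivative \<i> * nl \<alpha> \<beta> \<mu> (U 0 t x) (U 1 t x) (U 2 t x)) (at t within {0..\<delta>})"
    if t: "t \<in> {0..\<delta>}" for t x
  proof -
    let ?f = "\<lambda>\<tau>. \<i> * nl \<alpha> \<beta> \<mu> (U 0 \<tau> x) (U 1 \<tau> x) (U 2 \<tau> x)"
    have cf: "continuous_on {0..\<delta>} ?f"
      unfolding nl_def using k by (intro continuous_intros Uc1) auto
    have eq: "integral {0..s} ?f + \<phi>0 x = U 0 s x" if s: "s \<in> {0..\<delta>}" for s
    proof -
      have "(?f has_integral (\<phi> s x - \<phi>0 x)) {0..s}"
        by (rule has_integral_eq[OF _ int[OF s]]) (use NLU s in auto)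
      then have "integral {0..s} ?f = \<phi> s x - \<phi>0 x" by (rule integral_unique)
      then show ?thesis unfolding U0[OF s] by (simp only: diff_add_cancel)
    qed
    have "((\<lambda>s. integral {0..s} ?f + \<phi>0 x) has_vector_derivative ?f t) (at t within {0..\<delta>})"
      using has_vector_derivative_add[OF integral_has_vector_derivative[OF cf t] has_vector_derivative_const[of "\<phi>0 x"]]
      unfolding add_0_right .
    then show ?thesis
      by (rule has_vector_derivative_transform[OF t, rotated]) (rule eq[symmetric])
  qed
  have "U 0 0 = \<phi>0"
  proof
    fix x
    have "((\<lambda>\<tau>. \<i> * NL \<alpha> \<beta> \<mu> (\<phi> \<tau>) x) has_integral (\<phi> 0 x - \<phi>0 x)) {0..0}"
      using int[of 0 x] \<delta> by auto
    then have "\<phi> 0 x - \<phi>0 x = 0"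
      using has_integral_unique[OF _ has_integral_refl(2)[of _ 0]] by fastforce
    then show "U 0 0 x = \<phi>0 x" using U0[of 0] \<delta> by auto
  qed
  moreover have "csol \<alpha> \<beta> \<mu> (k - 1) M \<delta> U"
    unfolding csol_def using Uder Ub Ulip Ucont Utime by blast
  ultimately show ?thesis by blast
qed

section \<open>Two solutions and the vanishing of their difference\<close>

lemma
  assumes "csol \<alpha> \<beta> \<mu> m M T U" "t \<in> {0..T}"
  shows csol_deriv: "j < m \<Longrightarrow> (U j t has_vector_derivative U (Suc j) t x) (at x)"
    and csol_bound: "j \<le> m \<Longrightarrow> norm (U j t x) \<le> M"
    and csol_time: "((\<lambda>t. U 0 t x) has_vector_derivative
        \<i> * nl \<alpha> \<beta> \<mu> (U 0 t x) (U 1 t x) (U 2 t x)) (at t within {0..T})"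
proof -
  note c = assms(1)[unfolded csol_def] and t = assms(2)
  show "j < m \<Longrightarrow> (U j t has_vector_derivative U (Suc j) t x) (at x)"
    using conjunct1[OF c] t by blast
  show "j \<le> m \<Longrightarrow> norm (U j t x) \<le> M"
    using conjunct1[OF conjunct2[OF c]] t by blast
  show "((\<lambda>t. U 0 t x) has_vector_derivative
        \<i> * nl \<alpha> \<beta> \<mu> (U 0 t x) (U 1 t x) (U 2 t x)) (at t within {0..T})"
    using conjunct2[OF conjunct2[OF conjunct2[OF conjunct2[OF c]]]] t by blast
qed

lemma csol_cont: "csol \<alpha> \<beta> \<mu> m M T U \<Longrightarrow> j \<le> m \<Longrightarrow> continuous_on ({0..T} \<times> UNIV) (\<lambda>(t, x). U j t x)"
  unfolding csol_def by blast

lemma csol_lip: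
  assumes c: "csol \<alpha> \<beta> \<mu> m M T U" and t: "t \<in> {0..T}" and j: "j \<le> m"
  shows "norm (U j t x - U j t y) \<le> M * \<bar>x - y\<bar>"
proof (cases "j = m")
  case True
  then show ?thesis using c t unfolding csol_def by blast
next
  case False
  then have "j < m" using j by simp
  then show ?thesis
    using vector_derivative_bound[of UNIV "U j t" "U (Suc j) t" M x y] csol_deriv[OF c t, of j] csol_bound[OF c t, of "Suc j"] by auto
qed

text \<open>The time derivative is at most a multiple of \<open>|u|\<close>, so the deviation from
  the data, taken at the time of its maximum, is absorbed for short times. The bound is relative to
  the datum at the same \<open>x\<close>, so zeros persist and so does the comparison with
  \<open>\<eta> * sin x\<close>.\<close>

lemma csol_near_initial:
  assumes c: "csol \<alpha> \<beta> \<mu> m M T U" and m: "m \<ge> 2" and t: "t \<in> {0..T}"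
    and small: "bigA \<alpha> \<beta> \<mu> * M\<^sup>2 * T \<le> 1 / 2"
  shows "norm (U 0 t x - U 0 0 x) \<le> 2 * bigA \<alpha> \<beta> \<mu> * M\<^sup>2 * t * norm (U 0 0 x)"
proof -
  let ?C = "bigA \<alpha> \<beta> \<mu> * M\<^sup>2"
  have C: "?C \<ge> 0" using bigA_ge_1[of \<alpha> \<beta> \<mu>] by simp
  define h where "h = (\<lambda>s. norm (U 0 s x - U 0 0 x))"
  have der: "((\<lambda>s. U 0 s x) has_vector_derivative \<i> * nl \<alpha> \<beta> \<mu> (U 0 s x) (U 1 s x) (U 2 s x)) (at s within {0..t})"
    if "s \<in> {0..t}" for s
    using csol_time[OF c, of s x] that t by (auto intro: has_vector_derivative_within_subset)
  then have "continuous_on {0..t} (\<lambda>s. U 0 s x)"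
    unfolding continuous_on_eq_continuous_within by (blast intro: has_vector_derivative_continuous)
  then have "continuous_on {0..t} h" unfolding h_def by (intro continuous_intros)
  then obtain s0 where s0: "s0 \<in> {0..t}" "\<And>s. s \<in> {0..t} \<Longrightarrow> h s \<le> h s0"
    using continuous_attains_sup[of "{0..t}" h] t by auto
  let ?S = "h s0"
  have "norm (U 0 s0 x - U 0 0 x) \<le> (?C * (norm (U 0 0 x) + ?S)) * \<bar>s0 - 0\<bar>"
  proof (rule vector_derivative_bound[of "{0..t}", OF _ der])
    fix s assume s: "s \<in> {0..t}"
    then have sT: "s \<in> {0..T}" using t by auto
    have "norm (nl \<alpha> \<beta> \<mu> (U 0 s x) (U 1 s x) (U 2 s x)) \<le> ?C * norm (U 0 s x)"
      using csol_bound[OF c sT] m by (intro norm_nl_le) auto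
    also have "\<dots> \<le> ?C * (norm (U 0 0 x) + ?S)"
      using s0(2)[OF s] norm_triangle_sub[of "U 0 s x" "U 0 0 x"] C
      by (intro mult_left_mono) (auto simp: h_def)
    finally show "norm (\<i> * nl \<alpha> \<beta> \<mu> (U 0 s x) (U 1 s x) (U 2 s x)) \<le> ?C * (norm (U 0 0 x) + ?S)"
      by (simp add: norm_mult)
  qed (use s0 t in auto)
  also have "\<dots> \<le> (?C * (norm (U 0 0 x) + ?S)) * t"
    using s0(1) C by (intro mult_left_mono mult_nonneg_nonneg[OF C]) (auto simp: h_def)
  also have "\<dots> = ?C * t * norm (U 0 0 x) + (?C * t) * ?S" by (simp add: algebra_simps)
  also have "\<dots> \<le> ?C * t * norm (U 0 0 x) + 1 / 2 * ?S"
  proof -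
    have "?C * t \<le> ?C * T" using t C by (intro mult_left_mono) auto
    then show ?thesis using small by (intro add_left_mono mult_right_mono) (auto simp: h_def)
  qed
  finally have "?S \<le> 2 * (?C * t * norm (U 0 0 x))" by (simp add: h_def)
  then show ?thesis using s0(2)[of t] t by (simp add: h_def algebra_simps)
qed

text \<open>Here \<open>r\<close> is the distance to a common zero. Each derivative falling on the
  difference is paid for by one factor \<open>r\<close>, the scaling under which all Taylor terms of
  the difference have the same size.\<close>

lemma norm_nl_diff_le:
  assumes "cmod u \<le> M * r" "cmod v \<le> M * r" "r \<ge> 0" "M \<ge> 0"
    "cmod u \<le> M" "cmod v \<le> M" "cmod u1 \<le> M" "cmod v1 \<le> M" "cmod u2 \<le> M"
  shows "cmod (nl \<alpha> \<beta> \<mu> v v1 v2 - nl \<alpha> \<beta> \<mu> u u1 u2)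
    \<le> 3 * bigA \<alpha> \<beta> \<mu> * M\<^sup>2 * (r\<^sup>2 * cmod (v2 - u2) + r * cmod (v1 - u1) + cmod (v - u))"
proof -
  define w w1 w2 where w: "w = v - u" "w1 = v1 - u1" "w2 = v2 - u2"
  let ?X = "M\<^sup>2 * (r\<^sup>2 * cmod w2 + r * cmod w1 + cmod w)"
  have sq: "\<bar>(cmod a)\<^sup>2 - (cmod b)\<^sup>2\<bar> \<le> (2 * M) * cmod (a - b)" if "cmod a \<le> M" "cmod b \<le> M" for a b
  proof -
    have "(cmod a)\<^sup>2 - (cmod b)\<^sup>2 = (cmod a + cmod b) * (cmod a - cmod b)"
      by (simp add: power2_eq_square algebra_simps)
    then have "\<bar>(cmod a)\<^sup>2 - (cmod b)\<^sup>2\<bar> = (cmod a + cmod b) * \<bar>cmod a - cmod b\<bar>"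
      by (simp add: abs_mult)
    also have "\<dots> \<le> (2 * M) * cmod (a - b)"
      using that norm_triangle_ineq3[of a b] assms(4) by (intro mult_mono) auto
    finally show ?thesis .
  qed
  have u2: "(cmod a)\<^sup>2 \<le> M\<^sup>2" if "cmod a \<le> M" for a using that by (auto intro: power_mono)
  have t1: "of_real ((cmod v)\<^sup>2) * v2 - of_real ((cmod u)\<^sup>2) * u2
      = of_real ((cmod v)\<^sup>2) * w2 + of_real ((cmod v)\<^sup>2 - (cmod u)\<^sup>2) * u2"
    by (simp add: w algebra_simps)
  have b1: "cmod (of_real ((cmod v)\<^sup>2) * v2 - of_real ((cmod u)\<^sup>2) * u2) \<le> 3 * ?X"
  proof -
    have "cmod (of_real ((cmod v)\<^sup>2) * w2) \<le> (M * r)\<^sup>2 * cmod w2"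
      using assms by (auto simp: norm_mult norm_power intro!: mult_right_mono power_mono)
    moreover have "cmod (of_real ((cmod v)\<^sup>2 - (cmod u)\<^sup>2) * u2) \<le> ((2 * M) * cmod w) * M"
      unfolding norm_mult norm_of_real using sq[of v u] assms by (intro mult_mono) (auto simp: w)
    moreover have "0 \<le> M\<^sup>2 * (r * cmod w1)" "0 \<le> M\<^sup>2 * (r\<^sup>2 * cmod w2)" "0 \<le> M\<^sup>2 * cmod w" using assms by auto
    ultimately show ?thesis unfolding t1
      by (intro norm_triangle_le) (simp add: power_mult_distrib power2_eq_square algebra_simps)
  qed
  have t2: "v * of_real ((cmod v1)\<^sup>2) - u * of_real ((cmod u1)\<^sup>2)
     = w * of_real ((cmod v1)\<^sup>2) + u * of_real ((cmod v1)\<^sup>2 - (cmod u1)\<^sup>2)"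
    by (simp add: w algebra_simps)
  have b2: "cmod (v * of_real ((cmod v1)\<^sup>2) - u * of_real ((cmod u1)\<^sup>2)) \<le> 3 * ?X"
  proof -
    have "cmod (w * of_real ((cmod v1)\<^sup>2)) \<le> cmod w * M\<^sup>2"
      unfolding norm_mult norm_of_real using u2[of v1] assms by (intro mult_left_mono) auto
    moreover have "cmod (u * of_real ((cmod v1)\<^sup>2 - (cmod u1)\<^sup>2)) \<le> (M * r) * ((2 * M) * cmod w1)"
      unfolding norm_mult norm_of_real using sq[of v1 u1] assms by (intro mult_mono) (auto simp: w)
    moreover have "0 \<le> M\<^sup>2 * (r * cmod w1)" "0 \<le> M\<^sup>2 * (r\<^sup>2 * cmod w2)" "0 \<le> M\<^sup>2 * cmod w" using assms by auto
    ultimately show ?thesis unfolding t2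
      by (intro norm_triangle_le) (simp add: power2_eq_square algebra_simps)
  qed
  have t3: "cnj v * v1\<^sup>2 - cnj u * u1\<^sup>2 = cnj w * v1\<^sup>2 + cnj u * ((v1 + u1) * w1)"
    by (simp add: w algebra_simps power2_eq_square)
  have b3: "cmod (cnj v * v1\<^sup>2 - cnj u * u1\<^sup>2) \<le> 3 * ?X"
  proof -
    have "cmod (cnj w * v1\<^sup>2) \<le> cmod w * M\<^sup>2"
      unfolding norm_mult norm_power complex_mod_cnj using u2[of v1] assms by (intro mult_left_mono) auto
    moreover have "cmod (cnj u * ((v1 + u1) * w1)) \<le> (M * r) * ((2 * M) * cmod w1)"
      unfolding norm_mult complex_mod_cnj using assms norm_triangle_ineq[of v1 u1] by (intro mult_mono) auto
    moreover have "0 \<le> M\<^sup>2 * (r * cmod w1)" "0 \<le> M\<^sup>2 * (r\<^sup>2 * cmod w2)" "0 \<le> M\<^sup>2 * cmod w" using assms by auto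
    ultimately show ?thesis unfolding t3
      by (intro norm_triangle_le) (simp add: power2_eq_square algebra_simps)
  qed
  have t4: "of_real ((cmod v)\<^sup>2) * v - of_real ((cmod u)\<^sup>2) * u
     = of_real ((cmod v)\<^sup>2) * w + of_real ((cmod v)\<^sup>2 - (cmod u)\<^sup>2) * u"
    by (simp add: w algebra_simps)
  have b4: "cmod (of_real ((cmod v)\<^sup>2) * v - of_real ((cmod u)\<^sup>2) * u) \<le> 3 * ?X"
  proof -
    have "cmod (of_real ((cmod v)\<^sup>2) * w) \<le> M\<^sup>2 * cmod w"
      unfolding norm_mult norm_of_real using u2[of v] assms by (intro mult_right_mono) auto
    moreover have "cmod (of_real ((cmod v)\<^sup>2 - (cmod u)\<^sup>2) * u) \<le> ((2 * M) * cmod w) * M"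
      unfolding norm_mult norm_of_real using sq[of v u] assms by (intro mult_mono) (auto simp: w)
    moreover have "0 \<le> M\<^sup>2 * (r * cmod w1)" "0 \<le> M\<^sup>2 * (r\<^sup>2 * cmod w2)" using assms by auto
    ultimately show ?thesis unfolding t4
      by (intro norm_triangle_le) (simp add: power2_eq_square algebra_simps)
  qed
  have "nl \<alpha> \<beta> \<mu> v v1 v2 - nl \<alpha> \<beta> \<mu> u u1 u2 = (of_real ((cmod v)\<^sup>2) * v2 - of_real ((cmod u)\<^sup>2) * u2)
    + of_real \<alpha> * (v * of_real ((cmod v1)\<^sup>2) - u * of_real ((cmod u1)\<^sup>2))
    + of_real \<beta> * (cnj v * v1\<^sup>2 - cnj u * u1\<^sup>2)
    + \<mu> * (of_real ((cmod v)\<^sup>2) * v - of_real ((cmod u)\<^sup>2) * u)"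
    unfolding nl_def by (simp only: algebra_simps)
  also have "cmod \<dots> \<le> 3 * ?X + \<bar>\<alpha>\<bar> * (3 * ?X) + \<bar>\<beta>\<bar> * (3 * ?X) + cmod \<mu> * (3 * ?X)"
    using b1 mult_left_mono[OF b2, of "\<bar>\<alpha>\<bar>"] mult_left_mono[OF b3, of "\<bar>\<beta>\<bar>"] mult_left_mono[OF b4, of "cmod \<mu>"]
    by (intro norm_triangle_le add_mono) (simp_all only: norm_mult norm_of_real abs_ge_zero norm_ge_zero)
  also have "\<dots> = bigA \<alpha> \<beta> \<mu> * (3 * ?X)" by (simp add: bigA_def algebra_simps)
  finally show ?thesis unfolding w by (simp only: mult_ac)
qed

text \<open>The limit \<open>r\<close> to 0, in the form in which expansions at a zero and the
  cut-off of the integrals are removed.\<close>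

lemma le_of_linear:
  fixes a b c :: real
  assumes "\<And>r. 0 < r \<Longrightarrow> r \<le> 1 \<Longrightarrow> c \<le> a + b * r"
  shows "c \<le> a"
proof (rule field_le_epsilon)
  fix e :: real assume e: "0 < e"
  define r where "r = min 1 (e / (\<bar>b\<bar> + 1))"
  have r: "0 < r" "r \<le> 1" using e by (auto simp: r_def)
  have "b * r \<le> \<bar>b\<bar> * (e / (\<bar>b\<bar> + 1))"
    using r by (intro order_trans[OF mult_right_mono[OF abs_ge_self] mult_left_mono]) (auto simp: r_def)
  also have "\<dots> \<le> e" using e by (simp add: field_simps)
  finally show "c \<le> a + e" using assms[OF r] by linarith
qed

lemma abs_sin_le_dist:
  fixes x x0 :: real
  assumes "sin x0 = 0"
  shows "\<bar>sin x\<bar> \<le> \<bar>x - x0\<bar>"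
proof -
  have "norm (sin x - sin x0) \<le> 1 * \<bar>x - x0\<bar>"
    by (rule vector_derivative_bound[of UNIV sin cos])
      (auto simp: has_real_derivative_iff_has_vector_derivative[symmetric] intro: derivative_eq_intros)
  then show ?thesis using assms by simp
qed

text \<open>\<open>sigma\<close> is the definition of the critical exponent solved for the sum that
  occurs in the energy identity. \<open>ksig\<close> makes the boundary terms vanish at the zeros:
  the energy flux is O(sin^(2k+1-2 sigma)), the flux of the pairing O(sin^(k+1/2-sigma)).\<close>

locale parameters =
  fixes \<alpha> \<beta> \<sigma> \<eta> M :: real and \<mu> :: complex and k :: nat
  assumes sigma: "\<alpha> / 2 + \<beta> = 1 - \<sigma>" and eta: "0 < \<eta>" "\<eta> \<le> 1" and M1: "1 \<le> M"
    and k4: "4 \<le> k" and ksig: "\<sigma> + 3 / 2 < real k"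
begin

definition A where "A = bigA \<alpha> \<beta> \<mu>"

lemma A1: "1 \<le> A" by (simp add: A_def bigA_ge_1)

end

text \<open>The two bounds on \<open>T\<close> depend on \<open>M\<close> and the parameters alone:
  the first makes the Taylor coefficients of the difference vanish, the second closes the energy
  estimate. \<open>D\<close> may be arbitrarily large; it enters only through limits at the zeros
  and is absent from the final estimates.\<close>

locale two_solutions = parameters +
  fixes T D :: real and U V :: "nat \<Rightarrow> real \<Rightarrow> real \<Rightarrow> complex"
  assumes csolU: "csol \<alpha> \<beta> \<mu> (k - 1) M T U" and csolV: "csol \<alpha> \<beta> \<mu> (k - 1) M T V"
    and T: "0 < T" "18 * A * M\<^sup>2 * fact k * T \<le> 1" "24 * A * M\<^sup>2 * (1 + \<bar>\<sigma>\<bar>) * T \<le> 1"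
    and dataU: "\<And>x. 0 \<le> sin x \<Longrightarrow> norm (U 0 0 x - of_real (\<eta> * sin x)) \<le> \<eta> / 10 * sin x"
    and dataV: "\<And>x. 0 \<le> sin x \<Longrightarrow> norm (V 0 0 x - of_real (\<eta> * sin x)) \<le> \<eta> / 10 * sin x"
    and flatU: "\<And>x. norm (U 0 0 x - of_real (\<eta> * sin x)) \<le> D * (sin x)\<^sup>2"
    and flatV: "\<And>x. norm (V 0 0 x - of_real (\<eta> * sin x)) \<le> D * (sin x)\<^sup>2"
    and flatW: "\<And>x. norm (V 0 0 x - U 0 0 x) \<le> D * \<bar>sin x\<bar> ^ k"
begin

definition W where "W = (\<lambda>j t x. V j t x - U j t x)"

lemma D0: "0 \<le> D"
  using order_trans[OF norm_ge_zero flatU[of "pi / 2"]] by simp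

lemma T_small: "A * M\<^sup>2 * T \<le> 1 / 40"
proof -
  have "(24::real) \<le> fact k" using fact_mono[OF k4, where ?'a=real] by (simp add: numeral_eq_Suc)
  then have "A * M\<^sup>2 * T * (18 * 24) \<le> A * M\<^sup>2 * T * (18 * fact k)"
    using A1 T by (intro mult_left_mono) auto
  then show ?thesis using T(2) by (simp add: mult_ac)
qed

lemma near_initial:
  assumes "t \<in> {0..T}"
  shows "norm (U 0 t x - U 0 0 x) \<le> 2 * A * M\<^sup>2 * t * norm (U 0 0 x)"
    and "norm (V 0 t x - V 0 0 x) \<le> 2 * A * M\<^sup>2 * t * norm (V 0 0 x)"
  using csol_near_initial[OF csolU _ assms, of x] csol_near_initial[OF csolV _ assms, of x] k4 T_small
  by (auto simp: A_def)

lemma W_deriv: "t \<in> {0..T} \<Longrightarrow> j < k - 1 \<Longrightarrow> (W j t has_vector_derivative W (Suc j) t x) (at x)"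
  unfolding W_def by (intro has_vector_derivative_diff csol_deriv[OF csolU] csol_deriv[OF csolV])

lemma W_bound: "t \<in> {0..T} \<Longrightarrow> j \<le> k - 1 \<Longrightarrow> norm (W j t x) \<le> 2 * M"
  unfolding W_def using norm_triangle_ineq4[of "V j t x" "U j t x"] csol_bound[OF csolU, of t j x] csol_bound[OF csolV, of t j x]
  by fastforce

lemma W_lip: "t \<in> {0..T} \<Longrightarrow> j \<le> k - 1 \<Longrightarrow> norm (W j t x - W j t y) \<le> 2 * M * \<bar>x - y\<bar>"
  unfolding W_def using norm_triangle_ineq4[of "V j t x - V j t y" "U j t x - U j t y"]
    csol_lip[OF csolU, of t j x y] csol_lip[OF csolV, of t j x y]
  by (fastforce simp: algebra_simps)

lemma zero_preserved:
  assumes "sin x0 = 0" "t \<in> {0..T}"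
  shows "U 0 t x0 = 0" "V 0 t x0 = 0"
  using flatU[of x0] flatV[of x0] near_initial[OF assms(2), of x0] assms(1) by auto

lemma linear_bound:
  assumes "sin x0 = 0" "t \<in> {0..T}"
  shows "norm (U 0 t x) \<le> M * \<bar>x - x0\<bar>" "norm (V 0 t x) \<le> M * \<bar>x - x0\<bar>"
  using csol_lip[OF csolU assms(2), of 0 x x0] csol_lip[OF csolV assms(2), of 0 x x0] zero_preserved[OF assms] by auto

lemma W_time: "t \<in> {0..T} \<Longrightarrow> ((\<lambda>t. W 0 t x) has_vector_derivative
    \<i> * (nl \<alpha> \<beta> \<mu> (V 0 t x) (V 1 t x) (V 2 t x) - nl \<alpha> \<beta> \<mu> (U 0 t x) (U 1 t x) (U 2 t x))) (at t within {0..T})"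
  unfolding W_def right_diff_distrib by (intro has_vector_derivative_diff csol_time[OF csolU] csol_time[OF csolV])

lemma taylor_W:
  assumes t: "t \<in> {0..T}" and j: "j \<le> k - 1" and i: "i \<le> j" and van: "\<And>l. l < j \<Longrightarrow> W l t x0 = 0"
  shows "norm (W i t x - ((x - x0) ^ (j - i) / fact (j - i)) *\<^sub>R W j t x0) \<le> 2 * M * \<bar>x - x0\<bar> ^ (j - i + 1)"
proof -
  have "norm (W (i + 0) t x - ((x - x0) ^ (j - i) / fact (j - i)) *\<^sub>R W (i + (j - i)) t x0) \<le> 2 * M * \<bar>x - x0\<bar> ^ (j - i + 1)"
  proof (rule taylor_lipschitz[of "j - i" "\<lambda>l. W (i + l) t" "2 * M"])
    fix l x assume "l < j - i"
    then show "(W (i + l) t has_vector_derivative W (i + Suc l) t x) (at x)"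
      using W_deriv[OF t, of "i + l" x] j by simp
  next
    fix l assume "l < j - i" then show "W (i + l) t x0 = 0" using van by simp
  qed (use W_lip[OF t] i j in auto)
  then show ?thesis using i by simp
qed

text \<open>Induction over the order. If the lower derivatives vanish at \<open>x0\<close> and the
  derivative of order \<open>j\<close> is at most \<open>B\<close> there, the equation shows that at
  distance \<open>r\<close> the difference changes by O(T B r^j) + O(r^(j+1)). Division by r^j and
  \<open>r\<close> to 0 improve \<open>B\<close> to \<open>B / 2\<close>.\<close>

lemma W_vanish:
  assumes x0: "sin x0 = 0" and "j \<le> k - 1" "t \<in> {0..T}"
  shows "W j t x0 = 0"
  using assms(2,3)
proof (induction j arbitrary: t rule: less_induct)
  case (less j)
  show ?case
  proof (cases "j = 0")
    case True
    then show ?thesis using zero_preserved[OF x0 less.prems(2)] by (simp add: W_def)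
  next
    case False
    then have j1: "j \<ge> 1" by simp
    let ?Cd = "3 * A * M\<^sup>2"
    have Cd: "?Cd \<ge> 0" using A1 by simp
    have van: "W l s x0 = 0" if "l < j" "s \<in> {0..T}" for l s
      using less.IH[of l s] less.prems that by auto
    \<comment> \<open>Each passage through the equation halves the bound, uniformly in time; the
      starting value is the trivial bound on \<open>W\<close>.\<close>
    have "\<forall>t\<in>{0..T}. norm (W j t x0) \<le> 2 * M / 2 ^ n" for n
    proof (induction n)
      case 0
      then show ?case using W_bound less.prems by auto
    next
      case (Suc n)
      define B where "B = 2 * M / 2 ^ n"
      have B: "norm (W j s x0) \<le> B" if "s \<in> {0..T}" for s using Suc that by (simp add: B_def)
      have B0: "0 \<le> B" using M1 by (simp add: B_def)
      show ?case
      proof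
        fix t assume t: "t \<in> {0..T}"
        have "norm (W j t x0) \<le> B / 2 + fact j * (D + 3 * ?Cd * T * 2 * M + 2 * M) * r" if r: "0 < r" "r \<le> 1" for r
        proof -
          define x where "x = x0 + r"
          have xr: "x - x0 = r" by (simp add: x_def)
          let ?b = "B * r ^ j + 2 * M * r ^ (j + 1)"
          have Wi: "r ^ i * norm (W i s x) \<le> ?b" if s: "s \<in> {0..T}" and i: "i \<le> j" for s i
          proof -
            have "norm (W i s x - (r ^ (j - i) / fact (j - i)) *\<^sub>R W j s x0) \<le> 2 * M * r ^ (j - i + 1)"
              using taylor_W[OF s less.prems(1) i van[OF _ s], of x] r by (simp add: xr)
            moreover have "norm ((r ^ (j - i) / fact (j - i)) *\<^sub>R W j s x0) \<le> r ^ (j - i) * B"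
            proof -
              have "r ^ (j - i) / fact (j - i) \<le> r ^ (j - i)"
                using r by (simp add: divide_le_eq mult_ge1_I fact_ge_1 mult_le_cancel_left1)
              then have "(r ^ (j - i) / fact (j - i)) * norm (W j s x0) \<le> r ^ (j - i) * B"
                using B[OF s] r by (intro mult_mono) auto
              then show ?thesis using r by simp
            qed
            ultimately have "norm (W i s x) \<le> r ^ (j - i) * B + 2 * M * r ^ (j - i + 1)"
              using norm_triangle_sub[of "W i s x" "(r ^ (j - i) / fact (j - i)) *\<^sub>R W j s x0"] by linarith
            then have "r ^ i * norm (W i s x) \<le> r ^ i * (r ^ (j - i) * B + 2 * M * r ^ (j - i + 1))"
              using r by (intro mult_left_mono) auto
            also have "\<dots> = ?b" using i by (simp add: algebra_simps flip: power_add)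
            finally show ?thesis .
          qed
          \<comment> \<open>For \<open>j = 1\<close> the Taylor expansion does not reach the second
            derivative, but then \<open>r ^ 2 * (2 * M)\<close> is already of the order
            \<open>r ^ (j + 1)\<close> of the error.\<close>
          have W2: "r ^ 2 * norm (W 2 s x) \<le> ?b" if s: "s \<in> {0..T}" for s
          proof (cases "2 \<le> j")
            case False
            then have "j = 1" using j1 by simp
            have "r ^ 2 * norm (W 2 s x) \<le> r ^ 2 * (2 * M)"
              using W_bound[OF s, of 2 x] k4 by (intro mult_left_mono) auto
            also have "\<dots> \<le> ?b" using B0 r \<open>j = 1\<close> by (simp add: power2_eq_square)
            finally show ?thesis .
          qed (use Wi[OF s] in auto)
          have "norm (W 0 t x - W 0 0 x) \<le> (?Cd * (3 * ?b)) * \<bar>t - 0\<bar>"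
          proof (rule vector_derivative_bound[of "{0..T}", OF _ W_time])
            fix s assume s: "s \<in> {0..T}"
            have "norm (nl \<alpha> \<beta> \<mu> (V 0 s x) (V 1 s x) (V 2 s x) - nl \<alpha> \<beta> \<mu> (U 0 s x) (U 1 s x) (U 2 s x))
              \<le> 3 * bigA \<alpha> \<beta> \<mu> * M\<^sup>2 * (r\<^sup>2 * cmod (V 2 s x - U 2 s x) + r * cmod (V 1 s x - U 1 s x) + cmod (V 0 s x - U 0 s x))"
              using linear_bound[OF x0 s, of x] csol_bound[OF csolU s] csol_bound[OF csolV s] k4 r M1
              by (intro norm_nl_diff_le) (auto simp: xr)
            also have "\<dots> \<le> ?Cd * (3 * ?b)"
              unfolding A_def[symmetric]
              using Wi[OF s, of 0] Wi[OF s, of 1] W2[OF s] j1 Cd by (intro mult_left_mono) (auto simp: W_def)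
            finally show "norm (\<i> * (nl \<alpha> \<beta> \<mu> (V 0 s x) (V 1 s x) (V 2 s x) - nl \<alpha> \<beta> \<mu> (U 0 s x) (U 1 s x) (U 2 s x))) \<le> ?Cd * (3 * ?b)"
              by (simp add: norm_mult)
          qed (use t T in auto)
          also have "\<dots> \<le> (?Cd * (3 * ?b)) * T"
            using t Cd B0 r M1 by (intro mult_left_mono mult_nonneg_nonneg[OF Cd]) auto
          finally have 1: "norm (W 0 t x - W 0 0 x) \<le> (?Cd * (3 * ?b)) * T" .
          have 2: "norm (W 0 0 x) \<le> D * r ^ (j + 1)"
          proof -
            have "norm (W 0 0 x) \<le> D * \<bar>sin x\<bar> ^ k" using flatW[of x] by (simp add: W_def)
            also have "\<dots> \<le> D * r ^ k"
              using abs_sin_le_dist[OF x0, of x] r D0 by (intro mult_left_mono power_mono) (auto simp: xr)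
            also have "\<dots> \<le> D * r ^ (j + 1)"
              using r D0 less.prems(1) j1 by (intro mult_left_mono power_decreasing) auto
            finally show ?thesis .
          qed
          have 3: "norm (W 0 t x - (r ^ j / fact j) *\<^sub>R W j t x0) \<le> 2 * M * r ^ (j + 1)"
            using taylor_W[OF t less.prems(1) _ van[OF _ t], of 0 x] r by (simp add: xr)
          have "norm ((r ^ j / fact j) *\<^sub>R W j t x0) \<le> norm (W 0 t x) + norm (W 0 t x - (r ^ j / fact j) *\<^sub>R W j t x0)"
            using norm_triangle_ineq4[of "W 0 t x" "W 0 t x - (r ^ j / fact j) *\<^sub>R W j t x0"] by simp
          also have "norm (W 0 t x) \<le> norm (W 0 0 x) + norm (W 0 t x - W 0 0 x)"
            by (rule norm_triangle_sub)
          finally have "(r ^ j / fact j) * norm (W j t x0) \<le> D * r ^ (j + 1) + (?Cd * (3 * ?b)) * T + 2 * M * r ^ (j + 1)"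
            using 1 2 3 r by simp
          also have "\<dots> = r ^ j * (3 * ?Cd * T * B + (D + 3 * ?Cd * T * 2 * M + 2 * M) * r)"
            by (simp add: algebra_simps)
          finally have "r ^ j * norm (W j t x0) \<le> r ^ j * (fact j * (3 * ?Cd * T * B + (D + 3 * ?Cd * T * 2 * M + 2 * M) * r))"
            by (simp add: field_simps)
          then have "norm (W j t x0) \<le> fact j * (3 * ?Cd * T * B + (D + 3 * ?Cd * T * 2 * M + 2 * M) * r)"
            using r by (simp add: mult_le_cancel_left)
          also have "\<dots> = (fact j * (3 * ?Cd * T)) * B + fact j * (D + 3 * ?Cd * T * 2 * M + 2 * M) * r"
            by (simp add: algebra_simps)
          \<comment> \<open>Origin of the first smallness condition on \<open>T\<close>:
            \<open>3 * ?Cd\<close> is \<open>9 * A * M\<^sup>2\<close>, and the factorial is the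
            Taylor denominator.\<close>
          also have "fact j * (3 * ?Cd * T) \<le> 1 / 2"
          proof -
            have "fact j \<le> (fact k :: real)" using less.prems(1) by (intro fact_mono) auto
            then have "fact j * (3 * ?Cd * T) \<le> fact k * (3 * ?Cd * T)"
              using Cd T by (intro mult_right_mono) auto
            then show ?thesis using T(2) by (simp add: mult_ac)
          qed
          finally show ?thesis using B0 by (simp add: mult_right_mono)
        qed
        then have "norm (W j t x0) \<le> B / 2" by (rule le_of_linear)
        then show "norm (W j t x0) \<le> 2 * M / 2 ^ Suc n" by (simp add: B_def)
      qed
    qed
    then have le: "norm (W j t x0) \<le> 2 * M / 2 ^ n" for n using less.prems by auto
    have "(\<lambda>n. 2 * M / 2 ^ n) \<longlonglongrightarrow> 0"
      using LIMSEQ_divide_realpow_zero[of 2 "2 * M"] by simp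
    then have "norm (W j t x0) \<le> 0" using le by (intro LIMSEQ_le_const) auto
    then show ?thesis by simp
  qed
qed

text \<open>The Lipschitz bound on the derivative of order \<open>k - 1\<close> supplies the last
  order of vanishing.\<close>

lemma W_flat:
  assumes "sin x0 = 0" "t \<in> {0..T}" "i \<le> k - 1"
  shows "norm (W i t x) \<le> 2 * M * \<bar>x - x0\<bar> ^ (k - i)"
proof -
  have "k - 1 - i + 1 = k - i" using assms(3) k4 by simp
  then show ?thesis
    using taylor_W[OF assms(2) order.refl assms(3), of x0 x] W_vanish[OF assms(1) _ assms(2)] by simp
qed

end

section \<open>Size of the average of two solutions\<close>

text \<open>Up to \<open>pi / 3\<close> the function \<open>2 * sin y - y\<close> increases; beyond,
  \<open>2 * sin x\<close> is at least \<open>sqrt 3\<close>, which exceeds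
  \<open>pi / 2\<close>.\<close>

lemma le_2_sin:
  fixes x :: real
  assumes "0 \<le> x" "x \<le> pi / 2"
  shows "x \<le> 2 * sin x"
proof -
  have "x \<le> 2"
    using assms(2) pi_less_4 by linarith
  define f where "f = (\<lambda>y::real. 2 * sin y - y)"
  show ?thesis
  proof (cases "x \<le> pi / 3")
    case True
    have "f 0 \<le> f x"
    proof (rule DERIV_nonneg_imp_nondecreasing[OF assms(1)])
      fix y assume y: "0 \<le> y" "y \<le> x"
      have "cos (pi / 3) \<le> cos y"
        using y True by (intro cos_monotone_0_pi_le) (auto simp: pi_ge_zero)
      then have "0 \<le> 2 * cos y - 1" by (simp add: cos_60)
      moreover have "(f has_real_derivative (2 * cos y - 1)) (at y)"
        unfolding f_def by (auto intro!: derivative_eq_intros)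
      ultimately show "\<exists>D. (f has_real_derivative D) (at y) \<and> 0 \<le> D" by blast
    qed
    then show ?thesis by (simp add: f_def)
  next
    case False
    have "sin (pi / 3) \<le> sin x"
      using False assms by (intro sin_monotone_2pi_le) auto
    then have "sqrt 3 \<le> 2 * sin x" by (simp add: sin_60)
    moreover have "1.7 \<le> sqrt 3" by (rule real_le_rsqrt) (simp add: power2_eq_square)
    moreover have "x \<le> 1.6" using assms(2) pi_approx by simp
    ultimately show ?thesis by linarith
  qed
qed

lemma nearest_zero_sin:
  fixes x :: real
  assumes "0 \<le> x" "x \<le> pi"
  obtains x0 where "sin x0 = 0" "\<bar>x - x0\<bar> \<le> 2 * sin x" "(cos x0)\<^sup>2 = 1" "x0 = 0 \<or> x0 = pi"
proof (cases "x \<le> pi / 2")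
  case True
  then show ?thesis using that[of 0] le_2_sin[of x] assms by simp
next
  case False
  then show ?thesis using that[of pi] le_2_sin[of "pi - x"] assms by simp
qed

text \<open>The difference quotient at \<open>x0 + r\<close> is at most \<open>a + b * r\<close>.
  Increments to one side suffice, as the derivative is known to exist.\<close>

lemma derivative_le_of_linear_bound:
  fixes f :: "real \<Rightarrow> complex"
  assumes "(f has_vector_derivative f') (at x0)" "f x0 = 0"
    and "\<And>r. 0 < r \<Longrightarrow> r \<le> 1 \<Longrightarrow> norm (f (x0 + r)) \<le> a * r + b * r\<^sup>2"
  shows "norm f' \<le> a"
proof -
  have "norm f' \<le> a + e" if e: "e > 0" for e
  proof -
    obtain d where d: "d > 0" "\<And>y. norm (y - x0) < d \<Longrightarrow> norm (f y - f x0 - (y - x0) *\<^sub>R f') \<le> e / 2 * norm (y - x0)"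
      using assms(1) e unfolding has_vector_derivative_def has_derivative_at_alt by (meson half_gt_zero)
    define r where "r = min (min 1 (d / 2)) (e / (2 * (\<bar>b\<bar> + 1)))"
    have "0 < e / (2 * (\<bar>b\<bar> + 1))" using e by (simp add: zero_less_divide_iff)
    then have r: "0 < r" "r \<le> 1" "r < d" using d(1) by (auto simp: r_def)
    have "r \<le> e / (2 * (\<bar>b\<bar> + 1))" by (simp add: r_def)
    then have re: "r * (2 * (\<bar>b\<bar> + 1)) \<le> e"
      using pos_le_divide_eq[of "2 * (\<bar>b\<bar> + 1)" r e] abs_ge_zero[of b] by auto
    have "norm (r *\<^sub>R f') \<le> norm (f (x0 + r)) + norm (f (x0 + r) - r *\<^sub>R f')"
      using norm_triangle_ineq4[of "f (x0 + r)" "f (x0 + r) - r *\<^sub>R f'"] by simp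
    also have "\<dots> \<le> (a * r + b * r\<^sup>2) + e / 2 * r"
      using d(2)[of "x0 + r"] assms(2) assms(3)[OF r(1,2)] r by (intro add_mono) auto
    finally have "r * norm f' \<le> r * (a + b * r + e / 2)"
      using r by (simp add: power2_eq_square algebra_simps)
    then have "norm f' \<le> a + b * r + e / 2" using r by (simp add: mult_le_cancel_left)
    moreover have "b * r \<le> \<bar>b\<bar> * r" using r by (intro mult_right_mono) auto
    moreover have "\<bar>b\<bar> * r \<le> e / 2" using r re by (simp add: algebra_simps)
    ultimately show ?thesis by linarith
  qed
  then show ?thesis by (rule field_le_epsilon)
qed

lemma has_real_derivative_cmod_squared:
  assumes "(f has_vector_derivative f') (at t within S)"
  shows "((\<lambda>t. (cmod (f t))\<^sup>2) has_real_derivative 2 * Re (cnj (f t) * f')) (at t within S)"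
proof -
  have r: "((\<lambda>t. Re (f t)) has_real_derivative Re f') (at t within S)"
    using bounded_linear.has_vector_derivative[OF bounded_linear_Re assms]
    by (simp add: has_real_derivative_iff_has_vector_derivative)
  have i: "((\<lambda>t. Im (f t)) has_real_derivative Im f') (at t within S)"
    using bounded_linear.has_vector_derivative[OF bounded_linear_Im assms]
    by (simp add: has_real_derivative_iff_has_vector_derivative)
  have "((\<lambda>t. Re (f t) * Re (f t) + Im (f t) * Im (f t)) has_real_derivative
     (Re f' * Re (f t) + Re f' * Re (f t)) + (Im f' * Im (f t) + Im f' * Im (f t))) (at t within S)"
    by (intro DERIV_add DERIV_mult r i)
  then show ?thesis unfolding cmod_power2 by (simp add: power2_eq_square algebra_simps)
qed

context two_solutions
begin

lemma W_sin_bound: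
  assumes t: "t \<in> {0..T}" and x: "0 \<le> x" "x \<le> pi" and i: "i \<le> 2"
  shows "norm (W i t x) \<le> 2 ^ (k + 1) * M * (sin x) ^ (k - i)"
proof -
  obtain x0 where x0: "sin x0 = 0" "\<bar>x - x0\<bar> \<le> 2 * sin x"
    using nearest_zero_sin[OF x] by metis
  have "norm (W i t x) \<le> 2 * M * \<bar>x - x0\<bar> ^ (k - i)"
    using W_flat[OF x0(1) t] i k4 by auto
  also have "\<dots> \<le> 2 * M * (2 * sin x) ^ (k - i)"
    using M1 x0 by (intro mult_left_mono power_mono) auto
  also have "\<dots> = 2 * M * (2 ^ (k - i) * (sin x) ^ (k - i))" by (simp add: power_mult_distrib)
  also have "\<dots> \<le> 2 * M * (2 ^ k * (sin x) ^ (k - i))"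
    using M1 sin_ge_zero[OF x] by (intro mult_left_mono mult_right_mono) auto
  finally show ?thesis by (simp add: mult_ac)
qed

text \<open>Linearising at the midpoint of the two solutions rather than at one of them removes all
  terms quadratic in \<open>W\<close>.\<close>

definition v where "v = (\<lambda>j t x. (U j t x + V j t x) / 2)"

lemma U_eq: "U j t x = v j t x - W j t x / 2" and V_eq: "V j t x = v j t x + W j t x / 2"
  by (simp_all add: v_def W_def field_simps)

lemma v_deriv: "t \<in> {0..T} \<Longrightarrow> j < k - 1 \<Longrightarrow> (v j t has_vector_derivative v (Suc j) t x) (at x)"
  unfolding v_def
  by (rule has_vector_derivative_divide[OF has_vector_derivative_add[OF csol_deriv[OF csolU] csol_deriv[OF csolV]]])

lemma v_bound: "t \<in> {0..T} \<Longrightarrow> j \<le> k - 1 \<Longrightarrow> norm (v j t x) \<le> M"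
proof -
  assume "t \<in> {0..T}" "j \<le> k - 1"
  then have "norm (U j t x) \<le> M" "norm (V j t x) \<le> M"
    using csol_bound[OF csolU] csol_bound[OF csolV] by auto
  then show ?thesis
    unfolding v_def norm_divide norm_numeral using norm_triangle_ineq[of "U j t x" "V j t x"] by linarith
qed

lemma v_lip: "t \<in> {0..T} \<Longrightarrow> j \<le> k - 1 \<Longrightarrow> norm (v j t x - v j t y) \<le> M * \<bar>x - y\<bar>"
proof -
  assume "t \<in> {0..T}" "j \<le> k - 1"
  then have "norm (U j t x - U j t y) \<le> M * \<bar>x - y\<bar>" "norm (V j t x - V j t y) \<le> M * \<bar>x - y\<bar>"
    using csol_lip[OF csolU] csol_lip[OF csolV] by auto
  then have "norm ((U j t x - U j t y) + (V j t x - V j t y)) \<le> 2 * (M * \<bar>x - y\<bar>)"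
    using norm_triangle_ineq[of "U j t x - U j t y" "V j t x - V j t y"] by linarith
  moreover have "v j t x - v j t y = ((U j t x - U j t y) + (V j t x - V j t y)) / 2"
    by (simp add: v_def field_simps)
  ultimately show ?thesis by (simp only: norm_divide norm_numeral)
qed

lemma solutions_size:
  assumes t: "t \<in> {0..T}" and x: "0 \<le> sin x"
  shows "norm (U 0 t x - of_real (\<eta> * sin x)) \<le> \<eta> / 4 * sin x"
    and "norm (V 0 t x - of_real (\<eta> * sin x)) \<le> \<eta> / 4 * sin x"
proof -
  have *: "norm (f t - of_real (\<eta> * sin x)) \<le> \<eta> / 4 * sin x"
    if d: "norm (f 0 - of_real (\<eta> * sin x)) \<le> \<eta> / 10 * sin x"
      and n: "norm (f t - f 0) \<le> 2 * A * M\<^sup>2 * t * norm (f 0)" for f :: "real \<Rightarrow> complex"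
  proof -
    have s: "0 \<le> \<eta> * sin x" using x eta by simp
    have "norm (f 0) \<le> \<eta> * sin x + \<eta> / 10 * sin x"
      using norm_triangle_sub[of "f 0" "of_real (\<eta> * sin x)"] d s
      by (simp only: norm_of_real abs_of_nonneg)
    moreover have "2 * A * M\<^sup>2 * t \<le> 1 / 20"
    proof -
      have "A * M\<^sup>2 * t \<le> A * M\<^sup>2 * T" using t A1 by (intro mult_left_mono) auto
      then show ?thesis using T_small by simp
    qed
    moreover have "0 \<le> 2 * A * M\<^sup>2 * t" using t A1 by simp
    ultimately have "2 * A * M\<^sup>2 * t * norm (f 0) \<le> 1 / 20 * (\<eta> * sin x + \<eta> / 10 * sin x)"
      using s by (intro mult_mono) auto
    then have "norm (f t - f 0) \<le> 1 / 20 * (\<eta> * sin x + \<eta> / 10 * sin x)" using n by linarith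
    moreover have "norm (f t - of_real (\<eta> * sin x)) \<le> norm (f t - f 0) + norm (f 0 - of_real (\<eta> * sin x))"
      using norm_triangle_ineq[of "f t - f 0" "f 0 - of_real (\<eta> * sin x)"] by simp
    ultimately show ?thesis using d s by simp
  qed
  show "norm (U 0 t x - of_real (\<eta> * sin x)) \<le> \<eta> / 4 * sin x"
    by (rule *[of "\<lambda>t. U 0 t x"]) (use dataU[OF x] near_initial[OF t] in auto)
  show "norm (V 0 t x - of_real (\<eta> * sin x)) \<le> \<eta> / 4 * sin x"
    by (rule *[of "\<lambda>t. V 0 t x"]) (use dataV[OF x] near_initial[OF t] in auto)
qed

lemma v_size:
  assumes t: "t \<in> {0..T}" and x: "0 \<le> sin x"
  shows "norm (v 0 t x) \<le> 5 / 4 * (\<eta> * sin x)" and "3 / 4 * (\<eta> * sin x) \<le> norm (v 0 t x)"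
    and "norm (U 0 t x) \<le> 5 / 4 * (\<eta> * sin x)" and "norm (V 0 t x) \<le> 5 / 4 * (\<eta> * sin x)"
proof -
  let ?e = "complex_of_real (\<eta> * sin x)"
  have e: "norm ?e = \<eta> * sin x" using x eta by (simp only: norm_of_real abs_of_nonneg mult_nonneg_nonneg)
  have "v 0 t x - ?e = ((U 0 t x - ?e) + (V 0 t x - ?e)) / 2" by (simp add: v_def field_simps)
  then have "norm (v 0 t x - ?e) = norm ((U 0 t x - ?e) + (V 0 t x - ?e)) / 2" by (simp only: norm_divide norm_numeral)
  then have d: "norm (v 0 t x - ?e) \<le> \<eta> / 4 * sin x"
    using norm_triangle_ineq[of "U 0 t x - ?e" "V 0 t x - ?e"] solutions_size[OF t x] by linarith
  show "norm (v 0 t x) \<le> 5 / 4 * (\<eta> * sin x)"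
    using norm_triangle_sub[of "v 0 t x" ?e] d e by linarith
  show "3 / 4 * (\<eta> * sin x) \<le> norm (v 0 t x)"
    using norm_triangle_sub[of ?e "v 0 t x"] d e by (simp add: norm_minus_commute)
  show "norm (U 0 t x) \<le> 5 / 4 * (\<eta> * sin x)" "norm (V 0 t x) \<le> 5 / 4 * (\<eta> * sin x)"
    using norm_triangle_sub[of "U 0 t x" ?e] norm_triangle_sub[of "V 0 t x" ?e] solutions_size[OF t x] e by linarith+
qed

section \<open>The slope of the solutions at a zero\<close>

lemma slope_initial:
  assumes x0: "sin x0 = 0"
  shows "U 1 0 x0 = of_real (\<eta> * cos x0)"
proof -
  have t0: "0 \<in> {0..T}" using T by simp
  define f where "f = (\<lambda>x. U 0 0 x - of_real (\<eta> * sin x))"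
  have "(f has_vector_derivative U 1 0 x0 - of_real (\<eta> * cos x0)) (at x0)"
    unfolding f_def
  proof (rule has_vector_derivative_diff)
    show "(U 0 0 has_vector_derivative U 1 0 x0) (at x0)" using csol_deriv[OF csolU t0, of 0 x0] k4 by simp
    have "((\<lambda>x. \<eta> * sin x) has_real_derivative \<eta> * cos x0) (at x0)" by (auto intro!: derivative_eq_intros)
    then show "((\<lambda>x. complex_of_real (\<eta> * sin x)) has_vector_derivative of_real (\<eta> * cos x0)) (at x0)"
      unfolding has_real_derivative_iff_has_vector_derivative
      by (rule bounded_linear.has_vector_derivative[OF bounded_linear_of_real])
  qed
  moreover have "f x0 = 0" using flatU[of x0] x0 by (simp add: f_def)
  moreover have "norm (f (x0 + r)) \<le> 0 * r + D * r\<^sup>2" if "0 < r" "r \<le> 1" for r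
  proof -
    have "norm (f (x0 + r)) \<le> D * (sin (x0 + r))\<^sup>2" using flatU by (simp add: f_def)
    also have "(sin (x0 + r))\<^sup>2 \<le> r\<^sup>2" using abs_sin_le_dist[OF x0, of "x0 + r"] that by (intro abs_le_square_iff[THEN iffD1]) auto
    finally show ?thesis using D0 by (simp add: mult_left_mono)
  qed
  ultimately have "norm (U 1 0 x0 - of_real (\<eta> * cos x0)) \<le> 0"
    by (rule derivative_le_of_linear_bound)
  then show ?thesis by simp
qed

lemma slope_near_initial:
  assumes x0: "sin x0 = 0" and t: "t \<in> {0..T}"
  shows "norm (U 1 t x0 - U 1 0 x0) \<le> 2 * A * M ^ 3 * t"
proof (rule derivative_le_of_linear_bound[of "\<lambda>x. U 0 t x - U 0 0 x" _ x0 _ 0])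
  have t0: "0 \<in> {0..T}" using T by simp
  show "((\<lambda>x. U 0 t x - U 0 0 x) has_vector_derivative U 1 t x0 - U 1 0 x0) (at x0)"
    using csol_deriv[OF csolU t, of 0 x0] csol_deriv[OF csolU t0, of 0 x0] k4
    by (intro has_vector_derivative_diff) auto
  show "U 0 t x0 - U 0 0 x0 = 0" using zero_preserved[OF x0 t] zero_preserved[OF x0 t0] by simp
  fix r :: real assume r: "0 < r" "r \<le> 1"
  have "norm (U 0 t (x0 + r) - U 0 0 (x0 + r)) \<le> 2 * A * M\<^sup>2 * t * norm (U 0 0 (x0 + r))"
    by (rule near_initial[OF t])
  also have "\<dots> \<le> 2 * A * M\<^sup>2 * t * (M * r)"
    using linear_bound[OF x0 t0, of "x0 + r"] A1 t r by (intro mult_left_mono) auto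
  finally show "norm (U 0 t (x0 + r) - U 0 0 (x0 + r)) \<le> 2 * A * M ^ 3 * t * r + 0 * r\<^sup>2"
    by (simp add: power3_eq_cube power2_eq_square mult_ac)
qed

lemma first_order_U:
  assumes x0: "sin x0 = 0" and t: "t \<in> {0..T}"
  shows "norm (U 0 t x - (x - x0) *\<^sub>R U 1 t x0) \<le> M * (x - x0)\<^sup>2"
proof -
  have "norm (U 0 t x - ((x - x0) ^ 1 / fact 1) *\<^sub>R U 1 t x0) \<le> M * \<bar>x - x0\<bar> ^ (1 + 1)"
    using csol_deriv[OF csolU t] csol_lip[OF csolU t] zero_preserved[OF x0 t] k4
    by (intro taylor_lipschitz[of 1 "\<lambda>j. U j t"]) auto
  then show ?thesis by (simp add: power2_eq_square)
qed

text \<open>The quantity is half the time derivative of \<open>|u|^2\<close>, up to sign. The alpha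
  term is real and drops out. In the beta term, \<open>cnj u * p\<close> is
  \<open>r |b|^2 + O(r^2)\<close> with \<open>b\<close> the slope at the zero, so its square has
  imaginary part O(r^3). The other two terms are O(r^3) by size alone.\<close>

lemma modulus_derivative_small:
  assumes x0: "sin x0 = 0" and t: "t \<in> {0..T}" and r: "0 < r" "r \<le> 1"
  shows "\<bar>Im (cnj (U 0 t (x0 + r)) * nl \<alpha> \<beta> \<mu> (U 0 t (x0 + r)) (U 1 t (x0 + r)) (U 2 t (x0 + r)))\<bar> \<le> 4 * A * M ^ 4 * r ^ 3"
proof -
  define u p q b where d: "u = U 0 t (x0 + r)" "p = U 1 t (x0 + r)" "q = U 2 t (x0 + r)" "b = U 1 t x0"
  have bM: "cmod b \<le> M" "cmod p \<le> M" "cmod q \<le> M"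
    using csol_bound[OF csolU t] k4 by (auto simp: d)
  have uM: "cmod u \<le> M * r" using linear_bound(1)[OF x0 t, of "x0 + r"] r by (simp add: d)
  have e1: "cmod (u - r *\<^sub>R b) \<le> M * r\<^sup>2" using first_order_U[OF x0 t, of "x0 + r"] by (simp add: d)
  have e2: "cmod (p - b) \<le> M * r" using csol_lip[OF csolU t, of 1 "x0 + r" x0] k4 r by (simp add: d)
  have rr: "r ^ 4 \<le> r ^ 3" using r by (intro power_decreasing) auto
  have "cnj u * p - of_real (r * (cmod b)\<^sup>2) = cnj (u - r *\<^sub>R b) * p + of_real r * cnj b * (p - b)"
    by (simp add: algebra_simps complex_norm_square scaleR_conv_of_real del: of_real_power)
  also have "cmod \<dots> \<le> M * r\<^sup>2 * M + r * M * (M * r)"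
    unfolding d(4)[symmetric] using e1 e2 bM r M1
    by (intro norm_triangle_le add_mono) (auto simp: norm_mult simp del: complex_cnj_diff complex_cnj_scaleR intro!: mult_mono mult_nonneg_nonneg)
  finally have z: "cmod (cnj u * p - of_real (r * (cmod b)\<^sup>2)) \<le> 2 * M\<^sup>2 * r\<^sup>2"
    by (simp add: power2_eq_square mult_ac)
  have imz: "\<bar>Im (cnj u * p)\<bar> \<le> 2 * M\<^sup>2 * r\<^sup>2"
    using abs_Im_le_cmod[of "cnj u * p - of_real (r * (cmod b)\<^sup>2)"] z by simp
  have rez: "\<bar>Re (cnj u * p)\<bar> \<le> M\<^sup>2 * r"
  proof -
    have "\<bar>Re (cnj u * p)\<bar> \<le> cmod u * cmod p" using abs_Re_le_cmod[of "cnj u * p"] by (simp add: norm_mult)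
    also have "\<dots> \<le> (M * r) * M" using uM bM r M1 by (intro mult_mono) auto
    finally show ?thesis by (simp add: power2_eq_square mult_ac)
  qed
  have i2: "\<bar>Im ((cnj u * p)\<^sup>2)\<bar> \<le> 4 * (M ^ 4 * r ^ 3)"
  proof -
    have "\<bar>Im ((cnj u * p)\<^sup>2)\<bar> = 2 * (\<bar>Re (cnj u * p)\<bar> * \<bar>Im (cnj u * p)\<bar>)"
    proof -
      have "Im (z\<^sup>2) = 2 * (Re z * Im z)" for z by (simp add: power2_eq_square)
      then show ?thesis by (simp only: abs_mult abs_numeral)
    qed
    also have "\<dots> \<le> 2 * ((M\<^sup>2 * r) * (2 * M\<^sup>2 * r\<^sup>2))"
      using imz rez r by (intro mult_left_mono mult_mono) auto
    finally show ?thesis by (simp add: power2_eq_square power3_eq_cube power4_eq_xxxx mult_ac)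
  qed
  have i1: "\<bar>Im (of_real ((cmod u)\<^sup>2) * (cnj u * q))\<bar> \<le> M ^ 4 * r ^ 3"
  proof -
    have "\<bar>Im (of_real ((cmod u)\<^sup>2) * (cnj u * q))\<bar> \<le> (cmod u)\<^sup>2 * (cmod u * cmod q)"
      using abs_Im_le_cmod[of "of_real ((cmod u)\<^sup>2) * (cnj u * q)"] by (simp add: norm_mult norm_power)
    also have "\<dots> \<le> (M * r)\<^sup>2 * ((M * r) * M)"
      using uM bM r M1 by (intro mult_mono power_mono) auto
    finally show ?thesis by (simp add: power2_eq_square power3_eq_cube power4_eq_xxxx mult_ac)
  qed
  have i3: "\<bar>Im (\<mu> * of_real ((cmod u)\<^sup>2 * (cmod u)\<^sup>2))\<bar> \<le> cmod \<mu> * (M ^ 4 * r ^ 3)"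
  proof -
    have "\<bar>Im (\<mu> * of_real ((cmod u)\<^sup>2 * (cmod u)\<^sup>2))\<bar> \<le> cmod \<mu> * ((cmod u)\<^sup>2 * (cmod u)\<^sup>2)"
      using abs_Im_le_cmod[of "\<mu> * of_real ((cmod u)\<^sup>2 * (cmod u)\<^sup>2)"] by (simp add: norm_mult norm_power)
    also have "\<dots> \<le> cmod \<mu> * ((M * r)\<^sup>2 * (M * r)\<^sup>2)"
      using uM r M1 by (intro mult_left_mono mult_mono power_mono) auto
    also have "\<dots> = cmod \<mu> * (M ^ 4 * r ^ 4)" by (simp add: power2_eq_square power4_eq_xxxx mult_ac)
    also have "\<dots> \<le> cmod \<mu> * (M ^ 4 * r ^ 3)" using rr by (intro mult_left_mono) auto
    finally show ?thesis .
  qed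
  have "cnj u * nl \<alpha> \<beta> \<mu> u p q = of_real ((cmod u)\<^sup>2) * (cnj u * q) + of_real (\<alpha> * (cmod u)\<^sup>2 * (cmod p)\<^sup>2)
     + of_real \<beta> * (cnj u * p)\<^sup>2 + \<mu> * of_real ((cmod u)\<^sup>2 * (cmod u)\<^sup>2)"
    unfolding nl_def complex_norm_square of_real_mult by (simp add: algebra_simps power2_eq_square)
  then have "\<bar>Im (cnj u * nl \<alpha> \<beta> \<mu> u p q)\<bar> \<le> \<bar>Im (of_real ((cmod u)\<^sup>2) * (cnj u * q))\<bar> + \<bar>\<beta>\<bar> * \<bar>Im ((cnj u * p)\<^sup>2)\<bar>
     + \<bar>Im (\<mu> * of_real ((cmod u)\<^sup>2 * (cmod u)\<^sup>2))\<bar>"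
    by (simp add: abs_mult[symmetric] del: of_real_mult of_real_power)
  also have "\<dots> \<le> M ^ 4 * r ^ 3 + \<bar>\<beta>\<bar> * (4 * (M ^ 4 * r ^ 3)) + cmod \<mu> * (M ^ 4 * r ^ 3)"
    using i1 i2 i3 by (intro add_mono mult_left_mono) auto
  also have "\<dots> = (1 + 4 * \<bar>\<beta>\<bar> + cmod \<mu>) * (M ^ 4 * r ^ 3)" by (simp add: algebra_simps)
  also have "\<dots> \<le> (4 * A) * (M ^ 4 * r ^ 3)"
    using M1 r by (intro mult_right_mono) (auto simp: A_def bigA_def)
  finally show ?thesis by (simp add: d mult_ac)
qed

text \<open>Near the zero \<open>|u|^2\<close> is \<open>|b|^2 r^2 + O(r^3)\<close>, and it changes
  in time by O(r^3) only; divide by \<open>r^2\<close>. Hence the leading coefficient of the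
  linearised equation, and with it the speed of the packets, does not depend on time.\<close>

lemma slope_modulus:
  assumes x0: "sin x0 = 0" and t: "t \<in> {0..T}"
  shows "cmod (U 1 t x0) = \<eta>"
proof -
  have t0: "0 \<in> {0..T}" using T by simp
  have cos0: "\<bar>cos x0\<bar> = 1" using x0 sin_cos_squared_add[of x0] by (auto simp: power2_eq_1_iff)
  have b0: "cmod (U 1 0 x0) = \<eta>"
    using slope_initial[OF x0] eta cos0 by (simp add: norm_mult)
  have sq: "\<bar>(cmod (U 0 s (x0 + r)))\<^sup>2 - (cmod (U 1 s x0))\<^sup>2 * r\<^sup>2\<bar> \<le> 2 * M\<^sup>2 * r ^ 3"
    if s: "s \<in> {0..T}" and r: "0 < r" "r \<le> 1" for s r
  proof -
    let ?a = "cmod (U 0 s (x0 + r))" and ?b = "cmod (U 1 s x0) * r"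
    have "\<bar>?a - ?b\<bar> \<le> M * r\<^sup>2"
      using first_order_U[OF x0 s, of "x0 + r"] norm_triangle_ineq3[of "U 0 s (x0 + r)" "r *\<^sub>R U 1 s x0"] r
      by (simp add: mult.commute)
    moreover have "\<bar>?a + ?b\<bar> \<le> 2 * M * r"
    proof -
      have "?b \<le> M * r" using csol_bound[OF csolU s, of 1 x0] k4 r by (intro mult_right_mono) auto
      moreover have "?a \<le> M * r" using linear_bound(1)[OF x0 s, of "x0 + r"] r by simp
      moreover have "0 \<le> ?a + ?b" using r by simp
      ultimately show ?thesis by linarith
    qed
    ultimately have "\<bar>?a - ?b\<bar> * \<bar>?a + ?b\<bar> \<le> (M * r\<^sup>2) * (2 * M * r)"
      using M1 r by (intro mult_mono) auto
    moreover have "?a\<^sup>2 - (cmod (U 1 s x0))\<^sup>2 * r\<^sup>2 = (?a - ?b) * (?a + ?b)"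
      by (simp add: power2_eq_square algebra_simps)
    ultimately show ?thesis by (simp add: abs_mult power2_eq_square power3_eq_cube mult_ac)
  qed
  have "\<bar>(cmod (U 1 t x0))\<^sup>2 - \<eta>\<^sup>2\<bar> \<le> 0 + (4 * M\<^sup>2 + 8 * A * M ^ 4 * T) * r" if r: "0 < r" "r \<le> 1" for r
  proof -
    let ?P = "\<lambda>s. (cmod (U 0 s (x0 + r)))\<^sup>2"
    have "norm (?P t - ?P 0) \<le> (8 * A * M ^ 4 * r ^ 3) * \<bar>t - 0\<bar>"
    proof (rule vector_derivative_bound[of "{0..T}" ?P])
      fix s assume s: "s \<in> {0..T}"
      show "(?P has_vector_derivative 2 * Re (cnj (U 0 s (x0 + r)) * (\<i> * nl \<alpha> \<beta> \<mu> (U 0 s (x0 + r)) (U 1 s (x0 + r)) (U 2 s (x0 + r))))) (at s within {0..T})"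
        using has_real_derivative_cmod_squared[OF csol_time[OF csolU s, of "x0 + r"]]
        by (simp add: has_real_derivative_iff_has_vector_derivative)
      have e: "Re (z * (\<i> * y)) = - Im (z * y)" for z y by simp
      show "norm (2 * Re (cnj (U 0 s (x0 + r)) * (\<i> * nl \<alpha> \<beta> \<mu> (U 0 s (x0 + r)) (U 1 s (x0 + r)) (U 2 s (x0 + r))))) \<le> 8 * A * M ^ 4 * r ^ 3"
        using modulus_derivative_small[OF x0 s r] unfolding e by (simp only: real_norm_def abs_mult abs_minus_cancel abs_numeral)
    qed (use t T in auto)
    also have "\<dots> \<le> (8 * A * M ^ 4 * r ^ 3) * T"
      using t A1 M1 r by (intro mult_left_mono) auto
    finally have "\<bar>?P t - ?P 0\<bar> \<le> (8 * A * M ^ 4 * r ^ 3) * T" by simp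
    then have "\<bar>(cmod (U 1 t x0))\<^sup>2 * r\<^sup>2 - \<eta>\<^sup>2 * r\<^sup>2\<bar> \<le> 4 * M\<^sup>2 * r ^ 3 + (8 * A * M ^ 4 * r ^ 3) * T"
      using sq[OF t r] sq[OF t0 r] unfolding b0 by linarith
    also have "\<dots> = r\<^sup>2 * ((4 * M\<^sup>2 + 8 * A * M ^ 4 * T) * r)" by (simp add: power2_eq_square power3_eq_cube algebra_simps)
    also have "\<bar>(cmod (U 1 t x0))\<^sup>2 * r\<^sup>2 - \<eta>\<^sup>2 * r\<^sup>2\<bar> = r\<^sup>2 * \<bar>(cmod (U 1 t x0))\<^sup>2 - \<eta>\<^sup>2\<bar>"
    proof -
      have "(cmod (U 1 t x0))\<^sup>2 * r\<^sup>2 - \<eta>\<^sup>2 * r\<^sup>2 = r\<^sup>2 * ((cmod (U 1 t x0))\<^sup>2 - \<eta>\<^sup>2)" by (simp add: algebra_simps)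
      then show ?thesis by (simp only: abs_mult abs_power2)
    qed
    finally show ?thesis using r by (simp add: mult_le_cancel_left)
  qed
  then have "\<bar>(cmod (U 1 t x0))\<^sup>2 - \<eta>\<^sup>2\<bar> \<le> 0" by (rule le_of_linear)
  then have "(cmod (U 1 t x0))\<^sup>2 = \<eta>\<^sup>2" by simp
  then show ?thesis using eta by (simp add: power2_eq_iff_nonneg)
qed

text \<open>The modulus of the slope is conserved, whereas its phase may drift by O(t). Both
  solutions, hence also \<open>v\<close>, have the same slope at the zero because the first
  derivative of \<open>W\<close> vanishes there.\<close>

lemma v_near_linear:
  assumes t: "t \<in> {0..T}" and x: "0 \<le> x" "x \<le> pi"
  shows "\<exists>a. cmod a = \<eta> \<and> cmod (a - of_real \<eta>) \<le> 2 * A * M ^ 3 * t \<and>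
    cmod (v 0 t x - a * of_real (sin x)) \<le> 8 * M * (sin x)\<^sup>2 \<and> cmod (v 1 t x - a * of_real (cos x)) \<le> 4 * M * sin x"
proof -
  obtain x0 where x0: "sin x0 = 0" "\<bar>x - x0\<bar> \<le> 2 * sin x" "(cos x0)\<^sup>2 = 1"
    using nearest_zero_sin[OF x] by metis
  have cos1: "cos x0 = 1 \<or> cos x0 = -1" using x0(3) by (simp add: power2_eq_1_iff)
  \<comment> \<open>\<open>cos x0\<close> is 1 at 0 and -1 at \<open>pi\<close>; with this factor
    \<open>a * sin x\<close> has slope \<open>U 1 t x0\<close> at either zero.\<close>
  define a where "a = U 1 t x0 * of_real (cos x0)"
  have a1: "cmod a = \<eta>" using slope_modulus[OF x0(1) t] cos1 by (auto simp: a_def norm_mult)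
  have "a - of_real \<eta> = (U 1 t x0 - U 1 0 x0) * of_real (cos x0)"
    unfolding a_def slope_initial[OF x0(1)] using cos1 by (auto simp: algebra_simps)
  then have a2: "cmod (a - of_real \<eta>) \<le> 2 * A * M ^ 3 * t"
    using slope_near_initial[OF x0(1) t] cos1 by (auto simp: norm_mult)
  have v1: "v 1 t x0 = U 1 t x0"
    using W_vanish[OF x0(1) _ t, of 1] k4 by (simp add: W_def v_def)
  have v0: "v 0 t x0 = 0" using zero_preserved[OF x0(1) t] by (simp add: v_def)
  define F where "F = (\<lambda>(i::nat) x. if i = 0 then v 0 t x - a * of_real (sin x) else v 1 t x - a * of_real (cos x))"
  have F1: "F 1 x0 = 0" unfolding F_def a_def v1 using cos1 by auto
  have cl: "\<bar>cos y - cos z\<bar> \<le> \<bar>y - z\<bar>" for y z :: real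
    using vector_derivative_bound[of UNIV cos "\<lambda>x. - sin x" 1 y z]
    by (auto simp: has_real_derivative_iff_has_vector_derivative[symmetric] intro!: derivative_eq_intros)
  have lipF: "norm (F 1 y - F 1 z) \<le> 2 * M * \<bar>y - z\<bar>" for y z
  proof -
    have "F 1 y - F 1 z = (v 1 t y - v 1 t z) - a * of_real (cos y - cos z)" by (simp add: F_def algebra_simps)
    also have "norm \<dots> \<le> M * \<bar>y - z\<bar> + \<eta> * \<bar>y - z\<bar>"
    proof -
      have "norm (v 1 t y - v 1 t z) \<le> M * \<bar>y - z\<bar>" using v_lip[OF t, of 1 y z] k4 by simp
      moreover have "norm (a * of_real (cos y - cos z)) \<le> \<eta> * \<bar>y - z\<bar>"
        unfolding norm_mult norm_of_real a1 using cl[of y z] eta by (intro mult_left_mono) auto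
      ultimately show ?thesis
        using norm_triangle_ineq4[of "v 1 t y - v 1 t z" "a * of_real (cos y - cos z)"] by linarith
    qed
    also have "\<dots> \<le> M * \<bar>y - z\<bar> + M * \<bar>y - z\<bar>" using eta M1 by (intro add_left_mono mult_right_mono) auto
    finally show ?thesis by simp
  qed
  have dF: "(F 0 has_vector_derivative F 1 y) (at y)" for y
    unfolding F_def
  proof (simp, rule has_vector_derivative_diff)
    show "(v 0 t has_vector_derivative v (Suc 0) t y) (at y)" using v_deriv[OF t, of 0 y] k4 by simp
    have "((\<lambda>x. complex_of_real (sin x)) has_vector_derivative of_real (cos y)) (at y)"
      by (rule bounded_linear.has_vector_derivative[OF bounded_linear_of_real])
        (auto simp: has_real_derivative_iff_has_vector_derivative[symmetric] intro!: derivative_eq_intros)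
    then show "((\<lambda>x. a * complex_of_real (sin x)) has_vector_derivative a * of_real (cos y)) (at y)"
      by (rule has_vector_derivative_mult_right)
  qed
  have "norm (F 0 x - ((x - x0) ^ 1 / fact 1) *\<^sub>R F 1 x0) \<le> 2 * M * \<bar>x - x0\<bar> ^ (1 + 1)"
    using dF lipF v0 x0(1) by (intro taylor_lipschitz) (auto simp: F_def)
  then have "norm (F 0 x) \<le> 2 * M * \<bar>x - x0\<bar>\<^sup>2" using F1 by (simp add: power2_eq_square)
  also have "\<dots> \<le> 2 * M * (2 * sin x)\<^sup>2" using x0(2) M1 by (intro mult_left_mono power_mono) auto
  finally have b0: "norm (F 0 x) \<le> 8 * M * (sin x)\<^sup>2" by (simp add: power_mult_distrib)
  have "norm (F 1 x) \<le> 2 * M * \<bar>x - x0\<bar>" using lipF[of x x0] F1 by simp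
  also have "\<dots> \<le> 2 * M * (2 * sin x)" using x0(2) M1 by (intro mult_left_mono) auto
  finally have b1: "norm (F 1 x) \<le> 4 * M * sin x" by simp
  show ?thesis using a1 a2 b0 b1 by (intro exI[of _ a]) (auto simp: F_def)
qed

text \<open>In the first two expressions the phase of the slope cancels. The third contains the
  square of the slope, and the drift of its phase produces the additional term linear in
  \<open>t\<close>.\<close>

lemma v_coefficients:
  assumes t: "t \<in> {0..T}" and x: "0 \<le> x" "x \<le> pi"
  shows "\<bar>(cmod (v 0 t x))\<^sup>2 - \<eta>\<^sup>2 * (sin x)\<^sup>2\<bar> \<le> 24 * M * (sin x) ^ 3"
    and "cmod (cnj (v 0 t x) * v 1 t x - of_real (\<eta>\<^sup>2 * sin x * cos x)) \<le> 16 * M * (sin x)\<^sup>2"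
    and "cmod (v 0 t x * v 1 t x - of_real (\<eta>\<^sup>2 * sin x * cos x)) \<le> 16 * M * (sin x)\<^sup>2 + 4 * A * M ^ 3 * t * sin x"
proof -
  obtain a where a: "cmod a = \<eta>" "cmod (a - of_real \<eta>) \<le> 2 * A * M ^ 3 * t"
    "cmod (v 0 t x - a * of_real (sin x)) \<le> 8 * M * (sin x)\<^sup>2" "cmod (v 1 t x - a * of_real (cos x)) \<le> 4 * M * sin x"
    using v_near_linear[OF assms] by blast
  define s where "s = sin x"
  define C where "C = cos x"
  define e0 where "e0 = v 0 t x - a * of_real s"
  define e1 where "e1 = v 1 t x - a * of_real C"
  have s: "0 \<le> s" "s \<le> 1" using sin_ge_zero[OF x] by (auto simp: s_def)
  have C: "\<bar>C\<bar> \<le> 1" by (simp add: C_def)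
  have e0: "cmod e0 \<le> 8 * M * s\<^sup>2" and e1: "cmod e1 \<le> 4 * M * s" using a by (auto simp: e0_def e1_def s_def C_def)
  have v0: "v 0 t x = e0 + a * of_real s" and v1: "v 1 t x = e1 + a * of_real C" by (auto simp: e0_def e1_def)
  have "\<eta> * s \<le> 1 * s" using eta s by (intro mult_right_mono) auto
  then have vs: "cmod (v 0 t x) \<le> 2 * s"
    using v_size(1)[OF t, of x] s by (simp add: s_def)
  have ea: "cmod (a * of_real s) \<le> 1 * s" using a(1) eta s by (simp only: norm_mult norm_of_real abs_of_nonneg) (intro mult_right_mono; simp)
  have aC: "cmod (a * of_real C) \<le> 1 * 1" unfolding norm_mult norm_of_real using a(1) eta C by (intro mult_mono) auto
  have "\<bar>(cmod (v 0 t x))\<^sup>2 - (cmod (a * of_real s))\<^sup>2\<bar> = \<bar>cmod (v 0 t x) - cmod (a * of_real s)\<bar> * (cmod (v 0 t x) + cmod (a * of_real s))"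
  proof -
    have "X\<^sup>2 - Y\<^sup>2 = (X - Y) * (X + Y)" for X Y :: real by (simp add: power2_eq_square algebra_simps)
    then show ?thesis by (simp only: abs_mult abs_of_nonneg add_nonneg_nonneg norm_ge_zero)
  qed
  also have "\<dots> \<le> (8 * M * s\<^sup>2) * (3 * s)"
    using norm_triangle_ineq3[of "v 0 t x" "a * of_real s"] e0 vs ea s M1 by (intro mult_mono) (auto simp: e0_def)
  finally show "\<bar>(cmod (v 0 t x))\<^sup>2 - \<eta>\<^sup>2 * (sin x)\<^sup>2\<bar> \<le> 24 * M * (sin x) ^ 3"
    using a(1) by (simp add: s_def norm_mult power_mult_distrib power2_eq_square power3_eq_cube mult_ac)
  have main: "cmod (v 0 t x) * cmod e1 + cmod e0 * cmod (a * of_real C) \<le> 16 * M * s\<^sup>2"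
  proof -
    have "cmod (v 0 t x) * cmod e1 \<le> (2 * s) * (4 * M * s)" using vs e1 s M1 by (intro mult_mono) auto
    moreover have "cmod e0 * cmod (a * of_real C) \<le> (8 * M * s\<^sup>2) * (1 * 1)" using e0 aC s M1 by (intro mult_mono) auto
    ultimately show ?thesis by (simp add: power2_eq_square algebra_simps)
  qed
  have "cnj (v 0 t x) * v 1 t x - of_real ((cmod a)\<^sup>2 * s * C) = cnj (v 0 t x) * e1 + cnj e0 * (a * of_real C)"
    unfolding of_real_mult complex_norm_square by (simp add: e0_def e1_def algebra_simps)
  also have "cmod \<dots> \<le> 16 * M * s\<^sup>2"
    using main by (intro norm_triangle_le) (simp only: norm_mult complex_mod_cnj)
  finally show "cmod (cnj (v 0 t x) * v 1 t x - of_real (\<eta>\<^sup>2 * sin x * cos x)) \<le> 16 * M * (sin x)\<^sup>2"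
    by (simp only: a(1) s_def C_def)
  have "cmod (a\<^sup>2 - (of_real \<eta>)\<^sup>2) \<le> 2 * (2 * A * M ^ 3 * t)"
  proof -
    have "a\<^sup>2 - (of_real \<eta>)\<^sup>2 = (a + of_real \<eta>) * (a - of_real \<eta>)" by (simp add: power2_eq_square algebra_simps)
    also have "cmod \<dots> \<le> 2 * (2 * A * M ^ 3 * t)"
      unfolding norm_mult using a(1,2) eta norm_triangle_ineq[of a "of_real \<eta>"] by (intro mult_mono) auto
    finally show ?thesis .
  qed
  then have "cmod ((a\<^sup>2 - (of_real \<eta>)\<^sup>2) * of_real (s * C)) \<le> (4 * A * M ^ 3 * t) * s"
    unfolding norm_mult norm_of_real using C s t A1 M1 by (intro mult_mono) (auto simp: abs_mult mult_left_le)
  moreover have "v 0 t x * v 1 t x - of_real (\<eta>\<^sup>2 * s * C) = (v 0 t x * e1 + e0 * (a * of_real C)) + (a\<^sup>2 - (of_real \<eta>)\<^sup>2) * of_real (s * C)"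
    by (simp add: e0_def e1_def algebra_simps power2_eq_square)
  moreover have "cmod (v 0 t x * e1 + e0 * (a * of_real C)) \<le> 16 * M * s\<^sup>2"
    using main by (intro norm_triangle_le) (simp only: norm_mult)
  ultimately show "cmod (v 0 t x * v 1 t x - of_real (\<eta>\<^sup>2 * sin x * cos x)) \<le> 16 * M * (sin x)\<^sup>2 + 4 * A * M ^ 3 * t * sin x"
    using norm_triangle_mono[of "v 0 t x * e1 + e0 * (a * of_real C)" "16 * M * s\<^sup>2"
      "(a\<^sup>2 - (of_real \<eta>)\<^sup>2) * of_real (s * C)" "(4 * A * M ^ 3 * t) * s"]
    by (simp only: s_def C_def)
qed

end

section \<open>The weighted energy\<close>

context parameters
begin

definition bco where "bco v p = of_real \<alpha> * v * cnj p + 2 * of_real \<beta> * cnj v * p"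

definition zth where "zth v p q w = (v * cnj w + w * cnj v) * q + of_real \<alpha> * w * (p * cnj p) + of_real \<beta> * cnj w * p\<^sup>2
   + \<mu> * (2 * v * cnj v * w + v\<^sup>2 * cnj w)"

text \<open>\<open>nl\<close> is homogeneous of degree three over the reals, so in a symmetric
  difference all terms even in \<open>w\<close> cancel. There remain the linearisation at
  \<open>v\<close>, with first-order coefficient \<open>bco\<close> and zeroth-order part
  \<open>zth\<close>, and the cubic term.\<close>

lemma nl_symmetric_difference:
  "nl \<alpha> \<beta> \<mu> (v + w / 2) (p + w1 / 2) (q + w2 / 2) - nl \<alpha> \<beta> \<mu> (v - w / 2) (p - w1 / 2) (q - w2 / 2)
   = v * cnj v * w2 + bco v p * w1 + of_real \<alpha> * v * p * cnj w1 + zth v p q w + nl \<alpha> \<beta> \<mu> w w1 w2 / 4"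
proof -
  \<comment> \<open>Doubled variables remove all fractions before the ring normalisation.\<close>
  have halves: "v = 2 * a \<Longrightarrow> w = 2 * b \<Longrightarrow> p = 2 * c \<Longrightarrow> w1 = 2 * d \<Longrightarrow> q = 2 * e \<Longrightarrow> w2 = 2 * f \<Longrightarrow> ?thesis" for a b c d e f
    unfolding nl_def bco_def zth_def complex_norm_square
    by (simp add: algebra_simps power2_eq_square)
  show ?thesis by (rule halves[of "v / 2" "w / 2" "p / 2" "w1 / 2" "q / 2" "w2 / 2"]) simp_all
qed

lemma norm_zth_le:
  assumes "cmod v \<le> M" "cmod p \<le> M" "cmod q \<le> M"
  shows "cmod (zth v p q w) \<le> 3 * A * M\<^sup>2 * cmod w"
proof -
  have w: "0 \<le> cmod w" "0 \<le> M" using M1 by auto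
  have mm: "cmod a * cmod b \<le> M * M" if "cmod a \<le> M" "cmod b \<le> M" for a b
    using that w by (intro mult_mono) auto
  have 1: "cmod ((v * cnj w + w * cnj v) * q) \<le> 2 * (M\<^sup>2 * cmod w)"
  proof -
    have "cmod ((v * cnj w + w * cnj v) * q) \<le> (cmod v * cmod w + cmod w * cmod v) * cmod q"
      unfolding norm_mult[of _ q] using norm_triangle_ineq[of "v * cnj w" "w * cnj v"]
      by (intro mult_right_mono) (auto simp: norm_mult)
    also have "\<dots> = 2 * (cmod v * cmod q * cmod w)" by (simp add: algebra_simps)
    also have "\<dots> \<le> 2 * (M * M * cmod w)" using mm[OF assms(1,3)] w by (intro mult_left_mono mult_right_mono) auto
    finally show ?thesis by (simp add: power2_eq_square)
  qed
  have 2: "cmod (of_real \<alpha> * w * (p * cnj p)) \<le> \<bar>\<alpha>\<bar> * (M\<^sup>2 * cmod w)"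
    using mult_left_mono[OF mult_right_mono[OF mm[OF assms(2,2)] w(1)], of "\<bar>\<alpha>\<bar>"]
    by (simp add: norm_mult power2_eq_square mult_ac)
  have 3: "cmod (of_real \<beta> * cnj w * p\<^sup>2) \<le> \<bar>\<beta>\<bar> * (M\<^sup>2 * cmod w)"
    using mult_left_mono[OF mult_right_mono[OF mm[OF assms(2,2)] w(1)], of "\<bar>\<beta>\<bar>"]
    by (simp add: norm_mult power2_eq_square mult_ac)
  have 4: "cmod (\<mu> * (2 * v * cnj v * w + v\<^sup>2 * cnj w)) \<le> cmod \<mu> * (3 * (M\<^sup>2 * cmod w))"
  proof -
    have "cmod (2 * v * cnj v * w + v\<^sup>2 * cnj w) \<le> 3 * (cmod v * cmod v * cmod w)"
      using norm_triangle_ineq[of "2 * v * cnj v * w" "v\<^sup>2 * cnj w"] by (simp add: norm_mult power2_eq_square)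
    also have "\<dots> \<le> 3 * (M * M * cmod w)" using mm[OF assms(1,1)] w by (intro mult_left_mono mult_right_mono) auto
    finally show ?thesis unfolding norm_mult[of \<mu>] by (intro mult_left_mono) (auto simp: power2_eq_square)
  qed
  have "cmod (zth v p q w) \<le> 2 * (M\<^sup>2 * cmod w) + \<bar>\<alpha>\<bar> * (M\<^sup>2 * cmod w) + \<bar>\<beta>\<bar> * (M\<^sup>2 * cmod w) + cmod \<mu> * (3 * (M\<^sup>2 * cmod w))"
    unfolding zth_def by (intro norm_triangle_le add_mono 1 2 3 4)
  also have "\<dots> = (2 + \<bar>\<alpha>\<bar> + \<bar>\<beta>\<bar> + 3 * cmod \<mu>) * (M\<^sup>2 * cmod w)" by (simp add: algebra_simps)
  also have "\<dots> \<le> (3 * A) * (M\<^sup>2 * cmod w)" by (intro mult_right_mono) (auto simp: A_def bigA_def)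
  finally show ?thesis by (simp add: mult_ac)
qed

text \<open>Without a weight the top-order terms form an exact derivative except for
  \<open>2 * \<sigma> * \<rho>x * Im (cnj w * w1)\<close>; the coefficient is
  \<open>\<sigma>\<close> because of \<open>\<alpha> / 2 + \<beta> = 1 - \<sigma>\<close>. This term
  is what differentiating the weight \<open>\<rho> powr (- \<sigma>)\<close> in the flux
  cancels.\<close>

lemma energy_flux_identity:
  fixes v p q w w1 w2 :: complex
  defines "\<rho> \<equiv> (cmod v)\<^sup>2" and "\<rho>x \<equiv> 2 * Re (cnj v * p)" and "bi \<equiv> (\<alpha> - 2 * \<beta>) * Im (v * cnj p)"
  shows "2 * Re (cnj w * (\<i> * (v * cnj v * w2 + bco v p * w1 + of_real \<alpha> * v * p * cnj w1)))
    - (- 2 * (\<rho>x * Im (cnj w * w1) + \<rho> * Im (cnj w * w2)) - (\<alpha> - 2 * \<beta>) * Im (v * cnj q) * (cmod w)\<^sup>2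
       - bi * (2 * Re (cnj w * w1)) - \<alpha> * Im ((p * p + v * q) * (cnj w)\<^sup>2 + 2 * v * p * cnj w * cnj w1))
    = 2 * \<sigma> * \<rho>x * Im (cnj w * w1) + (\<alpha> - 2 * \<beta>) * Im (v * cnj q) * (cmod w)\<^sup>2 + \<alpha> * Im ((p * p + v * q) * (cnj w)\<^sup>2)"
proof -
  have \<sigma>: "\<sigma> = 1 - \<alpha> / 2 - \<beta>" using sigma by simp
  show ?thesis
    unfolding \<rho>_def \<rho>x_def bi_def bco_def cmod_power2 \<sigma>
    by (simp add: power2_eq_square) (simp add: algebra_simps)
qed

definition KE where "KE = 12 * A * M\<^sup>2 * (1 + \<bar>\<sigma>\<bar>)"

lemma abs_alpha_le: "\<bar>\<alpha>\<bar> \<le> A" "\<bar>\<alpha> - 2 * \<beta>\<bar> \<le> 2 * A"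
proof -
  have "\<bar>\<alpha> - 2 * \<beta>\<bar> \<le> \<bar>\<alpha>\<bar> + 2 * \<bar>\<beta>\<bar>" using abs_triangle_ineq4[of \<alpha> "2 * \<beta>"] by (simp add: abs_mult)
  moreover have "A = 1 + \<bar>\<alpha>\<bar> + \<bar>\<beta>\<bar> + cmod \<mu>" by (simp add: A_def bigA_def)
  moreover have "0 \<le> cmod \<mu>" "0 \<le> \<bar>\<alpha>\<bar>" "0 \<le> \<bar>\<beta>\<bar>" by auto
  ultimately show "\<bar>\<alpha>\<bar> \<le> A" "\<bar>\<alpha> - 2 * \<beta>\<bar> \<le> 2 * A" by linarith+
qed

text \<open>Division by \<open>\<rho>\<close> is harmless near a zero: \<open>\<rho>t\<close>
  carries the factor \<open>|v|^2\<close> by assumption, and \<open>\<rho>x / \<rho>\<close>, of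
  size \<open>2 |p| / |v|\<close> at most, is always multiplied by a term containing
  \<open>v\<close> and \<open>p\<close>.\<close>

lemma energy_remainder_bound:
  fixes v p q w w1 w2 :: complex and \<rho>t :: real
  assumes v0: "v \<noteq> 0" and v: "cmod v \<le> M" "cmod p \<le> M" "cmod q \<le> M" and w: "cmod w \<le> 2 * M" "cmod w1 \<le> 2 * M" "cmod w2 \<le> 2 * M"
    and \<rho>t: "\<bar>\<rho>t\<bar> \<le> 4 * A * M\<^sup>2 * (cmod v)\<^sup>2"
  defines "\<rho> \<equiv> (cmod v)\<^sup>2" and "\<rho>x \<equiv> 2 * Re (cnj v * p)" and "bi \<equiv> (\<alpha> - 2 * \<beta>) * Im (v * cnj p)"
  shows "\<bar>- \<sigma> * (\<rho>t / \<rho>) * (cmod w)\<^sup>2 + \<sigma> * (\<rho>x / \<rho>) * (- bi * (cmod w)\<^sup>2 - \<alpha> * Im (v * p * (cnj w)\<^sup>2))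
     + (\<alpha> - 2 * \<beta>) * Im (v * cnj q) * (cmod w)\<^sup>2 + \<alpha> * Im ((p * p + v * q) * (cnj w)\<^sup>2)
     - 2 * Im (cnj w * zth v p q w) - Im (cnj w * nl \<alpha> \<beta> \<mu> w w1 w2) / 2\<bar> \<le> KE * (cmod w)\<^sup>2"
proof -
  define N where "N = (cmod w)\<^sup>2"
  have N: "0 \<le> N" by (simp add: N_def)
  have M0: "0 \<le> M" using M1 by simp
  have \<rho>: "\<rho> > 0" using v0 by (simp add: \<rho>_def)
  have mm: "cmod a * cmod b \<le> M\<^sup>2" if "cmod a \<le> M" "cmod b \<le> M" for a b
    using mult_mono[OF that M0] by (simp add: power2_eq_square)
  have im: "\<bar>Im (z * (cnj w)\<^sup>2)\<bar> \<le> cmod z * N" for z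
    using abs_Im_le_cmod[of "z * (cnj w)\<^sup>2"] by (simp add: norm_mult norm_power N_def)
  have 1: "\<bar>- \<sigma> * (\<rho>t / \<rho>) * N\<bar> \<le> \<bar>\<sigma>\<bar> * (4 * (A * M\<^sup>2)) * N"
  proof -
    have "\<bar>\<rho>t / \<rho>\<bar> \<le> 4 * (A * M\<^sup>2)"
      using \<rho>t \<rho> by (simp add: \<rho>_def divide_le_eq mult_ac)
    then show ?thesis unfolding abs_mult using N A1 by (intro mult_right_mono mult_mono) auto
  qed
  have x: "\<bar>\<rho>x / \<rho>\<bar> * (cmod v * cmod p) \<le> 2 * M\<^sup>2"
  proof -
    have "\<bar>\<rho>x\<bar> \<le> 2 * (cmod v * cmod p)"
      using abs_Re_le_cmod[of "cnj v * p"] by (simp add: \<rho>x_def norm_mult)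
    then have "\<bar>\<rho>x\<bar> * (cmod v * cmod p) \<le> 2 * (cmod v * cmod p) * (cmod v * cmod p)"
      by (intro mult_right_mono) auto
    also have "\<dots> = \<rho> * (2 * (cmod p * cmod p))" by (simp add: \<rho>_def power2_eq_square)
    also have "\<dots> \<le> \<rho> * (2 * M\<^sup>2)" using mm[OF v(2,2)] \<rho> by (intro mult_left_mono) auto
    finally show ?thesis using \<rho> by (simp add: divide_le_eq mult_ac)
  qed
  have 2: "\<bar>\<sigma> * (\<rho>x / \<rho>) * (- bi * N - \<alpha> * Im (v * p * (cnj w)\<^sup>2))\<bar> \<le> \<bar>\<sigma>\<bar> * (6 * (A * M\<^sup>2)) * N"
  proof -
    have "\<bar>bi * N\<bar> \<le> 2 * A * (cmod v * cmod p) * N"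
      using abs_Im_le_cmod[of "v * cnj p"] abs_alpha_le(2) N A1
      by (auto simp: bi_def abs_mult norm_mult intro!: mult_right_mono mult_mono)
    moreover have "\<bar>\<alpha> * Im (v * p * (cnj w)\<^sup>2)\<bar> \<le> A * (cmod v * cmod p * N)"
      unfolding abs_mult using im[of "v * p"] abs_alpha_le(1) by (intro mult_mono) (auto simp: norm_mult)
    ultimately have "\<bar>- bi * N - \<alpha> * Im (v * p * (cnj w)\<^sup>2)\<bar> \<le> (cmod v * cmod p) * (3 * A * N)"
      by (simp add: algebra_simps)
    then have "\<bar>\<rho>x / \<rho>\<bar> * \<bar>- bi * N - \<alpha> * Im (v * p * (cnj w)\<^sup>2)\<bar> \<le> \<bar>\<rho>x / \<rho>\<bar> * ((cmod v * cmod p) * (3 * A * N))"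
      by (intro mult_left_mono) auto
    also have "\<dots> \<le> (2 * M\<^sup>2) * (3 * A * N)"
      unfolding mult.assoc[symmetric, of "\<bar>\<rho>x / \<rho>\<bar>"] using x A1 N by (intro mult_right_mono) auto
    finally have "\<bar>\<sigma>\<bar> * (\<bar>\<rho>x / \<rho>\<bar> * \<bar>- bi * N - \<alpha> * Im (v * p * (cnj w)\<^sup>2)\<bar>) \<le> \<bar>\<sigma>\<bar> * ((2 * M\<^sup>2) * (3 * A * N))"
      by (intro mult_left_mono) auto
    then show ?thesis unfolding abs_mult by (simp add: mult_ac)
  qed
  have 3: "\<bar>(\<alpha> - 2 * \<beta>) * Im (v * cnj q) * N\<bar> \<le> (2 * (A * M\<^sup>2)) * N"
  proof -
    have "\<bar>Im (v * cnj q)\<bar> \<le> M\<^sup>2" using abs_Im_le_cmod[of "v * cnj q"] mm[OF v(1,3)] by (simp add: norm_mult)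
    then have "\<bar>\<alpha> - 2 * \<beta>\<bar> * \<bar>Im (v * cnj q)\<bar> \<le> (2 * A) * M\<^sup>2"
      using abs_alpha_le(2) A1 by (intro mult_mono) auto
    from mult_right_mono[OF this N] show ?thesis unfolding abs_mult abs_of_nonneg[OF N] by (simp only: mult_ac)
  qed
  have 4: "\<bar>\<alpha> * Im ((p * p + v * q) * (cnj w)\<^sup>2)\<bar> \<le> (2 * (A * M\<^sup>2)) * N"
  proof -
    have "cmod (p * p + v * q) \<le> 2 * M\<^sup>2"
      using norm_triangle_ineq[of "p * p" "v * q"] mm[OF v(2,2)] mm[OF v(1,3)] by (simp add: norm_mult)
    then have "\<bar>Im ((p * p + v * q) * (cnj w)\<^sup>2)\<bar> \<le> 2 * M\<^sup>2 * N"
      using im[of "p * p + v * q"] mult_right_mono[of _ "2 * M\<^sup>2" N] N by (meson order_trans)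
    then have "\<bar>\<alpha>\<bar> * \<bar>Im ((p * p + v * q) * (cnj w)\<^sup>2)\<bar> \<le> A * (2 * M\<^sup>2 * N)"
      using abs_alpha_le(1) A1 by (intro mult_mono) auto
    then show ?thesis unfolding abs_mult by (simp add: mult_ac)
  qed
  have 5: "\<bar>2 * Im (cnj w * zth v p q w)\<bar> \<le> (6 * (A * M\<^sup>2)) * N"
  proof -
    have "\<bar>Im (cnj w * zth v p q w)\<bar> \<le> cmod w * cmod (zth v p q w)"
      using abs_Im_le_cmod[of "cnj w * zth v p q w"] by (simp add: norm_mult)
    also have "\<dots> \<le> cmod w * (3 * A * M\<^sup>2 * cmod w)" using norm_zth_le[OF v] by (intro mult_left_mono) auto
    finally show ?thesis by (simp add: N_def power2_eq_square mult_ac)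
  qed
  have 6: "\<bar>Im (cnj w * nl \<alpha> \<beta> \<mu> w w1 w2) / 2\<bar> \<le> (2 * (A * M\<^sup>2)) * N"
  proof -
    have "\<bar>Im (cnj w * nl \<alpha> \<beta> \<mu> w w1 w2)\<bar> \<le> cmod w * cmod (nl \<alpha> \<beta> \<mu> w w1 w2)"
      using abs_Im_le_cmod[of "cnj w * nl \<alpha> \<beta> \<mu> w w1 w2"] by (simp add: norm_mult)
    also have "\<dots> \<le> cmod w * (bigA \<alpha> \<beta> \<mu> * (2 * M)\<^sup>2 * cmod w)" using norm_nl_le[OF w] by (intro mult_left_mono) auto
    finally show ?thesis by (simp add: A_def N_def power2_eq_square mult_ac)
  qed
  have "\<bar>- \<sigma> * (\<rho>t / \<rho>) * N + \<sigma> * (\<rho>x / \<rho>) * (- bi * N - \<alpha> * Im (v * p * (cnj w)\<^sup>2))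
     + (\<alpha> - 2 * \<beta>) * Im (v * cnj q) * N + \<alpha> * Im ((p * p + v * q) * (cnj w)\<^sup>2)
     - 2 * Im (cnj w * zth v p q w) - Im (cnj w * nl \<alpha> \<beta> \<mu> w w1 w2) / 2\<bar>
    \<le> \<bar>\<sigma>\<bar> * (4 * (A * M\<^sup>2)) * N + \<bar>\<sigma>\<bar> * (6 * (A * M\<^sup>2)) * N + (2 * (A * M\<^sup>2)) * N + (2 * (A * M\<^sup>2)) * N
      + (6 * (A * M\<^sup>2)) * N + (2 * (A * M\<^sup>2)) * N"
  proof -
    have sum6: "\<bar>a + b + c + d - e - f\<bar> \<le> a' + b' + c' + d' + e' + f'"
      if "\<bar>a\<bar> \<le> a'" "\<bar>b\<bar> \<le> b'" "\<bar>c\<bar> \<le> c'" "\<bar>d\<bar> \<le> d'" "\<bar>e\<bar> \<le> e'" "\<bar>f\<bar> \<le> f'"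
      for a b c d e f a' b' c' d' e' f' :: real
      using that by linarith
    show ?thesis by (rule sum6[OF 1 2 3 4 5 6])
  qed
  also have "\<dots> = (10 * \<bar>\<sigma>\<bar> + 12) * (A * M\<^sup>2 * N)" by (simp add: algebra_simps)
  also have "\<dots> \<le> (12 * \<bar>\<sigma>\<bar> + 12) * (A * M\<^sup>2 * N)" using A1 N by (intro mult_right_mono) auto
  also have "\<dots> = KE * N" by (simp add: KE_def algebra_simps)
  finally show ?thesis unfolding N_def .
qed

text \<open>The exponent may have either sign, so the values at both ends of the range of
  \<open>|v| / sin x\<close> are added.\<close>

definition cb where "cb \<tau> = ((3 / 4 * \<eta>)\<^sup>2) powr \<tau> + ((5 / 4 * \<eta>)\<^sup>2) powr \<tau>"

lemma cb_pos: "0 < cb \<tau>"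
  using eta by (simp add: cb_def add_pos_pos)

lemma powr_comparable:
  assumes "0 < s" "3 / 4 * (\<eta> * s) \<le> r" "r \<le> 5 / 4 * (\<eta> * s)"
  shows "(r\<^sup>2) powr \<tau> \<le> cb \<tau> * s powr (2 * \<tau>)"
proof -
  define c where "c = r\<^sup>2 / s\<^sup>2"
  have c: "(3 / 4 * \<eta>)\<^sup>2 \<le> c" "c \<le> (5 / 4 * \<eta>)\<^sup>2"
  proof -
    have "(3 / 4 * (\<eta> * s))\<^sup>2 \<le> r\<^sup>2" "r\<^sup>2 \<le> (5 / 4 * (\<eta> * s))\<^sup>2"
      using assms eta by (auto intro!: power_mono mult_nonneg_nonneg)
    then show "(3 / 4 * \<eta>)\<^sup>2 \<le> c" "c \<le> (5 / 4 * \<eta>)\<^sup>2"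
      using assms(1) by (auto simp: c_def field_simps power2_eq_square)
  qed
  have c0: "0 < (3 / 4 * \<eta>)\<^sup>2" using eta by simp
  then have c00: "0 < c" using c by linarith
  have "c powr \<tau> \<le> cb \<tau>"
  proof (cases "0 \<le> \<tau>")
    case True
    then have "c powr \<tau> \<le> ((5 / 4 * \<eta>)\<^sup>2) powr \<tau>" using c c00 by (intro powr_mono2) auto
    then show ?thesis by (simp add: cb_def add_increasing)
  next
    case False
    then have "c powr \<tau> \<le> ((3 / 4 * \<eta>)\<^sup>2) powr \<tau>" using c c0 by (intro powr_mono2') auto
    then show ?thesis by (simp add: cb_def add_increasing2)
  qed
  moreover have "(r\<^sup>2) powr \<tau> = c powr \<tau> * s powr (2 * \<tau>)"
  proof -
    have "r\<^sup>2 = c * (s powr 2)" using assms(1) by (simp add: c_def powr_numeral)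
    then show ?thesis using c00 by (simp add: powr_mult powr_powr)
  qed
  ultimately show ?thesis by (simp add: mult_right_mono)
qed

end

lemma has_real_derivative_powr_within:
  assumes "(g has_real_derivative g') (at t within S)" "0 < g t"
  shows "((\<lambda>t. g t powr r) has_real_derivative r * g t powr r * (g' / g t)) (at t within S)"
proof -
  have "((\<lambda>t. g t powr r) has_real_derivative (r * g t powr (r - 1)) * g') (at t within S)"
    by (rule DERIV_chain2[OF has_real_derivative_powr[OF assms(2)] assms(1)])
  moreover have "(r * g t powr (r - 1)) * g' = r * g t powr r * (g' / g t)"
    using assms(2) by (simp add: powr_diff)
  ultimately show ?thesis by simp
qed

lemma has_real_derivative_Im:
  "(f has_vector_derivative f') F \<Longrightarrow> ((\<lambda>x. Im (f x)) has_real_derivative Im f') F"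
  using bounded_linear.has_vector_derivative[OF bounded_linear_Im]
  by (auto simp: has_real_derivative_iff_has_vector_derivative)

lemma has_real_derivative_Re:
  "(f has_vector_derivative f') F \<Longrightarrow> ((\<lambda>x. Re (f x)) has_real_derivative Re f') F"
  using bounded_linear.has_vector_derivative[OF bounded_linear_Re]
  by (auto simp: has_real_derivative_iff_has_vector_derivative)

lemma has_vector_derivative_cnj_comp:
  "(f has_vector_derivative f') F \<Longrightarrow> ((\<lambda>x. cnj (f x)) has_vector_derivative cnj f') F"
  by (rule bounded_linear.has_vector_derivative[OF bounded_linear_cnj])

text \<open>A Gronwall inequality on a time interval so short that no exponential is needed.\<close>
lemma short_time_gronwall:
  fixes E :: "real \<Rightarrow> real"
  assumes T: "0 \<le> T" "K * T \<le> 1 / 2" "0 \<le> K" and c: "0 \<le> c"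
    and der: "\<And>t. t \<in> {0..T} \<Longrightarrow> (E has_real_derivative E' t) (at t within {0..T})"
    and le: "\<And>t. t \<in> {0..T} \<Longrightarrow> E' t \<le> K * E t + c"
    and pos: "\<And>t. t \<in> {0..T} \<Longrightarrow> 0 \<le> E t" and t: "t \<in> {0..T}"
  shows "E t \<le> 2 * E 0 + 2 * c * T"
proof -
  have "continuous_on {0..T} E"
    using der by (meson DERIV_continuous continuous_on_eq_continuous_within)
  then obtain t0 where t0: "t0 \<in> {0..T}" "\<And>s. s \<in> {0..T} \<Longrightarrow> E s \<le> E t0"
    using continuous_attains_sup[of "{0..T}" E] T by auto
  have "\<exists>z\<in>{0..t0}. E t0 - E 0 = E' z * (t0 - 0)"
  proof (rule mvt_very_simple[where f' = "\<lambda>z h. E' z * h"])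
    fix x assume "0 \<le> x" "x \<le> t0"
    then have "(E has_real_derivative E' x) (at x within {0..t0})"
      using der[of x] t0(1) by (auto intro: DERIV_subset)
    then show "(E has_derivative (\<lambda>h. E' x * h)) (at x within {0..t0})"
      by (simp add: has_field_derivative_def)
  qed (use t0 in auto)
  then obtain z where z: "z \<in> {0..t0}" "E t0 - E 0 = E' z * t0" by auto
  have "E' z \<le> K * E t0 + c"
    using le[of z] t0 z(1) mult_left_mono[OF t0(2)[of z] T(3)] by auto
  then have "E' z * t0 \<le> (K * E t0 + c) * t0" using t0 by (intro mult_right_mono) auto
  also have "\<dots> \<le> (K * E t0 + c) * T"
    using t0 T c pos[OF t0(1)] by (intro mult_left_mono) auto
  also have "\<dots> = (K * T) * E t0 + c * T" by (simp add: algebra_simps)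
  also have "\<dots> \<le> 1 / 2 * E t0 + c * T"
    using T(2) pos[OF t0(1)] by (intro add_right_mono mult_right_mono) auto
  finally have "E t0 \<le> 2 * E 0 + 2 * c * T" using z(2) by simp
  then show ?thesis using t0(2)[OF t] by simp
qed

context two_solutions
begin

section \<open>Energy density, its flux, and the energy estimate\<close>

lemma cont_U: "j \<le> 2 \<Longrightarrow> S \<subseteq> {0..T} \<times> UNIV \<Longrightarrow> continuous_on S (\<lambda>z. U j (fst z) (snd z))"
proof -
  assume "j \<le> 2" and S: "S \<subseteq> {0..T} \<times> UNIV"
  then have "continuous_on ({0..T} \<times> UNIV) (\<lambda>z. U j (fst z) (snd z))"
    using csol_cont[OF csolU, of j] k4 by (simp add: split_beta)
  then show ?thesis using S by (rule continuous_on_subset)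
qed

lemma cont_V: "j \<le> 2 \<Longrightarrow> S \<subseteq> {0..T} \<times> UNIV \<Longrightarrow> continuous_on S (\<lambda>z. V j (fst z) (snd z))"
proof -
  assume "j \<le> 2" and S: "S \<subseteq> {0..T} \<times> UNIV"
  then have "continuous_on ({0..T} \<times> UNIV) (\<lambda>z. V j (fst z) (snd z))"
    using csol_cont[OF csolV, of j] k4 by (simp add: split_beta)
  then show ?thesis using S by (rule continuous_on_subset)
qed

lemma cont_v: "j \<le> 2 \<Longrightarrow> S \<subseteq> {0..T} \<times> UNIV \<Longrightarrow> continuous_on S (\<lambda>z. v j (fst z) (snd z))"
  unfolding v_def by (intro continuous_intros cont_U cont_V) auto

lemma cont_W: "j \<le> 2 \<Longrightarrow> S \<subseteq> {0..T} \<times> UNIV \<Longrightarrow> continuous_on S (\<lambda>z. W j (fst z) (snd z))"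
  unfolding W_def by (intro continuous_intros cont_U cont_V)

lemma cont_slice:
  assumes "continuous_on ({0..T} \<times> S) (\<lambda>z. f (fst z) (snd z))" "t \<in> {0..T}"
  shows "continuous_on S (f t)"
proof -
  have "continuous_on S (\<lambda>x. f (fst (t, x)) (snd (t, x)))"
    by (rule continuous_on_compose2[OF assms(1)]) (use assms(2) in \<open>auto intro!: continuous_intros\<close>)
  then show ?thesis by simp
qed

definition nlU where "nlU t x = nl \<alpha> \<beta> \<mu> (U 0 t x) (U 1 t x) (U 2 t x)"
definition nlV where "nlV t x = nl \<alpha> \<beta> \<mu> (V 0 t x) (V 1 t x) (V 2 t x)"
definition Wt where "Wt t x = \<i> * (nlV t x - nlU t x)"
definition vt where "vt t x = \<i> * (nlU t x + nlV t x) / 2"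

lemma Wt_deriv: "t \<in> {0..T} \<Longrightarrow> ((\<lambda>t. W 0 t x) has_vector_derivative Wt t x) (at t within {0..T})"
  using W_time[of t x] by (simp add: Wt_def nlU_def nlV_def)

lemma vt_deriv: "t \<in> {0..T} \<Longrightarrow> ((\<lambda>t. v 0 t x) has_vector_derivative vt t x) (at t within {0..T})"
  unfolding v_def vt_def nlU_def nlV_def ring_distribs
  by (rule has_vector_derivative_divide[OF has_vector_derivative_add[OF csol_time[OF csolU] csol_time[OF csolV]]])

lemma cont_nlU: "S \<subseteq> {0..T} \<times> UNIV \<Longrightarrow> continuous_on S (\<lambda>z. nlU (fst z) (snd z))"
  unfolding nlU_def nl_def by (intro continuous_intros cont_U) simp_all

lemma cont_nlV: "S \<subseteq> {0..T} \<times> UNIV \<Longrightarrow> continuous_on S (\<lambda>z. nlV (fst z) (snd z))"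
  unfolding nlV_def nl_def by (intro continuous_intros cont_V) simp_all

lemma Wt_eq: "Wt t x = \<i> * (v 0 t x * cnj (v 0 t x) * W 2 t x + bco (v 0 t x) (v 1 t x) * W 1 t x
    + of_real \<alpha> * v 0 t x * v 1 t x * cnj (W 1 t x) + zth (v 0 t x) (v 1 t x) (v 2 t x) (W 0 t x)
    + nl \<alpha> \<beta> \<mu> (W 0 t x) (W 1 t x) (W 2 t x) / 4)"
  unfolding Wt_def nlU_def nlV_def
  using nl_symmetric_difference[of "v 0 t x" "W 0 t x" "v 1 t x" "W 1 t x" "v 2 t x" "W 2 t x"]
  by (simp only: U_eq[symmetric] V_eq[symmetric])

text \<open>In the following names a trailing \<open>t\<close> or \<open>x\<close> marks the formal
  derivative in that variable; \<open>en_deriv\<close> and \<open>flux_deriv\<close> confirm it. The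
  weight is taken from \<open>v\<close>, not from \<open>sin\<close>, since only then does the flux
  absorb the top-order terms exactly.\<close>

definition rho where "rho t x = (cmod (v 0 t x))\<^sup>2"
definition rhot where "rhot t x = 2 * Re (cnj (v 0 t x) * vt t x)"
definition rhox where "rhox t x = 2 * Re (cnj (v 0 t x) * v 1 t x)"
definition en where "en t x = rho t x powr (- \<sigma>) * (cmod (W 0 t x))\<^sup>2"
definition ent where "ent t x = - \<sigma> * rho t x powr (- \<sigma>) * (rhot t x / rho t x) * (cmod (W 0 t x))\<^sup>2
  + rho t x powr (- \<sigma>) * (2 * Re (cnj (W 0 t x) * Wt t x))"
text \<open>The imaginary part of the coefficient \<open>bco (v 0 t x) (v 1 t x)\<close>. Its real
  part is \<open>(\<alpha> + 2 * \<beta>) * rhox t x / 2\<close>, through which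
  \<open>\<sigma>\<close> comes in.\<close>

definition bim where "bim t x = (\<alpha> - 2 * \<beta>) * Im (v 0 t x * cnj (v 1 t x))"
definition flux0 where "flux0 t x = - 2 * rho t x * Im (cnj (W 0 t x) * W 1 t x) - bim t x * (cmod (W 0 t x))\<^sup>2
  - \<alpha> * Im (v 0 t x * v 1 t x * (cnj (W 0 t x))\<^sup>2)"
definition flux0x where "flux0x t x = - 2 * (rhox t x * Im (cnj (W 0 t x) * W 1 t x) + rho t x * Im (cnj (W 0 t x) * W 2 t x))
  - (\<alpha> - 2 * \<beta>) * Im (v 0 t x * cnj (v 2 t x)) * (cmod (W 0 t x))\<^sup>2
  - bim t x * (2 * Re (cnj (W 0 t x) * W 1 t x))
  - \<alpha> * Im ((v 1 t x * v 1 t x + v 0 t x * v 2 t x) * (cnj (W 0 t x))\<^sup>2 + 2 * v 0 t x * v 1 t x * cnj (W 0 t x) * cnj (W 1 t x))"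
definition flux where "flux t x = rho t x powr (- \<sigma>) * flux0 t x"
definition fluxx where "fluxx t x = - \<sigma> * rho t x powr (- \<sigma>) * (rhox t x / rho t x) * flux0 t x + rho t x powr (- \<sigma>) * flux0x t x"

lemma rho_pos: "t \<in> {0..T} \<Longrightarrow> 0 < sin x \<Longrightarrow> 0 < rho t x"
proof -
  assume t: "t \<in> {0..T}" and x: "0 < sin x"
  have "0 < \<eta> * sin x" using eta x by simp
  then have "0 < cmod (v 0 t x)" using v_size(2)[OF t, of x] x by linarith
  then show ?thesis by (simp add: rho_def)
qed

lemma en_deriv:
  assumes "t \<in> {0..T}" "0 < sin x"
  shows "((\<lambda>t. en t x) has_real_derivative ent t x) (at t within {0..T})"
proof -
  have "((\<lambda>t. rho t x) has_real_derivative rhot t x) (at t within {0..T})"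
    unfolding rho_def rhot_def by (rule has_real_derivative_cmod_squared[OF vt_deriv[OF assms(1)]])
  from has_real_derivative_powr_within[OF this rho_pos[OF assms], of "- \<sigma>"]
  have 1: "((\<lambda>t. rho t x powr (- \<sigma>)) has_real_derivative - \<sigma> * rho t x powr (- \<sigma>) * (rhot t x / rho t x)) (at t within {0..T})" .
  have 2: "((\<lambda>t. (cmod (W 0 t x))\<^sup>2) has_real_derivative 2 * Re (cnj (W 0 t x) * Wt t x)) (at t within {0..T})"
    by (rule has_real_derivative_cmod_squared[OF Wt_deriv[OF assms(1)]])
  show ?thesis unfolding en_def ent_def
    by (rule DERIV_cong[OF DERIV_mult[OF 1 2]]) (simp add: algebra_simps)
qed

lemma flux_deriv:
  assumes t: "t \<in> {0..T}" and x: "0 < sin x"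
  shows "((\<lambda>x. flux t x) has_real_derivative fluxx t x) (at x)"
proof -
  have v: "(v 0 t has_vector_derivative v 1 t x) (at x)" "(v 1 t has_vector_derivative v 2 t x) (at x)"
    using v_deriv[OF t, of 0 x] v_deriv[OF t, of 1 x] k4 by (simp_all add: numeral_2_eq_2)
  have W: "(W 0 t has_vector_derivative W 1 t x) (at x)" "(W 1 t has_vector_derivative W 2 t x) (at x)"
    using W_deriv[OF t, of 0 x] W_deriv[OF t, of 1 x] k4 by (simp_all add: numeral_2_eq_2)
  have r: "((\<lambda>x. rho t x) has_real_derivative rhox t x) (at x)"
    unfolding rho_def rhox_def by (rule has_real_derivative_cmod_squared[OF v(1)])
  have p: "((\<lambda>x. rho t x powr (- \<sigma>)) has_real_derivative - \<sigma> * rho t x powr (- \<sigma>) * (rhox t x / rho t x)) (at x)"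
    by (rule has_real_derivative_powr_within[OF r rho_pos[OF assms]])
  have W2: "((\<lambda>x. (cmod (W 0 t x))\<^sup>2) has_real_derivative 2 * Re (cnj (W 0 t x) * W 1 t x)) (at x)"
    by (rule has_real_derivative_cmod_squared[OF W(1)])
  note cW = has_vector_derivative_cnj_comp[OF W(1)] and cv = has_vector_derivative_cnj_comp[OF v(2)]
  have d1: "((\<lambda>x. Im (cnj (W 0 t x) * W 1 t x)) has_real_derivative Im (cnj (W 0 t x) * W 2 t x)) (at x)"
    by (rule DERIV_cong[OF has_real_derivative_Im[OF has_vector_derivative_mult[OF cW W(2)]]]) simp
  have d2: "((\<lambda>x. bim t x) has_real_derivative (\<alpha> - 2 * \<beta>) * Im (v 0 t x * cnj (v 2 t x))) (at x)"
    unfolding bim_def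
    by (rule DERIV_cong[OF DERIV_cmult[OF has_real_derivative_Im[OF has_vector_derivative_mult[OF v(1) cv]]]]) simp
  have d3: "((\<lambda>x. Im (v 0 t x * v 1 t x * (cnj (W 0 t x) * cnj (W 0 t x)))) has_real_derivative
     Im ((v 1 t x * v 1 t x + v 0 t x * v 2 t x) * (cnj (W 0 t x))\<^sup>2 + 2 * v 0 t x * v 1 t x * cnj (W 0 t x) * cnj (W 1 t x))) (at x)"
    by (rule DERIV_cong[OF has_real_derivative_Im[OF has_vector_derivative_mult[OF has_vector_derivative_mult[OF v] has_vector_derivative_mult[OF cW cW]]]])
       (rule arg_cong[where f=Im], simp add: algebra_simps power2_eq_square)
  have q: "((\<lambda>x. flux0 t x) has_real_derivative flux0x t x) (at x)"
    unfolding flux0_def flux0x_def power2_eq_square[of "cnj _"]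
    by (rule DERIV_cong[OF DERIV_diff[OF DERIV_diff[OF DERIV_mult[OF DERIV_cmult[OF r] d1] DERIV_mult[OF d2 W2]] DERIV_cmult[OF d3]]])
      (simp add: algebra_simps power2_eq_square)
  show ?thesis unfolding flux_def fluxx_def
    by (rule DERIV_cong[OF DERIV_mult[OF p q]]) (simp add: algebra_simps)
qed

lemma vt_bound:
  assumes t: "t \<in> {0..T}" and x: "0 \<le> sin x"
  shows "\<bar>rhot t x\<bar> \<le> 4 * A * M\<^sup>2 * rho t x"
proof -
  have U: "cmod (nlU t x) \<le> A * M\<^sup>2 * cmod (U 0 t x)" and V: "cmod (nlV t x) \<le> A * M\<^sup>2 * cmod (V 0 t x)"
    unfolding nlU_def nlV_def A_def using csol_bound[OF csolU t] csol_bound[OF csolV t] k4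
    by (intro norm_nl_le; simp)+
  have AM: "0 \<le> A * M\<^sup>2" using A1 by simp
  have "cmod (nlU t x) \<le> A * M\<^sup>2 * (5 / 3 * cmod (v 0 t x))" "cmod (nlV t x) \<le> A * M\<^sup>2 * (5 / 3 * cmod (v 0 t x))"
  proof -
    \<comment> \<open>\<open>5 / 3\<close> is the quotient of the upper and lower constants in
      \<open>v_size\<close>.\<close>
    have "cmod (U 0 t x) \<le> 5 / 3 * cmod (v 0 t x)" "cmod (V 0 t x) \<le> 5 / 3 * cmod (v 0 t x)"
      using v_size[OF t x] by linarith+
    from mult_left_mono[OF this(1) AM] mult_left_mono[OF this(2) AM]
    show "cmod (nlU t x) \<le> A * M\<^sup>2 * (5 / 3 * cmod (v 0 t x))" "cmod (nlV t x) \<le> A * M\<^sup>2 * (5 / 3 * cmod (v 0 t x))"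
      using U V by linarith+
  qed
  then have "cmod (nlU t x + nlV t x) / 2 \<le> A * M\<^sup>2 * (5 / 3 * cmod (v 0 t x))"
    using norm_triangle_ineq[of "nlU t x" "nlV t x"] by linarith
  then have vt: "cmod (vt t x) \<le> A * M\<^sup>2 * (2 * cmod (v 0 t x))"
    using mult_left_mono[OF _ AM, of "5 / 3 * cmod (v 0 t x)" "2 * cmod (v 0 t x)"]
    by (simp add: vt_def norm_divide norm_mult)
  have "\<bar>rhot t x\<bar> \<le> 2 * (cmod (v 0 t x) * cmod (vt t x))"
    using abs_Re_le_cmod[of "cnj (v 0 t x) * vt t x"] by (simp add: rhot_def norm_mult abs_mult)
  also have "\<dots> \<le> 2 * (cmod (v 0 t x) * (A * M\<^sup>2 * (2 * cmod (v 0 t x))))"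
    using vt by (intro mult_left_mono) auto
  finally show ?thesis by (simp add: rho_def power2_eq_square mult_ac)
qed

text \<open>A local conservation law up to zeroth order: the term
  \<open>2 * \<sigma> * rhox t x * Im (cnj w * w1)\<close> in \<open>fl\<close> cancels against the
  one that the derivative of the weight produces in \<open>f0\<close>. No derivative of
  \<open>W\<close> remains outside the flux and the bounded remainder.\<close>

lemma energy_pointwise:
  assumes t: "t \<in> {0..T}" and x: "0 < sin x"
  shows "ent t x \<le> fluxx t x + KE * en t x"
proof -
  define w w1 w2 V0 p q where d: "w = W 0 t x" "w1 = W 1 t x" "w2 = W 2 t x" "V0 = v 0 t x" "p = v 1 t x" "q = v 2 t x"
  let ?m = "rho t x powr (- \<sigma>)" and ?N = "(cmod w)\<^sup>2"
  let ?X = "V0 * cnj V0 * w2 + bco V0 p * w1 + of_real \<alpha> * V0 * p * cnj w1"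
  have r0: "rho t x > 0" by (rule rho_pos[OF t x])
  then have V0: "V0 \<noteq> 0" by (auto simp: rho_def d)
  have rr: "rho t x = (cmod V0)\<^sup>2" by (simp add: rho_def d)
  have bnd: "cmod V0 \<le> M" "cmod p \<le> M" "cmod q \<le> M" "cmod w \<le> 2 * M" "cmod w1 \<le> 2 * M" "cmod w2 \<le> 2 * M"
    using v_bound[OF t] W_bound[OF t] k4 by (auto simp: d)
  have Z: "\<bar>- \<sigma> * (rhot t x / rho t x) * ?N + \<sigma> * (rhox t x / rho t x) * (- bim t x * ?N - \<alpha> * Im (V0 * p * (cnj w)\<^sup>2))
     + (\<alpha> - 2 * \<beta>) * Im (V0 * cnj q) * ?N + \<alpha> * Im ((p * p + V0 * q) * (cnj w)\<^sup>2)
     - 2 * Im (cnj w * zth V0 p q w) - Im (cnj w * nl \<alpha> \<beta> \<mu> w w1 w2) / 2\<bar> \<le> KE * ?N"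
    using energy_remainder_bound[OF V0 bnd, of "rhot t x"] vt_bound[OF t, of x] x
    by (simp add: rho_def rhox_def bim_def d)
  have re: "2 * Re (cnj w * Wt t x) = 2 * Re (cnj w * (\<i> * ?X)) - 2 * Im (cnj w * zth V0 p q w) - Im (cnj w * nl \<alpha> \<beta> \<mu> w w1 w2) / 2"
  proof -
    have "2 * Re (c * (\<i> * (X + Z + N / 4))) = 2 * Re (c * (\<i> * X)) - 2 * Im (c * Z) - Im (c * N) / 2" for c X Z N
      by (simp add: field_simps)
    then show ?thesis unfolding Wt_eq d .
  qed
  have fl: "2 * Re (cnj w * (\<i> * ?X)) - flux0x t x
    = 2 * \<sigma> * rhox t x * Im (cnj w * w1) + (\<alpha> - 2 * \<beta>) * Im (V0 * cnj q) * ?N + \<alpha> * Im ((p * p + V0 * q) * (cnj w)\<^sup>2)"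
    using energy_flux_identity[of w V0 w2 p w1 q] unfolding flux0x_def rho_def rhox_def bim_def d .
  have f0: "\<sigma> * (rhox t x / rho t x) * flux0 t x = - 2 * \<sigma> * rhox t x * Im (cnj w * w1)
     + \<sigma> * (rhox t x / rho t x) * (- bim t x * ?N - \<alpha> * Im (V0 * p * (cnj w)\<^sup>2))"
    using r0 unfolding flux0_def d by (simp add: field_simps)
  have "ent t x - fluxx t x = ?m * (- \<sigma> * (rhot t x / rho t x) * ?N + 2 * Re (cnj w * Wt t x)
     + \<sigma> * (rhox t x / rho t x) * flux0 t x - flux0x t x)"
    unfolding ent_def fluxx_def d(1) by (simp add: algebra_simps)
  also have "\<dots> = ?m * (- \<sigma> * (rhot t x / rho t x) * ?N + \<sigma> * (rhox t x / rho t x) * (- bim t x * ?N - \<alpha> * Im (V0 * p * (cnj w)\<^sup>2))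
     + (\<alpha> - 2 * \<beta>) * Im (V0 * cnj q) * ?N + \<alpha> * Im ((p * p + V0 * q) * (cnj w)\<^sup>2)
     - 2 * Im (cnj w * zth V0 p q w) - Im (cnj w * nl \<alpha> \<beta> \<mu> w w1 w2) / 2)"
    unfolding re f0 using fl by (intro arg_cong[where f="\<lambda>z. ?m * z"]) linarith
  also have "\<dots> \<le> ?m * (KE * ?N)"
    using Z by (intro mult_left_mono) auto
  also have "\<dots> = KE * en t x" by (simp add: en_def d)
  finally show ?thesis by simp
qed

definition KQ where "KQ = 14 * A * M * (2 ^ (k + 1) * M)\<^sup>2 * cb (- \<sigma>)"

lemma KQ0: "0 \<le> KQ" unfolding KQ_def using A1 M1 cb_pos[of "- \<sigma>"] by simp

text \<open>Powers of \<open>s = sin x\<close>: two from \<open>rho\<close>, \<open>k\<close> and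
  \<open>k - 1\<close> from \<open>W\<close> and its derivative, \<open>- 2 * \<sigma>\<close> from
  the weight. The total is at least 1 by \<open>ksig\<close>.\<close>

lemma flux_bound:
  assumes t: "t \<in> {0..T}" and x: "0 < x" "x < pi"
  shows "\<bar>flux t x\<bar> \<le> KQ * sin x"
proof -
  define s where "s = sin x"
  have s: "0 < s" "s \<le> 1" using sin_gt_zero[OF x] by (auto simp: s_def)
  define Kw where "Kw = 2 ^ (k + 1) * M"
  have Kw: "0 \<le> Kw" using M1 by (simp add: Kw_def)
  have w: "cmod (W 0 t x) \<le> Kw * s ^ k" "cmod (W 1 t x) \<le> Kw * s ^ (k - 1)"
    using W_sin_bound[OF t, of x 0] W_sin_bound[OF t, of x 1] x by (auto simp: Kw_def s_def)
  have es: "\<eta> * s \<le> 1 * s" using eta s by (intro mult_right_mono) auto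
  have v: "cmod (v 0 t x) \<le> 2 * s" proof -
    have "cmod (v 0 t x) \<le> 5 / 4 * (\<eta> * s)" using v_size(1)[OF t, of x] s by (simp add: s_def)
    then show ?thesis using es s by linarith
  qed
  have p: "cmod (v 1 t x) \<le> M" using v_bound[OF t, of 1 x] k4 by simp
  have ww: "(cmod (W 0 t x))\<^sup>2 \<le> Kw\<^sup>2 * s ^ (2 * k)"
    using power_mono[OF w(1), of 2] by (simp add: power_mult_distrib power_mult mult.commute)
  have sk: "s * s ^ (2 * k) = s ^ (2 * k + 1)" by simp
  have a1: "\<bar>2 * rho t x * Im (cnj (W 0 t x) * W 1 t x)\<bar> \<le> 8 * (Kw\<^sup>2 * s ^ (2 * k + 1))"
  proof -
    have "\<bar>Im (cnj (W 0 t x) * W 1 t x)\<bar> \<le> cmod (W 0 t x) * cmod (W 1 t x)"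
      using abs_Im_le_cmod[of "cnj (W 0 t x) * W 1 t x"] by (simp add: norm_mult)
    also have "\<dots> \<le> (Kw * s ^ k) * (Kw * s ^ (k - 1))" using w Kw s by (intro mult_mono) auto
    finally have i: "\<bar>Im (cnj (W 0 t x) * W 1 t x)\<bar> \<le> (Kw * s ^ k) * (Kw * s ^ (k - 1))" .
    have "rho t x \<le> (2 * s)\<^sup>2" unfolding rho_def using v by (intro power_mono) auto
    then have "\<bar>2 * rho t x * Im (cnj (W 0 t x) * W 1 t x)\<bar> \<le> (2 * (2 * s)\<^sup>2) * ((Kw * s ^ k) * (Kw * s ^ (k - 1)))"
      unfolding abs_mult using i Kw s by (intro mult_mono) (auto simp: rho_def)
    also have "\<dots> = 8 * (Kw\<^sup>2 * (s * s ^ k * (s * s ^ (k - 1))))" by (simp add: power2_eq_square mult_ac)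
    also have "s * s ^ (k - 1) = s ^ k" using k4 by (cases k) auto
    also have "s * s ^ k * s ^ k = s ^ (2 * k + 1)" by (simp add: power_add mult_2)
    finally show ?thesis .
  qed
  have vp: "cmod (v 0 t x) * cmod (v 1 t x) \<le> 2 * s * M" using v p s M1 by (intro mult_mono) auto
  have a2: "\<bar>bim t x * (cmod (W 0 t x))\<^sup>2\<bar> \<le> 4 * (A * M) * (Kw\<^sup>2 * s ^ (2 * k + 1))"
  proof -
    have "\<bar>bim t x\<bar> \<le> (2 * A) * (2 * s * M)"
      unfolding bim_def abs_mult using abs_alpha_le(2) abs_Im_le_cmod[of "v 0 t x * cnj (v 1 t x)"] vp A1
      by (intro mult_mono) (auto simp: norm_mult)
    then have "\<bar>bim t x * (cmod (W 0 t x))\<^sup>2\<bar> \<le> ((2 * A) * (2 * s * M)) * (Kw\<^sup>2 * s ^ (2 * k))"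
      unfolding abs_mult using ww s A1 M1 by (intro mult_mono) auto
    then show ?thesis by (simp add: mult_ac)
  qed
  have a3: "\<bar>\<alpha> * Im (v 0 t x * v 1 t x * (cnj (W 0 t x))\<^sup>2)\<bar> \<le> 2 * (A * M) * (Kw\<^sup>2 * s ^ (2 * k + 1))"
  proof -
    have "\<bar>Im (v 0 t x * v 1 t x * (cnj (W 0 t x))\<^sup>2)\<bar> \<le> (cmod (v 0 t x) * cmod (v 1 t x)) * (cmod (W 0 t x))\<^sup>2"
      using abs_Im_le_cmod[of "v 0 t x * v 1 t x * (cnj (W 0 t x))\<^sup>2"] by (simp add: norm_mult norm_power)
    also have "\<dots> \<le> (2 * s * M) * (Kw\<^sup>2 * s ^ (2 * k))" using s M1 by (intro mult_mono[OF vp ww]) auto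
    finally have "\<bar>\<alpha> * Im (v 0 t x * v 1 t x * (cnj (W 0 t x))\<^sup>2)\<bar> \<le> A * ((2 * s * M) * (Kw\<^sup>2 * s ^ (2 * k)))"
      unfolding abs_mult using abs_alpha_le(1) by (intro mult_mono) auto
    then show ?thesis by (simp add: mult_ac)
  qed
  have "\<bar>flux0 t x\<bar> \<le> 8 * (Kw\<^sup>2 * s ^ (2 * k + 1)) + 4 * (A * M) * (Kw\<^sup>2 * s ^ (2 * k + 1)) + 2 * (A * M) * (Kw\<^sup>2 * s ^ (2 * k + 1))"
  proof -
    have tri: "\<bar>- 2 * r * i - b - c\<bar> \<le> a' + b' + c'" if "\<bar>2 * r * i\<bar> \<le> a'" "\<bar>b\<bar> \<le> b'" "\<bar>c\<bar> \<le> c'" for r i b c a' b' c' :: real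
      using that by linarith
    show ?thesis unfolding flux0_def by (rule tri[OF a1 a2 a3])
  qed
  also have "\<dots> \<le> 8 * (A * M) * (Kw\<^sup>2 * s ^ (2 * k + 1)) + 4 * (A * M) * (Kw\<^sup>2 * s ^ (2 * k + 1)) + 2 * (A * M) * (Kw\<^sup>2 * s ^ (2 * k + 1))"
  proof -
    have "1 * 1 \<le> A * M" using A1 M1 by (intro mult_mono) auto
    then have "1 * (Kw\<^sup>2 * s ^ (2 * k + 1)) \<le> (A * M) * (Kw\<^sup>2 * s ^ (2 * k + 1))"
      using Kw s by (intro mult_right_mono) auto
    then show ?thesis by linarith
  qed
  finally have f0: "\<bar>flux0 t x\<bar> \<le> 14 * (A * M * Kw\<^sup>2) * s ^ (2 * k + 1)" by (simp add: algebra_simps)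
  have m: "rho t x powr (- \<sigma>) \<le> cb (- \<sigma>) * s powr (2 * (- \<sigma>))"
    unfolding rho_def using v_size(1,2)[OF t, of x] s by (intro powr_comparable) (auto simp: s_def)
  have "\<bar>flux t x\<bar> \<le> (cb (- \<sigma>) * s powr (2 * (- \<sigma>))) * (14 * (A * M * Kw\<^sup>2) * s ^ (2 * k + 1))"
    unfolding flux_def abs_mult using m f0 cb_pos[of "- \<sigma>"] by (intro mult_mono) auto
  also have "\<dots> = KQ * (s powr (2 * (- \<sigma>)) * s ^ (2 * k + 1))" by (simp add: KQ_def Kw_def mult_ac)
  also have "s powr (2 * (- \<sigma>)) * s ^ (2 * k + 1) = s powr (2 * (- \<sigma>) + real (2 * k + 1))"
  proof -
    have "s ^ (2 * k + 1) = s powr real (2 * k + 1)" using s by (simp only: powr_realpow)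
    then show ?thesis by (simp only: powr_add)
  qed
  also have "KQ * s powr (2 * (- \<sigma>) + real (2 * k + 1)) \<le> KQ * s powr 1"
    using s ksig KQ0 by (intro mult_left_mono powr_mono') auto
  finally show ?thesis using s by (simp add: s_def)
qed

text \<open>The cut-off \<open>\<kappa>\<close> keeps the weight regular, so that the integral may
  be differentiated in time. The weight is the fixed function \<open>sin\<close> here, so that
  values at different times can be compared.\<close>

definition energy where "energy \<kappa> t = integral {\<kappa>..pi - \<kappa>} (\<lambda>x. sin x powr (- 2 * \<sigma>) * (cmod (W 0 t x))\<^sup>2)"

definition K1 where "K1 = 2 * cb \<sigma> * cb (- \<sigma>)"
definition K2 where "K2 = 4 * cb \<sigma> * KQ"

text \<open>The flux identity is used with the moving weight \<open>rho\<close> and then translated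
  to the fixed weight. \<open>K1\<close> collects the factor 2 of the short-time Gronwall bound and
  the two comparison constants, \<open>K2 * \<kappa>\<close> the flux through both end
  points.\<close>

lemma energy_estimate:
  assumes \<kappa>: "0 < \<kappa>" "\<kappa> < pi / 2" and t: "t \<in> {0..T}"
  shows "energy \<kappa> t \<le> K1 * energy \<kappa> 0 + K2 * \<kappa>"
proof -
  let ?I = "{\<kappa>..pi - \<kappa>}"
  have I: "0 < x \<and> x < pi \<and> 0 < sin x" if "x \<in> ?I" for x
    using that \<kappa> sin_gt_zero[of x] by auto
  have sub: "{0..T} \<times> ?I \<subseteq> {0..T} \<times> UNIV" by auto
  have crho: "continuous_on ({0..T} \<times> ?I) (\<lambda>z. rho (fst z) (snd z))"
    unfolding rho_def by (intro continuous_intros cont_v sub) simp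
  have rne: "rho (fst z) (snd z) \<noteq> 0" if "z \<in> {0..T} \<times> ?I" for z
    using rho_pos[of "fst z" "snd z"] I that by force
  have cen: "continuous_on ({0..T} \<times> ?I) (\<lambda>z. en (fst z) (snd z))"
    unfolding en_def using rne by (intro continuous_intros crho cont_W sub) auto
  have cent: "continuous_on ({0..T} \<times> ?I) (\<lambda>z. ent (fst z) (snd z))"
    unfolding ent_def rhot_def vt_def Wt_def using rne
    by (intro continuous_intros crho cont_W cont_v cont_nlU cont_nlV sub) auto
  define E where "E = (\<lambda>t. integral ?I (en t))"
  have der: "(E has_real_derivative integral ?I (ent t)) (at t within {0..T})" if t: "t \<in> {0..T}" for t
  proof -
    have "((\<lambda>t. integral (cbox \<kappa> (pi - \<kappa>)) (en t)) has_vector_derivative integral (cbox \<kappa> (pi - \<kappa>)) (ent t)) (at t within {0..T})"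
    proof (rule leibniz_rule_vector_derivative)
      fix t x assume "t \<in> {0..T}" "x \<in> cbox \<kappa> (pi - \<kappa>)"
      then show "((\<lambda>t. en t x) has_vector_derivative ent t x) (at t within {0..T})"
        using en_deriv[of t x] I[of x] by (simp add: has_real_derivative_iff_has_vector_derivative)
    next
      fix t assume "t \<in> {0..T}"
      then show "en t integrable_on cbox \<kappa> (pi - \<kappa>)"
        using cont_slice[OF cen] by (auto intro: integrable_continuous_real)
    next
      show "continuous_on ({0..T} \<times> cbox \<kappa> (pi - \<kappa>)) (\<lambda>(x, t). ent x t)"
        using cent by (simp add: split_beta)
    qed (use t in auto)
    then show ?thesis by (simp add: E_def has_real_derivative_iff_has_vector_derivative)
  qed
  have le: "integral ?I (ent t) \<le> KE * E t + 2 * KQ * \<kappa>" if t: "t \<in> {0..T}" for t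
  proof -
    have "(fluxx t has_integral flux t (pi - \<kappa>) - flux t \<kappa>) ?I"
    proof (rule fundamental_theorem_of_calculus)
      fix x assume "x \<in> ?I"
      then show "(flux t has_vector_derivative fluxx t x) (at x within ?I)"
        using flux_deriv[OF t, of x] I[of x]
        by (simp add: has_real_derivative_iff_has_vector_derivative has_vector_derivative_at_within)
    qed (use \<kappa> in auto)
    moreover have "(en t has_integral E t) ?I"
      unfolding E_def using cont_slice[OF cen t] by (intro integrable_integral integrable_continuous_real)
    ultimately have 1: "((\<lambda>x. fluxx t x + KE * en t x) has_integral (flux t (pi - \<kappa>) - flux t \<kappa>) + KE * E t) ?I"
      by (intro has_integral_add has_integral_mult_right)
    have 2: "(ent t has_integral integral ?I (ent t)) ?I"
      using cont_slice[OF cent t] by (intro integrable_integral integrable_continuous_real)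
    have "integral ?I (ent t) \<le> (flux t (pi - \<kappa>) - flux t \<kappa>) + KE * E t"
      by (rule has_integral_le[OF 2 1]) (use energy_pointwise[OF t] I in auto)
    moreover have "\<bar>flux t (pi - \<kappa>)\<bar> \<le> KQ * \<kappa>" "\<bar>flux t \<kappa>\<bar> \<le> KQ * \<kappa>"
    proof -
      have s: "KQ * sin \<kappa> \<le> KQ * \<kappa>" using KQ0 \<kappa> sin_x_le_x[of \<kappa>] by (intro mult_left_mono) auto
      show "\<bar>flux t (pi - \<kappa>)\<bar> \<le> KQ * \<kappa>" using flux_bound[OF t, of "pi - \<kappa>"] s \<kappa> by simp
      show "\<bar>flux t \<kappa>\<bar> \<le> KQ * \<kappa>" using flux_bound[OF t, of \<kappa>] s \<kappa> by simp
    qed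
    ultimately show ?thesis by linarith
  qed
  have E0: "0 \<le> E t" if "t \<in> {0..T}" for t
    unfolding E_def by (rule integral_nonneg)
      (use cont_slice[OF cen that] in \<open>auto simp: en_def intro: integrable_continuous_real\<close>)
  have Et: "E t \<le> 2 * E 0 + 2 * (2 * KQ * \<kappa>) * T"
  proof (rule short_time_gronwall[where K=KE and E'="\<lambda>t. integral ?I (ent t)"])
    show "KE * T \<le> 1 / 2" using T(3) by (simp add: KE_def mult_ac)
    show "0 \<le> KE" using A1 by (simp add: KE_def)
    show "0 \<le> 2 * KQ * \<kappa>" using KQ0 \<kappa> by simp
  qed (use T der le E0 t in auto)
  have cE: "continuous_on ?I (\<lambda>x. sin x powr (- 2 * \<sigma>) * (cmod (W 0 t x))\<^sup>2)" if "t \<in> {0..T}" for t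
  proof -
    have "continuous_on ({0..T} \<times> ?I) (\<lambda>z. W 0 (fst z) (snd z))" by (rule cont_W[OF _ sub]) simp
    then have "continuous_on ?I (W 0 t)" using that by (rule cont_slice)
    then show ?thesis by (intro continuous_intros) (use I in force)+
  qed
  have sx: "s powr (- 2 * \<sigma>) * N \<le> cb \<sigma> * (r powr (- \<sigma>) * N)" "r powr (- \<sigma>) * N \<le> cb (- \<sigma>) * (s powr (- 2 * \<sigma>) * N)"
    if "t \<in> {0..T}" "x \<in> ?I" "s = sin x" "r = rho t x" "0 \<le> N" for t x s r N
  proof -
    have s0: "0 < s" and r0: "0 < r" using I[OF that(2)] rho_pos that by auto
    have "r powr \<tau> \<le> cb \<tau> * s powr (2 * \<tau>)" for \<tau>
      unfolding that rho_def using v_size(1,2)[OF that(1), of x] s0 that(3) by (intro powr_comparable) auto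
    from this[of \<sigma>] this[of "- \<sigma>"] have a: "r powr \<sigma> \<le> cb \<sigma> * s powr (2 * \<sigma>)" "r powr (- \<sigma>) \<le> cb (- \<sigma>) * s powr (- 2 * \<sigma>)" by auto
    \<comment> \<open>The inserted product of powers of \<open>r\<close> is 1; it converts the upper
      bound on \<open>r powr \<sigma>\<close> into a lower bound on
      \<open>r powr (- \<sigma>)\<close>.\<close>
    have "s powr (- 2 * \<sigma>) * (r powr \<sigma> * r powr (- \<sigma>)) \<le> s powr (- 2 * \<sigma>) * ((cb \<sigma> * s powr (2 * \<sigma>)) * r powr (- \<sigma>))"
      using a(1) by (intro mult_left_mono mult_right_mono) auto
    also have "\<dots> = cb \<sigma> * r powr (- \<sigma>) * (s powr (- 2 * \<sigma>) * s powr (2 * \<sigma>))" by (simp add: mult_ac)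
    finally have "s powr (- 2 * \<sigma>) \<le> cb \<sigma> * r powr (- \<sigma>)"
      using s0 r0 by (simp flip: powr_add)
    then show "s powr (- 2 * \<sigma>) * N \<le> cb \<sigma> * (r powr (- \<sigma>) * N)"
      unfolding mult.assoc[symmetric] using that(5) by (intro mult_right_mono) auto
    show "r powr (- \<sigma>) * N \<le> cb (- \<sigma>) * (s powr (- 2 * \<sigma>) * N)"
      unfolding mult.assoc[symmetric] using a(2) that(5) by (intro mult_right_mono) (auto simp: mult.assoc)
  qed
  have up: "energy \<kappa> t \<le> cb \<sigma> * E t" if t: "t \<in> {0..T}" for t
    unfolding energy_def E_def integral_mult_right[symmetric]
  proof (rule integral_le)
    show "(\<lambda>x. cb \<sigma> * en t x) integrable_on ?I"
      using cont_slice[OF cen t] by (intro integrable_continuous_real continuous_intros)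
  qed (use cE[OF t] sx(1)[OF t] in \<open>auto simp: en_def intro: integrable_continuous_real\<close>)
  have lo: "E t \<le> cb (- \<sigma>) * energy \<kappa> t" if t: "t \<in> {0..T}" for t
    unfolding energy_def E_def integral_mult_right[symmetric]
  proof (rule integral_le)
    show "en t integrable_on ?I"
      using cont_slice[OF cen t] by (intro integrable_continuous_real)
    show "(\<lambda>x. cb (- \<sigma>) * (sin x powr (- 2 * \<sigma>) * (cmod (W 0 t x))\<^sup>2)) integrable_on ?I"
      using cE[OF t] by (intro integrable_continuous_real continuous_on_mult_left)
  qed (use sx(2)[OF t] in \<open>auto simp: en_def\<close>)
  have t0: "0 \<in> {0..T}" using T by simp
  have "T \<le> 1"
  proof -
    have "1 * 1 * 1 \<le> A * M\<^sup>2 * 40" using A1 M1 by (intro mult_mono) auto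
    then have "1 * T \<le> (A * M\<^sup>2 * 40) * T" using T(1) by (intro mult_right_mono) auto
    then show ?thesis using T_small by simp
  qed
  have "energy \<kappa> t \<le> cb \<sigma> * (2 * E 0 + 2 * (2 * KQ * \<kappa>) * T)"
    using up[OF t] mult_left_mono[OF Et, of "cb \<sigma>"] cb_pos[of \<sigma>] by linarith
  also have "\<dots> \<le> cb \<sigma> * (2 * (cb (- \<sigma>) * energy \<kappa> 0) + 2 * (2 * KQ * \<kappa>) * 1)"
    using lo[OF t0] cb_pos[of \<sigma>] KQ0 \<kappa> \<open>T \<le> 1\<close> by (intro mult_left_mono add_mono) auto
  finally show ?thesis by (simp add: K1_def K2_def algebra_simps)
qed

end

section \<open>Packets travelling into a zero\<close>

lemma has_vector_derivative_Complex:
  assumes "(a has_real_derivative a') (at x within S)" "(b has_real_derivative b') (at x within S)"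
  shows "((\<lambda>x. Complex (a x) (b x)) has_vector_derivative Complex a' b') (at x within S)"
proof -
  have "((\<lambda>x. of_real (a x) + \<i> * of_real (b x)) has_vector_derivative of_real a' + \<i> * of_real b') (at x within S)"
    using assms unfolding has_real_derivative_iff_has_vector_derivative
    by (intro has_vector_derivative_add has_vector_derivative_mult_right bounded_linear.has_vector_derivative[OF bounded_linear_of_real])
  then show ?thesis by (simp only: complex_eq[symmetric] Complex_eq)
qed

lemma has_vector_derivative_exp_comp:
  fixes f :: "real \<Rightarrow> complex"
  assumes "(f has_vector_derivative f') (at x within S)"
  shows "((\<lambda>x. exp (f x)) has_vector_derivative f' * exp (f x)) (at x within S)"
  using field_vector_diff_chain_within[OF assms, of exp "exp (f x)"]
  by (simp add: o_def DERIV_exp has_field_derivative_at_within)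

context parameters
begin

text \<open>Half the first-order coefficient of the model adjoint equation in the variable
  \<open>y = ln (sin x)\<close>, see \<open>two_r0\<close>; a factor \<open>exp (- r0 * y)\<close>
  removes the first-order term.\<close>

definition r0 where "r0 = \<sigma> + 1 / 2"

lemma two_r0: "3 - \<alpha> - 2 * \<beta> = 2 * r0"
  using sigma by (simp add: r0_def algebra_simps)

text \<open>\<open>d\<close> is the logarithmic \<open>y\<close>-derivative of the wave and
  \<open>d\<^sup>2 - 2\<close> its second-order counterpart, since \<open>d\<close> has derivative
  -2. The phase speed removes the \<open>l\<^sup>2\<close> terms, the motion of the centre at speed
  \<open>2 * \<eta>\<^sup>2 * l\<close> the \<open>l * Y\<close> terms, and \<open>r0\<close> the
  terms linear in \<open>l\<close> alone.\<close>

lemma wave_coefficient_incoming: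
  assumes "d = Complex (- r0 - 2 * Y) l"
  shows "of_real (- 4 * \<eta>\<^sup>2 * l * Y) + \<i> * of_real (\<eta>\<^sup>2 * l\<^sup>2) + \<i> * of_real (\<eta>\<^sup>2) * (d\<^sup>2 - 2 + of_real (3 - \<alpha> - 2 * \<beta>) * d)
     = \<i> * of_real (\<eta>\<^sup>2 * (4 * Y\<^sup>2 - r0\<^sup>2 - 2))"
  unfolding two_r0 assms by (simp add: complex_eq_iff power2_eq_square) (simp add: algebra_simps)

text \<open>The reflected wave is the conjugate of the incoming one: same centre, opposite phase. It
  misses its own equation by \<open>2 * \<eta>\<^sup>2 * l\<^sup>2\<close> at top order, and this
  defect is put to use by \<open>Bc\<close>.\<close>

lemma wave_coefficient_reflected:
  assumes "d = Complex (- r0 - 2 * Y) (- l)"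
  shows "of_real (- 4 * \<eta>\<^sup>2 * l * Y) - \<i> * of_real (\<eta>\<^sup>2 * l\<^sup>2) + \<i> * of_real (\<eta>\<^sup>2) * (d\<^sup>2 - 2 + of_real (3 - \<alpha> - 2 * \<beta>) * d)
     = \<i> * of_real (\<eta>\<^sup>2 * (4 * Y\<^sup>2 - r0\<^sup>2 - 2)) - of_real (8 * \<eta>\<^sup>2 * l * Y) - 2 * \<i> * of_real (\<eta>\<^sup>2 * l\<^sup>2)"
  unfolding two_r0 assms by (simp add: complex_eq_iff power2_eq_square) (simp add: algebra_simps)

text \<open>The reflected wave carries the coefficient \<open>B\<close>, which is chosen so that its leading term
  cancels the coupling of the incoming wave through the complex conjugate of \<open>w\<^sub>x\<close>.\<close>

definition Bc :: "real \<Rightarrow> complex" where "Bc l = - \<i> * of_real (\<alpha> / (2 * l))"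

text \<open>The residual of the superposed waves in the limit \<open>sin x = 0\<close>, once the
  top-order coupling has been cancelled by \<open>Bc\<close>.\<close>

definition R00 where "R00 l Y E1 E2 = E1 * (\<i> * of_real (\<eta>\<^sup>2 * (4 * Y\<^sup>2 - r0\<^sup>2 - 2)))
   + Bc l * E2 * (\<i> * of_real (\<eta>\<^sup>2 * (4 * Y\<^sup>2 - r0\<^sup>2 - 2)) - of_real (8 * \<eta>\<^sup>2 * l * Y))
   + \<i> * of_real (\<alpha> * \<eta>\<^sup>2) * of_real (- r0 - 2 * Y) * E2
   + \<i> * of_real (\<alpha> * \<eta>\<^sup>2) * cnj (Bc l) * Complex (- r0 - 2 * Y) l * E1"

text \<open>\<open>D1\<close> and \<open>D2\<close> are the first two derivatives in
  \<open>y = ln (sin x)\<close> of incoming plus reflected wave, \<open>gx\<close> and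
  \<open>gxx\<close> the same in \<open>x\<close>. Replacing \<open>C\<^sup>2\<close> by
  \<open>1 - s\<^sup>2\<close> separates the equation at the zero from a correction with factor
  \<open>s\<^sup>2\<close>.\<close>

lemma residual_identity:
  fixes E1 E2 :: complex and s C Y l :: real
  assumes s: "s > 0" "C\<^sup>2 = 1 - s\<^sup>2" and l: "l > 0" and E: "cnj E1 = E2"
  defines "d1 \<equiv> Complex (- r0 - 2 * Y) l" and "d2 \<equiv> Complex (- r0 - 2 * Y) (- l)"
  defines "D1 \<equiv> d1 * E1 + Bc l * d2 * E2" and "D2 \<equiv> (d1\<^sup>2 - 2) * E1 + Bc l * (d2\<^sup>2 - 2) * E2"
  defines "gt \<equiv> (of_real (- 4 * \<eta>\<^sup>2 * l * Y) + \<i> * of_real (\<eta>\<^sup>2 * l\<^sup>2)) * E1 + Bc l * (of_real (- 4 * \<eta>\<^sup>2 * l * Y) - \<i> * of_real (\<eta>\<^sup>2 * l\<^sup>2)) * E2"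
  defines "gx \<equiv> of_real (C / s) * D1" and "gxx \<equiv> of_real ((C / s)\<^sup>2) * D2 - of_real (1 / s\<^sup>2) * D1"
  shows "gt + \<i> * (of_real (\<eta>\<^sup>2 * s\<^sup>2) * gxx + of_real ((4 - \<alpha> - 2 * \<beta>) * (\<eta>\<^sup>2 * s * C)) * gx) + \<i> * of_real \<alpha> * of_real (\<eta>\<^sup>2 * s * C) * cnj gx
    = R00 l Y E1 E2 - of_real (s\<^sup>2) * (\<i> * of_real (\<eta>\<^sup>2) * (D2 + of_real (4 - \<alpha> - 2 * \<beta>) * D1) + \<i> * of_real (\<alpha> * \<eta>\<^sup>2) * cnj D1)"
proof -
  have s1: "of_real (\<eta>\<^sup>2 * s\<^sup>2) * gxx = of_real (\<eta>\<^sup>2) * (of_real (C\<^sup>2) * D2 - D1)"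
    using s(1) by (simp add: gxx_def field_simps power_divide)
  have s2: "of_real ((4 - \<alpha> - 2 * \<beta>) * (\<eta>\<^sup>2 * s * C)) * gx = of_real (\<eta>\<^sup>2) * of_real (4 - \<alpha> - 2 * \<beta>) * of_real (C\<^sup>2) * D1"
    using s(1) by (simp add: gx_def field_simps power2_eq_square)
  have s3: "\<i> * of_real \<alpha> * of_real (\<eta>\<^sup>2 * s * C) * cnj gx = \<i> * of_real (\<alpha> * \<eta>\<^sup>2) * of_real (C\<^sup>2) * cnj D1"
    using s(1) by (simp add: gx_def field_simps power2_eq_square)
  have cd: "cnj d1 = d2" "cnj d2 = d1" by (simp_all add: d1_def d2_def complex_eq_iff)
  have cE: "cnj E2 = E1" using E by (metis complex_cnj_cnj)
  have cD: "cnj D1 = d2 * E2 + cnj (Bc l) * d1 * E1" by (simp add: D1_def cd cE E)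
  \<comment> \<open>The defining property of \<open>Bc\<close>: the top-order defect of the
    reflected wave cancels the coupling of the incoming wave through the conjugate
    derivative.\<close>
  have B: "Bc l * (- 2 * \<i> * of_real (\<eta>\<^sup>2 * l\<^sup>2)) + of_real (\<alpha> * \<eta>\<^sup>2 * l) = 0"
    using l by (simp add: Bc_def complex_eq_iff power2_eq_square field_simps)
  let ?n = "of_real (\<eta>\<^sup>2) :: complex" and ?c = "of_real (3 - \<alpha> - 2 * \<beta>) :: complex"
  let ?m = "of_real (4 - \<alpha> - 2 * \<beta>) :: complex"
  \<comment> \<open>The extra 1 compensates the \<open>- D1\<close> which the chain rule leaves in
    \<open>gxx\<close>.\<close>
  have m: "?m = ?c + 1"
  proof -
    have "4 - \<alpha> - 2 * \<beta> = (3 - \<alpha> - 2 * \<beta>) + 1" by simp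
    then show ?thesis by (simp only: of_real_add of_real_1)
  qed
  have core: "gt + \<i> * ?n * (D2 - D1 + ?m * D1) + \<i> * of_real (\<alpha> * \<eta>\<^sup>2) * cnj D1 = R00 l Y E1 E2"
  proof -
    have "gt + \<i> * ?n * (D2 - D1 + ?m * D1) + \<i> * of_real (\<alpha> * \<eta>\<^sup>2) * cnj D1
      = E1 * (of_real (- 4 * \<eta>\<^sup>2 * l * Y) + \<i> * of_real (\<eta>\<^sup>2 * l\<^sup>2) + \<i> * ?n * (d1\<^sup>2 - 2 + ?c * d1))
      + Bc l * E2 * (of_real (- 4 * \<eta>\<^sup>2 * l * Y) - \<i> * of_real (\<eta>\<^sup>2 * l\<^sup>2) + \<i> * ?n * (d2\<^sup>2 - 2 + ?c * d2))
      + \<i> * of_real (\<alpha> * \<eta>\<^sup>2) * d2 * E2 + \<i> * of_real (\<alpha> * \<eta>\<^sup>2) * cnj (Bc l) * d1 * E1"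
      unfolding cD unfolding gt_def D1_def D2_def m by (simp only: algebra_simps mult_1_left mult_1_right)
    also have "\<dots> = E1 * (\<i> * of_real (\<eta>\<^sup>2 * (4 * Y\<^sup>2 - r0\<^sup>2 - 2)))
      + Bc l * E2 * (\<i> * of_real (\<eta>\<^sup>2 * (4 * Y\<^sup>2 - r0\<^sup>2 - 2)) - of_real (8 * \<eta>\<^sup>2 * l * Y) - 2 * \<i> * of_real (\<eta>\<^sup>2 * l\<^sup>2))
      + \<i> * of_real (\<alpha> * \<eta>\<^sup>2) * d2 * E2 + \<i> * of_real (\<alpha> * \<eta>\<^sup>2) * cnj (Bc l) * d1 * E1"
      unfolding wave_coefficient_incoming[OF d1_def[THEN meta_eq_to_obj_eq]] wave_coefficient_reflected[OF d2_def[THEN meta_eq_to_obj_eq]] ..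
    also have "\<dots> = R00 l Y E1 E2 + (Bc l * (- 2 * \<i> * of_real (\<eta>\<^sup>2 * l\<^sup>2)) + of_real (\<alpha> * \<eta>\<^sup>2 * l)) * E2"
    proof -
      have d2: "d2 = of_real (- r0 - 2 * Y) - \<i> * of_real l" by (simp add: d2_def complex_eq_iff)
      have i2: "\<i> * (X * (\<i> * Z)) = - (X * Z)" for X Z
        by (simp add: complex_eq_iff)
      show ?thesis unfolding R00_def d1_def[symmetric] d2 by (simp add: algebra_simps i2)
    qed
    finally show ?thesis unfolding B by simp
  qed
  have "gt + \<i> * (of_real (\<eta>\<^sup>2 * s\<^sup>2) * gxx + of_real ((4 - \<alpha> - 2 * \<beta>) * (\<eta>\<^sup>2 * s * C)) * gx) + \<i> * of_real \<alpha> * of_real (\<eta>\<^sup>2 * s * C) * cnj gx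
    = (gt + \<i> * ?n * (D2 - D1 + ?m * D1) + \<i> * of_real (\<alpha> * \<eta>\<^sup>2) * cnj D1)
      + (of_real (C\<^sup>2) - 1) * (\<i> * ?n * (D2 + ?m * D1) + \<i> * of_real (\<alpha> * \<eta>\<^sup>2) * cnj D1)"
    unfolding s1 s2 s3 by (simp only: algebra_simps mult_1_left mult_1_right)
  also have "of_real (C\<^sup>2) - (1::complex) = - of_real (s\<^sup>2)" unfolding s(2) by simp
  finally show ?thesis unfolding core by simp
qed

definition K3 where "K3 = \<bar>r0\<bar> + 3"
definition KR00 where "KR00 = 2 * (6 + r0\<^sup>2) + 4 * A + 2 * A * (\<bar>r0\<bar> + 2) + A\<^sup>2"
definition KR0 where "KR0 = KR00 + K3\<^sup>2 * (16 * A + 8 * (24 * M) + 2 * (64 * A * M) + 2 * A * (16 * A * M ^ 3))"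

text \<open>No power of \<open>l\<close> survives: each \<open>l\<close> in \<open>R00\<close> is
  accompanied by \<open>Bc l\<close>, and \<open>cmod (Bc l) * l\<close> is at most
  \<open>A / 2\<close>.\<close>

lemma norm_R00_le:
  assumes l: "A \<le> l" and E: "cmod E1 = e" "cmod E2 = e"
  shows "cmod (R00 l Y E1 E2) \<le> KR00 * (1 + \<bar>Y\<bar>)\<^sup>2 * e"
proof -
  define u where "u = 1 + \<bar>Y\<bar>"
  have u: "1 \<le> u" "\<bar>Y\<bar> \<le> u" "u \<le> u\<^sup>2" "1 \<le> u\<^sup>2" "Y\<^sup>2 \<le> u\<^sup>2"
  proof -
    show "1 \<le> u" "\<bar>Y\<bar> \<le> u" by (auto simp: u_def)
    then show "u \<le> u\<^sup>2" "1 \<le> u\<^sup>2" by (auto simp: power2_eq_square mult_le_cancel_left1 intro: mult_ge1_I)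
    show "Y\<^sup>2 \<le> u\<^sup>2" using \<open>\<bar>Y\<bar> \<le> u\<close> by (metis abs_le_square_iff abs_of_nonneg abs_ge_zero order_trans)
  qed
  have l0: "0 < l" using l A1 by linarith
  have e: "0 \<le> e" using E by auto
  have eta2: "\<eta>\<^sup>2 \<le> 1" "0 \<le> \<eta>\<^sup>2" using eta by (auto simp: power_le_one)
  have Bl: "cmod (Bc l) * l \<le> A / 2"
    using l0 abs_alpha_le(1) by (simp add: Bc_def norm_mult norm_divide field_simps)
  have B1: "cmod (Bc l) \<le> 1"
  proof -
    have "cmod (Bc l) = \<bar>\<alpha>\<bar> / (2 * l)" using l0 by (simp add: Bc_def norm_mult norm_divide)
    also have "\<dots> \<le> 1" using l0 l abs_alpha_le(1) by (simp add: divide_le_eq)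
    finally show ?thesis .
  qed
  have q: "\<bar>\<eta>\<^sup>2 * (4 * Y\<^sup>2 - r0\<^sup>2 - 2)\<bar> \<le> (6 + r0\<^sup>2) * u\<^sup>2"
  proof -
    have "\<bar>\<eta>\<^sup>2 * (4 * Y\<^sup>2 - r0\<^sup>2 - 2)\<bar> \<le> 1 * (4 * Y\<^sup>2 + r0\<^sup>2 + 2)"
      unfolding abs_mult using eta2 by (intro mult_mono) (auto simp: abs_le_iff)
    also have "\<dots> \<le> 4 * u\<^sup>2 + r0\<^sup>2 * u\<^sup>2 + 2 * u\<^sup>2"
      using u mult_left_mono[OF u(4), of "r0\<^sup>2"] by simp
    finally show ?thesis by (simp add: algebra_simps)
  qed
  have ry: "\<bar>- r0 - 2 * Y\<bar> \<le> (\<bar>r0\<bar> + 2) * u"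
  proof -
    have "\<bar>- r0 - 2 * Y\<bar> \<le> \<bar>r0\<bar> * 1 + 2 * \<bar>Y\<bar>" by linarith
    also have "\<dots> \<le> \<bar>r0\<bar> * u + 2 * u" using u by (intro add_mono mult_left_mono) auto
    finally show ?thesis by (simp add: algebra_simps)
  qed
  have t1: "cmod (E1 * (\<i> * of_real (\<eta>\<^sup>2 * (4 * Y\<^sup>2 - r0\<^sup>2 - 2)))) \<le> (6 + r0\<^sup>2) * u\<^sup>2 * e"
    using mult_left_mono[OF q e] E by (simp add: norm_mult norm_ii norm_of_real mult_ac del: of_real_mult of_real_diff of_real_power)
  have t2: "cmod (Bc l * E2 * (\<i> * of_real (\<eta>\<^sup>2 * (4 * Y\<^sup>2 - r0\<^sup>2 - 2)) - of_real (8 * \<eta>\<^sup>2 * l * Y))) \<le> ((6 + r0\<^sup>2) + 4 * A) * u\<^sup>2 * e"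
  proof -
    have "cmod (\<i> * of_real (\<eta>\<^sup>2 * (4 * Y\<^sup>2 - r0\<^sup>2 - 2)) - of_real (8 * \<eta>\<^sup>2 * l * Y)) \<le> (6 + r0\<^sup>2) * u\<^sup>2 + 8 * l * u"
    proof -
      have "\<bar>8 * \<eta>\<^sup>2 * l * Y\<bar> = \<eta>\<^sup>2 * (8 * l * \<bar>Y\<bar>)" using l0 by (simp add: abs_mult)
      also have "\<dots> \<le> 1 * (8 * l * u)" using eta2 u l0 by (intro mult_mono) auto
      finally have "\<bar>8 * \<eta>\<^sup>2 * l * Y\<bar> \<le> 8 * l * u" by simp
      then show ?thesis
        using norm_triangle_ineq4[of "\<i> * of_real (\<eta>\<^sup>2 * (4 * Y\<^sup>2 - r0\<^sup>2 - 2))" "of_real (8 * \<eta>\<^sup>2 * l * Y)"] q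
        by (simp only: norm_mult norm_ii norm_of_real mult_1)
    qed
    then have "cmod (Bc l * E2 * (\<i> * of_real (\<eta>\<^sup>2 * (4 * Y\<^sup>2 - r0\<^sup>2 - 2)) - of_real (8 * \<eta>\<^sup>2 * l * Y)))
       \<le> cmod (Bc l) * e * ((6 + r0\<^sup>2) * u\<^sup>2 + 8 * l * u)"
      unfolding norm_mult E using e by (intro mult_left_mono) auto
    also have "\<dots> = (cmod (Bc l) * ((6 + r0\<^sup>2) * u\<^sup>2)) * e + 8 * (cmod (Bc l) * l) * u * e" by (simp add: algebra_simps)
    also have "\<dots> \<le> (1 * ((6 + r0\<^sup>2) * u\<^sup>2)) * e + 8 * (A / 2) * u\<^sup>2 * e"
      using B1 Bl u e l0 A1 by (intro add_mono mult_right_mono mult_mono) auto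
    finally show ?thesis by (simp add: algebra_simps)
  qed
  have a\<eta>: "\<bar>\<alpha> * \<eta>\<^sup>2\<bar> \<le> A * 1" unfolding abs_mult using abs_alpha_le(1) eta2 A1 by (intro mult_mono) auto
  have t3: "cmod (\<i> * of_real (\<alpha> * \<eta>\<^sup>2) * of_real (- r0 - 2 * Y) * E2) \<le> A * (\<bar>r0\<bar> + 2) * u\<^sup>2 * e"
  proof -
    have "\<bar>- r0 - 2 * Y\<bar> \<le> (\<bar>r0\<bar> + 2) * u\<^sup>2" using ry mult_left_mono[OF u(3), of "\<bar>r0\<bar> + 2"] by linarith
    then have "\<bar>\<alpha> * \<eta>\<^sup>2\<bar> * \<bar>- r0 - 2 * Y\<bar> * e \<le> (A * 1) * ((\<bar>r0\<bar> + 2) * u\<^sup>2) * e"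
      using a\<eta> e A1 by (intro mult_right_mono mult_mono) auto
    then show ?thesis unfolding norm_mult norm_ii norm_of_real E by (simp add: mult_ac)
  qed
  have t4: "cmod (\<i> * of_real (\<alpha> * \<eta>\<^sup>2) * cnj (Bc l) * Complex (- r0 - 2 * Y) l * E1) \<le> (A * (\<bar>r0\<bar> + 2) + A\<^sup>2) * u\<^sup>2 * e"
  proof -
    have "cmod (Complex (- r0 - 2 * Y) l) \<le> \<bar>- r0 - 2 * Y\<bar> + l"
      using cmod_le[of "Complex (- r0 - 2 * Y) l"] l0 by simp
    then have "cmod (Bc l) * cmod (Complex (- r0 - 2 * Y) l) \<le> cmod (Bc l) * ((\<bar>r0\<bar> + 2) * u + l)"
      using ry by (intro mult_left_mono) auto
    also have "\<dots> = cmod (Bc l) * ((\<bar>r0\<bar> + 2) * u) + cmod (Bc l) * l" by (simp add: algebra_simps)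
    also have "\<dots> \<le> 1 * ((\<bar>r0\<bar> + 2) * u\<^sup>2) + A * u\<^sup>2"
    proof (rule add_mono)
      show "cmod (Bc l) * ((\<bar>r0\<bar> + 2) * u) \<le> 1 * ((\<bar>r0\<bar> + 2) * u\<^sup>2)"
        using B1 u by (intro mult_mono) auto
      have "A / 2 * 1 \<le> A * u\<^sup>2" using u A1 by (intro mult_mono) auto
      then show "cmod (Bc l) * l \<le> A * u\<^sup>2" using Bl by simp
    qed
    finally have "\<bar>\<alpha> * \<eta>\<^sup>2\<bar> * (cmod (Bc l) * cmod (Complex (- r0 - 2 * Y) l)) * e \<le> (A * 1) * (1 * ((\<bar>r0\<bar> + 2) * u\<^sup>2) + A * u\<^sup>2) * e"
      using a\<eta> e A1 by (intro mult_right_mono mult_mono) auto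
    then show ?thesis unfolding norm_mult norm_ii norm_of_real E complex_mod_cnj by (simp add: power2_eq_square algebra_simps)
  qed
  have "cmod (R00 l Y E1 E2) \<le> (6 + r0\<^sup>2) * u\<^sup>2 * e + ((6 + r0\<^sup>2) + 4 * A) * u\<^sup>2 * e + A * (\<bar>r0\<bar> + 2) * u\<^sup>2 * e + (A * (\<bar>r0\<bar> + 2) + A\<^sup>2) * u\<^sup>2 * e"
    unfolding R00_def by (intro norm_triangle_le add_mono t1 t2 t3 t4)
  also have "\<dots> = KR00 * u\<^sup>2 * e" by (simp add: KR00_def algebra_simps)
  finally show ?thesis by (simp add: u_def)
qed

text \<open>The true coefficients differ from the model ones by O(s^3), O(s^2) and O(s^2 + t s), and
  a derivative in \<open>x\<close> costs \<open>l / s\<close>. The resulting errors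
  \<open>s * l\<^sup>2\<close> and \<open>t * l\<close> explain why the packet starts at
  \<open>sin x = 1 / l\<^sup>2\<close> and why the time must be short.\<close>

lemma residual_bound:
  fixes E1 E2 z' b' :: complex and s C Y l \<rho> t e :: real
  assumes s: "s > 0" "s \<le> 1" "C\<^sup>2 = 1 - s\<^sup>2" and l: "A \<le> l" and E: "cnj E1 = E2" "cmod E1 = e" and t: "0 \<le> t"
    and \<rho>: "\<bar>\<rho> - \<eta>\<^sup>2 * s\<^sup>2\<bar> \<le> 24 * M * s ^ 3"
    and b': "cmod (b' - of_real ((4 - \<alpha> - 2 * \<beta>) * (\<eta>\<^sup>2 * s * C))) \<le> 64 * A * M * s\<^sup>2"
    and z': "cmod (z' - of_real (\<eta>\<^sup>2 * s * C)) \<le> 16 * A * M ^ 3 * (s\<^sup>2 + t * s)"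
  defines "d1 \<equiv> Complex (- r0 - 2 * Y) l" and "d2 \<equiv> Complex (- r0 - 2 * Y) (- l)"
  defines "D1 \<equiv> d1 * E1 + Bc l * d2 * E2" and "D2 \<equiv> (d1\<^sup>2 - 2) * E1 + Bc l * (d2\<^sup>2 - 2) * E2"
  defines "gt \<equiv> (of_real (- 4 * \<eta>\<^sup>2 * l * Y) + \<i> * of_real (\<eta>\<^sup>2 * l\<^sup>2)) * E1 + Bc l * (of_real (- 4 * \<eta>\<^sup>2 * l * Y) - \<i> * of_real (\<eta>\<^sup>2 * l\<^sup>2)) * E2"
  defines "gx \<equiv> of_real (C / s) * D1" and "gxx \<equiv> of_real ((C / s)\<^sup>2) * D2 - of_real (1 / s\<^sup>2) * D1"
  shows "cmod (gt + \<i> * (of_real \<rho> * gxx + b' * gx) + \<i> * of_real \<alpha> * z' * cnj gx)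
      \<le> KR0 * (1 + \<bar>Y\<bar>)\<^sup>2 * (1 + s * l\<^sup>2 + t * l) * e"
    and "cmod (E1 + Bc l * E2) \<le> 2 * e" and "cmod gx \<le> 2 * K3 * l * (1 + \<bar>Y\<bar>) / s * e"
proof -
  define u where "u = 1 + \<bar>Y\<bar>"
  \<comment> \<open>The cost of one derivative in \<open>y\<close>: it bounds \<open>d1\<close> and
    \<open>d2\<close>. A derivative in \<open>x\<close> costs \<open>L / s\<close>.\<close>
  define L where "L = l * u * K3"
  have l1: "1 \<le> l" using l A1 by linarith
  have u1: "1 \<le> u" by (simp add: u_def)
  have K31: "3 \<le> K3" by (simp add: K3_def)
  have L1: "1 \<le> L" unfolding L_def using l1 u1 K31 by (intro mult_ge1_I) auto
  then have L2: "L \<le> L\<^sup>2" by (simp add: power2_eq_square mult_le_cancel_left1)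
  have E2: "cmod E2 = e" using E by auto
  have e: "0 \<le> e" using E(2) by auto
  have eta2: "\<eta>\<^sup>2 \<le> 1" "0 \<le> \<eta>\<^sup>2" using eta by (auto simp: power_le_one)
  have B1: "cmod (Bc l) \<le> 1"
  proof -
    have "cmod (Bc l) = \<bar>\<alpha>\<bar> / (2 * l)" using l1 by (simp add: Bc_def norm_mult norm_divide)
    also have "\<dots> \<le> 1" using l1 l abs_alpha_le(1) by (simp add: divide_le_eq)
    finally show ?thesis .
  qed
  have comb: "cmod (x * E1 + Bc l * y * E2) \<le> 2 * X * e" if "cmod x \<le> X" "cmod y \<le> X" for x y X
  proof -
    have X: "0 \<le> X" using that(1) norm_ge_zero order_trans by blast
    have "cmod (x * E1) \<le> X * e" unfolding norm_mult E(2) using that e by (intro mult_right_mono) auto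
    moreover have "cmod (Bc l * y * E2) \<le> 1 * X * e" unfolding norm_mult E2 using that B1 e X by (intro mult_right_mono mult_mono) auto
    ultimately show ?thesis using norm_triangle_ineq[of "x * E1" "Bc l * y * E2"] by linarith
  qed
  have d: "cmod d1 \<le> L" "cmod d2 \<le> L"
  proof -
    have "\<bar>- r0 - 2 * Y\<bar> + l \<le> (\<bar>r0\<bar> + 2 * \<bar>Y\<bar>) * 1 + l"
      using abs_triangle_ineq4[of "- r0" "2 * Y"] by (simp add: abs_mult)
    also have "\<dots> \<le> (\<bar>r0\<bar> + 2 * \<bar>Y\<bar>) * l + l" using l1 by (intro add_right_mono mult_left_mono) auto
    also have "\<dots> = l * (\<bar>r0\<bar> + 2 * \<bar>Y\<bar> + 1)" by (simp add: algebra_simps)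
    also have "\<dots> \<le> l * (u * K3)"
      using l1 by (intro mult_left_mono) (auto simp: u_def K3_def algebra_simps)
    finally have *: "\<bar>- r0 - 2 * Y\<bar> + l \<le> L" by (simp add: L_def)
    show "cmod d1 \<le> L" using cmod_le[of d1] * l1 by (simp add: d1_def)
    show "cmod d2 \<le> L" using cmod_le[of d2] * l1 by (simp add: d2_def)
  qed
  have D1: "cmod D1 \<le> 2 * L * e" unfolding D1_def by (rule comb[OF d])
  have D2: "cmod D2 \<le> 6 * L\<^sup>2 * e"
  proof -
    have "cmod (x\<^sup>2 - 2) \<le> 3 * L\<^sup>2" if "cmod x \<le> L" for x
    proof -
      have "cmod (x\<^sup>2 - 2) \<le> (cmod x)\<^sup>2 + 2" using norm_triangle_ineq4[of "x\<^sup>2" 2] by (simp add: norm_power)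
      also have "\<dots> \<le> L\<^sup>2 + 2 * L\<^sup>2" using that L1 L2 by (intro add_mono power_mono) auto
      finally show ?thesis by simp
    qed
    from comb[OF this[OF d(1)] this[OF d(2)]] show ?thesis by (simp add: D2_def)
  qed
  have C: "\<bar>C\<bar> \<le> 1" "C\<^sup>2 \<le> 1"
  proof -
    show "C\<^sup>2 \<le> 1" using s by simp
    then show "\<bar>C\<bar> \<le> 1" by (simp add: abs_square_le_1)
  qed
  have gx: "cmod gx \<le> 2 * L * e / s"
  proof -
    have "cmod gx = \<bar>C\<bar> * cmod D1 / s" using s by (simp add: gx_def norm_mult norm_divide)
    also have "\<dots> \<le> 1 * (2 * L * e) / s" using C D1 s by (intro divide_right_mono mult_mono) auto
    finally show ?thesis by simp
  qed
  then show "cmod gx \<le> 2 * K3 * l * (1 + \<bar>Y\<bar>) / s * e" by (simp add: L_def u_def mult_ac)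
  show "cmod (E1 + Bc l * E2) \<le> 2 * e" using comb[of 1 1 1] by simp
  have gxx: "cmod gxx \<le> 8 * L\<^sup>2 * e / s\<^sup>2"
  proof -
    have "gxx = (of_real (C\<^sup>2) * D2 - D1) / of_real (s\<^sup>2)" by (simp add: gxx_def power_divide diff_divide_distrib)
    then have "cmod gxx = cmod (of_real (C\<^sup>2) * D2 - D1) / s\<^sup>2" by (simp add: norm_divide norm_power)
    also have "\<dots> \<le> (1 * (6 * L\<^sup>2 * e) + 2 * L\<^sup>2 * e) / s\<^sup>2"
    proof (intro divide_right_mono)
      have "cmod (of_real (C\<^sup>2) * D2) \<le> 1 * (6 * L\<^sup>2 * e)"
        unfolding norm_mult norm_of_real using C D2 by (intro mult_mono) auto
      moreover have "2 * L * e \<le> 2 * L\<^sup>2 * e" using L2 e by (intro mult_right_mono) auto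
      ultimately show "cmod (of_real (C\<^sup>2) * D2 - D1) \<le> 1 * (6 * L\<^sup>2 * e) + 2 * L\<^sup>2 * e"
        using norm_triangle_ineq4[of "of_real (C\<^sup>2) * D2" D1] D1 by linarith
    qed simp
    finally show ?thesis by (simp add: mult_ac)
  qed
  let ?R01 = "\<i> * of_real (\<eta>\<^sup>2) * (D2 + of_real (4 - \<alpha> - 2 * \<beta>) * D1) + \<i> * of_real (\<alpha> * \<eta>\<^sup>2) * cnj D1"
  have a4: "\<bar>4 - \<alpha> - 2 * \<beta>\<bar> \<le> 4 * A"
  proof -
    have "\<bar>4 - \<alpha> - 2 * \<beta>\<bar> \<le> 4 + \<bar>\<alpha>\<bar> + 2 * \<bar>\<beta>\<bar>" by linarith
    moreover have "A = 1 + \<bar>\<alpha>\<bar> + \<bar>\<beta>\<bar> + cmod \<mu>" by (simp add: A_def bigA_def)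
    moreover have "0 \<le> cmod \<mu>" "0 \<le> \<bar>\<alpha>\<bar>" "0 \<le> \<bar>\<beta>\<bar>" by auto
    ultimately show ?thesis by linarith
  qed
  have R01: "cmod ?R01 \<le> 16 * A * L\<^sup>2 * e"
  proof -
    have p1: "cmod (D2 + of_real (4 - \<alpha> - 2 * \<beta>) * D1) \<le> 6 * L\<^sup>2 * e + (4 * A) * (2 * L * e)"
    proof -
      have "cmod (of_real (4 - \<alpha> - 2 * \<beta>) * D1) \<le> (4 * A) * (2 * L * e)"
        unfolding norm_mult norm_of_real using a4 D1 A1 by (intro mult_mono) auto
      then show ?thesis using norm_triangle_ineq[of D2 "of_real (4 - \<alpha> - 2 * \<beta>) * D1"] D2 by linarith
    qed
    have p2: "cmod (\<i> * of_real (\<eta>\<^sup>2) * (D2 + of_real (4 - \<alpha> - 2 * \<beta>) * D1)) \<le> 1 * (6 * L\<^sup>2 * e + (4 * A) * (2 * L * e))"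
    proof -
      have "\<bar>\<eta>\<^sup>2\<bar> * cmod (D2 + of_real (4 - \<alpha> - 2 * \<beta>) * D1) \<le> 1 * (6 * L\<^sup>2 * e + (4 * A) * (2 * L * e))"
        using eta2 p1 by (intro mult_mono) auto
      then show ?thesis by (simp only: norm_mult norm_ii norm_of_real mult_1)
    qed
    have p3: "cmod (\<i> * of_real (\<alpha> * \<eta>\<^sup>2) * cnj D1) \<le> A * (2 * L * e)"
    proof -
      have "\<bar>\<alpha> * \<eta>\<^sup>2\<bar> \<le> A * 1" unfolding abs_mult using abs_alpha_le(1) eta2 A1 by (intro mult_mono) auto
      then show ?thesis unfolding norm_mult norm_ii norm_of_real mult_1 complex_mod_cnj using D1 A1 by (intro mult_mono) auto
    qed
    have "L * e \<le> L\<^sup>2 * e" using L2 e by (intro mult_right_mono) auto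
    then have "A * (L * e) \<le> A * (L\<^sup>2 * e)" "1 * (L\<^sup>2 * e) \<le> A * (L\<^sup>2 * e)"
      using A1 e mult_right_mono[OF A1, of "L\<^sup>2 * e"] by (auto intro!: mult_left_mono)
    then show ?thesis using p2 p3 norm_triangle_ineq[of "\<i> * of_real (\<eta>\<^sup>2) * (D2 + of_real (4 - \<alpha> - 2 * \<beta>) * D1)" "\<i> * of_real (\<alpha> * \<eta>\<^sup>2) * cnj D1"]
      by (simp add: mult.assoc)
  qed
  let ?main = "gt + \<i> * (of_real (\<eta>\<^sup>2 * s\<^sup>2) * gxx + of_real ((4 - \<alpha> - 2 * \<beta>) * (\<eta>\<^sup>2 * s * C)) * gx) + \<i> * of_real \<alpha> * of_real (\<eta>\<^sup>2 * s * C) * cnj gx"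
  have main: "?main = R00 l Y E1 E2 - of_real (s\<^sup>2) * ?R01"
    unfolding gt_def gx_def gxx_def D1_def D2_def d1_def d2_def
    by (rule residual_identity) (use s l1 E in auto)
  have ss: "s\<^sup>2 \<le> s" using s by (simp add: power2_eq_square mult_le_one mult_left_le)
  have m1: "cmod (of_real (s\<^sup>2) * ?R01) \<le> s * (16 * A * L\<^sup>2 * e)"
    unfolding norm_mult[of "of_real (s\<^sup>2)"] norm_of_real using ss s R01 by (intro mult_mono) auto
  have m0: "cmod (R00 l Y E1 E2) \<le> KR00 * u\<^sup>2 * e" unfolding u_def by (rule norm_R00_le[OF l E(2) E2])
  have x1: "cmod (\<i> * (of_real (\<rho> - \<eta>\<^sup>2 * s\<^sup>2) * gxx)) \<le> s * (8 * (24 * M) * L\<^sup>2 * e)"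
  proof -
    have "cmod (\<i> * (of_real (\<rho> - \<eta>\<^sup>2 * s\<^sup>2) * gxx)) \<le> (24 * M * s ^ 3) * (8 * L\<^sup>2 * e / s\<^sup>2)"
      unfolding norm_mult norm_ii norm_of_real mult_1 using \<rho> gxx M1 s by (intro mult_mono) auto
    also have "\<dots> = s * (8 * (24 * M) * L\<^sup>2 * e)" using s by (simp add: power2_eq_square power3_eq_cube)
    finally show ?thesis .
  qed
  have LL: "L * e \<le> L\<^sup>2 * e" using L2 e by (intro mult_right_mono) auto
  have x2: "cmod (\<i> * ((b' - of_real ((4 - \<alpha> - 2 * \<beta>) * (\<eta>\<^sup>2 * s * C))) * gx)) \<le> s * (2 * (64 * A * M) * (L\<^sup>2 * e))"
  proof -
    have "cmod (\<i> * ((b' - of_real ((4 - \<alpha> - 2 * \<beta>) * (\<eta>\<^sup>2 * s * C))) * gx)) \<le> (64 * A * M * s\<^sup>2) * (2 * L * e / s)"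
      unfolding norm_mult norm_ii mult_1 using b' gx M1 A1 s by (intro mult_mono) auto
    also have "\<dots> = s * (2 * (64 * A * M) * (L * e))" using s by (simp add: power2_eq_square)
    also have "\<dots> \<le> s * (2 * (64 * A * M) * (L\<^sup>2 * e))" using LL s A1 M1 by (intro mult_left_mono) auto
    finally show ?thesis .
  qed
  have x3: "cmod (\<i> * of_real \<alpha> * (z' - of_real (\<eta>\<^sup>2 * s * C)) * cnj gx) \<le> (2 * A * (16 * A * M ^ 3)) * (s * (L\<^sup>2 * e) + t * (L * e))"
  proof -
    have "cmod (\<i> * of_real \<alpha> * (z' - of_real (\<eta>\<^sup>2 * s * C)) * cnj gx) \<le> A * (16 * A * M ^ 3 * (s\<^sup>2 + t * s)) * (2 * L * e / s)"
      unfolding norm_mult norm_ii mult_1 norm_of_real complex_mod_cnj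
      using z' gx abs_alpha_le(1) M1 A1 s t by (intro mult_mono) auto
    also have "\<dots> = (2 * A * (16 * A * M ^ 3)) * (s * (L * e) + t * (L * e))" using s by (simp add: power2_eq_square field_simps)
    also have "\<dots> \<le> (2 * A * (16 * A * M ^ 3)) * (s * (L\<^sup>2 * e) + t * (L * e))"
      using LL s A1 M1 by (intro mult_left_mono add_right_mono) auto
    finally show ?thesis .
  qed
  have eq: "gt + \<i> * (of_real \<rho> * gxx + b' * gx) + \<i> * of_real \<alpha> * z' * cnj gx
    = ?main + \<i> * (of_real (\<rho> - \<eta>\<^sup>2 * s\<^sup>2) * gxx) + \<i> * ((b' - of_real ((4 - \<alpha> - 2 * \<beta>) * (\<eta>\<^sup>2 * s * C))) * gx)
      + \<i> * of_real \<alpha> * (z' - of_real (\<eta>\<^sup>2 * s * C)) * cnj gx"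
    unfolding of_real_diff[of \<rho>] by (simp only: algebra_simps)
  have "cmod (gt + \<i> * (of_real \<rho> * gxx + b' * gx) + \<i> * of_real \<alpha> * z' * cnj gx) \<le> (KR00 * u\<^sup>2 * e + s * (16 * A * L\<^sup>2 * e)) + s * (8 * (24 * M) * L\<^sup>2 * e) + s * (2 * (64 * A * M) * (L\<^sup>2 * e))
      + (2 * A * (16 * A * M ^ 3)) * (s * (L\<^sup>2 * e) + t * (L * e))"
    unfolding eq unfolding main
    using norm_triangle_ineq4[of "R00 l Y E1 E2" "of_real (s\<^sup>2) * ?R01"] m0 m1
    by (intro norm_triangle_le add_mono x1 x2 x3) linarith
  also have "\<dots> = KR00 * u\<^sup>2 * e + (16 * A + 8 * (24 * M) + 2 * (64 * A * M) + 2 * A * (16 * A * M ^ 3)) * (s * (L\<^sup>2 * e)) + (2 * A * (16 * A * M ^ 3)) * (t * (L * e))"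
    by (simp add: algebra_simps)
  also have "\<dots> \<le> KR0 * u\<^sup>2 * (1 + s * l\<^sup>2 + t * l) * e"
  proof -
    define G where "G = 16 * A + 8 * (24 * M) + 2 * (64 * A * M) + 2 * A * (16 * A * M ^ 3)"
    have G: "0 \<le> G" "2 * A * (16 * A * M ^ 3) \<le> G" using A1 M1 by (auto simp: G_def)
    have KR00: "0 \<le> KR00" using A1 by (simp add: KR00_def)
    have L2e: "L\<^sup>2 = l\<^sup>2 * u\<^sup>2 * K3\<^sup>2" by (simp add: L_def power_mult_distrib)
    have "t * (L * e) \<le> (t * l) * (u\<^sup>2 * K3\<^sup>2 * e)"
    proof -
      have "u * K3 \<le> u\<^sup>2 * K3\<^sup>2" using u1 K31 by (intro mult_mono) (auto simp: power2_eq_square mult_le_cancel_left1)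
      then have "(t * l) * (u * K3 * e) \<le> (t * l) * (u\<^sup>2 * K3\<^sup>2 * e)" using t l1 e by (intro mult_left_mono mult_right_mono) auto
      then show ?thesis by (simp add: L_def mult_ac)
    qed
    then have "(2 * A * (16 * A * M ^ 3)) * (t * (L * e)) \<le> G * ((t * l) * (u\<^sup>2 * K3\<^sup>2 * e))"
      using G t e L1 by (intro mult_mono[OF G(2)]) auto
    then have "KR00 * u\<^sup>2 * e + G * (s * (L\<^sup>2 * e)) + (2 * A * (16 * A * M ^ 3)) * (t * (L * e))
      \<le> KR00 * u\<^sup>2 * e + G * (s * (L\<^sup>2 * e)) + G * ((t * l) * (u\<^sup>2 * K3\<^sup>2 * e))" by simp
    also have "\<dots> = u\<^sup>2 * e * (KR00 + K3\<^sup>2 * G * (s * l\<^sup>2 + t * l))" unfolding L2e by (simp add: algebra_simps)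
    also have "\<dots> \<le> u\<^sup>2 * e * ((KR00 + K3\<^sup>2 * G) * (1 + s * l\<^sup>2 + t * l))"
    proof (intro mult_left_mono)
      have "0 \<le> KR00 * (s * l\<^sup>2 + t * l)" "0 \<le> K3\<^sup>2 * G" using KR00 G s t l1 by auto
      then show "KR00 + K3\<^sup>2 * G * (s * l\<^sup>2 + t * l) \<le> (KR00 + K3\<^sup>2 * G) * (1 + s * l\<^sup>2 + t * l)"
        by (simp add: algebra_simps)
    qed (use e in auto)
    finally show ?thesis by (simp add: G_def KR0_def mult_ac)
  qed
  finally show "cmod (gt + \<i> * (of_real \<rho> * gxx + b' * gx) + \<i> * of_real \<alpha> * z' * cnj gx)
      \<le> KR0 * (1 + \<bar>Y\<bar>)\<^sup>2 * (1 + s * l\<^sup>2 + t * l) * e"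
    by (simp add: u_def)
qed

end

text \<open>The Gaussian absorbs the polynomial and the factor \<open>exp Y\<close> that stands for
  \<open>s * l\<^sup>2\<close>, and an integrable \<open>exp (- \<bar>Y\<bar>)\<close> is left. The
  constant 40 is 4 times 10, where 10 exceeds \<open>exp (9 / 4)\<close> and \<open>9 / 4\<close> is
  the maximum of \<open>3 * u - u\<^sup>2\<close>.\<close>

lemma gaussian_absorbs:
  fixes Y m :: real
  assumes "0 \<le> m"
  shows "(1 + \<bar>Y\<bar>)\<^sup>2 * (1 + exp Y + m) * exp (- (Y\<^sup>2)) \<le> 40 * (1 + m) * exp (- \<bar>Y\<bar>)"
proof -
  define u where "u = \<bar>Y\<bar>"
  have u: "0 \<le> u" "Y\<^sup>2 = u\<^sup>2" by (auto simp: u_def)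
  have "1 + u + u\<^sup>2 / 2 \<le> exp u" using exp_lower_Taylor_quadratic[OF u(1)] .
  then have 1: "(1 + u)\<^sup>2 \<le> 2 * exp u" using u by (simp add: power2_eq_square algebra_simps)
  have "exp Y \<le> exp u" "1 \<le> exp u" using u by (auto simp: u_def)
  moreover have "m \<le> m * exp u" using assms \<open>1 \<le> exp u\<close> by (simp add: mult_le_cancel_left1)
  ultimately have "1 + exp Y + m \<le> 2 * exp u + m * exp u" by linarith
  also have "\<dots> \<le> (1 + m) * (2 * exp u)" using assms by (simp add: algebra_simps)
  finally have 2: "1 + exp Y + m \<le> (1 + m) * (2 * exp u)" .
  have "(1 + u)\<^sup>2 * (1 + exp Y + m) * exp (- (u\<^sup>2)) \<le> (2 * exp u) * ((1 + m) * (2 * exp u)) * exp (- (u\<^sup>2))"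
    using 1 2 assms by (intro mult_right_mono mult_mono) (auto intro!: add_nonneg_nonneg)
  also have "\<dots> = 4 * (1 + m) * exp (2 * u - u\<^sup>2)"
  proof -
    have "exp (2 * u - u\<^sup>2) = exp u * exp u * exp (- (u\<^sup>2))" by (simp flip: exp_add)
    then show ?thesis by simp
  qed
  also have "\<dots> \<le> 4 * (1 + m) * (10 * exp (- u))"
  proof (intro mult_left_mono)
    have "3 * u - u\<^sup>2 \<le> 9 / 4" using zero_le_power2[of "u - 3 / 2"] by (simp add: power2_eq_square algebra_simps)
    then have "exp (2 * u - u\<^sup>2) \<le> exp (9 / 4 - u)" by simp
    also have "\<dots> = exp (9 / 4) * exp (- u)" by (simp flip: exp_add)
    also have "\<dots> \<le> 10 * exp (- u)"
    proof (intro mult_right_mono)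
      have "exp (9 / 4 :: real) = exp (1 / 4) * (exp 1 * exp 1)" by (simp flip: exp_add)
      also have "\<dots> \<le> (1 + 1 / 4 + (1 / 4)\<^sup>2) * (272 / 100 * (272 / 100))"
        using e_less_272 exp_bound[of "1 / 4"] by (intro mult_mono) auto
      also have "\<dots> \<le> 10" by (simp add: power2_eq_square)
      finally show "exp (9 / 4 :: real) \<le> 10" .
    qed simp
    finally show "exp (2 * u - u\<^sup>2) \<le> 10 * exp (- u)" .
  qed (use assms in auto)
  finally show ?thesis by (simp add: u u_def[symmetric] mult_ac)
qed

lemma gaussian_moment: "(1 + \<bar>Y\<bar>) * exp (- (Y\<^sup>2)) \<le> (2::real)"
proof -
  have "1 + \<bar>Y\<bar> \<le> 2 * (1 + Y\<^sup>2)"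
  proof -
    have "2 * \<bar>Y\<bar> \<le> 1 + Y\<^sup>2"
      using zero_le_power2[of "\<bar>Y\<bar> - 1"] by (simp add: power2_eq_square algebra_simps)
    moreover have "1 + a \<le> 2 * (1 + q)" if "2 * a \<le> 1 + q" "0 \<le> q" for a q :: real
      using that by (simp add: algebra_simps)
    ultimately show ?thesis using zero_le_power2[of Y] by blast
  qed
  also have "\<dots> \<le> 2 * exp (Y\<^sup>2)" by (intro mult_left_mono exp_ge_add_one_self) simp
  finally have "(1 + \<bar>Y\<bar>) * exp (- (Y\<^sup>2)) \<le> (2 * exp (Y\<^sup>2)) * exp (- (Y\<^sup>2))"
    by (intro mult_right_mono) auto
  moreover have "(2 * exp (Y\<^sup>2)) * exp (- (Y\<^sup>2)) = 2" by (simp add: exp_minus)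
  ultimately show ?thesis by simp
qed

text \<open>The substitution \<open>y = ln (sin x)\<close> is replaced by comparison with derivatives of \<open>arctan\<close>.\<close>

lemma weight_integral_bound:
  fixes S \<kappa> :: real
  assumes S: "0 < S" and \<kappa>: "0 < \<kappa>" "\<kappa> < pi / 2"
  shows "(\<lambda>x. exp (- 2 * \<bar>ln (sin x / S)\<bar>) / sin x) integrable_on {\<kappa>..pi - \<kappa>}"
    and "integral {\<kappa>..pi - \<kappa>} (\<lambda>x. exp (- 2 * \<bar>ln (sin x / S)\<bar>) / sin x) \<le> 4 * pi"
proof -
  let ?I = "{\<kappa>..pi - \<kappa>}"
  have I: "0 < x \<and> x < pi \<and> 0 < sin x" if "x \<in> ?I" for x
    using that \<kappa> sin_gt_zero[of x] by auto
  let ?f = "\<lambda>x. exp (- 2 * \<bar>ln (sin x / S)\<bar>) / sin x"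
  \<comment> \<open>\<open>sin x\<close> is at least half the distance to the nearer zero. Adding
    the bounds belonging to both zeros avoids splitting the interval.\<close>
  let ?h = "\<lambda>x. 2 * S / (x\<^sup>2 / 4 + S\<^sup>2) + 2 * S / ((pi - x)\<^sup>2 / 4 + S\<^sup>2)"
  let ?H = "\<lambda>x. 4 * arctan (x / (2 * S)) - 4 * arctan ((pi - x) / (2 * S))"
  have "continuous_on ?I ?f"
    by (intro continuous_intros) (use I S in force)+
  then show f: "?f integrable_on ?I" by (rule integrable_continuous_real)
  have at: "((\<lambda>x. 4 * arctan (c x / (2 * S))) has_real_derivative d * (2 * S / ((c x)\<^sup>2 / 4 + S\<^sup>2))) (at x)"
    if "(c has_real_derivative d) (at x)" for c d x
  proof -
    have "((\<lambda>x. 4 * arctan (c x / (2 * S))) has_real_derivative 4 * (inverse (1 + (c x / (2 * S))\<^sup>2) * (d / (2 * S)))) (at x)"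
      by (rule DERIV_cmult[OF DERIV_chain2[OF DERIV_arctan DERIV_cdivide[OF that]]])
    moreover have "4 * (inverse (1 + (c x / (2 * S))\<^sup>2) * (d / (2 * S))) = d * (2 * S / ((c x)\<^sup>2 / 4 + S\<^sup>2))"
    proof -
      have "1 + (c x / (2 * S))\<^sup>2 = ((c x)\<^sup>2 / 4 + S\<^sup>2) / S\<^sup>2" using S by (simp add: field_simps power2_eq_square)
      then show ?thesis using S by (simp add: field_simps power2_eq_square)
    qed
    ultimately show ?thesis by simp
  qed
  have "(?h has_integral ?H (pi - \<kappa>) - ?H \<kappa>) ?I"
  proof (rule fundamental_theorem_of_calculus)
    fix x assume "x \<in> ?I"
    have "((\<lambda>x. pi - x) has_real_derivative -1) (at x)" by (auto intro!: derivative_eq_intros)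
    from DERIV_diff[OF at[OF DERIV_ident] at[OF this]]
    have "(?H has_real_derivative ?h x) (at x)" by simp
    then show "(?H has_vector_derivative ?h x) (at x within ?I)"
      by (simp add: has_real_derivative_iff_has_vector_derivative has_vector_derivative_at_within)
  qed (use \<kappa> in auto)
  then have "integral ?I ?f \<le> ?H (pi - \<kappa>) - ?H \<kappa>"
  proof (rule has_integral_le[OF integrable_integral[OF f]])
    fix x assume x: "x \<in> ?I"
    define s where "s = sin x"
    have s: "0 < s" using I[OF x] by (simp add: s_def)
    let ?q = "s / S"
    have q: "0 < ?q" using s S by simp
    have "exp (- 2 * \<bar>ln ?q\<bar>) \<le> exp (- \<bar>ln ?q\<bar>)" by simp
    \<comment> \<open>The exponential of \<open>\<bar>u\<bar>\<close> dominates the hyperbolic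
      cosine of \<open>u\<close>, here with \<open>u = ln ?q\<close>.\<close>
    also have "\<dots> \<le> 2 / (?q + 1 / ?q)"
    proof -
      have "exp (ln ?q) = ?q" "exp (- ln ?q) = 1 / ?q" using q by (simp_all add: exp_minus inverse_eq_divide)
      then have "?q + 1 / ?q \<le> 2 * exp \<bar>ln ?q\<bar>"
        using exp_le_cancel_iff[of "ln ?q" "\<bar>ln ?q\<bar>"] exp_le_cancel_iff[of "- ln ?q" "\<bar>ln ?q\<bar>"] by linarith
      moreover have "0 < ?q + 1 / ?q" using s S by (intro add_pos_pos) auto
      ultimately show ?thesis by (simp add: exp_minus field_simps)
    qed
    finally have "exp (- 2 * \<bar>ln ?q\<bar>) / s \<le> 2 / (?q + 1 / ?q) / s" using s by (intro divide_right_mono) auto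
    also have "\<dots> = 2 * S / (s\<^sup>2 + S\<^sup>2)"
    proof -
      have "?q + 1 / ?q = (s\<^sup>2 + S\<^sup>2) / (s * S)" using s S by (simp add: field_simps power2_eq_square)
      then show ?thesis using s by (simp only:) (simp add: mult.commute)
    qed
    also have "\<dots> \<le> ?h x"
    proof (cases "x \<le> pi / 2")
      case True
      then have "x / 2 \<le> s" using le_2_sin[of x] I[OF x] by (simp add: s_def)
      then have "(x / 2)\<^sup>2 \<le> s\<^sup>2" using I[OF x] by (intro power_mono) auto
      then have "2 * S / (s\<^sup>2 + S\<^sup>2) \<le> 2 * S / (x\<^sup>2 / 4 + S\<^sup>2)"
        using S by (intro divide_left_mono) (auto simp: power_divide add_nonneg_pos)
      moreover have "0 \<le> 2 * S / ((pi - x)\<^sup>2 / 4 + S\<^sup>2)" using S by simp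
      ultimately show ?thesis by simp
    next
      case False
      then have "(pi - x) / 2 \<le> s" using le_2_sin[of "pi - x"] I[OF x] by (simp add: s_def)
      then have "((pi - x) / 2)\<^sup>2 \<le> s\<^sup>2" using I[OF x] by (intro power_mono) auto
      then have "2 * S / (s\<^sup>2 + S\<^sup>2) \<le> 2 * S / ((pi - x)\<^sup>2 / 4 + S\<^sup>2)"
        using S by (intro divide_left_mono) (auto simp: power_divide add_nonneg_pos)
      moreover have "0 \<le> 2 * S / (x\<^sup>2 / 4 + S\<^sup>2)" using S by simp
      ultimately show ?thesis by simp
    qed
    finally show "exp (- 2 * \<bar>ln (sin x / S)\<bar>) / sin x \<le> ?h x" by (simp add: s_def)
  qed
  also have "\<dots> \<le> 4 * pi"
  proof -
    have "arctan ((pi - \<kappa>) / (2 * S)) \<le> pi / 2" using arctan_ubound less_eq_real_def by blast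
    moreover have "0 \<le> arctan (\<kappa> / (2 * S))" using S \<kappa> by simp
    moreover have "?H (pi - \<kappa>) - ?H \<kappa> = 8 * arctan ((pi - \<kappa>) / (2 * S)) - 8 * arctan (\<kappa> / (2 * S))" by simp
    ultimately show ?thesis by linarith
  qed
  finally show "integral ?I ?f \<le> 4 * pi" .
qed

section \<open>The incoming and the reflected wave\<close>

context parameters
begin

text \<open>Position relative to the packet, measured in \<open>ln (sin x)\<close>. The centre sits
  at \<open>sin x = exp (- 2 * \<eta>\<^sup>2 * l * t) / l\<^sup>2\<close> and moves into the zero
  at speed \<open>2 * \<eta>\<^sup>2 * l\<close>.\<close>

definition Yf where "Yf l t x = ln (sin x) + 2 * ln l + 2 * \<eta>\<^sup>2 * l * t"

text \<open>The parameter \<open>e\<close> is 1 for the incoming and -1 for the reflected wave. With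
  the exponent given by real and imaginary part the modulus can be read off.\<close>

definition Ef where "Ef e l t x = exp (Complex (- r0 * ln (sin x) - (Yf l t x)\<^sup>2) (e * (l * ln (sin x) + \<eta>\<^sup>2 * l\<^sup>2 * t)))"

lemma norm_Ef: "0 < sin x \<Longrightarrow> cmod (Ef e l t x) = sin x powr (- r0) * exp (- ((Yf l t x)\<^sup>2))"
  by (simp add: Ef_def powr_def flip: exp_add)

lemma cnj_Ef: "cnj (Ef 1 l t x) = Ef (- 1) l t x"
  unfolding Ef_def exp_cnj by (rule arg_cong[where f=exp]) (simp add: complex_eq_iff)

lemma Yf_dx: "0 < sin x \<Longrightarrow> ((\<lambda>x. Yf l t x) has_real_derivative cos x / sin x) (at x)"
  unfolding Yf_def by (auto intro!: derivative_eq_intros)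

lemma Ef_dx:
  assumes "0 < sin x"
  shows "((\<lambda>x. Ef e l t x) has_vector_derivative of_real (cos x / sin x) * (Complex (- r0 - 2 * Yf l t x) (e * l) * Ef e l t x)) (at x)"
proof -
  have ln: "((\<lambda>x. ln (sin x)) has_real_derivative cos x / sin x) (at x)" using assms by (auto intro!: derivative_eq_intros)
  have a: "((\<lambda>x. - r0 * ln (sin x) - (Yf l t x)\<^sup>2) has_real_derivative (cos x / sin x) * (- r0 - 2 * Yf l t x)) (at x)"
    unfolding power2_eq_square
    by (rule DERIV_cong[OF DERIV_diff[OF DERIV_cmult[OF ln] DERIV_mult[OF Yf_dx[OF assms] Yf_dx[OF assms]]]])
      (simp add: algebra_simps)
  have b: "((\<lambda>x. e * (l * ln (sin x) + \<eta>\<^sup>2 * l\<^sup>2 * t)) has_real_derivative (cos x / sin x) * (e * l)) (at x)"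
    by (rule DERIV_cong[OF DERIV_cmult[OF DERIV_add[OF DERIV_cmult[OF ln] DERIV_const]]]) (simp add: algebra_simps)
  have "Complex ((cos x / sin x) * (- r0 - 2 * Yf l t x)) ((cos x / sin x) * (e * l)) = of_real (cos x / sin x) * Complex (- r0 - 2 * Yf l t x) (e * l)"
    by (simp add: complex_eq_iff)
  then show ?thesis
    using has_vector_derivative_exp_comp[OF has_vector_derivative_Complex[OF a b]]
    unfolding Ef_def by (simp only: mult.assoc)
qed

lemma Ef_dt: "((\<lambda>t. Ef e l t x) has_vector_derivative
    (of_real (- 4 * \<eta>\<^sup>2 * l * Yf l t x) + \<i> * of_real (e * (\<eta>\<^sup>2 * l\<^sup>2))) * Ef e l t x) (at t within S)"
proof -
  have y: "((\<lambda>t. Yf l t x) has_real_derivative 2 * \<eta>\<^sup>2 * l) (at t within S)"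
    unfolding Yf_def by (auto intro!: derivative_eq_intros)
  have a: "((\<lambda>t. - r0 * ln (sin x) - (Yf l t x)\<^sup>2) has_real_derivative - 4 * \<eta>\<^sup>2 * l * Yf l t x) (at t within S)"
    unfolding power2_eq_square[of "Yf _ _ _"]
    by (rule DERIV_cong[OF DERIV_diff[OF DERIV_const DERIV_mult[OF y y]]]) (simp add: algebra_simps)
  have b: "((\<lambda>t. e * (l * ln (sin x) + \<eta>\<^sup>2 * l\<^sup>2 * t)) has_real_derivative e * (\<eta>\<^sup>2 * l\<^sup>2)) (at t within S)"
    by (auto intro!: derivative_eq_intros)
  have "Complex (- 4 * \<eta>\<^sup>2 * l * Yf l t x) (e * (\<eta>\<^sup>2 * l\<^sup>2)) = of_real (- 4 * \<eta>\<^sup>2 * l * Yf l t x) + \<i> * of_real (e * (\<eta>\<^sup>2 * l\<^sup>2))"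
    by (simp add: complex_eq_iff)
  then show ?thesis
    using has_vector_derivative_exp_comp[OF has_vector_derivative_Complex[OF a b]]
    unfolding Ef_def by (simp only:)
qed

definition d1f where "d1f l t x = Complex (- r0 - 2 * Yf l t x) l"
definition d2f where "d2f l t x = Complex (- r0 - 2 * Yf l t x) (- l)"
text \<open>The approximate solution of the adjoint equation; the names that follow are its
  derivatives in \<open>x\<close> and \<open>t\<close>, with \<open>gD1\<close> and
  \<open>gD2\<close> the derivatives in \<open>ln (sin x)\<close>.\<close>

definition gf where "gf l t x = Ef 1 l t x + Bc l * Ef (- 1) l t x"
definition gD1 where "gD1 l t x = d1f l t x * Ef 1 l t x + Bc l * d2f l t x * Ef (- 1) l t x"
definition gD2 where "gD2 l t x = ((d1f l t x)\<^sup>2 - 2) * Ef 1 l t x + Bc l * ((d2f l t x)\<^sup>2 - 2) * Ef (- 1) l t x"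
definition gfx where "gfx l t x = of_real (cos x / sin x) * gD1 l t x"
definition gfxx where "gfxx l t x = of_real ((cos x / sin x)\<^sup>2) * gD2 l t x - of_real (1 / (sin x)\<^sup>2) * gD1 l t x"
definition gft where "gft l t x = (of_real (- 4 * \<eta>\<^sup>2 * l * Yf l t x) + \<i> * of_real (\<eta>\<^sup>2 * l\<^sup>2)) * Ef 1 l t x
   + Bc l * (of_real (- 4 * \<eta>\<^sup>2 * l * Yf l t x) - \<i> * of_real (\<eta>\<^sup>2 * l\<^sup>2)) * Ef (- 1) l t x"

lemma gf_dt: "((\<lambda>t. gf l t x) has_vector_derivative gft l t x) (at t within S)"
proof -
  have "gft l t x = (of_real (- 4 * \<eta>\<^sup>2 * l * Yf l t x) + \<i> * of_real (1 * (\<eta>\<^sup>2 * l\<^sup>2))) * Ef 1 l t x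
    + Bc l * ((of_real (- 4 * \<eta>\<^sup>2 * l * Yf l t x) + \<i> * of_real ((- 1) * (\<eta>\<^sup>2 * l\<^sup>2))) * Ef (- 1) l t x)"
    by (simp add: gft_def)
  then show ?thesis unfolding gf_def
    using has_vector_derivative_add[OF Ef_dt[of 1 l x t S] has_vector_derivative_mult_right[OF Ef_dt[of "- 1" l x t S], of "Bc l"]]
    by (simp only:)
qed

lemma gf_dx:
  assumes "0 < sin x"
  shows "((\<lambda>x. gf l t x) has_vector_derivative gfx l t x) (at x)"
proof -
  have "gfx l t x = of_real (cos x / sin x) * (Complex (- r0 - 2 * Yf l t x) (1 * l) * Ef 1 l t x)
    + Bc l * (of_real (cos x / sin x) * (Complex (- r0 - 2 * Yf l t x) (- 1 * l) * Ef (- 1) l t x))"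
    by (simp add: gfx_def gD1_def d1f_def d2f_def algebra_simps)
  then show ?thesis unfolding gf_def
    using has_vector_derivative_add[OF Ef_dx[OF assms, of 1 l t] has_vector_derivative_mult_right[OF Ef_dx[OF assms, of "- 1" l t], of "Bc l"]]
    by (simp only:)
qed

lemma gfx_dx:
  assumes s: "0 < sin x"
  shows "((\<lambda>x. gfx l t x) has_vector_derivative gfxx l t x) (at x)"
proof -
  let ?r = "cos x / sin x"
  have "((\<lambda>x. - r0 - 2 * Yf l t x) has_real_derivative - 2 * ?r) (at x)"
    by (rule DERIV_cong[OF DERIV_diff[OF DERIV_const DERIV_cmult[OF Yf_dx[OF s]]]]) simp
  then have d: "((\<lambda>x. Complex (- r0 - 2 * Yf l t x) m) has_vector_derivative Complex (- 2 * ?r) 0) (at x)" for m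
    by (intro has_vector_derivative_Complex) auto
  have c: "Complex (- 2 * ?r) 0 = of_real ?r * (- 2)" by (simp add: complex_eq_iff)
  have part: "((\<lambda>x. Complex (- r0 - 2 * Yf l t x) (e * l) * Ef e l t x) has_vector_derivative
     of_real ?r * (((Complex (- r0 - 2 * Yf l t x) (e * l))\<^sup>2 - 2) * Ef e l t x)) (at x)" for e
    using has_vector_derivative_mult[OF d[of "e * l"] Ef_dx[OF s, of e l t]] unfolding c
    by (simp add: algebra_simps power2_eq_square)
  have "((\<lambda>x. gD1 l t x) has_vector_derivative of_real ?r * gD2 l t x) (at x)"
    using has_vector_derivative_add[OF part[of 1] has_vector_derivative_mult_right[OF part[of "- 1"], of "Bc l"]]
    by (simp add: gD1_def gD2_def d1f_def d2f_def algebra_simps)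
  moreover have "((\<lambda>x. complex_of_real (cos x / sin x)) has_vector_derivative of_real (- (1 / (sin x)\<^sup>2))) (at x)"
  proof (rule bounded_linear.has_vector_derivative[OF bounded_linear_of_real])
    have "((\<lambda>x. cos x / sin x) has_real_derivative - (1 / (sin x)\<^sup>2)) (at x)"
    proof (rule DERIV_cong[OF DERIV_divide[OF DERIV_cos DERIV_sin]])
      have "- sin x * sin x - cos x * cos x = - 1" using sin_cos_squared_add3[of x] by linarith
      then show "(- sin x * sin x - cos x * cos x) / (sin x * sin x) = - (1 / (sin x)\<^sup>2)"
        by (simp add: power2_eq_square)
    qed (use s in auto)
    then show "((\<lambda>x. cos x / sin x) has_vector_derivative - (1 / (sin x)\<^sup>2)) (at x)"
      by (simp add: has_real_derivative_iff_has_vector_derivative)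
  qed
  ultimately have "((\<lambda>x. of_real (cos x / sin x) * gD1 l t x) has_vector_derivative
    of_real ?r * (of_real ?r * gD2 l t x) + of_real (- (1 / (sin x)\<^sup>2)) * gD1 l t x) (at x)"
    by (intro has_vector_derivative_mult)
  moreover have "of_real ?r * (of_real ?r * gD2 l t x) + of_real (- (1 / (sin x)\<^sup>2)) * gD1 l t x = gfxx l t x"
  proof -
    have "a * (a * X) + - c * Y = a * a * X - c * Y" for a c X Y :: complex by simp
    then show ?thesis unfolding gfxx_def power2_eq_square[of ?r] of_real_minus of_real_mult .
  qed
  ultimately show ?thesis unfolding gfx_def by (simp only:)
qed

lemma gf_bounds:
  assumes s: "0 < sin x" and l: "A \<le> l"
  shows "cmod (gf l t x) \<le> 2 * (sin x powr (- r0) * exp (- ((Yf l t x)\<^sup>2)))"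
    and "cmod (gfx l t x) \<le> 4 * K3 * l / sin x * sin x powr (- r0)"
proof -
  let ?e = "sin x powr (- r0) * exp (- ((Yf l t x)\<^sup>2))"
  have c2: "(cos x)\<^sup>2 = 1 - (sin x)\<^sup>2" by (simp add: cos_squared_eq)
  \<comment> \<open>The last two bounds of \<open>residual_bound\<close> concern the waves only; the
    exact model coefficients and \<open>t = 0\<close> make its hypotheses on the coefficients
    trivial.\<close>
  note rb2 = residual_bound(2)[where t = 0 and \<rho> = "\<eta>\<^sup>2 * (sin x)\<^sup>2" and z' = "of_real (\<eta>\<^sup>2 * sin x * cos x)"
      and b' = "of_real ((4 - \<alpha> - 2 * \<beta>) * (\<eta>\<^sup>2 * sin x * cos x))", OF s sin_le_one c2 l cnj_Ef norm_Ef[OF s]]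
  note rb3 = residual_bound(3)[where t = 0 and \<rho> = "\<eta>\<^sup>2 * (sin x)\<^sup>2" and z' = "of_real (\<eta>\<^sup>2 * sin x * cos x)"
      and b' = "of_real ((4 - \<alpha> - 2 * \<beta>) * (\<eta>\<^sup>2 * sin x * cos x))", OF s sin_le_one c2 l cnj_Ef norm_Ef[OF s]]
  show "cmod (gf l t x) \<le> 2 * ?e"
    unfolding gf_def by (rule rb2) (use A1 M1 s in auto)
  have "cmod (gfx l t x) \<le> 2 * K3 * l * (1 + \<bar>Yf l t x\<bar>) / sin x * ?e"
    unfolding gfx_def gD1_def d1f_def d2f_def by (rule rb3) (use A1 M1 s in auto)
  also have "\<dots> = (2 * K3 * l / sin x * sin x powr (- r0)) * ((1 + \<bar>Yf l t x\<bar>) * exp (- ((Yf l t x)\<^sup>2)))"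
    by simp
  also have "\<dots> \<le> (2 * K3 * l / sin x * sin x powr (- r0)) * 2"
    using gaussian_moment[of "Yf l t x"] s l A1 by (intro mult_left_mono) (auto simp: K3_def)
  finally show "cmod (gfx l t x) \<le> 4 * K3 * l / sin x * sin x powr (- r0)" by simp
qed

end

section \<open>Pairing of the difference with a packet\<close>

context parameters
begin

definition KP where "KP = KR0 + 28 * A * M\<^sup>2"
definition KB where "KB = 2 ^ (k + 1) * M * (8 + 8 * M + 16 * K3 + 12 * A * M)"

lemma KP0: "0 \<le> KP" and KB0: "0 \<le> KB"
proof -
  have "0 \<le> KR00" using A1 by (simp add: KR00_def)
  then show "0 \<le> KP" "0 \<le> KB" using A1 M1 by (auto simp: KP_def KB_def KR0_def K3_def)
qed

end

context two_solutions
begin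

text \<open>\<open>rc1\<close> and \<open>rc2\<close> are the first and second space derivatives of
  \<open>|v|^2\<close>, kept complex for the integration by parts; \<open>bc1\<close> is the space
  derivative of \<open>bco\<close>.\<close>

definition rc1 where "rc1 t x = v 0 t x * cnj (v 1 t x) + v 1 t x * cnj (v 0 t x)"
definition rc2 where "rc2 t x = v 0 t x * cnj (v 2 t x) + 2 * (v 1 t x * cnj (v 1 t x)) + v 2 t x * cnj (v 0 t x)"
definition bc1 where "bc1 t x = of_real \<alpha> * (v 0 t x * cnj (v 2 t x) + v 1 t x * cnj (v 1 t x))
   + 2 * of_real \<beta> * (cnj (v 0 t x) * v 2 t x + cnj (v 1 t x) * v 1 t x)"

text \<open>A product without conjugation of which only the real part is taken: the equation for
  \<open>W\<close> is merely real linear, so its adjoint is formed for the real pairing.\<close>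

definition pd where "pd l t x = Re (W 0 t x * gf l t x)"
definition pdt where "pdt l t x = Re (W 0 t x * gft l t x + Wt t x * gf l t x)"

definition pflux where "pflux l t x = Re (\<i> * (v 0 t x * cnj (v 0 t x) * gf l t x * W 1 t x
   - (rc1 t x * gf l t x + v 0 t x * cnj (v 0 t x) * gfx l t x) * W 0 t x
   + bco (v 0 t x) (v 1 t x) * gf l t x * W 0 t x
   + of_real \<alpha> * (v 0 t x * v 1 t x) * gf l t x * cnj (W 0 t x)))"

definition pfluxx where "pfluxx l t x = Re (\<i> * (v 0 t x * cnj (v 0 t x) * gf l t x * W 2 t x
   - (rc2 t x * gf l t x + 2 * rc1 t x * gfx l t x + v 0 t x * cnj (v 0 t x) * gfxx l t x) * W 0 t x
   + (bc1 t x * gf l t x + bco (v 0 t x) (v 1 t x) * gfx l t x) * W 0 t x + bco (v 0 t x) (v 1 t x) * gf l t x * W 1 t x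
   + of_real \<alpha> * ((v 1 t x * v 1 t x + v 0 t x * v 2 t x) * gf l t x + v 0 t x * v 1 t x * gfx l t x) * cnj (W 0 t x)
   + of_real \<alpha> * (v 0 t x * v 1 t x) * gf l t x * cnj (W 1 t x)))"

lemma pd_deriv:
  assumes "t \<in> {0..T}"
  shows "((\<lambda>t. pd l t x) has_real_derivative pdt l t x) (at t within {0..T})"
  unfolding pd_def pdt_def
  by (rule has_real_derivative_Re[OF has_vector_derivative_mult[OF Wt_deriv[OF assms] gf_dt]])

lemma pflux_deriv:
  assumes t: "t \<in> {0..T}" and x: "0 < sin x"
  shows "((\<lambda>x. pflux l t x) has_real_derivative pfluxx l t x) (at x)"
proof -
  have v: "(v 0 t has_vector_derivative v 1 t x) (at x)" "(v 1 t has_vector_derivative v 2 t x) (at x)"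
    using v_deriv[OF t, of 0 x] v_deriv[OF t, of 1 x] k4 by (simp_all add: numeral_2_eq_2)
  have W: "(W 0 t has_vector_derivative W 1 t x) (at x)" "(W 1 t has_vector_derivative W 2 t x) (at x)"
    using W_deriv[OF t, of 0 x] W_deriv[OF t, of 1 x] k4 by (simp_all add: numeral_2_eq_2)
  note cv = has_vector_derivative_cnj_comp[OF v(1)] has_vector_derivative_cnj_comp[OF v(2)]
  note cW = has_vector_derivative_cnj_comp[OF W(1)]
  note g = gf_dx[OF x, of l t] and gx = gfx_dx[OF x, of l t]
  have r: "((\<lambda>x. v 0 t x * cnj (v 0 t x)) has_vector_derivative rc1 t x) (at x)"
    using has_vector_derivative_mult[OF v(1) cv(1)] by (simp add: rc1_def)
  have r1: "((\<lambda>x. rc1 t x) has_vector_derivative rc2 t x) (at x)"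
    using has_vector_derivative_add[OF has_vector_derivative_mult[OF v(1) cv(2)] has_vector_derivative_mult[OF v(2) cv(1)]]
    by (simp add: rc1_def rc2_def algebra_simps)
  have b: "((\<lambda>x. bco (v 0 t x) (v 1 t x)) has_vector_derivative bc1 t x) (at x)"
    using has_vector_derivative_add[OF has_vector_derivative_mult_right[OF has_vector_derivative_mult[OF v(1) cv(2)], of "of_real \<alpha>"]
      has_vector_derivative_mult_right[OF has_vector_derivative_mult[OF cv(1) v(2)], of "2 * of_real \<beta>"]]
    by (simp add: bco_def bc1_def mult.assoc)
  have vp: "((\<lambda>x. of_real \<alpha> * (v 0 t x * v 1 t x)) has_vector_derivative of_real \<alpha> * (v 0 t x * v 2 t x + v 1 t x * v 1 t x)) (at x)"
    by (rule has_vector_derivative_mult_right[OF has_vector_derivative_mult[OF v]])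
  note t1 = has_vector_derivative_mult[OF has_vector_derivative_mult[OF r g] W(2)]
  note t2 = has_vector_derivative_mult[OF has_vector_derivative_add[OF has_vector_derivative_mult[OF r1 g] has_vector_derivative_mult[OF r gx]] W(1)]
  note t3 = has_vector_derivative_mult[OF has_vector_derivative_mult[OF b g] W(1)]
  note t4 = has_vector_derivative_mult[OF has_vector_derivative_mult[OF vp g] cW]
  note all = has_real_derivative_Re[OF has_vector_derivative_mult_right[OF has_vector_derivative_add[OF has_vector_derivative_add[OF has_vector_derivative_diff[OF t1 t2] t3] t4], of "\<i>"]]
  show ?thesis unfolding pflux_def pfluxx_def
    by (rule DERIV_cong[OF all]) (rule arg_cong[where f=Re], rule arg_cong[where f="\<lambda>z. \<i> * z"], simp add: algebra_simps)
qed

text \<open>Integration by parts at the level of densities. The first line applies the adjoint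
  operator to the packet, the second collects all terms in which \<open>W\<close> is
  undifferentiated up to the cubic one, which \<open>norm_nl_le\<close> controls by \<open>W\<close>
  itself.\<close>

lemma pairing_identity:
  "pdt l t x - pfluxx l t x = Re (W 0 t x * (gft l t x + \<i> * (v 0 t x * cnj (v 0 t x) * gfxx l t x + (2 * rc1 t x - bco (v 0 t x) (v 1 t x)) * gfx l t x)
       + \<i> * of_real \<alpha> * cnj (v 0 t x * v 1 t x) * cnj (gfx l t x)))
    + Re (\<i> * (rc2 t x * W 0 t x - bc1 t x * W 0 t x - of_real \<alpha> * (v 1 t x * v 1 t x + v 0 t x * v 2 t x) * cnj (W 0 t x)
       + zth (v 0 t x) (v 1 t x) (v 2 t x) (W 0 t x) + nl \<alpha> \<beta> \<mu> (W 0 t x) (W 1 t x) (W 2 t x) / 4) * gf l t x)"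
proof -
  \<comment> \<open>A number and its conjugate have the same real part. This moves the conjugation
    from \<open>W\<close> to the derivative of the packet.\<close>
  have re: "Re (- (\<i> * of_real a * (X * Y) * cnj W0)) = Re (W0 * (\<i> * of_real a * cnj X * cnj Y))" for W0 X Y and a :: real
    by (simp add: algebra_simps)
  have core: "Re (w0 * G_t + \<i> * (r * w2 + b * w1 + a * v0 * v1 * cnj w1 + z + n) * G)
     - Re (\<i> * (r * G * w2 - (R2 * G + 2 * R1 * Gx + r * Gxx) * w0 + (B1 * G + b * Gx) * w0 + b * G * w1
        + a * (q * G + v0 * v1 * Gx) * cnj w0 + a * (v0 * v1) * G * cnj w1))
    = Re (w0 * (G_t + \<i> * (r * Gxx + (2 * R1 - b) * Gx))) + Re (- (\<i> * a * (v0 * v1 * Gx) * cnj w0))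
      + Re (\<i> * (R2 * w0 - B1 * w0 - a * q * cnj w0 + z + n) * G)"
    for w0 G_t r w2 b w1 a v0 v1 z n G R2 R1 Gx Gxx B1 q
    unfolding minus_complex.sel(1)[symmetric] plus_complex.sel(1)[symmetric]
    by (rule arg_cong[where f=Re]) (simp add: algebra_simps)
  have "pdt l t x - pfluxx l t x = Re (W 0 t x * (gft l t x + \<i> * (v 0 t x * cnj (v 0 t x) * gfxx l t x + (2 * rc1 t x - bco (v 0 t x) (v 1 t x)) * gfx l t x)))
    + Re (- (\<i> * of_real \<alpha> * (v 0 t x * v 1 t x * gfx l t x) * cnj (W 0 t x)))
    + Re (\<i> * (rc2 t x * W 0 t x - bc1 t x * W 0 t x - of_real \<alpha> * (v 1 t x * v 1 t x + v 0 t x * v 2 t x) * cnj (W 0 t x)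
       + zth (v 0 t x) (v 1 t x) (v 2 t x) (W 0 t x) + nl \<alpha> \<beta> \<mu> (W 0 t x) (W 1 t x) (W 2 t x) / 4) * gf l t x)"
    unfolding pdt_def pfluxx_def Wt_eq by (rule core)
  then show ?thesis unfolding re by (simp only: distrib_left plus_complex.sel)
qed

text \<open>\<open>v_coefficients\<close> provides the hypotheses of \<open>residual_bound\<close>
  for the true coefficients; the growth \<open>s * l\<^sup>2\<close> is at most \<open>exp Y\<close>
  and is absorbed by the Gaussian.\<close>

lemma pairing_pointwise:
  assumes t: "t \<in> {0..T}" and x: "0 < x" "x < pi" and l: "A \<le> l"
  shows "\<bar>pdt l t x - pfluxx l t x\<bar> \<le> 40 * KP * (1 + t * l) * (cmod (W 0 t x) * (sin x powr (- r0) * exp (- \<bar>Yf l t x\<bar>)))"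
proof -
  define s C Y e w where d: "s = sin x" "C = cos x" "Y = Yf l t x" "e = sin x powr (- r0) * exp (- ((Yf l t x)\<^sup>2))" "w = cmod (W 0 t x)"
  have x': "0 \<le> x" "x \<le> pi" using x by auto
  have s: "0 < s" "s \<le> 1" using sin_gt_zero[OF x] by (auto simp: d)
  have C: "C\<^sup>2 = 1 - s\<^sup>2" by (simp add: d cos_squared_eq)
  have t0: "0 \<le> t" using t by simp
  have l1: "1 \<le> l" using l A1 by linarith
  have w: "0 \<le> w" by (simp add: d)
  have e: "0 \<le> e" by (simp add: d)
  \<comment> \<open>Both parts of the first-order coefficient are combinations of \<open>z\<close>
    and its conjugate: \<open>rc1\<close> is their sum and \<open>bco\<close> is
    \<open>\<alpha> * cnj z + 2 * \<beta> * z\<close>.\<close>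
  define z where "z = cnj (v 0 t x) * v 1 t x"
  define \<kappa> where "\<kappa> = \<eta>\<^sup>2 * s * C"
  note vc = v_coefficients[OF t x']
  have z: "cmod (z - of_real \<kappa>) \<le> 16 * M * s\<^sup>2" using vc(2) by (simp add: z_def \<kappa>_def d)
  have h1: "\<bar>(cmod (v 0 t x))\<^sup>2 - \<eta>\<^sup>2 * s\<^sup>2\<bar> \<le> 24 * M * s ^ 3" using vc(1) by (simp add: d)
  have h2: "cmod ((2 * rc1 t x - bco (v 0 t x) (v 1 t x)) - of_real ((4 - \<alpha> - 2 * \<beta>) * (\<eta>\<^sup>2 * s * C))) \<le> 64 * A * M * s\<^sup>2"
  proof -
    let ?y = "z - of_real \<kappa>"
    have "(2 * rc1 t x - bco (v 0 t x) (v 1 t x)) - of_real ((4 - \<alpha> - 2 * \<beta>) * \<kappa>)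
      = 2 * ?y + 2 * cnj ?y - of_real \<alpha> * cnj ?y - 2 * of_real \<beta> * ?y"
      by (simp add: rc1_def bco_def z_def algebra_simps)
    also have "cmod \<dots> \<le> 2 * cmod ?y + 2 * cmod ?y + \<bar>\<alpha>\<bar> * cmod ?y + 2 * \<bar>\<beta>\<bar> * cmod ?y"
    proof -
      have tri: "cmod (a + b - c - d) \<le> a' + b' + c' + d'" if "cmod a = a'" "cmod b = b'" "cmod c = c'" "cmod d = d'" for a b c d a' b' c' d'
        using norm_triangle_ineq4[of "a + b - c" d] norm_triangle_ineq4[of "a + b" c] norm_triangle_ineq[of a b] that by linarith
      show ?thesis by (rule tri) (simp_all only: norm_mult norm_numeral complex_mod_cnj norm_of_real)
    qed
    also have "\<dots> = (4 + \<bar>\<alpha>\<bar> + 2 * \<bar>\<beta>\<bar>) * cmod ?y" by (simp add: algebra_simps)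
    also have "\<dots> \<le> (4 * A) * (16 * M * s\<^sup>2)"
      using z A1 by (intro mult_mono) (auto simp: A_def bigA_def)
    finally show ?thesis by (simp add: \<kappa>_def mult_ac)
  qed
  have h3: "cmod (cnj (v 0 t x * v 1 t x) - of_real (\<eta>\<^sup>2 * s * C)) \<le> 16 * A * M ^ 3 * (s\<^sup>2 + t * s)"
  proof -
    have "cnj (v 0 t x * v 1 t x) - of_real (\<eta>\<^sup>2 * s * C) = cnj (v 0 t x * v 1 t x - of_real (\<eta>\<^sup>2 * s * C))" by simp
    then have "cmod (cnj (v 0 t x * v 1 t x) - of_real (\<eta>\<^sup>2 * s * C)) = cmod (v 0 t x * v 1 t x - of_real (\<eta>\<^sup>2 * s * C))"
      by (simp only: complex_mod_cnj)
    also have "\<dots> \<le> 16 * M * s\<^sup>2 + 4 * A * M ^ 3 * t * s" using vc(3) by (simp add: d)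
    also have "\<dots> \<le> 16 * (A * M ^ 3) * s\<^sup>2 + 16 * (A * M ^ 3) * (t * s)"
    proof (rule add_mono)
      have "M * 1 \<le> M * M\<^sup>2" using M1 by (intro mult_left_mono) auto
      then have "1 * M \<le> A * M ^ 3" using A1 M1 by (intro mult_mono) (auto simp: power2_eq_square power3_eq_cube)
      then show "16 * M * s\<^sup>2 \<le> 16 * (A * M ^ 3) * s\<^sup>2" by (intro mult_right_mono) auto
      have "4 * (A * M ^ 3) * (t * s) \<le> 16 * (A * M ^ 3) * (t * s)" using A1 M1 s t0 by (intro mult_right_mono) auto
      then show "4 * A * M ^ 3 * t * s \<le> 16 * (A * M ^ 3) * (t * s)" by (simp add: mult_ac)
    qed
    finally show ?thesis by (simp add: algebra_simps)
  qed
  let ?\<Phi> = "gft l t x + \<i> * (v 0 t x * cnj (v 0 t x) * gfxx l t x + (2 * rc1 t x - bco (v 0 t x) (v 1 t x)) * gfx l t x)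
       + \<i> * of_real \<alpha> * cnj (v 0 t x * v 1 t x) * cnj (gfx l t x)"
  have sx: "0 < sin x" using s by (simp add: d)
  have "cmod ?\<Phi> \<le> KR0 * (1 + \<bar>Y\<bar>)\<^sup>2 * (1 + s * l\<^sup>2 + t * l) * e"
    using residual_bound(1)[OF s C l cnj_Ef[of l t x] norm_Ef[OF sx, of 1 l t] t0 h1 h2 h3, of Y]
    unfolding gft_def gfx_def gfxx_def gD1_def gD2_def d1f_def d2f_def d complex_norm_square .
  then have p1: "\<bar>Re (W 0 t x * ?\<Phi>)\<bar> \<le> w * (KR0 * (1 + \<bar>Y\<bar>)\<^sup>2 * (1 + s * l\<^sup>2 + t * l) * e)"
    using abs_Re_le_cmod[of "W 0 t x * ?\<Phi>"] mult_left_mono[OF _ w] unfolding norm_mult d(5)[symmetric] by (meson order_trans)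
  let ?V0 = "v 0 t x" and ?V1 = "v 1 t x" and ?V2 = "v 2 t x"
  have vb: "cmod ?V0 \<le> M" "cmod ?V1 \<le> M" "cmod ?V2 \<le> M" using v_bound[OF t] k4 by auto
  have vv: "cmod a * cmod b \<le> M\<^sup>2" if "cmod a \<le> M" "cmod b \<le> M" for a b
    using mult_mono[OF that] M1 by (simp add: power2_eq_square)
  let ?R = "rc2 t x * W 0 t x - bc1 t x * W 0 t x - of_real \<alpha> * (?V1 * ?V1 + ?V0 * ?V2) * cnj (W 0 t x)
       + zth ?V0 ?V1 ?V2 (W 0 t x) + nl \<alpha> \<beta> \<mu> (W 0 t x) (W 1 t x) (W 2 t x) / 4"
  have R: "cmod ?R \<le> 14 * A * M\<^sup>2 * w"
  proof -
    have AM: "M\<^sup>2 \<le> A * M\<^sup>2" using A1 by (simp add: mult_le_cancel_right1)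
    have a1: "cmod (rc2 t x) \<le> 4 * (A * M\<^sup>2)"
    proof -
      have "cmod (rc2 t x) \<le> cmod ?V0 * cmod ?V2 + 2 * (cmod ?V1 * cmod ?V1) + cmod ?V2 * cmod ?V0"
        unfolding rc2_def by (intro norm_triangle_le add_mono) (simp_all add: norm_mult)
      then show ?thesis using vv[OF vb(1,3)] vv[OF vb(2,2)] vv[OF vb(3,1)] AM by linarith
    qed
    have a2: "cmod (bc1 t x) \<le> 4 * (A * M\<^sup>2)"
    proof -
      have q: "cmod (?V0 * cnj ?V2 + ?V1 * cnj ?V1) \<le> 2 * M\<^sup>2" "cmod (cnj ?V0 * ?V2 + cnj ?V1 * ?V1) \<le> 2 * M\<^sup>2"
        using norm_triangle_ineq[of "?V0 * cnj ?V2" "?V1 * cnj ?V1"] norm_triangle_ineq[of "cnj ?V0 * ?V2" "cnj ?V1 * ?V1"]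
          vv[OF vb(1,3)] vv[OF vb(2,2)] by (simp_all only: norm_mult complex_mod_cnj)
      have "cmod (of_real \<alpha> * (?V0 * cnj ?V2 + ?V1 * cnj ?V1)) \<le> \<bar>\<alpha>\<bar> * (2 * M\<^sup>2)"
        unfolding norm_mult[of "of_real \<alpha>"] norm_of_real by (rule mult_left_mono[OF q(1)]) simp
      moreover have "cmod (2 * of_real \<beta> * (cnj ?V0 * ?V2 + cnj ?V1 * ?V1)) \<le> 2 * \<bar>\<beta>\<bar> * (2 * M\<^sup>2)"
        unfolding norm_mult[of "2 * of_real \<beta>"] norm_mult[of 2] norm_of_real norm_numeral by (rule mult_left_mono[OF q(2)]) simp
      ultimately have "cmod (bc1 t x) \<le> \<bar>\<alpha>\<bar> * (2 * M\<^sup>2) + 2 * \<bar>\<beta>\<bar> * (2 * M\<^sup>2)"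
        unfolding bc1_def by (rule norm_triangle_le[OF add_mono])
      also have "\<dots> = (\<bar>\<alpha>\<bar> + 2 * \<bar>\<beta>\<bar>) * (2 * M\<^sup>2)" by (simp add: algebra_simps)
      also have "\<dots> \<le> (2 * A) * (2 * M\<^sup>2)" by (intro mult_right_mono) (auto simp: A_def bigA_def)
      finally show ?thesis by simp
    qed
    have a3: "cmod (of_real \<alpha> * (?V1 * ?V1 + ?V0 * ?V2)) \<le> 2 * (A * M\<^sup>2)"
    proof -
      have "cmod (?V1 * ?V1 + ?V0 * ?V2) \<le> 2 * M\<^sup>2"
        using norm_triangle_ineq[of "?V1 * ?V1" "?V0 * ?V2"] vv[OF vb(1,3)] vv[OF vb(2,2)] by (simp only: norm_mult)
      then have "\<bar>\<alpha>\<bar> * cmod (?V1 * ?V1 + ?V0 * ?V2) \<le> A * (2 * M\<^sup>2)" using abs_alpha_le(1) A1 by (intro mult_mono) auto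
      then show ?thesis by (simp add: norm_mult)
    qed
    have a4: "cmod (nl \<alpha> \<beta> \<mu> (W 0 t x) (W 1 t x) (W 2 t x) / 4) \<le> (A * M\<^sup>2) * w"
    proof -
      have "cmod (nl \<alpha> \<beta> \<mu> (W 0 t x) (W 1 t x) (W 2 t x)) \<le> bigA \<alpha> \<beta> \<mu> * (2 * M)\<^sup>2 * cmod (W 0 t x)"
        using W_bound[OF t] k4 by (intro norm_nl_le) auto
      then show ?thesis by (simp add: A_def d norm_divide power_mult_distrib)
    qed
    have a5: "cmod (zth ?V0 ?V1 ?V2 (W 0 t x)) \<le> 3 * (A * M\<^sup>2) * w"
      using norm_zth_le[OF vb, of "W 0 t x"] by (simp add: d mult.assoc)
    have m: "cmod (a * W 0 t x) \<le> c * w" "cmod (a * cnj (W 0 t x)) \<le> c * w" if "cmod a \<le> c" for a c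
      using mult_right_mono[OF that w] by (simp_all add: norm_mult d)
    have tri: "cmod (p - q - r + y + n) \<le> p' + q' + r' + y' + n'" if "cmod p \<le> p'" "cmod q \<le> q'" "cmod r \<le> r'" "cmod y \<le> y'" "cmod n \<le> n'"
      for p q r y n p' q' r' y' n'
      using norm_triangle_ineq[of "p - q - r + y" n] norm_triangle_ineq[of "p - q - r" y] norm_triangle_ineq4[of "p - q" r]
        norm_triangle_ineq4[of p q] that by linarith
    have "cmod ?R \<le> 4 * (A * M\<^sup>2) * w + 4 * (A * M\<^sup>2) * w + 2 * (A * M\<^sup>2) * w + 3 * (A * M\<^sup>2) * w + (A * M\<^sup>2) * w"
      by (rule tri[OF m(1)[OF a1] m(1)[OF a2] m(2)[OF a3] a5 a4])
    then show ?thesis by (simp add: algebra_simps)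
  qed
  have p2: "\<bar>Re (\<i> * ?R * gf l t x)\<bar> \<le> w * (28 * A * M\<^sup>2 * e)"
  proof -
    have "\<bar>Re (\<i> * ?R * gf l t x)\<bar> \<le> cmod ?R * cmod (gf l t x)"
      using abs_Re_le_cmod[of "\<i> * ?R * gf l t x"] by (simp only: norm_mult norm_ii mult_1)
    also have "\<dots> \<le> (14 * A * M\<^sup>2 * w) * (2 * e)"
      using R gf_bounds(1)[OF sx l, of t] A1 w by (intro mult_mono) (auto simp: d)
    finally show ?thesis by (simp add: mult_ac)
  qed
  \<comment> \<open>\<open>exp Y\<close> equals \<open>s * l\<^sup>2\<close> times
    \<open>exp (2 * \<eta>\<^sup>2 * l * t)\<close>, and \<open>t\<close> is nonnegative.\<close>
  have Yl: "s * l\<^sup>2 \<le> exp Y"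
  proof -
    have "exp Y = s * (exp (ln l) * exp (ln l)) * exp (2 * \<eta>\<^sup>2 * l * t)"
      using s by (simp add: d Yf_def exp_add flip: exp_add[of "ln l" "ln l"])
    also have "\<dots> = s * l\<^sup>2 * exp (2 * \<eta>\<^sup>2 * l * t)" using l1 by (simp add: power2_eq_square)
    finally have "exp Y = s * l\<^sup>2 * exp (2 * \<eta>\<^sup>2 * l * t)" .
    moreover have "s * l\<^sup>2 * 1 \<le> s * l\<^sup>2 * exp (2 * \<eta>\<^sup>2 * l * t)"
      using s l1 t0 by (intro mult_left_mono) auto
    ultimately show ?thesis by simp
  qed
  have one: "1 \<le> (1 + \<bar>Y\<bar>)\<^sup>2 * (1 + s * l\<^sup>2 + t * l)"
  proof -
    have "1 \<le> (1 + \<bar>Y\<bar>)\<^sup>2" using power_mono[of 1 "1 + \<bar>Y\<bar>" 2] by simp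
    moreover have "1 \<le> 1 + s * l\<^sup>2 + t * l" using s l1 t0 by simp
    ultimately show ?thesis by (rule mult_ge1_I)
  qed
  have KR0: "0 \<le> KR0"
  proof -
    have "0 \<le> KR00" using A1 by (simp add: KR00_def)
    then show ?thesis using A1 M1 by (simp add: KR0_def)
  qed
  have "\<bar>pdt l t x - pfluxx l t x\<bar> \<le> w * (KR0 * (1 + \<bar>Y\<bar>)\<^sup>2 * (1 + s * l\<^sup>2 + t * l) * e) + w * (28 * A * M\<^sup>2 * e)"
    unfolding pairing_identity using p1 p2 by linarith
  also have "\<dots> \<le> w * (KR0 * (1 + \<bar>Y\<bar>)\<^sup>2 * (1 + s * l\<^sup>2 + t * l) * e) + w * (28 * A * M\<^sup>2 * e) * ((1 + \<bar>Y\<bar>)\<^sup>2 * (1 + s * l\<^sup>2 + t * l))"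
    using mult_left_mono[OF one, of "w * (28 * A * M\<^sup>2 * e)"] w e A1 by simp
  also have "\<dots> = KP * w * ((1 + \<bar>Y\<bar>)\<^sup>2 * (1 + s * l\<^sup>2 + t * l) * e)" by (simp add: KP_def algebra_simps)
  also have "\<dots> \<le> KP * w * ((1 + \<bar>Y\<bar>)\<^sup>2 * (1 + exp Y + t * l) * e)"
    using Yl KP0 w e by (intro mult_left_mono mult_right_mono) auto
  also have "\<dots> = KP * w * sin x powr (- r0) * ((1 + \<bar>Y\<bar>)\<^sup>2 * (1 + exp Y + t * l) * exp (- (Y\<^sup>2)))"
    by (simp add: d)
  also have "\<dots> \<le> KP * w * sin x powr (- r0) * (40 * (1 + t * l) * exp (- \<bar>Y\<bar>))"
    using gaussian_absorbs[of "t * l" Y] KP0 w t0 l1 by (intro mult_left_mono) auto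
  finally show ?thesis by (simp only: d mult_ac)
qed

text \<open>Each term carries \<open>sin x ^ (k + 1)\<close> from the coefficients and
  \<open>W\<close>, against \<open>sin x powr (- r0)\<close> from the packet; the exponent left
  exceeds 1 by \<open>ksig\<close>. One derivative of the packet accounts for the factor
  \<open>l\<close>.\<close>

lemma pflux_bound:
  assumes t: "t \<in> {0..T}" and x: "0 < x" "x < pi" and l: "A \<le> l"
  shows "\<bar>pflux l t x\<bar> \<le> KB * l * sin x"
proof -
  define s where "s = sin x"
  have s: "0 < s" "s \<le> 1" using sin_gt_zero[OF x] by (auto simp: s_def)
  define Kw where "Kw = 2 ^ (k + 1) * M"
  have Kw: "0 \<le> Kw" using M1 by (simp add: Kw_def)
  have l1: "1 \<le> l" using l A1 by linarith
  have w: "cmod (W 0 t x) \<le> Kw * s ^ k" "cmod (W 1 t x) \<le> Kw * s ^ (k - 1)"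
    using W_sin_bound[OF t, of x 0] W_sin_bound[OF t, of x 1] x by (auto simp: Kw_def s_def)
  have v: "cmod (v 0 t x) \<le> 2 * s"
  proof -
    have "\<eta> * s \<le> 1 * s" using eta s by (intro mult_right_mono) auto
    moreover have "cmod (v 0 t x) \<le> 5 / 4 * (\<eta> * s)" using v_size(1)[OF t, of x] s by (simp add: s_def)
    ultimately show ?thesis using s by linarith
  qed
  have p: "cmod (v 1 t x) \<le> M" using v_bound[OF t, of 1 x] k4 by simp
  have vp: "cmod (v 0 t x) * cmod (v 1 t x) \<le> 2 * s * M" using v p s M1 by (intro mult_mono) auto
  have vv: "cmod (v 0 t x) * cmod (v 0 t x) \<le> (2 * s) * (2 * s)" using v s by (intro mult_mono) auto
  define Z where "Z = s powr (- r0)"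
  have Z: "0 \<le> Z" by (simp add: Z_def)
  have sx: "0 < sin x" using s by (simp add: s_def)
  have g: "cmod (gf l t x) \<le> 2 * Z"
  proof -
    have "cmod (gf l t x) \<le> 2 * (Z * exp (- ((Yf l t x)\<^sup>2)))" using gf_bounds(1)[OF sx l] by (simp add: Z_def s_def)
    also have "\<dots> \<le> 2 * (Z * 1)" using Z by (intro mult_left_mono) auto
    finally show ?thesis by simp
  qed
  have gx: "cmod (gfx l t x) \<le> 4 * K3 * l / s * Z" using gf_bounds(2)[OF sx l] by (simp add: Z_def s_def)
  have K3: "0 \<le> K3" by (simp add: K3_def)
  define Q where "Q = Kw * (Z * (s * s ^ k))"
  have Q: "0 \<le> Q" using Kw Z s by (simp add: Q_def)
  have ss: "s * s ^ (k - 1) = s ^ k" using k4 by (cases k) auto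
  have a1: "cmod (v 0 t x * cnj (v 0 t x) * gf l t x * W 1 t x) \<le> 8 * Q"
  proof -
    have "cmod (v 0 t x * cnj (v 0 t x) * gf l t x * W 1 t x) \<le> ((2 * s) * (2 * s)) * (2 * Z) * (Kw * s ^ (k - 1))"
      unfolding norm_mult complex_mod_cnj by (intro mult_mono[OF mult_mono[OF vv g] w(2)]) (use s Z Kw in auto)
    also have "\<dots> = 8 * (Kw * (Z * (s * (s * s ^ (k - 1)))))" by simp
    finally show ?thesis unfolding ss Q_def .
  qed
  have rc: "cmod (rc1 t x) \<le> 4 * s * M"
  proof -
    have "cmod (rc1 t x) \<le> cmod (v 0 t x) * cmod (v 1 t x) + cmod (v 1 t x) * cmod (v 0 t x)"
      unfolding rc1_def by (intro norm_triangle_le) (simp add: norm_mult)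
    then show ?thesis using vp by (simp add: mult.commute)
  qed
  have a2: "cmod (rc1 t x * gf l t x * W 0 t x) \<le> 8 * M * Q"
  proof -
    have "cmod (rc1 t x * gf l t x * W 0 t x) \<le> (4 * s * M) * (2 * Z) * (Kw * s ^ k)"
      unfolding norm_mult by (intro mult_mono[OF mult_mono[OF rc g] w(1)]) (use s Z Kw M1 in auto)
    then show ?thesis by (simp add: Q_def mult_ac)
  qed
  have a3: "cmod (v 0 t x * cnj (v 0 t x) * gfx l t x * W 0 t x) \<le> 16 * K3 * l * Q"
  proof -
    have "cmod (v 0 t x * cnj (v 0 t x) * gfx l t x * W 0 t x) \<le> ((2 * s) * (2 * s)) * (4 * K3 * l / s * Z) * (Kw * s ^ k)"
      unfolding norm_mult complex_mod_cnj by (intro mult_mono[OF mult_mono[OF vv gx] w(1)]) (use s Z Kw K3 l1 in auto)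
    also have "\<dots> = 16 * K3 * l * Q" using s by (simp add: Q_def field_simps)
    finally show ?thesis .
  qed
  have bb: "cmod (bco (v 0 t x) (v 1 t x)) \<le> 4 * A * s * M"
  proof -
    have "cmod (bco (v 0 t x) (v 1 t x)) \<le> \<bar>\<alpha>\<bar> * (cmod (v 0 t x) * cmod (v 1 t x)) + 2 * \<bar>\<beta>\<bar> * (cmod (v 0 t x) * cmod (v 1 t x))"
      unfolding bco_def by (intro norm_triangle_le) (simp add: norm_mult)
    also have "\<dots> = (\<bar>\<alpha>\<bar> + 2 * \<bar>\<beta>\<bar>) * (cmod (v 0 t x) * cmod (v 1 t x))" by (simp add: algebra_simps)
    also have "\<dots> \<le> (2 * A) * (2 * s * M)" using A1 by (intro mult_mono[OF _ vp]) (auto simp: A_def bigA_def)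
    finally show ?thesis by simp
  qed
  have a4: "cmod (bco (v 0 t x) (v 1 t x) * gf l t x * W 0 t x) \<le> 8 * A * M * Q"
  proof -
    have "cmod (bco (v 0 t x) (v 1 t x) * gf l t x * W 0 t x) \<le> (4 * A * s * M) * (2 * Z) * (Kw * s ^ k)"
      unfolding norm_mult by (intro mult_mono[OF mult_mono[OF bb g] w(1)]) (use s Z Kw M1 A1 in auto)
    then show ?thesis by (simp add: Q_def mult_ac)
  qed
  have a5: "cmod (of_real \<alpha> * (v 0 t x * v 1 t x) * gf l t x * cnj (W 0 t x)) \<le> 4 * A * M * Q"
  proof -
    have av: "\<bar>\<alpha>\<bar> * (cmod (v 0 t x) * cmod (v 1 t x)) \<le> A * (2 * s * M)" using abs_alpha_le(1) A1 by (intro mult_mono[OF _ vp]) auto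
    have "cmod (of_real \<alpha> * (v 0 t x * v 1 t x) * gf l t x * cnj (W 0 t x)) \<le> (A * (2 * s * M)) * (2 * Z) * (Kw * s ^ k)"
      unfolding norm_mult norm_of_real complex_mod_cnj by (intro mult_mono[OF mult_mono[OF av g] w(1)]) (use s Z Kw M1 A1 in auto)
    then show ?thesis by (simp add: Q_def mult_ac)
  qed
  have tri: "cmod (a - (b + c) * d + e + f) \<le> a' + b' + c' + e' + f'"
    if "cmod a \<le> a'" "cmod (b * d) \<le> b'" "cmod (c * d) \<le> c'" "cmod e \<le> e'" "cmod f \<le> f'" for a b c d e f a' b' c' e' f'
    using norm_triangle_ineq[of "a - (b + c) * d + e" f] norm_triangle_ineq[of "a - (b + c) * d" e] norm_triangle_ineq4[of a "(b + c) * d"]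
      norm_triangle_ineq[of "b * d" "c * d"] that unfolding distrib_right[of b c d] by linarith
  have "\<bar>pflux l t x\<bar> \<le> 8 * Q + 8 * M * Q + 16 * K3 * l * Q + 8 * A * M * Q + 4 * A * M * Q"
    unfolding pflux_def by (rule order_trans[OF abs_Re_le_cmod]) (simp only: norm_mult[of \<i>] norm_ii mult_1, rule tri[OF a1 a2 a3 a4 a5])
  also have "\<dots> = (8 + 8 * M + 12 * A * M) * 1 * Q + 16 * K3 * l * Q" by (simp add: algebra_simps)
  also have "\<dots> \<le> (8 + 8 * M + 12 * A * M) * l * Q + 16 * K3 * l * Q"
    using l1 A1 M1 Q by (intro add_right_mono mult_right_mono mult_left_mono) auto
  also have "\<dots> = (8 + 8 * M + 16 * K3 + 12 * A * M) * l * Q" by (simp add: algebra_simps)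
  also have "\<dots> \<le> (8 + 8 * M + 16 * K3 + 12 * A * M) * l * (Kw * s)"
  proof -
    have "Z * (s * s ^ k) = s powr (- r0 + (1 + real k))"
    proof -
      have "s powr (1 + real k) = s * s ^ k" using s by (simp add: powr_add powr_realpow)
      then show ?thesis by (simp only: Z_def powr_add[of s "- r0"])
    qed
    also have "\<dots> \<le> s powr 1" using s ksig by (intro powr_mono') (auto simp: r0_def)
    finally have "Q \<le> Kw * s" unfolding Q_def using s Kw by (intro mult_left_mono) auto
    then show ?thesis using l1 A1 M1 K3 by (intro mult_left_mono) auto
  qed
  finally show ?thesis by (simp add: KB_def Kw_def s_def mult_ac)
qed

definition pairing where "pairing \<kappa> l t = integral {\<kappa>..pi - \<kappa>} (pd l t)"

end

text \<open>The phase is opposite to that of the incoming wave at time 0. Since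
  \<open>(\<sigma> - 1 / 2) - r0\<close> is -1, their product is a positive Gaussian density times
  \<open>1 / sin x\<close>, that is, a Gaussian in \<open>ln (sin x)\<close>.\<close>

definition packet :: "real \<Rightarrow> real \<Rightarrow> real \<Rightarrow> complex" where
  "packet \<sigma> l x = exp (Complex ((\<sigma> - 1 / 2) * ln (sin x) - (ln (sin x) + 2 * ln l)\<^sup>2) (- (l * ln (sin x))))"

context parameters
begin

definition KI where "KI = 20 * KP * (36 * pi * cb \<sigma> * cb (- \<sigma>) + 4 * pi)"

end

section \<open>The pairing at the initial and at the final time\<close>

context two_solutions
begin

lemma sin_pos_interior:
  fixes \<kappa> x :: real
  assumes "0 < \<kappa>" "\<kappa> < pi / 2" "x \<in> {\<kappa>..pi - \<kappa>}"
  shows "0 < x \<and> x < pi \<and> 0 < sin x"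
  using assms sin_gt_zero[of x] by auto

lemma W_slice_continuous:
  assumes \<kappa>: "0 < \<kappa>" "\<kappa> < pi / 2" and t: "t \<in> {0..T}"
  shows "continuous_on {\<kappa>..pi - \<kappa>} (W 0 t)"
proof -
  have "continuous_on ({0..T} \<times> {\<kappa>..pi - \<kappa>}) (\<lambda>z. W 0 (fst z) (snd z))"
    by (rule cont_W) auto
  then show ?thesis using t by (rule cont_slice)
qed

lemma energy_density_integrable:
  assumes \<kappa>: "0 < \<kappa>" "\<kappa> < pi / 2" and t: "t \<in> {0..T}"
  shows "(\<lambda>x. sin x powr (- 2 * \<sigma>) * (cmod (W 0 t x))\<^sup>2) integrable_on {\<kappa>..pi - \<kappa>}"
  by (intro integrable_continuous_real continuous_intros W_slice_continuous[OF assms])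
    (use sin_pos_interior[OF \<kappa>] in force)+

lemma packet_continuous:
  assumes \<kappa>: "0 < \<kappa>" "\<kappa> < pi / 2"
  shows "continuous_on (S \<times> {\<kappa>..pi - \<kappa>}) (\<lambda>z. Yf l (fst z) (snd z))"
    and "continuous_on (S \<times> {\<kappa>..pi - \<kappa>}) (\<lambda>z. Ef e l (fst z) (snd z))"
proof -
  have s: "sin (snd z) \<noteq> 0" if "z \<in> S \<times> {\<kappa>..pi - \<kappa>}" for z
    using sin_pos_interior[OF \<kappa>, of "snd z"] that by auto
  show Y: "continuous_on (S \<times> {\<kappa>..pi - \<kappa>}) (\<lambda>z. Yf l (fst z) (snd z))"
    unfolding Yf_def using s by (intro continuous_intros) auto
  show "continuous_on (S \<times> {\<kappa>..pi - \<kappa>}) (\<lambda>z. Ef e l (fst z) (snd z))"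
    unfolding Ef_def Complex_eq using s by (intro continuous_intros Y) auto
qed

text \<open>In place of the Cauchy-Schwarz inequality, a weighted arithmetic-geometric mean is used
  under the integral. The weight \<open>a\<close> will be the amplitude, so that an energy of size
  a^2 and the fixed packet mass both contribute a multiple of \<open>a\<close>.\<close>

lemma pairing_estimate:
  assumes \<kappa>: "0 < \<kappa>" "\<kappa> < pi / 2" and l: "A \<le> l" and a: "0 < a" and \<tau>: "\<tau> \<in> {0..T}"
  shows "\<bar>pairing \<kappa> l \<tau> - pairing \<kappa> l 0\<bar>
    \<le> (2 * KB * l * \<kappa> + 20 * KP * (1 + \<tau> * l) * ((K1 * energy \<kappa> 0 + K2 * \<kappa>) / a + 4 * pi * a)) * \<tau>"
proof -
  let ?I = "{\<kappa>..pi - \<kappa>}"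
  note I = sin_pos_interior[OF \<kappa>]
  have l1: "1 \<le> l" using l A1 by linarith
  have sub: "{0..T} \<times> ?I \<subseteq> {0..T} \<times> UNIV" by auto
  have cpd: "continuous_on ({0..T} \<times> ?I) (\<lambda>z. pd l (fst z) (snd z))"
    unfolding pd_def gf_def by (intro continuous_intros cont_W packet_continuous[OF \<kappa>] sub) simp
  have cpdt: "continuous_on ({0..T} \<times> ?I) (\<lambda>z. pdt l (fst z) (snd z))"
    unfolding pdt_def gf_def gft_def Wt_def
    by (intro continuous_intros cont_W cont_nlU cont_nlV packet_continuous[OF \<kappa>] sub) simp
  have der: "((\<lambda>t. pairing \<kappa> l t) has_vector_derivative integral ?I (pdt l t)) (at t within {0..T})" if t: "t \<in> {0..T}" for t
  proof -
    have "((\<lambda>t. integral (cbox \<kappa> (pi - \<kappa>)) (pd l t)) has_vector_derivative integral (cbox \<kappa> (pi - \<kappa>)) (pdt l t)) (at t within {0..T})"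
    proof (rule leibniz_rule_vector_derivative)
      fix t x assume "t \<in> {0..T}" "x \<in> cbox \<kappa> (pi - \<kappa>)"
      then show "((\<lambda>t. pd l t x) has_vector_derivative pdt l t x) (at t within {0..T})"
        using pd_deriv[of t l x] by (simp add: has_real_derivative_iff_has_vector_derivative)
    next
      fix t assume "t \<in> {0..T}"
      then show "pd l t integrable_on cbox \<kappa> (pi - \<kappa>)"
        using cont_slice[OF cpd] by (auto intro: integrable_continuous_real)
    next
      show "continuous_on ({0..T} \<times> cbox \<kappa> (pi - \<kappa>)) (\<lambda>(x, t). pdt l x t)"
        using cpdt by (simp add: split_beta)
    qed (use t in auto)
    then show ?thesis by (simp add: pairing_def)
  qed
  have bound: "norm (integral ?I (pdt l t)) \<le> 2 * KB * l * \<kappa> + 20 * KP * (1 + \<tau> * l) * ((K1 * energy \<kappa> 0 + K2 * \<kappa>) / a + 4 * pi * a)"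
    if t\<tau>: "t \<in> {0..\<tau>}" for t
  proof -
    have t: "t \<in> {0..T}" using t\<tau> \<tau> by auto
    \<comment> \<open>The centre of the packet at time \<open>t\<close>, expressed as a value of
      \<open>sin x\<close>.\<close>
    define S where "S = exp (- (2 * ln l + 2 * \<eta>\<^sup>2 * l * t))"
    have S: "0 < S" by (simp add: S_def)
    have YS: "Yf l t x = ln (sin x / S)" if "x \<in> ?I" for x
      using I[OF that] by (simp add: Yf_def S_def ln_div)
    note wi = weight_integral_bound[OF S \<kappa>]
    let ?h = "\<lambda>x. 20 * KP * (1 + t * l) * (sin x powr (- 2 * \<sigma>) * (cmod (W 0 t x))\<^sup>2 / a + a * (exp (- 2 * \<bar>ln (sin x / S)\<bar>) / sin x))"
    have hi: "(?h has_integral 20 * KP * (1 + t * l) * (energy \<kappa> t / a + a * integral ?I (\<lambda>x. exp (- 2 * \<bar>ln (sin x / S)\<bar>) / sin x))) ?I"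
      unfolding energy_def
      by (intro has_integral_mult_right has_integral_add has_integral_divide integrable_integral energy_density_integrable[OF \<kappa> t] wi(1))
    have fl: "(pfluxx l t has_integral pflux l t (pi - \<kappa>) - pflux l t \<kappa>) ?I"
    proof (rule fundamental_theorem_of_calculus)
      fix x assume "x \<in> ?I"
      then show "(pflux l t has_vector_derivative pfluxx l t x) (at x within ?I)"
        using pflux_deriv[OF t, of x l] I[of x]
        by (simp add: has_real_derivative_iff_has_vector_derivative has_vector_derivative_at_within)
    qed (use \<kappa> in auto)
    have pi: "(pdt l t has_integral integral ?I (pdt l t)) ?I"
      using cont_slice[OF cpdt t] by (intro integrable_integral integrable_continuous_real)
    have di: "((\<lambda>x. pdt l t x - pfluxx l t x) has_integral integral ?I (pdt l t) - (pflux l t (pi - \<kappa>) - pflux l t \<kappa>)) ?I"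
      by (rule has_integral_diff[OF pi fl])
    have "norm (integral ?I (\<lambda>x. pdt l t x - pfluxx l t x)) \<le> integral ?I ?h"
    proof (rule integral_norm_bound_integral)
      show "(\<lambda>x. pdt l t x - pfluxx l t x) integrable_on ?I" using di by blast
      show "?h integrable_on ?I" using hi by blast
      fix x assume x: "x \<in> ?I"
      have s: "0 < sin x" using I[OF x] by simp
      \<comment> \<open>The exponent \<open>r0 = \<sigma> + 1 / 2\<close> is divided up:
        \<open>\<sigma>\<close> goes to the energy weight and \<open>1 / 2\<close> to the packet,
        whose square then has the density \<open>1 / sin x\<close>.\<close>
      define P where "P = sin x powr (- \<sigma>) * cmod (W 0 t x)"
      define Q where "Q = sin x powr (- (1 / 2)) * exp (- \<bar>Yf l t x\<bar>)"
      have "cmod (W 0 t x) * (sin x powr (- r0) * exp (- \<bar>Yf l t x\<bar>)) = P * Q"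
        using s by (simp add: P_def Q_def r0_def mult_ac flip: powr_add)
      also have "\<dots> \<le> 1 / 2 * (P\<^sup>2 / a + a * Q\<^sup>2)"
      proof -
        have "0 \<le> (P - a * Q)\<^sup>2 / a" using a by simp
        also have "\<dots> = P\<^sup>2 / a + a * Q\<^sup>2 - 2 * (P * Q)" using a by (simp add: field_simps power2_eq_square)
        finally show ?thesis by simp
      qed
      also have "P\<^sup>2 = sin x powr (- 2 * \<sigma>) * (cmod (W 0 t x))\<^sup>2"
      proof -
        have "sin x powr (- \<sigma>) * sin x powr (- \<sigma>) = sin x powr (- 2 * \<sigma>)" by (simp flip: powr_add)
        then show ?thesis by (simp add: P_def power2_eq_square mult_ac)
      qed
      also have "Q\<^sup>2 = exp (- 2 * \<bar>ln (sin x / S)\<bar>) / sin x"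
      proof -
        define z E where "z = sin x powr (- (1 / 2))" and "E = exp (- \<bar>Yf l t x\<bar>)"
        have "z * z = sin x powr (- 1)" unfolding z_def powr_add[symmetric] by simp
        then have z: "z * z = 1 / sin x" using s by (simp add: powr_minus_divide)
        have E: "E * E = exp (- 2 * \<bar>Yf l t x\<bar>)" unfolding E_def exp_add[symmetric] by simp
        have "Q\<^sup>2 = (z * z) * (E * E)" unfolding Q_def z_def[symmetric] E_def[symmetric] by (simp add: power2_eq_square)
        then have "Q\<^sup>2 = 1 / sin x * exp (- 2 * \<bar>Yf l t x\<bar>)" unfolding z E .
        then show ?thesis unfolding YS[OF x] by simp
      qed
      finally have "cmod (W 0 t x) * (sin x powr (- r0) * exp (- \<bar>Yf l t x\<bar>)) \<le> 1 / 2 * (sin x powr (- 2 * \<sigma>) * (cmod (W 0 t x))\<^sup>2 / a + a * (exp (- 2 * \<bar>ln (sin x / S)\<bar>) / sin x))" .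
      moreover have "0 \<le> 40 * KP * (1 + t * l)" using KP0 t l1 by simp
      ultimately have b1: "40 * KP * (1 + t * l) * (cmod (W 0 t x) * (sin x powr (- r0) * exp (- \<bar>Yf l t x\<bar>)))
        \<le> 40 * KP * (1 + t * l) * (1 / 2 * (sin x powr (- 2 * \<sigma>) * (cmod (W 0 t x))\<^sup>2 / a + a * (exp (- 2 * \<bar>ln (sin x / S)\<bar>) / sin x)))"
        by (rule mult_left_mono)
      have e: "40 * KP * c * (1 / 2 * Z) = 20 * KP * c * Z" for c Z by simp
      have b2: "norm (pdt l t x - pfluxx l t x) \<le> 40 * KP * (1 + t * l) * (cmod (W 0 t x) * (sin x powr (- r0) * exp (- \<bar>Yf l t x\<bar>)))"
        unfolding real_norm_def using I[OF x] by (intro pairing_pointwise t l) auto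
      show "norm (pdt l t x - pfluxx l t x) \<le> ?h x" using order_trans[OF b2 b1] unfolding e .
    qed
    also have "integral ?I ?h = 20 * KP * (1 + t * l) * (energy \<kappa> t / a + a * integral ?I (\<lambda>x. exp (- 2 * \<bar>ln (sin x / S)\<bar>) / sin x))"
      using hi by (rule integral_unique)
    also have "\<dots> \<le> 20 * KP * (1 + \<tau> * l) * ((K1 * energy \<kappa> 0 + K2 * \<kappa>) / a + 4 * pi * a)"
    proof (intro mult_mono)
      show "1 + t * l \<le> 1 + \<tau> * l" using t\<tau> l1 by (auto intro: mult_right_mono)
      have "energy \<kappa> t / a \<le> (K1 * energy \<kappa> 0 + K2 * \<kappa>) / a"
        using energy_estimate[OF \<kappa> t] a by (intro divide_right_mono) auto
      moreover have "a * integral ?I (\<lambda>x. exp (- 2 * \<bar>ln (sin x / S)\<bar>) / sin x) \<le> a * (4 * pi)"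
        using wi(2) a by (intro mult_left_mono) auto
      ultimately show "energy \<kappa> t / a + a * integral ?I (\<lambda>x. exp (- 2 * \<bar>ln (sin x / S)\<bar>) / sin x) \<le> (K1 * energy \<kappa> 0 + K2 * \<kappa>) / a + 4 * pi * a"
        by (simp only: mult.commute[of "4 * pi" a] add_mono)
      have "0 \<le> energy \<kappa> t" unfolding energy_def
        by (rule integral_nonneg[OF energy_density_integrable[OF \<kappa> t]]) simp
      moreover have "0 \<le> integral ?I (\<lambda>x. exp (- 2 * \<bar>ln (sin x / S)\<bar>) / sin x)"
        by (rule integral_nonneg[OF wi(1)]) (use I in force)
      ultimately show "0 \<le> energy \<kappa> t / a + a * integral ?I (\<lambda>x. exp (- 2 * \<bar>ln (sin x / S)\<bar>) / sin x)" using a by simp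
    qed (use KP0 \<tau> t l1 in auto)
    also have "integral ?I (\<lambda>x. pdt l t x - pfluxx l t x) = integral ?I (pdt l t) - (pflux l t (pi - \<kappa>) - pflux l t \<kappa>)"
      using di by (rule integral_unique)
    finally have main: "\<bar>integral ?I (pdt l t) - (pflux l t (pi - \<kappa>) - pflux l t \<kappa>)\<bar> \<le> 20 * KP * (1 + \<tau> * l) * ((K1 * energy \<kappa> 0 + K2 * \<kappa>) / a + 4 * pi * a)"
      by simp
    have sk: "KB * l * sin \<kappa> \<le> KB * l * \<kappa>" using KB0 l1 \<kappa> sin_x_le_x[of \<kappa>] by (intro mult_left_mono) auto
    have "\<bar>pflux l t (pi - \<kappa>)\<bar> \<le> KB * l * \<kappa>" using pflux_bound[OF t, of "pi - \<kappa>" l] l sk \<kappa> by simp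
    moreover have "\<bar>pflux l t \<kappa>\<bar> \<le> KB * l * \<kappa>" using pflux_bound[OF t, of \<kappa> l] l sk \<kappa> by simp
    ultimately show ?thesis using main unfolding real_norm_def by linarith
  qed
  have "norm (pairing \<kappa> l \<tau> - pairing \<kappa> l 0) \<le> (2 * KB * l * \<kappa> + 20 * KP * (1 + \<tau> * l) * ((K1 * energy \<kappa> 0 + K2 * \<kappa>) / a + 4 * pi * a)) * \<bar>\<tau> - 0\<bar>"
  proof (rule vector_derivative_bound[of "{0..\<tau>}"])
    fix t assume "t \<in> {0..\<tau>}"
    then show "((\<lambda>t. pairing \<kappa> l t) has_vector_derivative integral ?I (pdt l t)) (at t within {0..\<tau>})"
      using der[of t] \<tau> by (auto intro: has_vector_derivative_within_subset)
  qed (use bound \<tau> in auto)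
  then show ?thesis using \<tau> by simp
qed

text \<open>\<open>W\<close> is O(sin^k x) and the packet O(sin^(-r0) x), so their product is at
  most a multiple of \<open>sin x\<close> times the Gaussian, which is located where
  \<open>sin x\<close> is exponentially small.\<close>

lemma pairing_final:
  assumes \<kappa>: "0 < \<kappa>" "\<kappa> < pi / 2" and l: "A \<le> l" and \<tau>: "\<tau> \<in> {0..T}"
  shows "\<bar>pairing \<kappa> l \<tau>\<bar> \<le> 4 * pi * (2 ^ (k + 1) * M) * exp (- (2 * \<eta>\<^sup>2 * l * \<tau>))"
proof -
  let ?I = "{\<kappa>..pi - \<kappa>}"
  note I = sin_pos_interior[OF \<kappa>]
  have l1: "1 \<le> l" using l A1 by linarith
  define Kw where "Kw = 2 ^ (k + 1) * M"
  have Kw: "0 \<le> Kw" using M1 by (simp add: Kw_def)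
  let ?E = "exp (- (2 * \<eta>\<^sup>2 * l * \<tau>))"
  have pw: "norm (pd l \<tau> x) \<le> 4 * Kw * ?E" if x: "x \<in> ?I" for x
  proof -
    define s Y where d: "s = sin x" "Y = Yf l \<tau> x"
    have s: "0 < s" "s \<le> 1" using I[OF x] by (auto simp: d)
    have "norm (pd l \<tau> x) \<le> cmod (W 0 \<tau> x) * cmod (gf l \<tau> x)"
      unfolding pd_def using abs_Re_le_cmod[of "W 0 \<tau> x * gf l \<tau> x"] by (simp add: norm_mult)
    also have "\<dots> \<le> (Kw * s ^ k) * (2 * (s powr (- r0) * exp (- (Y\<^sup>2))))"
      using W_sin_bound[OF \<tau>, of x 0] gf_bounds(1)[of x l \<tau>] I[OF x] l s Kw
      by (intro mult_mono) (auto simp: d Kw_def)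
    also have "\<dots> = 2 * Kw * (s powr (real k - r0) * exp (- (Y\<^sup>2)))"
    proof -
      have "s ^ k * s powr (- r0) = s powr (real k - r0)"
        using s by (simp add: powr_diff powr_minus_divide powr_realpow)
      then show ?thesis by (simp add: mult_ac)
    qed
    also have "\<dots> \<le> 2 * Kw * (s powr 1 * exp (- (Y\<^sup>2)))"
      using s ksig Kw by (intro mult_left_mono mult_right_mono powr_mono') (auto simp: r0_def)
    \<comment> \<open>\<open>sin x\<close> is measured from the centre of the packet:
      \<open>Y - Y\<^sup>2\<close> is bounded, and \<open>ln s - Y\<close> is the logarithm of the
      centre.\<close>
    also have "\<dots> = 2 * Kw * (exp (Y - Y\<^sup>2) * exp (ln s - Y))"
    proof -
      have "exp (Y - Y\<^sup>2) * exp (ln s - Y) = exp (ln s) * exp (- (Y\<^sup>2))" by (simp flip: exp_add)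
      then show ?thesis using s by simp
    qed
    also have "\<dots> \<le> 2 * Kw * (2 * ?E)"
    proof (intro mult_left_mono mult_mono)
      have "Y - Y\<^sup>2 \<le> 1 / 4" using zero_le_power2[of "Y - 1 / 2"] by (simp add: power2_eq_square algebra_simps)
      then have "exp (Y - Y\<^sup>2) \<le> exp (1 / 4)" by simp
      also have "\<dots> \<le> 2" using exp_bound[of "1 / 4"] by (simp add: power2_eq_square)
      finally show "exp (Y - Y\<^sup>2) \<le> 2" .
      have "0 \<le> ln l" using l1 by simp
      then show "exp (ln s - Y) \<le> ?E" by (simp add: d Yf_def)
    qed (use Kw in auto)
    finally show ?thesis by simp
  qed
  have "continuous_on ({0..T} \<times> ?I) (\<lambda>z. pd l (fst z) (snd z))"
    unfolding pd_def gf_def by (intro continuous_intros cont_W packet_continuous[OF \<kappa>]) auto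
  then have "pd l \<tau> integrable_on ?I" using cont_slice[OF _ \<tau>] integrable_continuous_real by blast
  then have "norm (integral ?I (pd l \<tau>)) \<le> integral ?I (\<lambda>x. 4 * Kw * ?E)"
    using pw by (intro integral_norm_bound_integral) auto
  also have "\<dots> = (pi - 2 * \<kappa>) * (4 * Kw * ?E)" using \<kappa> by simp
  also have "\<dots> \<le> pi * (4 * Kw * ?E)" using \<kappa> Kw by (intro mult_right_mono) auto
  finally show ?thesis by (simp add: pairing_def Kw_def mult_ac)
qed

text \<open>With \<open>S = 1 / l\<^sup>2\<close>, on the interval from \<open>S\<close> to
  \<open>2 * S\<close> the value \<open>sin x\<close> lies within a factor 2 of the centre. The
  density is thus at least \<open>exp (- 1) / (2 * S)\<close>, hence \<open>1 / (6 * S)\<close>, on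
  a length \<open>S\<close>.\<close>

lemma packet_weight_lower:
  assumes l: "2 \<le> l" and \<kappa>: "0 < \<kappa>" "\<kappa> \<le> 1 / l\<^sup>2"
  shows "1 / 6 \<le> integral {\<kappa>..pi - \<kappa>} (\<lambda>x. exp (- 2 * (Yf l 0 x)\<^sup>2) / sin x)"
    and "(\<lambda>x. exp (- 2 * (Yf l 0 x)\<^sup>2) / sin x) integrable_on {\<kappa>..pi - \<kappa>}" and "\<kappa> < pi / 2"
proof -
  let ?I = "{\<kappa>..pi - \<kappa>}"
  define S where "S = 1 / l\<^sup>2"
  have S: "0 < S" "S \<le> 1 / 4"
  proof -
    show "0 < S" using l by (simp add: S_def)
    have "2\<^sup>2 \<le> l\<^sup>2" using l by (intro power_mono) auto
    then show "S \<le> 1 / 4" using l by (simp add: S_def divide_le_eq)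
  qed
  have \<kappa>S: "\<kappa> \<le> S" using \<kappa> by (simp add: S_def)
  have pi3: "3 < pi" by (rule pi_gt3)
  show k2: "\<kappa> < pi / 2" using \<kappa>S S pi3 by linarith
  note I = sin_pos_interior[OF \<kappa>(1) k2]
  let ?f = "\<lambda>x. exp (- 2 * (Yf l 0 x)\<^sup>2) / sin x"
  have "continuous_on ?I ?f"
    unfolding Yf_def by (intro continuous_intros) (use I in force)+
  then show fi: "?f integrable_on ?I" by (rule integrable_continuous_real)
  have sub: "{S..2 * S} \<subseteq> ?I" using \<kappa>S S pi3 by auto
  have fs: "?f integrable_on {S..2 * S}" using integrable_subinterval_real[OF fi sub] .
  have "1 / 6 = integral {S..2 * S} (\<lambda>x. 1 / (6 * S))" using S by simp
  also have "\<dots> \<le> integral {S..2 * S} ?f"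
  proof (rule integral_le[OF _ fs])
    fix x assume x: "x \<in> {S..2 * S}"
    then have xI: "x \<in> ?I" using sub by auto
    define s where "s = sin x"
    have s: "0 < s" using I[OF xI] by (simp add: s_def)
    have s2: "s \<le> 2 * S" using sin_x_le_x[of x] x S by (auto simp: s_def)
    have s1: "S / 2 \<le> s" using le_2_sin[of x] x S pi3 by (auto simp: s_def)
    have "Yf l 0 x = ln (s / S)"
      using s S l by (simp add: Yf_def s_def S_def ln_div ln_mult ln_realpow)
    moreover have "ln (s / S) \<le> ln 2" using s s2 S by (subst ln_le_cancel_iff) (auto simp: divide_le_eq)
    moreover have "- ln 2 \<le> ln (s / S)"
    proof -
      have "ln (1 / 2) \<le> ln (s / S)" using s s1 S by (subst ln_le_cancel_iff) (auto simp: le_divide_eq)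
      then show ?thesis by (simp add: ln_div)
    qed
    ultimately have "\<bar>Yf l 0 x\<bar> \<le> ln 2" by auto
    also have "\<dots> \<le> 7 / 10" using ln2_le_25_over_36 by simp
    finally have "(Yf l 0 x)\<^sup>2 \<le> (7 / 10)\<^sup>2" using abs_le_square_iff[of "Yf l 0 x" "7 / 10"] by simp
    then have "- 1 \<le> - 2 * (Yf l 0 x)\<^sup>2" by (simp add: power2_eq_square)
    then have "exp (- 1) \<le> exp (- 2 * (Yf l 0 x)\<^sup>2)" by (simp only: exp_le_cancel_iff)
    moreover have "1 / 3 \<le> exp (- 1 :: real)" using e_less_272 by (simp add: exp_minus field_simps)
    ultimately have "1 / 3 \<le> exp (- 2 * (Yf l 0 x)\<^sup>2)" by linarith
    then have "(1 / 3) / (2 * S) \<le> exp (- 2 * (Yf l 0 x)\<^sup>2) / s"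
      using s s2 by (intro frac_le) auto
    then show "1 / (6 * S) \<le> ?f x" by (simp add: s_def)
  qed (rule integrable_const_ivl)
  also have "\<dots> \<le> integral ?I ?f"
    using fi fs sub I by (intro integral_subset_le) force+
  finally show "1 / 6 \<le> integral ?I ?f" .
qed

lemma packet_facts:
  assumes s: "0 < sin x"
  shows "(cmod (packet \<sigma> l x))\<^sup>2 * sin x powr (- 2 * \<sigma>) = exp (- 2 * (Yf l 0 x)\<^sup>2) / sin x"
    and "packet \<sigma> l x * Ef 1 l 0 x = of_real (exp (- 2 * (Yf l 0 x)\<^sup>2) / sin x)"
    and "cmod (packet \<sigma> l x * Ef (- 1) l 0 x) = exp (- 2 * (Yf l 0 x)\<^sup>2) / sin x"
proof -
  let ?y = "ln (sin x)" and ?Y = "Yf l 0 x"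
  have Y: "?y + 2 * ln l = ?Y" by (simp add: Yf_def)
  have ee: "exp (- ?y - 2 * ?Y\<^sup>2) = exp (- 2 * ?Y\<^sup>2) / sin x"
    using s by (simp add: exp_diff exp_minus field_simps)
  have n: "cmod (packet \<sigma> l x) = exp ((\<sigma> - 1 / 2) * ?y - ?Y\<^sup>2)" by (simp add: packet_def Y)
  have "(cmod (packet \<sigma> l x))\<^sup>2 * sin x powr (- 2 * \<sigma>) = exp (((\<sigma> - 1 / 2) * ?y - ?Y\<^sup>2) + ((\<sigma> - 1 / 2) * ?y - ?Y\<^sup>2) + (- 2 * \<sigma>) * ?y)"
    using s unfolding n power2_eq_square[of "exp _"] exp_add by (simp add: powr_def)
  also have "\<dots> = exp (- ?y - 2 * ?Y\<^sup>2)" by (rule arg_cong[where f=exp]) (simp add: algebra_simps)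
  finally show "(cmod (packet \<sigma> l x))\<^sup>2 * sin x powr (- 2 * \<sigma>) = exp (- 2 * ?Y\<^sup>2) / sin x" unfolding ee .
  have "packet \<sigma> l x * Ef 1 l 0 x = exp (of_real (- ?y - 2 * ?Y\<^sup>2))"
    unfolding packet_def Ef_def Y exp_add[symmetric] by (rule arg_cong[where f=exp]) (simp add: complex_eq_iff r0_def algebra_simps)
  then show "packet \<sigma> l x * Ef 1 l 0 x = of_real (exp (- 2 * ?Y\<^sup>2) / sin x)" unfolding exp_of_real ee .
  have "cmod (packet \<sigma> l x * Ef (- 1) l 0 x) = exp (((\<sigma> - 1 / 2) * ?y - ?Y\<^sup>2) + (- r0 * ?y - ?Y\<^sup>2))"
    unfolding norm_mult n exp_add by (simp add: Ef_def)
  also have "\<dots> = exp (- ?y - 2 * ?Y\<^sup>2)" by (rule arg_cong[where f=exp]) (simp add: r0_def algebra_simps)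
  finally show "cmod (packet \<sigma> l x * Ef (- 1) l 0 x) = exp (- 2 * ?Y\<^sup>2) / sin x" unfolding ee .
qed

text \<open>\<open>a\<close> is the amplitude of the first packet by which the two data differ.
  \<open>tail\<close> collects all later packets; being quadratic in \<open>a\<close> it is
  negligible in both energy and pairing.\<close>

context
  fixes l a :: real and tail :: "real \<Rightarrow> complex"
  assumes l: "A \<le> l" "2 \<le> l" and a: "0 < a" "a \<le> 1"
    and W0: "\<And>x. 0 < sin x \<Longrightarrow> W 0 0 x = of_real a * packet \<sigma> l x + tail x"
    and tail: "\<And>x. 0 < sin x \<Longrightarrow> cmod (tail x) \<le> a\<^sup>2 * sin x ^ k"
begin

text \<open>In the weighted norm the packet is a Gaussian in \<open>ln (sin x)\<close> of bounded
  mass. The packet contributes \<open>16 * pi\<close> and the tail \<open>2 * pi\<close>.\<close>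

lemma initial_energy:
  assumes \<kappa>: "0 < \<kappa>" "\<kappa> \<le> 1 / l\<^sup>2"
  shows "energy \<kappa> 0 \<le> 18 * pi * a\<^sup>2"
proof -
  let ?I = "{\<kappa>..pi - \<kappa>}"
  have k2: "\<kappa> < pi / 2" using packet_weight_lower(3)[OF l(2) \<kappa>] .
  note I = sin_pos_interior[OF \<kappa>(1) k2]
  define S where "S = exp (- (2 * ln l))"
  have S: "0 < S" by (simp add: S_def)
  have YS: "Yf l 0 x = ln (sin x / S)" if "x \<in> ?I" for x
    using I[OF that] by (simp add: Yf_def S_def ln_div)
  note wi = weight_integral_bound[OF S \<kappa>(1) k2]
  have t0: "0 \<in> {0..T}" using T by simp
  let ?h = "\<lambda>x. a\<^sup>2 * (4 * (exp (- 2 * \<bar>ln (sin x / S)\<bar>) / sin x) + 2)"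
  have hi: "(?h has_integral a\<^sup>2 * (4 * integral ?I (\<lambda>x. exp (- 2 * \<bar>ln (sin x / S)\<bar>) / sin x) + (pi - \<kappa> - \<kappa>) * 2)) ?I"
    using has_integral_const_real[of "2::real" \<kappa> "pi - \<kappa>"] k2
    by (intro has_integral_mult_right has_integral_add integrable_integral wi(1)) auto
  have "energy \<kappa> 0 \<le> integral ?I ?h"
    unfolding energy_def
  proof (rule integral_le[OF energy_density_integrable[OF \<kappa>(1) k2 t0]])
    show "?h integrable_on ?I" using hi by blast
    fix x assume x: "x \<in> ?I"
    have s: "0 < sin x" "sin x \<le> 1" using I[OF x] by auto
    have "(cmod (W 0 0 x))\<^sup>2 \<le> 2 * ((cmod (of_real a * packet \<sigma> l x))\<^sup>2 + (cmod (tail x))\<^sup>2)"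
    proof -
      have "(cmod (W 0 0 x))\<^sup>2 \<le> (cmod (of_real a * packet \<sigma> l x) + cmod (tail x))\<^sup>2"
        unfolding W0[OF s(1)] by (intro power_mono norm_triangle_ineq) auto
      also have "\<dots> \<le> 2 * ((cmod (of_real a * packet \<sigma> l x))\<^sup>2 + (cmod (tail x))\<^sup>2)"
        using zero_le_power2[of "cmod (of_real a * packet \<sigma> l x) - cmod (tail x)"] by (simp add: power2_eq_square algebra_simps)
      finally show ?thesis .
    qed
    also have "\<dots> \<le> 2 * (a\<^sup>2 * (cmod (packet \<sigma> l x))\<^sup>2 + (a\<^sup>2 * sin x ^ k)\<^sup>2)"
      using tail[OF s(1)] a by (intro mult_left_mono add_mono power_mono) (auto simp: norm_mult power_mult_distrib)
    finally have "sin x powr (- 2 * \<sigma>) * (cmod (W 0 0 x))\<^sup>2 \<le> sin x powr (- 2 * \<sigma>) * (2 * (a\<^sup>2 * (cmod (packet \<sigma> l x))\<^sup>2 + (a\<^sup>2 * sin x ^ k)\<^sup>2))"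
      by (intro mult_left_mono) auto
    also have "\<dots> = 2 * a\<^sup>2 * ((cmod (packet \<sigma> l x))\<^sup>2 * sin x powr (- 2 * \<sigma>)) + 2 * a\<^sup>2 * (a\<^sup>2 * (sin x powr (- 2 * \<sigma>) * (sin x ^ k)\<^sup>2))"
      by (simp add: power2_eq_square algebra_simps)
    also have "\<dots> \<le> 2 * a\<^sup>2 * (2 * (exp (- 2 * \<bar>ln (sin x / S)\<bar>) / sin x)) + 2 * a\<^sup>2 * (1 * 1)"
    proof -
      have A: "(cmod (packet \<sigma> l x))\<^sup>2 * sin x powr (- 2 * \<sigma>) \<le> 2 * (exp (- 2 * \<bar>ln (sin x / S)\<bar>) / sin x)"
      proof -
        let ?u = "\<bar>ln (sin x / S)\<bar>"
        have "- 2 * ?u\<^sup>2 \<le> 1 / 2 + - 2 * ?u" using zero_le_power2[of "?u - 1 / 2"] by (simp add: power2_eq_square algebra_simps)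
        then have "exp (- 2 * ?u\<^sup>2) \<le> exp (1 / 2) * exp (- 2 * ?u)" unfolding exp_add[symmetric] by (simp only: exp_le_cancel_iff)
        also have "\<dots> \<le> 2 * exp (- 2 * ?u)"
          using exp_bound[of "1 / 2"] by (intro mult_right_mono) (auto simp: power2_eq_square)
        finally have "exp (- 2 * (Yf l 0 x)\<^sup>2) / sin x \<le> 2 * exp (- 2 * ?u) / sin x"
          unfolding YS[OF x] using s by (intro divide_right_mono) auto
        then show ?thesis unfolding packet_facts(1)[OF s(1)] by simp
      qed
      have B: "a\<^sup>2 \<le> 1" using a by (simp add: power_le_one)
      have "sin x powr (- 2 * \<sigma>) * (sin x ^ k)\<^sup>2 = sin x powr (- 2 * \<sigma> + real (k * 2))"
        using s by (simp only: powr_add powr_realpow power_mult)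
      also have "\<dots> \<le> 1" using s ksig by (intro powr_le1) auto
      finally have C: "sin x powr (- 2 * \<sigma>) * (sin x ^ k)\<^sup>2 \<le> 1" .
      have "a\<^sup>2 * (sin x powr (- 2 * \<sigma>) * (sin x ^ k)\<^sup>2) \<le> 1 * 1" by (rule mult_mono[OF B C]) auto
      then show ?thesis using A by (intro add_mono mult_left_mono) auto
    qed
    finally show "sin x powr (- 2 * \<sigma>) * (cmod (W 0 0 x))\<^sup>2 \<le> ?h x" by (simp add: algebra_simps)
  qed
  also have "integral ?I ?h = a\<^sup>2 * (4 * integral ?I (\<lambda>x. exp (- 2 * \<bar>ln (sin x / S)\<bar>) / sin x) + (pi - \<kappa> - \<kappa>) * 2)"
    using hi by (rule integral_unique)
  also have "\<dots> \<le> a\<^sup>2 * (4 * (4 * pi) + pi * 2)"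
    using wi(2) \<kappa>(1) by (intro mult_left_mono add_mono mult_right_mono) auto
  finally show ?thesis by (simp add: mult_ac)
qed

text \<open>Against the incoming wave the packet gives its full mass, at least \<open>1 / 6\<close>.
  The reflected wave takes away at most half of it, as \<open>cmod (Bc l)\<close> is at most
  \<open>1 / 2\<close> for \<open>A \<le> l\<close>.\<close>

lemma initial_pairing:
  assumes \<kappa>: "0 < \<kappa>" "\<kappa> \<le> 1 / l\<^sup>2"
  shows "a / 12 - 2 * pi * a\<^sup>2 \<le> pairing \<kappa> l 0"
proof -
  let ?I = "{\<kappa>..pi - \<kappa>}"
  have k2: "\<kappa> < pi / 2" using packet_weight_lower(3)[OF l(2) \<kappa>] .
  note I = sin_pos_interior[OF \<kappa>(1) k2]
  let ?f = "\<lambda>x. exp (- 2 * (Yf l 0 x)\<^sup>2) / sin x"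
  let ?h = "\<lambda>x. a / 2 * ?f x - 2 * a\<^sup>2"
  have t0: "0 \<in> {0..T}" using T by simp
  have hi: "(?h has_integral a / 2 * integral ?I ?f - (pi - \<kappa> - \<kappa>) * (2 * a\<^sup>2)) ?I"
    using has_integral_const_real[of "2 * a\<^sup>2" \<kappa> "pi - \<kappa>"] k2
    by (intro has_integral_diff has_integral_mult_right integrable_integral packet_weight_lower(2)[OF l(2) \<kappa>]) auto
  have "continuous_on ({0..T} \<times> ?I) (\<lambda>z. pd l (fst z) (snd z))"
    unfolding pd_def gf_def by (intro continuous_intros cont_W packet_continuous[OF \<kappa>(1) k2]) auto
  then have pi: "pd l 0 integrable_on ?I" using cont_slice[OF _ t0] integrable_continuous_real by blast
  have "integral ?I ?h \<le> integral ?I (pd l 0)"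
  proof (rule integral_le)
    show "?h integrable_on ?I" using hi by blast
    show "pd l 0 integrable_on ?I" by (rule pi)
    fix x assume x: "x \<in> ?I"
    have s: "0 < sin x" "sin x \<le> 1" using I[OF x] by auto
    let ?F = "?f x"
    have F: "0 \<le> ?F" using s by simp
    have B: "cmod (Bc l) \<le> 1 / 2"
      using l abs_alpha_le(1) A1 by (simp add: Bc_def norm_mult norm_divide divide_le_eq)
    have eq: "packet \<sigma> l x * gf l 0 x = of_real ?F + Bc l * (packet \<sigma> l x * Ef (- 1) l 0 x)"
      unfolding gf_def distrib_left packet_facts(2)[OF s(1)] by (simp only: mult.left_commute)
    have "\<bar>Re (Bc l * (packet \<sigma> l x * Ef (- 1) l 0 x))\<bar> \<le> 1 / 2 * ?F"
    proof -
      have "cmod (Bc l * (packet \<sigma> l x * Ef (- 1) l 0 x)) \<le> 1 / 2 * ?F"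
        unfolding norm_mult[of "Bc l"] packet_facts(3)[OF s(1)] using B F by (intro mult_right_mono) auto
      then show ?thesis using abs_Re_le_cmod order_trans by blast
    qed
    then have r1: "1 / 2 * ?F \<le> Re (packet \<sigma> l x * gf l 0 x)" unfolding eq plus_complex.sel Re_complex_of_real by linarith
    have r2: "\<bar>Re (tail x * gf l 0 x)\<bar> \<le> 2 * a\<^sup>2"
    proof -
      have "\<bar>Re (tail x * gf l 0 x)\<bar> \<le> cmod (tail x) * cmod (gf l 0 x)"
        using abs_Re_le_cmod[of "tail x * gf l 0 x"] by (simp add: norm_mult)
      also have "\<dots> \<le> (a\<^sup>2 * sin x ^ k) * (2 * (sin x powr (- r0) * 1))"
      proof (rule mult_mono[OF tail[OF s(1)]])
        have "cmod (gf l 0 x) \<le> 2 * (sin x powr (- r0) * exp (- ((Yf l 0 x)\<^sup>2)))" by (rule gf_bounds(1)[OF s(1) l(1)])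
        also have "\<dots> \<le> 2 * (sin x powr (- r0) * 1)" by (intro mult_left_mono) auto
        finally show "cmod (gf l 0 x) \<le> 2 * (sin x powr (- r0) * 1)" .
      qed (use s a in auto)
      also have "\<dots> = 2 * a\<^sup>2 * (sin x powr (- r0) * sin x ^ k)" by simp
      also have "sin x powr (- r0) * sin x ^ k = sin x powr (- r0 + real k)"
        using s by (simp only: powr_add powr_realpow)
      also have "2 * a\<^sup>2 * sin x powr (- r0 + real k) \<le> 2 * a\<^sup>2 * 1"
        using s ksig by (intro mult_left_mono powr_le1) (auto simp: r0_def)
      finally show ?thesis by simp
    qed
    have "pd l 0 x = a * Re (packet \<sigma> l x * gf l 0 x) + Re (tail x * gf l 0 x)"
      unfolding pd_def W0[OF s(1)] distrib_right by (simp add: mult.assoc)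
    moreover have "a * (1 / 2 * ?F) \<le> a * Re (packet \<sigma> l x * gf l 0 x)" using r1 a by (intro mult_left_mono) auto
    ultimately show "?h x \<le> pd l 0 x" using r2 by (simp add: abs_le_iff)
  qed
  then have "a / 2 * integral ?I ?f - (pi - \<kappa> - \<kappa>) * (2 * a\<^sup>2) \<le> pairing \<kappa> l 0"
    unfolding pairing_def using integral_unique[OF hi] by linarith
  moreover have "a / 2 * (1 / 6) \<le> a / 2 * integral ?I ?f"
    using packet_weight_lower(1)[OF l(2) \<kappa>] a by (intro mult_left_mono) auto
  moreover have "(pi - \<kappa> - \<kappa>) * (2 * a\<^sup>2) \<le> pi * (2 * a\<^sup>2)" using \<kappa> by (intro mult_right_mono) auto
  ultimately show ?thesis by simp
qed

text \<open>The initial pairing is at most the final pairing plus the change in between. The energy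
  is O(a^2), so dividing it by the weight \<open>a\<close> leaves an error proportional to
  \<open>a\<close>.\<close>

lemma amplitude_inequality:
  assumes \<tau>: "\<tau> \<in> {0..T}"
  shows "a / 12 \<le> 2 * pi * a\<^sup>2 + 4 * pi * (2 ^ (k + 1) * M) * exp (- (2 * \<eta>\<^sup>2 * l * \<tau>)) + KI * (\<tau> * (1 + \<tau> * l)) * a"
proof (rule le_of_linear)
  fix r :: real assume r: "0 < r" "r \<le> 1"
  \<comment> \<open>The cut-off is proportional to the variable that tends to 0, and small enough
    not to cut away the packet.\<close>
  define \<kappa> where "\<kappa> = r / l\<^sup>2"
  have \<kappa>: "0 < \<kappa>" "\<kappa> \<le> 1 / l\<^sup>2" using r l by (auto simp: \<kappa>_def divide_right_mono)
  have k2: "\<kappa> < pi / 2" using packet_weight_lower(3)[OF l(2) \<kappa>] .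
  have K1: "0 \<le> K1" using cb_pos by (simp add: K1_def less_imp_le)
  have l0: "0 \<le> l" "0 \<le> \<tau>" using l \<tau> by auto
  have "a / 12 - 2 * pi * a\<^sup>2 \<le> \<bar>pairing \<kappa> l \<tau>\<bar> + \<bar>pairing \<kappa> l \<tau> - pairing \<kappa> l 0\<bar>"
    using initial_pairing[OF \<kappa>] by linarith
  also have "\<dots> \<le> 4 * pi * (2 ^ (k + 1) * M) * exp (- (2 * \<eta>\<^sup>2 * l * \<tau>))
    + (2 * KB * l * \<kappa> + 20 * KP * (1 + \<tau> * l) * ((K1 * energy \<kappa> 0 + K2 * \<kappa>) / a + 4 * pi * a)) * \<tau>"
    by (intro add_mono pairing_final[OF \<kappa>(1) k2 l(1) \<tau>] pairing_estimate[OF \<kappa>(1) k2 l(1) a(1) \<tau>])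
  also have "\<dots> \<le> 4 * pi * (2 ^ (k + 1) * M) * exp (- (2 * \<eta>\<^sup>2 * l * \<tau>))
    + (2 * KB * l * \<kappa> + 20 * KP * (1 + \<tau> * l) * ((K1 * (18 * pi * a\<^sup>2) + K2 * \<kappa>) / a + 4 * pi * a)) * \<tau>"
    using initial_energy[OF \<kappa>] K1 KP0 l0 a
    by (intro add_left_mono mult_right_mono mult_left_mono add_right_mono divide_right_mono) auto
  also have "\<dots> = 4 * pi * (2 ^ (k + 1) * M) * exp (- (2 * \<eta>\<^sup>2 * l * \<tau>)) + KI * (\<tau> * (1 + \<tau> * l)) * a
    + ((2 * KB * l + 20 * KP * (1 + \<tau> * l) * (K2 / a)) * \<tau> / l\<^sup>2) * r"
  proof -
    have "(K1 * (18 * pi * a\<^sup>2) + K2 * \<kappa>) / a = 18 * pi * K1 * a + K2 / a * \<kappa>"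
      using a by (simp add: power2_eq_square add_divide_distrib)
    moreover have "(2 * KB * l + 20 * KP * (1 + \<tau> * l) * (K2 / a)) * \<tau> / l\<^sup>2 * r = (2 * KB * l + 20 * KP * (1 + \<tau> * l) * (K2 / a)) * \<tau> * \<kappa>"
      by (simp add: \<kappa>_def)
    ultimately show ?thesis by (simp only: KI_def K1_def) (simp add: algebra_simps)
  qed
  finally show "a / 12 \<le> (2 * pi * a\<^sup>2 + 4 * pi * (2 ^ (k + 1) * M) * exp (- (2 * \<eta>\<^sup>2 * l * \<tau>)) + KI * (\<tau> * (1 + \<tau> * l)) * a)
     + ((2 * KB * l + 20 * KP * (1 + \<tau> * l) * (K2 / a)) * \<tau> / l\<^sup>2) * r" by simp
qed

end

end

section \<open>Choice of amplitude, frequency and time\<close>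

context parameters
begin

text \<open>The order of the quantifiers matters: the threshold depends on \<open>M\<close>,
  \<open>T0\<close> and the parameters, not on the solutions, on \<open>D\<close> or on the tail. It
  is reached once all terms of \<open>amplitude_inequality\<close>, divided by the amplitude, sum up
  to less than \<open>1 / 12\<close>.\<close>

lemma solutions_determined:
  assumes T0: "0 < T0"
  shows "\<exists>\<nu>0. \<forall>\<nu>\<ge>\<nu>0. \<forall>U V D tail. csol \<alpha> \<beta> \<mu> (k - 1) M T0 U \<longrightarrow> csol \<alpha> \<beta> \<mu> (k - 1) M T0 V \<longrightarrow>
     (\<forall>x. 0 \<le> sin x \<longrightarrow> norm (U 0 0 x - of_real (\<eta> * sin x)) \<le> \<eta> / 10 * sin x) \<longrightarrow>
     (\<forall>x. 0 \<le> sin x \<longrightarrow> norm (V 0 0 x - of_real (\<eta> * sin x)) \<le> \<eta> / 10 * sin x) \<longrightarrow>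
     (\<forall>x. norm (U 0 0 x - of_real (\<eta> * sin x)) \<le> D * (sin x)\<^sup>2) \<longrightarrow>
     (\<forall>x. norm (V 0 0 x - of_real (\<eta> * sin x)) \<le> D * (sin x)\<^sup>2) \<longrightarrow>
     (\<forall>x. norm (V 0 0 x - U 0 0 x) \<le> D * \<bar>sin x\<bar> ^ k) \<longrightarrow>
     (\<forall>x. 0 < sin x \<longrightarrow> V 0 0 x - U 0 0 x = of_real (exp (- \<nu>)) * packet \<sigma> (\<nu> ^ 5) x + tail x) \<longrightarrow>
     (\<forall>x. 0 < sin x \<longrightarrow> cmod (tail x) \<le> (exp (- \<nu>))\<^sup>2 * sin x ^ k) \<longrightarrow> False"
proof -
  define c1 where "c1 = 18 * A * M\<^sup>2 * fact k"
  define c2 where "c2 = 24 * A * M\<^sup>2 * (1 + \<bar>\<sigma>\<bar>)"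
  have c: "0 < c1" "0 < c2" using A1 M1 by (auto simp: c1_def c2_def intro!: mult_pos_pos)
  define T where "T = min T0 (min (1 / c1) (1 / c2))"
  have T: "0 < T" "T \<le> T0" "c1 * T \<le> 1" "c2 * T \<le> 1"
  proof -
    show "0 < T" "T \<le> T0" using T0 c by (auto simp: T_def)
    have "T \<le> 1 / c1" "T \<le> 1 / c2" by (auto simp: T_def)
    then have "c1 * T \<le> c1 * (1 / c1)" "c2 * T \<le> c2 * (1 / c2)" using c by (intro mult_left_mono; simp)+
    then show "c1 * T \<le> 1" "c2 * T \<le> 1" using c by auto
  qed
  \<comment> \<open>The right-hand side of \<open>amplitude_inequality\<close> divided by
    \<open>exp (- \<nu>)\<close>, for \<open>l = \<nu> ^ 5\<close> and
    \<open>\<tau> = 1 / \<nu> ^ 3\<close>. Time and frequency satisfy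
    \<open>l * \<tau> = \<nu>\<^sup>2\<close>, which defeats \<open>exp \<nu>\<close>, and
    \<open>l * \<tau>\<^sup>2 = 1 / \<nu>\<close>, which tends to 0.\<close>
  define G where "G = (\<lambda>\<nu>::real. 2 * pi * exp (- \<nu>) + 4 * pi * (2 ^ (k + 1) * M) * exp (\<nu> - 2 * \<eta>\<^sup>2 * \<nu>\<^sup>2) + KI * ((1 + \<nu>\<^sup>2) / \<nu> ^ 3))"
  have "(G \<longlongrightarrow> 2 * pi * 0 + 4 * pi * (2 ^ (k + 1) * M) * 0 + KI * 0) at_top"
  proof -
    have e2: "0 < \<eta>\<^sup>2" using eta by simp
    have 1: "((\<lambda>\<nu>::real. exp (- \<nu>)) \<longlongrightarrow> 0) at_top" by real_asymp
    have 2: "((\<lambda>\<nu>::real. exp (\<nu> - 2 * b * \<nu>\<^sup>2)) \<longlongrightarrow> 0) at_top" if "0 < b" for b :: real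
      using that by real_asymp
    have 3: "((\<lambda>\<nu>::real. (1 + \<nu>\<^sup>2) / \<nu> ^ 3) \<longlongrightarrow> 0) at_top" by real_asymp
    show ?thesis unfolding G_def by (intro tendsto_intros 1 2[OF e2] 3)
  qed
  then have "(G \<longlongrightarrow> 0) at_top" by simp
  then have ev1: "eventually (\<lambda>\<nu>. G \<nu> < 1 / 12) at_top" by (rule order_tendstoD) simp
  have ev2: "eventually (\<lambda>\<nu>::real. A \<le> \<nu> ^ 5) at_top" by real_asymp
  have ev3: "eventually (\<lambda>\<nu>::real. 1 / \<nu> ^ 3 \<le> T) at_top" using T(1) by real_asymp
  have ev: "eventually (\<lambda>\<nu>::real. G \<nu> < 1 / 12 \<and> A \<le> \<nu> ^ 5 \<and> 1 / \<nu> ^ 3 \<le> T \<and> 2 \<le> \<nu>) at_top"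
    by (intro eventually_conj ev1 ev2 ev3 eventually_ge_at_top)
  then obtain \<nu>0 where \<nu>0: "\<And>\<nu>. \<nu>0 \<le> \<nu> \<Longrightarrow> G \<nu> < 1 / 12 \<and> A \<le> \<nu> ^ 5 \<and> 1 / \<nu> ^ 3 \<le> T \<and> 2 \<le> \<nu>"
    unfolding eventually_at_top_linorder by blast
  show ?thesis
  proof (intro exI[of _ \<nu>0] allI impI)
    fix \<nu> U V D tail
    assume \<nu>: "\<nu>0 \<le> \<nu>"
      and cU: "csol \<alpha> \<beta> \<mu> (k - 1) M T0 U" and cV: "csol \<alpha> \<beta> \<mu> (k - 1) M T0 V"
      and d1: "\<forall>x. 0 \<le> sin x \<longrightarrow> norm (U 0 0 x - of_real (\<eta> * sin x)) \<le> \<eta> / 10 * sin x"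
      and d2: "\<forall>x. 0 \<le> sin x \<longrightarrow> norm (V 0 0 x - of_real (\<eta> * sin x)) \<le> \<eta> / 10 * sin x"
      and f1: "\<forall>x. norm (U 0 0 x - of_real (\<eta> * sin x)) \<le> D * (sin x)\<^sup>2"
      and f2: "\<forall>x. norm (V 0 0 x - of_real (\<eta> * sin x)) \<le> D * (sin x)\<^sup>2"
      and f3: "\<forall>x. norm (V 0 0 x - U 0 0 x) \<le> D * \<bar>sin x\<bar> ^ k"
      and w: "\<forall>x. 0 < sin x \<longrightarrow> V 0 0 x - U 0 0 x = of_real (exp (- \<nu>)) * packet \<sigma> (\<nu> ^ 5) x + tail x"
      and tl: "\<forall>x. 0 < sin x \<longrightarrow> cmod (tail x) \<le> (exp (- \<nu>))\<^sup>2 * sin x ^ k"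
    interpret two_solutions \<alpha> \<beta> \<sigma> \<eta> M \<mu> k T D U V
    proof
      show "csol \<alpha> \<beta> \<mu> (k - 1) M T U" "csol \<alpha> \<beta> \<mu> (k - 1) M T V"
        using csol_mono[OF cU order.refl T(2)] csol_mono[OF cV order.refl T(2)] by auto
      show "0 < T" "18 * A * M\<^sup>2 * fact k * T \<le> 1" "24 * A * M\<^sup>2 * (1 + \<bar>\<sigma>\<bar>) * T \<le> 1"
        using T by (auto simp: c1_def c2_def)
    qed (use d1 d2 f1 f2 f3 in blast)+
    note F = \<nu>0[OF \<nu>]
    let ?l = "\<nu> ^ 5" and ?a = "exp (- \<nu>)" and ?\<tau> = "1 / \<nu> ^ 3"
    have \<nu>2: "2 \<le> \<nu>" using F by simp
    have l: "A \<le> ?l" "2 \<le> ?l"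
    proof -
      show "A \<le> ?l" using F by simp
      have "2 ^ 1 \<le> \<nu> ^ 1" using \<nu>2 by simp
      also have "\<nu> ^ 1 \<le> ?l" using \<nu>2 by (intro power_increasing) auto
      finally show "2 \<le> ?l" by simp
    qed
    have \<tau>: "?\<tau> \<in> {0..T}" using F \<nu>2 by auto
    have "?a / 12 \<le> 2 * pi * ?a\<^sup>2 + 4 * pi * (2 ^ (k + 1) * M) * exp (- (2 * \<eta>\<^sup>2 * ?l * ?\<tau>)) + KI * (?\<tau> * (1 + ?\<tau> * ?l)) * ?a"
    proof (rule amplitude_inequality[of ?l ?a tail ?\<tau>, OF l _ _ _ _ \<tau>])
      show "W 0 0 x = of_real ?a * packet \<sigma> ?l x + tail x" if "0 < sin x" for x
        using w that by (simp add: W_def)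
      show "cmod (tail x) \<le> ?a\<^sup>2 * sin x ^ k" if "0 < sin x" for x using tl that by blast
    qed (use \<nu>2 in auto)
    also have "2 * \<eta>\<^sup>2 * ?l * ?\<tau> = 2 * \<eta>\<^sup>2 * \<nu>\<^sup>2" using \<nu>2 by (simp add: field_simps power_numeral_reduce)
    also have "?\<tau> * (1 + ?\<tau> * ?l) = (1 + \<nu>\<^sup>2) / \<nu> ^ 3" using \<nu>2 by (simp add: field_simps power_numeral_reduce)
    also have "2 * pi * ?a\<^sup>2 + 4 * pi * (2 ^ (k + 1) * M) * exp (- (2 * \<eta>\<^sup>2 * \<nu>\<^sup>2)) + KI * ((1 + \<nu>\<^sup>2) / \<nu> ^ 3) * ?a = ?a * G \<nu>"
    proof -
      have "exp (- (2 * \<eta>\<^sup>2 * \<nu>\<^sup>2)) = ?a * exp (\<nu> - 2 * \<eta>\<^sup>2 * \<nu>\<^sup>2)" by (simp flip: exp_add)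
      then show ?thesis unfolding G_def by (simp only: power2_eq_square[of ?a] algebra_simps)
    qed
    finally have "?a * (1 / 12) \<le> ?a * G \<nu>" by simp
    then have "1 / 12 \<le> G \<nu>" by (simp only: mult_le_cancel_left_pos exp_gt_zero)
    then show False using F by simp
  qed
qed

end

section \<open>Smoothness of packets\<close>

text \<open>A class of functions of the packet parameter \<open>\<nu>\<close> and of \<open>x\<close> that is closed under
  differentiation in \<open>x\<close> and whose members are bounded by powers of \<open>\<nu> / sin x\<close>.\<close>

inductive symbol :: "(real \<Rightarrow> real \<Rightarrow> complex) \<Rightarrow> bool" where
  symbol_const: "symbol (\<lambda>\<nu> x. c)"
| symbol_nu: "symbol (\<lambda>\<nu> x. of_real \<nu>)"
| symbol_ln_nu: "symbol (\<lambda>\<nu> x. of_real (ln \<nu>))"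
| symbol_sin: "symbol (\<lambda>\<nu> x. of_real (sin x))"
| symbol_cos: "symbol (\<lambda>\<nu> x. of_real (cos x))"
| symbol_csc: "symbol (\<lambda>\<nu> x. of_real (1 / sin x))"
| symbol_ln_sin: "symbol (\<lambda>\<nu> x. of_real (ln (sin x)))"
| symbol_add: "symbol f \<Longrightarrow> symbol g \<Longrightarrow> symbol (\<lambda>\<nu> x. f \<nu> x + g \<nu> x)"
| symbol_mult: "symbol f \<Longrightarrow> symbol g \<Longrightarrow> symbol (\<lambda>\<nu> x. f \<nu> x * g \<nu> x)"

lemma has_vector_derivative_complex_of_real:
  "(f has_real_derivative f') F \<Longrightarrow> ((\<lambda>x. complex_of_real (f x)) has_vector_derivative of_real f') F"
  unfolding has_real_derivative_iff_has_vector_derivative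
  by (rule bounded_linear.has_vector_derivative[OF bounded_linear_of_real])

lemma symbol_derivative:
  "symbol f \<Longrightarrow> \<exists>f'. symbol f' \<and> (\<forall>\<nu> x. 0 < sin x \<longrightarrow> ((\<lambda>x. f \<nu> x) has_vector_derivative f' \<nu> x) (at x))"
proof (induction rule: symbol.induct)
  case (symbol_const c)
  then show ?case using symbol.symbol_const[of 0] by (intro exI[of _ "\<lambda>\<nu> x. 0"]) auto
next
  case symbol_nu
  then show ?case using symbol.symbol_const[of 0] by (intro exI[of _ "\<lambda>\<nu> x. 0"]) auto
next
  case symbol_ln_nu
  then show ?case using symbol.symbol_const[of 0] by (intro exI[of _ "\<lambda>\<nu> x. 0"]) auto
next
  case symbol_sin
  have "((\<lambda>x. complex_of_real (sin x)) has_vector_derivative of_real (cos x)) (at x)" for x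
    by (rule has_vector_derivative_complex_of_real) (auto intro!: derivative_eq_intros)
  then show ?case using symbol.symbol_cos by blast
next
  case symbol_cos
  have "((\<lambda>x. complex_of_real (cos x)) has_vector_derivative of_real (- sin x)) (at x)" for x
    by (rule has_vector_derivative_complex_of_real) (auto intro!: derivative_eq_intros)
  then have "((\<lambda>x. complex_of_real (cos x)) has_vector_derivative (- 1) * of_real (sin x)) (at x)" for x by simp
  then show ?case using symbol.symbol_mult[OF symbol.symbol_const[of "- 1"] symbol.symbol_sin] by blast
next
  case symbol_csc
  have "((\<lambda>x. complex_of_real (1 / sin x)) has_vector_derivative ((- 1) * of_real (cos x)) * (of_real (1 / sin x) * of_real (1 / sin x))) (at x)"
    if "0 < sin x" for x
  proof -
    have "((\<lambda>x. 1 / sin x) has_real_derivative (- 1 * cos x) * (1 / sin x * (1 / sin x))) (at x)"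
      using that by (auto intro!: derivative_eq_intros simp: power2_eq_square)
    from has_vector_derivative_complex_of_real[OF this] show ?thesis by simp
  qed
  then show ?case
    using symbol.symbol_mult[OF symbol.symbol_mult[OF symbol.symbol_const[of "- 1"] symbol.symbol_cos] symbol.symbol_mult[OF symbol.symbol_csc symbol.symbol_csc]]
    by blast
next
  case symbol_ln_sin
  have "((\<lambda>x. complex_of_real (ln (sin x))) has_vector_derivative of_real (cos x) * of_real (1 / sin x)) (at x)" if "0 < sin x" for x
  proof -
    have "((\<lambda>x. ln (sin x)) has_real_derivative cos x * (1 / sin x)) (at x)"
      using that by (auto intro!: derivative_eq_intros)
    from has_vector_derivative_complex_of_real[OF this] show ?thesis by simp
  qed
  then show ?case using symbol.symbol_mult[OF symbol.symbol_cos symbol.symbol_csc] by blast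
next
  case (symbol_add f g)
  then obtain f' g' where "symbol f'" "symbol g'"
    "\<And>\<nu> x. 0 < sin x \<Longrightarrow> ((\<lambda>x. f \<nu> x) has_vector_derivative f' \<nu> x) (at x)"
    "\<And>\<nu> x. 0 < sin x \<Longrightarrow> ((\<lambda>x. g \<nu> x) has_vector_derivative g' \<nu> x) (at x)" by blast
  then show ?case
    by (intro exI[of _ "\<lambda>\<nu> x. f' \<nu> x + g' \<nu> x"]) (auto intro: symbol.symbol_add has_vector_derivative_add)
next
  case (symbol_mult f g)
  then obtain f' g' where d: "symbol f'" "symbol g'"
    "\<And>\<nu> x. 0 < sin x \<Longrightarrow> ((\<lambda>x. f \<nu> x) has_vector_derivative f' \<nu> x) (at x)"
    "\<And>\<nu> x. 0 < sin x \<Longrightarrow> ((\<lambda>x. g \<nu> x) has_vector_derivative g' \<nu> x) (at x)" by blast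
  have "symbol (\<lambda>\<nu> x. f \<nu> x * g' \<nu> x + f' \<nu> x * g \<nu> x)"
    using d symbol_mult by (intro symbol.symbol_add symbol.symbol_mult)
  then show ?case using d(3,4) has_vector_derivative_mult by blast
qed

lemma symbol_bound:
  "symbol f \<Longrightarrow> \<exists>K N. 0 \<le> K \<and> (\<forall>\<nu>\<ge>1. \<forall>x. 0 < sin x \<longrightarrow> cmod (f \<nu> x) \<le> K * (\<nu> / sin x) ^ N)"
proof (induction rule: symbol.induct)
  have one: "1 \<le> \<nu> / sin x" if "1 \<le> \<nu>" "0 < sin x" for \<nu> x :: real
    using that sin_le_one[of x] by (simp add: le_divide_eq del: sin_le_one)
  {
    case (symbol_const c)
    then show ?case by (intro exI[of _ "cmod c"] exI[of _ 0]) auto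
  next
    case symbol_nu
    have "\<nu> \<le> \<nu> / sin x" if "1 \<le> \<nu>" "0 < sin x" for \<nu> x :: real
    proof -
      have "\<nu> * sin x \<le> \<nu> * 1" using that by (intro mult_left_mono) auto
      then show ?thesis using that by (simp add: le_divide_eq)
    qed
    then show ?case by (intro exI[of _ 1] exI[of _ 1]) auto
  next
    case symbol_ln_nu
    have "\<bar>ln \<nu>\<bar> \<le> \<nu> / sin x" if "1 \<le> \<nu>" "0 < sin x" for \<nu> x :: real
    proof -
      have "\<nu> * sin x \<le> \<nu> * 1" using that by (intro mult_left_mono) auto
      then have "\<nu> \<le> \<nu> / sin x" using that by (simp add: le_divide_eq)
      moreover have "ln \<nu> \<le> \<nu>" "0 \<le> ln \<nu>" using that ln_bound[of \<nu>] by auto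
      ultimately show ?thesis by simp
    qed
    then show ?case by (intro exI[of _ 1] exI[of _ 1]) auto
  next
    case symbol_sin
    then show ?case by (intro exI[of _ 1] exI[of _ 0]) auto
  next
    case symbol_cos
    then show ?case by (intro exI[of _ 1] exI[of _ 0]) auto
  next
    case symbol_csc
    have "1 / sin x \<le> \<nu> / sin x" if "1 \<le> \<nu>" "0 < sin x" for \<nu> x :: real
      using that by (intro divide_right_mono) auto
    then show ?case by (intro exI[of _ 1] exI[of _ 1]) (auto simp: norm_divide)
  next
    case symbol_ln_sin
    have "\<bar>ln (sin x)\<bar> \<le> \<nu> / sin x" if "1 \<le> \<nu>" "0 < sin x" for \<nu> x :: real
    proof -
      have "ln (1 / sin x) \<le> 1 / sin x" using that by (intro ln_bound) auto
      moreover have "ln (sin x) \<le> 0" using that by simp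
      moreover have "1 / sin x \<le> \<nu> / sin x" using that by (intro divide_right_mono) auto
      ultimately show ?thesis using that by (simp add: ln_div)
    qed
    then show ?case by (intro exI[of _ 1] exI[of _ 1]) auto
  next
    case (symbol_add f g)
    then obtain K N K' N' where K: "0 \<le> K" "0 \<le> K'"
      "\<And>\<nu> x. 1 \<le> \<nu> \<Longrightarrow> 0 < sin x \<Longrightarrow> cmod (f \<nu> x) \<le> K * (\<nu> / sin x) ^ N"
      "\<And>\<nu> x. 1 \<le> \<nu> \<Longrightarrow> 0 < sin x \<Longrightarrow> cmod (g \<nu> x) \<le> K' * (\<nu> / sin x) ^ N'" by blast
    have "cmod (f \<nu> x + g \<nu> x) \<le> (K + K') * (\<nu> / sin x) ^ (N + N')" if a: "1 \<le> \<nu>" "0 < sin x" for \<nu> x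
    proof -
      have "K * (\<nu> / sin x) ^ N \<le> K * (\<nu> / sin x) ^ (N + N')" "K' * (\<nu> / sin x) ^ N' \<le> K' * (\<nu> / sin x) ^ (N + N')"
        using one[OF a] K by (auto intro!: mult_left_mono power_increasing)
      then show ?thesis using K(3,4)[OF a] norm_triangle_ineq[of "f \<nu> x" "g \<nu> x"] by (simp add: distrib_right)
    qed
    then show ?case using K by (intro exI[of _ "K + K'"] exI[of _ "N + N'"]) auto
  next
    case (symbol_mult f g)
    then obtain K N K' N' where K: "0 \<le> K" "0 \<le> K'"
      "\<And>\<nu> x. 1 \<le> \<nu> \<Longrightarrow> 0 < sin x \<Longrightarrow> cmod (f \<nu> x) \<le> K * (\<nu> / sin x) ^ N"
      "\<And>\<nu> x. 1 \<le> \<nu> \<Longrightarrow> 0 < sin x \<Longrightarrow> cmod (g \<nu> x) \<le> K' * (\<nu> / sin x) ^ N'" by blast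
    have "cmod (f \<nu> x * g \<nu> x) \<le> (K * K') * (\<nu> / sin x) ^ (N + N')" if a: "1 \<le> \<nu>" "0 < sin x" for \<nu> x
    proof -
      have "cmod (f \<nu> x) * cmod (g \<nu> x) \<le> (K * (\<nu> / sin x) ^ N) * (K' * (\<nu> / sin x) ^ N')"
        using K(3,4)[OF a] K a by (intro mult_mono) auto
      then show ?thesis by (simp add: norm_mult power_add mult_ac)
    qed
    then show ?case using K by (intro exI[of _ "K * K'"] exI[of _ "N + N'"]) auto
  }
qed

lemma power_le_exp_half:
  fixes x :: real
  assumes "0 \<le> x"
  shows "x ^ B \<le> (2 * real B) ^ B * exp (x / 2)"
proof (cases "B = 0")
  case False
  have "(x / (2 * real B)) ^ B \<le> (exp (x / (2 * real B))) ^ B"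
  proof (rule power_mono)
    show "x / (2 * real B) \<le> exp (x / (2 * real B))"
      using exp_ge_add_one_self[of "x / (2 * real B)"] by linarith
  qed (use assms in simp)
  also have "\<dots> = exp (real B * (x / (2 * real B)))" by (rule exp_of_nat_mult[symmetric])
  also have "real B * (x / (2 * real B)) = x / 2" using False by simp
  finally have "(2 * real B) ^ B * (x / (2 * real B)) ^ B \<le> (2 * real B) ^ B * exp (x / 2)"
    by (intro mult_left_mono) auto
  then show ?thesis unfolding power_mult_distrib[symmetric] using False by simp
qed (use assms in simp)

text \<open>The logarithmic derivative is spelled out, with the fifth power as a repeated product,
  so that the rules of \<open>symbol\<close> apply to it literally.\<close>

lemma packet_derivative:
  assumes \<nu>: "0 < \<nu>" and x: "0 < sin x"
  shows "((\<lambda>x. packet \<sigma> (\<nu> ^ 5) x) has_vector_derivative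
     (of_real (cos x) * of_real (1 / sin x)) * ((of_real (\<sigma> - 1 / 2) + (- 2) * (of_real (ln (sin x)) + 10 * of_real (ln \<nu>)))
       + (- \<i>) * (of_real \<nu> * (of_real \<nu> * (of_real \<nu> * (of_real \<nu> * of_real \<nu>))))) * packet \<sigma> (\<nu> ^ 5) x) (at x)"
proof -
  have ln: "((\<lambda>x. ln (sin x)) has_real_derivative cos x / sin x) (at x)" using x by (auto intro!: derivative_eq_intros)
  have ln5: "2 * ln (\<nu> ^ 5) = 10 * ln \<nu>" using \<nu> by (simp add: ln_realpow)
  have q: "((\<lambda>x. ln (sin x) + 10 * ln \<nu>) has_real_derivative cos x / sin x) (at x)"
    using DERIV_add[OF ln DERIV_const[of "10 * ln \<nu>"]] by simp
  have a: "((\<lambda>x. (\<sigma> - 1 / 2) * ln (sin x) - (ln (sin x) + 10 * ln \<nu>)\<^sup>2) has_real_derivative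
      (cos x / sin x) * ((\<sigma> - 1 / 2) - 2 * (ln (sin x) + 10 * ln \<nu>))) (at x)"
    unfolding power2_eq_square
    by (rule DERIV_cong[OF DERIV_diff[OF DERIV_cmult[OF ln] DERIV_mult[OF q q]]]) (simp add: algebra_simps)
  have b: "((\<lambda>x. - (\<nu> ^ 5 * ln (sin x))) has_real_derivative (cos x / sin x) * (- (\<nu> ^ 5))) (at x)"
    by (rule DERIV_cong[OF DERIV_minus[OF DERIV_cmult[OF ln]]]) simp
  have e: "Complex ((cos x / sin x) * ((\<sigma> - 1 / 2) - 2 * (ln (sin x) + 10 * ln \<nu>))) ((cos x / sin x) * (- (\<nu> ^ 5)))
    = (of_real (cos x) * of_real (1 / sin x)) * ((of_real (\<sigma> - 1 / 2) + (- 2) * (of_real (ln (sin x)) + 10 * of_real (ln \<nu>)))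
       + (- \<i>) * (of_real \<nu> * (of_real \<nu> * (of_real \<nu> * (of_real \<nu> * of_real \<nu>)))))"
    by (simp add: complex_eq_iff power_numeral_reduce)
  show ?thesis
    using has_vector_derivative_exp_comp[OF has_vector_derivative_Complex[OF a b]]
    unfolding packet_def ln5 e .
qed

text \<open>\<open>Tf n\<close> is the factor in front of the packet in its derivative of order
  \<open>n\<close>. \<open>symbol_derivative\<close> is existential, so the factors are obtained by
  dependent choice; the next one is \<open>Tf n\<close> times the logarithmic derivative plus the
  derivative of \<open>Tf n\<close>.\<close>

lemma packet_symbols:
  "\<exists>Tf. Tf 0 = (\<lambda>\<nu> x. 1) \<and> (\<forall>n. symbol (Tf n) \<and> (\<forall>\<nu>>0. \<forall>x. 0 < sin x \<longrightarrow>
     ((\<lambda>x. Tf n \<nu> x * packet \<sigma> (\<nu> ^ 5) x) has_vector_derivative Tf (Suc n) \<nu> x * packet \<sigma> (\<nu> ^ 5) x) (at x)))"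
proof -
  let ?P = "\<lambda>(n::nat) f. symbol f \<and> (n = 0 \<longrightarrow> f = (\<lambda>\<nu> x. 1))"
  let ?Q = "\<lambda>(n::nat) f g. \<forall>\<nu>>0. \<forall>x. 0 < sin x \<longrightarrow>
     ((\<lambda>x. f \<nu> x * packet \<sigma> (\<nu> ^ 5) x) has_vector_derivative g \<nu> x * packet \<sigma> (\<nu> ^ 5) x) (at x)"
  have "\<exists>Tf. \<forall>n. ?P n (Tf n) \<and> ?Q n (Tf n) (Tf (Suc n))"
  proof (rule dependent_nat_choice)
    show "\<exists>f. ?P 0 f" using symbol_const[of 1] by blast
  next
    fix f n assume "?P n f"
    then have f: "symbol f" by blast
    then obtain f' where f': "symbol f'" "\<And>\<nu> x. 0 < sin x \<Longrightarrow> ((\<lambda>x. f \<nu> x) has_vector_derivative f' \<nu> x) (at x)"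
      using symbol_derivative by blast
    define q :: "real \<Rightarrow> real \<Rightarrow> complex" where
      "q = (\<lambda>\<nu> x. (of_real (cos x) * of_real (1 / sin x)) * ((of_real (\<sigma> - 1 / 2) + (- 2) * (of_real (ln (sin x)) + 10 * of_real (ln \<nu>)))
       + (- \<i>) * (of_real \<nu> * (of_real \<nu> * (of_real \<nu> * (of_real \<nu> * of_real \<nu>))))))"
    have q: "symbol q" unfolding q_def by (intro symbol.intros)
    define g where "g = (\<lambda>\<nu> x. f \<nu> x * q \<nu> x + f' \<nu> x)"
    have "symbol g" unfolding g_def by (intro symbol.intros f q f')
    moreover have "((\<lambda>x. f \<nu> x * packet \<sigma> (\<nu> ^ 5) x) has_vector_derivative g \<nu> x * packet \<sigma> (\<nu> ^ 5) x) (at x)"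
      if "0 < \<nu>" "0 < sin x" for \<nu> x
      using has_vector_derivative_mult[OF f'(2)[OF that(2), of \<nu>] packet_derivative[OF that, of \<sigma>]]
      unfolding g_def q_def by (simp add: algebra_simps)
    ultimately show "\<exists>g. ?P (Suc n) g \<and> ?Q n f g" by blast
  qed
  then obtain Tf where Tf: "\<And>n. ?P n (Tf n) \<and> ?Q n (Tf n) (Tf (Suc n))" by blast
  show ?thesis by (rule exI[of _ Tf]) (use Tf in blast)
qed

text \<open>In \<open>y = ln (sin x)\<close> the Gaussian dominates every power of
  \<open>sin x\<close>, at the price of a power of \<open>\<nu>\<close>, because its centre is at
  \<open>- 10 * ln \<nu>\<close>. Half of the amplitude \<open>exp (- \<nu>)\<close> pays for that
  power.\<close>

lemma packet_decay:
  assumes f: "symbol f"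
  shows "\<exists>C\<ge>0. \<forall>\<nu>\<ge>1. \<forall>x. 0 < sin x \<longrightarrow> exp (- \<nu>) * cmod (f \<nu> x * packet \<sigma> (\<nu> ^ 5) x) \<le> C * exp (- \<nu> / 2) * sin x ^ q"
proof -
  obtain K N where K: "0 \<le> K" "\<And>\<nu> x. 1 \<le> \<nu> \<Longrightarrow> 0 < sin x \<Longrightarrow> cmod (f \<nu> x) \<le> K * (\<nu> / sin x) ^ N"
    using symbol_bound[OF f] by blast
  define c where "c = \<sigma> - 1 / 2 - real N - real q"
  \<comment> \<open>The power of \<open>\<nu>\<close> left after completing the square in
    \<open>y + 10 * ln \<nu>\<close>: \<open>c\<close> is the exponent of \<open>sin x\<close> still
    to be absorbed, and shifting it to the centre costs \<open>- 10 * c\<close>.\<close>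
  define B where "B = N + nat \<lceil>10 * \<bar>c\<bar>\<rceil>"
  have B: "real N - 10 * c \<le> real B" unfolding B_def by linarith
  define C where "C = K * exp (c\<^sup>2 / 4) * (2 * real B) ^ B"
  have "exp (- \<nu>) * cmod (f \<nu> x * packet \<sigma> (\<nu> ^ 5) x) \<le> C * exp (- \<nu> / 2) * sin x ^ q" if \<nu>: "1 \<le> \<nu>" and x: "0 < sin x" for \<nu> x
  proof -
    let ?y = "ln (sin x)" and ?m = "ln \<nu>"
    have ln5: "2 * ln (\<nu> ^ 5) = 10 * ?m" using \<nu> by (simp add: ln_realpow)
    have p: "cmod (packet \<sigma> (\<nu> ^ 5) x) = exp ((\<sigma> - 1 / 2) * ?y - (?y + 10 * ?m)\<^sup>2)"
      unfolding packet_def ln5 by simp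
    have r: "(\<nu> / sin x) ^ N = exp (real N * (?m - ?y))"
    proof -
      have "\<nu> / sin x = exp (?m - ?y)" using \<nu> x by (simp add: exp_diff)
      then show ?thesis by (simp add: exp_of_nat_mult)
    qed
    have s: "sin x ^ q = exp (real q * ?y)" using x by (simp add: exp_of_nat_mult)
    have "cmod (f \<nu> x * packet \<sigma> (\<nu> ^ 5) x) \<le> K * exp (real N * (?m - ?y)) * exp ((\<sigma> - 1 / 2) * ?y - (?y + 10 * ?m)\<^sup>2)"
      unfolding norm_mult p using K(2)[OF \<nu> x] unfolding r by (intro mult_right_mono) auto
    also have "\<dots> = K * exp (real N * (?m - ?y) + ((\<sigma> - 1 / 2) * ?y - (?y + 10 * ?m)\<^sup>2))" by (simp add: exp_add)
    also have "\<dots> \<le> K * exp (c\<^sup>2 / 4 + (real B * ?m + real q * ?y))"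
    proof -
      have "0 \<le> (?y + 10 * ?m - c / 2)\<^sup>2" by simp
      then have sq: "c * (?y + 10 * ?m) - (?y + 10 * ?m)\<^sup>2 \<le> c\<^sup>2 / 4" by (simp add: power2_eq_square algebra_simps)
      have "(real N - 10 * c) * ?m \<le> real B * ?m" using B \<nu> by (intro mult_right_mono) auto
      then have "real N * (?m - ?y) + ((\<sigma> - 1 / 2) * ?y - (?y + 10 * ?m)\<^sup>2) \<le> c\<^sup>2 / 4 + (real B * ?m + real q * ?y)"
        using sq unfolding c_def by (simp add: algebra_simps)
      then show ?thesis using K by (intro mult_left_mono) auto
    qed
    also have "\<dots> = K * exp (c\<^sup>2 / 4) * \<nu> ^ B * sin x ^ q"
      unfolding s exp_add using \<nu> by (simp add: exp_of_nat_mult mult_ac)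
    also have "\<dots> \<le> K * exp (c\<^sup>2 / 4) * ((2 * real B) ^ B * exp (\<nu> / 2)) * sin x ^ q"
      using power_le_exp_half[of \<nu> B] \<nu> K x by (intro mult_right_mono mult_left_mono) auto
    finally have "exp (- \<nu>) * cmod (f \<nu> x * packet \<sigma> (\<nu> ^ 5) x) \<le> exp (- \<nu>) * (C * exp (\<nu> / 2) * sin x ^ q)"
      unfolding C_def by (intro mult_left_mono) (auto simp: mult_ac)
    also have "\<dots> = C * (exp (- \<nu>) * exp (\<nu> / 2)) * sin x ^ q" by simp
    also have "exp (- \<nu>) * exp (\<nu> / 2) = exp (- \<nu> / 2)" unfolding exp_add[symmetric] by (rule arg_cong[where f=exp]) simp
    finally show ?thesis .
  qed
  moreover have "0 \<le> C" using K by (simp add: C_def)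
  ultimately show ?thesis by blast
qed

section \<open>The initial data\<close>

text \<open>\<open>F n\<close> is the derivative of order \<open>n\<close> of the packet extended by
  0 to \<open>sin x \<le> 0\<close>. The locale keeps only the two properties on which the
  superposition rests: differentiability and flatness of every order.\<close>

locale packet_family =
  fixes \<sigma> :: real and F :: "nat \<Rightarrow> real \<Rightarrow> real \<Rightarrow> complex"
  assumes F_0: "F 0 \<nu> x = (if 0 < sin x then packet \<sigma> (\<nu> ^ 5) x else 0)"
    and F_deriv: "1 \<le> \<nu> \<Longrightarrow> (F n \<nu> has_vector_derivative F (Suc n) \<nu> x) (at x)"
    and F_decay: "\<exists>C\<ge>0. \<forall>\<nu>\<ge>1. \<forall>x. exp (- \<nu>) * cmod (F n \<nu> x) \<le> C * exp (- \<nu> / 2) * \<bar>sin x\<bar> ^ q"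

text \<open>Off the zeros of \<open>sin\<close> one branch is valid on an open set. At a zero, the
  decay with \<open>q = 2\<close> is a quadratic remainder bound with derivative 0.\<close>

lemma packet_family_exists: "\<exists>F. packet_family \<sigma> F"
proof -
  obtain Tf where T0: "Tf 0 = (\<lambda>\<nu> x. 1)" and Ts: "\<And>n. symbol (Tf n)"
    and Td: "\<And>n \<nu> x. 0 < \<nu> \<Longrightarrow> 0 < sin x \<Longrightarrow>
      ((\<lambda>x. Tf n \<nu> x * packet \<sigma> (\<nu> ^ 5) x) has_vector_derivative Tf (Suc n) \<nu> x * packet \<sigma> (\<nu> ^ 5) x) (at x)"
    using packet_symbols[of \<sigma>] by blast
  define F where "F = (\<lambda>n \<nu> x. if 0 < sin x then Tf n \<nu> x * packet \<sigma> (\<nu> ^ 5) x else 0)"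
  have dec: "\<exists>C\<ge>0. \<forall>\<nu>\<ge>1. \<forall>x. exp (- \<nu>) * cmod (F n \<nu> x) \<le> C * exp (- \<nu> / 2) * \<bar>sin x\<bar> ^ q" for n q
  proof -
    obtain C where C: "0 \<le> C" "\<And>\<nu> x. 1 \<le> \<nu> \<Longrightarrow> 0 < sin x \<Longrightarrow> exp (- \<nu>) * cmod (Tf n \<nu> x * packet \<sigma> (\<nu> ^ 5) x) \<le> C * exp (- \<nu> / 2) * sin x ^ q"
      using packet_decay[OF Ts, of n \<sigma> q] by blast
    have "exp (- \<nu>) * cmod (F n \<nu> x) \<le> C * exp (- \<nu> / 2) * \<bar>sin x\<bar> ^ q" if "1 \<le> \<nu>" for \<nu> x
      using C(2)[OF that, of x] C(1) by (cases "0 < sin x") (auto simp: F_def)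
    then show ?thesis using C(1) by blast
  qed
  have "packet_family \<sigma> F"
  proof
    show "F 0 \<nu> x = (if 0 < sin x then packet \<sigma> (\<nu> ^ 5) x else 0)" for \<nu> x by (simp add: F_def T0)
    show "\<exists>C\<ge>0. \<forall>\<nu>\<ge>1. \<forall>x. exp (- \<nu>) * cmod (F n \<nu> x) \<le> C * exp (- \<nu> / 2) * \<bar>sin x\<bar> ^ q" for n q by (rule dec)
    fix \<nu> x :: real and n assume \<nu>: "1 \<le> \<nu>"
    consider "0 < sin x" | "sin x < 0" | "sin x = 0"
      by (rule linorder_cases[of "sin x" 0])
    then show "(F n \<nu> has_vector_derivative F (Suc n) \<nu> x) (at x)"
    proof cases
      case 1
      have op: "open {x::real. 0 < sin x}" by (intro open_Collect_less continuous_intros)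
      have "((\<lambda>x. Tf n \<nu> x * packet \<sigma> (\<nu> ^ 5) x) has_vector_derivative F (Suc n) \<nu> x) (at x)"
        using Td[of \<nu> x n] \<nu> 1 by (simp add: F_def)
      then show ?thesis
        by (rule has_vector_derivative_transform_within_open[OF _ op]) (use 1 in \<open>auto simp: F_def\<close>)
    next
      case 2
      have op: "open {x::real. sin x < 0}" by (intro open_Collect_less continuous_intros)
      have "((\<lambda>x. 0) has_vector_derivative F (Suc n) \<nu> x) (at x)" using 2 by (simp add: F_def)
      then show ?thesis
        by (rule has_vector_derivative_transform_within_open[OF _ op]) (use 2 in \<open>auto simp: F_def\<close>)
    next
      case 3
      obtain C where C: "0 \<le> C" "\<And>y. exp (- \<nu>) * cmod (F n \<nu> y) \<le> C * exp (- \<nu> / 2) * \<bar>sin y\<bar> ^ 2"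
        using dec[of n 2] \<nu> by blast
      have z: "F m \<nu> x = 0" for m using 3 by (simp add: F_def)
      show ?thesis
      proof (rule has_vector_derivative_of_quadratic_remainder)
        fix y
        have "cmod (F n \<nu> y) = exp \<nu> * (exp (- \<nu>) * cmod (F n \<nu> y))" by (simp add: exp_minus)
        also have "\<dots> \<le> exp \<nu> * (C * exp (- \<nu> / 2) * \<bar>sin y\<bar> ^ 2)" using C(2) by (intro mult_left_mono) auto
        also have "\<dots> \<le> exp \<nu> * (C * exp (- \<nu> / 2) * \<bar>y - x\<bar> ^ 2)"
          using abs_sin_le_dist[OF 3, of y] C(1) by (intro mult_left_mono power_mono) auto
        finally show "norm (F n \<nu> y - F n \<nu> x - (y - x) *\<^sub>R F (Suc n) \<nu> x) \<le> (exp \<nu> * (C * exp (- \<nu> / 2))) * (y - x)\<^sup>2"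
          by (simp add: z mult_ac)
      qed
    qed
  qed
  then show ?thesis by blast
qed

text \<open>The ratio 8 makes all packets after the first differing one together smaller than the
  square of its amplitude; the shift \<open>J\<close> makes the whole sum small.\<close>

definition freq :: "nat \<Rightarrow> nat \<Rightarrow> real" where "freq J j = 8 ^ (j + J)"

lemma freq_ge_1: "1 \<le> freq J j" by (simp add: freq_def)

lemma freq_sums: "summable (\<lambda>j. exp (- freq J j / 4))" "(\<Sum>j. exp (- freq J j / 4)) \<le> 8 / 8 ^ J"
proof -
  have le: "exp (- freq J j / 4) \<le> (4 / 8 ^ J) * (1 / 8) ^ j" for j
  proof -
    have p: "0 < freq J j" by (simp add: freq_def)
    have "freq J j / 4 \<le> exp (freq J j / 4)" using exp_ge_add_one_self[of "freq J j / 4"] by linarith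
    then have "1 / exp (freq J j / 4) \<le> 1 / (freq J j / 4)" using p by (intro divide_left_mono) auto
    then have "exp (- freq J j / 4) \<le> 4 / freq J j" by (simp add: exp_minus inverse_eq_divide)
    also have "\<dots> = (4 / 8 ^ J) * (1 / 8) ^ j" by (simp add: freq_def power_add power_divide)
    finally show ?thesis .
  qed
  have g: "(\<lambda>j. (4 / 8 ^ J) * (1 / 8 :: real) ^ j) sums ((4 / 8 ^ J) * (1 / (1 - 1 / 8)))"
    by (intro sums_mult geometric_sums) simp
  show s: "summable (\<lambda>j. exp (- freq J j / 4))"
    by (rule summable_comparison_test'[OF sums_summable[OF g], of 0]) (use le in auto)
  have "(\<Sum>j. exp (- freq J j / 4)) \<le> (\<Sum>j. (4 / 8 ^ J) * (1 / 8 :: real) ^ j)"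
    by (rule suminf_le[OF le s sums_summable[OF g]])
  also have "\<dots> = (4 / 8 ^ J) * (1 / (1 - 1 / 8))" using g by (rule sums_unique[symmetric])
  also have "\<dots> \<le> 8 / 8 ^ J" by (simp add: field_simps)
  finally show "(\<Sum>j. exp (- freq J j / 4)) \<le> 8 / 8 ^ J" .
qed

lemma norm_suminf_le_freq:
  fixes g :: "nat \<Rightarrow> complex"
  assumes "\<And>j. norm (g j) \<le> K * exp (- freq J j / 4)" and "0 \<le> K"
  shows "summable g" "norm (suminf g) \<le> K * (8 / 8 ^ J)"
proof -
  note s = summable_mult[OF freq_sums(1)[of J], of K]
  have n: "summable (\<lambda>j. norm (g j))"
    by (rule summable_comparison_test'[OF s, of 0]) (use assms in auto)
  then show "summable g" by (rule summable_norm_cancel)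
  have "norm (suminf g) \<le> (\<Sum>j. norm (g j))" by (rule summable_norm[OF n])
  also have "\<dots> \<le> (\<Sum>j. K * exp (- freq J j / 4))" by (rule suminf_le[OF assms(1) n s])
  also have "\<dots> = K * (\<Sum>j. exp (- freq J j / 4))" by (rule suminf_mult[OF freq_sums(1)])
  also have "\<dots> \<le> K * (8 / 8 ^ J)" using freq_sums(2) assms(2) by (intro mult_left_mono)
  finally show "norm (suminf g) \<le> K * (8 / 8 ^ J)" .
qed

context packet_family
begin

definition bump where "bump J S n x j = (if j \<in> S then exp (- freq J j) *\<^sub>R F n (freq J j) x else 0)"

definition bumps where "bumps J S n x = suminf (bump J S n x)"

text \<open>One constant per derivative and order of flatness, independent of \<open>J\<close> and
  of the set \<open>S\<close>, so that \<open>J\<close> can be chosen afterwards and uniformly in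
  \<open>S\<close>.\<close>

definition decay_const where
  "decay_const n q = (SOME C. 0 \<le> C \<and> (\<forall>\<nu>\<ge>1. \<forall>x. exp (- \<nu>) * cmod (F n \<nu> x) \<le> C * exp (- \<nu> / 2) * \<bar>sin x\<bar> ^ q))"

lemma decay_const: "0 \<le> decay_const n q"
  "1 \<le> \<nu> \<Longrightarrow> exp (- \<nu>) * cmod (F n \<nu> x) \<le> decay_const n q * exp (- \<nu> / 2) * \<bar>sin x\<bar> ^ q"
proof -
  have "\<exists>C. 0 \<le> C \<and> (\<forall>\<nu>\<ge>1. \<forall>x. exp (- \<nu>) * cmod (F n \<nu> x) \<le> C * exp (- \<nu> / 2) * \<bar>sin x\<bar> ^ q)"
    using F_decay[of n q] by blast
  from someI_ex[OF this] show "0 \<le> decay_const n q"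
    "1 \<le> \<nu> \<Longrightarrow> exp (- \<nu>) * cmod (F n \<nu> x) \<le> decay_const n q * exp (- \<nu> / 2) * \<bar>sin x\<bar> ^ q"
    unfolding decay_const_def by blast+
qed

lemma norm_bump_le: "norm (bump J S n x j) \<le> decay_const n q * \<bar>sin x\<bar> ^ q * exp (- freq J j / 4)"
proof -
  have "exp (- freq J j) * cmod (F n (freq J j) x) \<le> decay_const n q * exp (- freq J j / 2) * \<bar>sin x\<bar> ^ q"
    by (rule decay_const(2)[OF freq_ge_1])
  also have "\<dots> \<le> decay_const n q * exp (- freq J j / 4) * \<bar>sin x\<bar> ^ q"
    using decay_const(1)[of n q] freq_ge_1[of J j] by (intro mult_right_mono mult_left_mono) auto
  finally show ?thesis using decay_const(1)[of n q] by (auto simp: bump_def mult_ac)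
qed

lemma summable_bump: "summable (bump J S n x)"
  using norm_suminf_le_freq(1)[OF norm_bump_le[of J S n x _ 0]] decay_const(1)[of n 0] by simp

lemma norm_bumps_le: "norm (bumps J S n x) \<le> decay_const n q * (8 / 8 ^ J) * \<bar>sin x\<bar> ^ q"
  using norm_suminf_le_freq(2)[OF norm_bump_le[of J S n x _ q]] decay_const(1)[of n q]
  by (simp add: bumps_def mult_ac)

lemma bump_deriv: "((\<lambda>x. bump J S n x j) has_vector_derivative bump J S (Suc n) x j) (at x)"
  unfolding bump_def using F_deriv[OF freq_ge_1, of n J j x]
  by (cases "j \<in> S") (auto intro: bounded_linear.has_vector_derivative[OF bounded_linear_scaleR_right])

text \<open>Termwise differentiation: the quadratic remainders of the summands have summable
  constants, given by the second derivatives.\<close>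

lemma bumps_deriv: "(bumps J S n has_vector_derivative bumps J S (Suc n) x) (at x)"
proof (rule has_vector_derivative_of_quadratic_remainder)
  fix y
  let ?K = "decay_const (Suc (Suc n)) 0"
  have "norm (bump J S n y j - bump J S n x j - (y - x) *\<^sub>R bump J S (Suc n) x j) \<le> (?K * (y - x)\<^sup>2) * exp (- freq J j / 4)" for j
  proof -
    define f where "f = (\<lambda>i::nat. if i = 0 then (\<lambda>y. bump J S n y j - bump J S n x j) else (\<lambda>y. bump J S (Suc n) y j))"
    have "norm (f 0 y - ((y - x) ^ 1 / fact 1) *\<^sub>R f 1 x) \<le> (?K * exp (- freq J j / 4)) * \<bar>y - x\<bar> ^ (1 + 1)"
    proof (rule taylor_lipschitz)
      fix i :: nat and z :: real assume "i < 1"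
      then show "(f i has_vector_derivative f (Suc i) z) (at z)"
        using has_vector_derivative_diff[OF bump_deriv[of J S n j z] has_vector_derivative_const[of "bump J S n x j"]]
        by (simp add: f_def)
    next
      fix u z
      have "norm (bump J S (Suc n) u j - bump J S (Suc n) z j) \<le> (?K * exp (- freq J j / 4)) * \<bar>u - z\<bar>"
        using vector_derivative_bound[of UNIV "\<lambda>x. bump J S (Suc n) x j" "\<lambda>x. bump J S (Suc (Suc n)) x j" "?K * exp (- freq J j / 4)" u z]
          bump_deriv norm_bump_le[of J S "Suc (Suc n)" _ j 0] by simp
      then show "norm (f 1 u - f 1 z) \<le> (?K * exp (- freq J j / 4)) * \<bar>u - z\<bar>" by (simp add: f_def)
    qed (simp add: f_def)
    then show ?thesis by (simp add: f_def power2_eq_square mult_ac)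
  qed
  from norm_suminf_le_freq(2)[OF this]
  have "norm (\<Sum>j. bump J S n y j - bump J S n x j - (y - x) *\<^sub>R bump J S (Suc n) x j) \<le> (?K * (y - x)\<^sup>2) * (8 / 8 ^ J)"
    using decay_const(1) by simp
  moreover have "(\<Sum>j. bump J S n y j - bump J S n x j - (y - x) *\<^sub>R bump J S (Suc n) x j)
    = bumps J S n y - bumps J S n x - (y - x) *\<^sub>R bumps J S (Suc n) x"
    unfolding bumps_def
    by (simp add: suminf_diff[symmetric] suminf_scaleR_right[symmetric] summable_bump summable_diff summable_scaleR_right)
  ultimately show "norm (bumps J S n y - bumps J S n x - (y - x) *\<^sub>R bumps J S (Suc n) x) \<le> (?K * (8 / 8 ^ J)) * (y - x)\<^sup>2"
    by (simp add: mult_ac)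
qed

text \<open>Summands before \<open>m\<close> cancel and the one at \<open>m\<close> is subtracted.
  For \<open>j > m\<close> the frequency is at least \<open>8 * freq J m\<close>, so half of it
  dominates \<open>2 * freq J m\<close> plus a quarter of itself, and that quarter is kept for
  summation.\<close>

lemma bumps_first_difference:
  assumes eq: "\<And>j. j < m \<Longrightarrow> j \<in> S \<longleftrightarrow> j \<in> S'" and m: "m \<in> S'" "m \<notin> S"
  shows "norm (bumps J S' 0 x - bumps J S 0 x - exp (- freq J m) *\<^sub>R F 0 (freq J m) x)
    \<le> decay_const 0 q * exp (- 2 * freq J m) * (8 / 8 ^ J) * \<bar>sin x\<bar> ^ q"
proof -
  let ?s = "\<lambda>j. if j = m then exp (- freq J m) *\<^sub>R F 0 (freq J m) x else 0"
  let ?d = "\<lambda>j. bump J S' 0 x j - bump J S 0 x j - ?s j"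
  let ?K = "decay_const 0 q"
  have "norm (?d j) \<le> (?K * exp (- 2 * freq J m) * \<bar>sin x\<bar> ^ q) * exp (- freq J j / 4)" for j
  proof (cases "j \<le> m")
    case True
    then have "?d j = 0" using eq[of j] m by (cases "j = m") (auto simp: bump_def)
    then show ?thesis using decay_const(1)[of 0 q] by simp
  next
    case False
    have "norm (?d j) \<le> exp (- freq J j) * cmod (F 0 (freq J j) x)" using False by (auto simp: bump_def)
    also have "\<dots> \<le> ?K * exp (- freq J j / 2) * \<bar>sin x\<bar> ^ q" by (rule decay_const(2)[OF freq_ge_1])
    also have "\<dots> \<le> ?K * (exp (- 2 * freq J m) * exp (- freq J j / 4)) * \<bar>sin x\<bar> ^ q"
    proof (intro mult_right_mono mult_left_mono)
      have "8 ^ (Suc m + J) \<le> (8::real) ^ (j + J)" using False by (intro power_increasing) auto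
      then have "8 * freq J m \<le> freq J j" by (simp add: freq_def)
      then show "exp (- freq J j / 2) \<le> exp (- 2 * freq J m) * exp (- freq J j / 4)"
        unfolding exp_add[symmetric] by simp
    qed (use decay_const(1) in auto)
    finally show ?thesis by (simp add: mult_ac)
  qed
  from norm_suminf_le_freq(2)[OF this]
  have "norm (suminf ?d) \<le> (?K * exp (- 2 * freq J m) * \<bar>sin x\<bar> ^ q) * (8 / 8 ^ J)"
    using decay_const(1)[of 0 q] by simp
  moreover have "?d sums (bumps J S' 0 x - bumps J S 0 x - exp (- freq J m) *\<^sub>R F 0 (freq J m) x)"
    unfolding bumps_def
    by (intro sums_diff summable_sums summable_bump sums_single)
  ultimately show ?thesis by (simp add: sums_unique[symmetric] mult_ac)
qed

end

theorem theorem1p2: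
  fixes \<alpha> \<beta> :: real and \<mu> :: complex and \<epsilon> :: real and s0 :: nat
  assumes "\<epsilon> > 0" and "int s0 \<ge> s_c \<alpha> \<beta> + 2"
  shows "\<exists>\<phi>0. Cinf \<phi>0 \<and> Cnorm s0 \<phi>0 < \<epsilon> \<and>
           (\<forall>\<delta>>0. \<not> (\<exists>\<phi>. is_Linf_Ck_solution \<alpha> \<beta> \<mu> (nat (s_c \<alpha> \<beta> + 2)) \<delta> \<phi>0 \<phi>))"
proof -
  define \<sigma> where "\<sigma> = sigma_c \<alpha> \<beta>"
  define k where "k = nat (s_c \<alpha> \<beta> + 2)"
  \<comment> \<open>Each of the \<open>s0 + 1\<close> suprema in the norm of
    \<open>\<eta> * sin x\<close> is at most \<open>\<eta>\<close>, so the sine part uses at most a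
    quarter of \<open>\<epsilon>\<close>.\<close>
  define \<eta> where "\<eta> = min 1 (\<epsilon> / (4 * (real s0 + 1)))"
  have \<eta>: "0 < \<eta>" "\<eta> \<le> 1" using assms(1) by (auto simp: \<eta>_def)
  have \<eta>\<epsilon>: "(real s0 + 1) * \<eta> \<le> \<epsilon> / 4"
  proof -
    have "(real s0 + 1) * \<eta> \<le> (real s0 + 1) * (\<epsilon> / (4 * (real s0 + 1)))" by (intro mult_left_mono) (auto simp: \<eta>_def)
    also have "\<dots> = \<epsilon> / 4"
    proof -
      have "real s0 + 1 \<noteq> 0" by linarith
      then show ?thesis by (simp add: divide_simps)
    qed
    finally show ?thesis .
  qed
  have k4: "4 \<le> k" by (simp add: k_def s_c_def)
  \<comment> \<open>The strict inequality comes from the floor: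
    \<open>\<lfloor>z\<rfloor> + 1\<close> exceeds \<open>z\<close>, here with
    \<open>z = \<sigma> - 1 / 2\<close>.\<close>
  have ksig: "\<sigma> + 3 / 2 < real k"
  proof -
    have "\<lfloor>\<sigma> - 1 / 2\<rfloor> + 3 \<le> int k" unfolding k_def s_c_def \<sigma>_def by simp
    then have "real_of_int (\<lfloor>\<sigma> - 1 / 2\<rfloor>) + 3 \<le> real k" by linarith
    then show ?thesis by linarith
  qed
  have par: "parameters \<alpha> \<beta> \<sigma> \<eta> M k" if "1 \<le> M" for M
    by unfold_locales (use \<eta> that k4 ksig in \<open>auto simp: \<sigma>_def sigma_c_def\<close>)
  obtain F where "packet_family \<sigma> F" using packet_family_exists by blast
  then interpret packet_family \<sigma> F .
  define Cs where "Cs = (\<Sum>n\<le>s0. decay_const n 0)"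
  \<comment> \<open>The three conditions serve, in this order, the tail bound by the squared
    amplitude, the closeness to \<open>\<eta> * sin x\<close>, and the smallness of the
    norm.\<close>
  obtain J where J: "decay_const 0 k * (8 / 8 ^ J) \<le> 1" "decay_const 0 1 * (8 / 8 ^ J) \<le> \<eta> / 10" "Cs * (8 / 8 ^ J) < \<epsilon> / 4"
  proof -
    have lim: "(\<lambda>J. c * (8 / 8 ^ J)) \<longlonglongrightarrow> 0" for c :: real
      using LIMSEQ_divide_realpow_zero[of 8 "c * 8"] by simp
    have "eventually (\<lambda>J. decay_const 0 k * (8 / 8 ^ J) < 1 \<and> decay_const 0 1 * (8 / 8 ^ J) < \<eta> / 10 \<and> Cs * (8 / 8 ^ J) < \<epsilon> / 4) sequentially"
      using \<eta> assms(1) by (intro eventually_conj order_tendstoD(2)[OF lim]) auto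
    from eventually_happens'[OF sequentially_bot this] show ?thesis using that less_imp_le by blast
  qed
  \<comment> \<open>All derivatives of the data at once: differentiating the sine shifts its
    argument by \<open>pi / 2\<close>.\<close>
  define G where "G = (\<lambda>S n x. complex_of_real (\<eta> * sin (x + real n * (pi / 2))) + bumps J S n x)"
  define ph where "ph = (\<lambda>S. G S 0)"
  have Gd: "(G S n has_vector_derivative G S (Suc n) x) (at x)" for S n x
  proof -
    have "((\<lambda>x. \<eta> * sin (x + real n * (pi / 2))) has_real_derivative \<eta> * cos (x + real n * (pi / 2))) (at x)"
      by (auto intro!: derivative_eq_intros)
    moreover have "cos (x + real n * (pi / 2)) = sin (x + real (Suc n) * (pi / 2))"
    proof -
      have "x + real (Suc n) * (pi / 2) = (x + real n * (pi / 2)) + pi / 2" by (simp add: distrib_right)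
      then show ?thesis by (simp only: sin_add[of "x + real n * (pi / 2)"]) simp
    qed
    ultimately show ?thesis unfolding G_def
      by (intro has_vector_derivative_add bumps_deriv has_vector_derivative_complex_of_real) simp
  qed
  have DG: "(Dx ^^ n) (ph S) = G S n" for S n
  proof (induction n)
    case (Suc n)
    have "Dx (G S n) = G S (Suc n)" unfolding Dx_def using vector_derivative_at[OF Gd] by auto
    then show ?case using Suc by simp
  qed (simp add: ph_def)
  have phx: "ph S x = of_real (\<eta> * sin x) + bumps J S 0 x" for S x by (simp add: ph_def G_def)
  have smooth: "Cinf (ph S)" for S
  proof -
    have "tper (ph S)"
    proof -
      have "F 0 \<nu> (x + 2 * pi) = F 0 \<nu> x" for \<nu> x by (simp add: F_0 packet_def)
      then show ?thesis by (simp add: tper_def phx bumps_def bump_def[abs_def] cong: if_cong)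
    qed
    moreover have "(G S n) differentiable (at x)" for n x using Gd differentiableI_vector by blast
    moreover have "continuous_on UNIV (G S n)" for n
      using Gd by (meson continuous_at_imp_continuous_on has_vector_derivative_continuous)
    ultimately show ?thesis by (simp add: Cinf_def Ck_def DG)
  qed
  have small: "Cnorm s0 (ph S) < \<epsilon>" for S
  proof -
    have "(SUP x. norm ((Dx ^^ n) (ph S) x)) \<le> \<eta> + decay_const n 0 * (8 / 8 ^ J)" for n
    proof (rule cSUP_least)
      fix x
      have "norm (complex_of_real (\<eta> * sin (x + real n * (pi / 2)))) \<le> \<eta> * 1"
        unfolding norm_of_real abs_mult using \<eta> by (intro mult_mono) auto
      then show "norm ((Dx ^^ n) (ph S) x) \<le> \<eta> + decay_const n 0 * (8 / 8 ^ J)"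
        unfolding DG G_def using norm_bumps_le[of J S n x 0] by (intro norm_triangle_le) simp
    qed simp
    then have "Cnorm s0 (ph S) \<le> (\<Sum>n\<le>s0. \<eta> + decay_const n 0 * (8 / 8 ^ J))"
      unfolding Cnorm_def by (intro sum_mono)
    also have "\<dots> = (real s0 + 1) * \<eta> + Cs * (8 / 8 ^ J)"
      unfolding sum.distrib Cs_def sum_distrib_right by (simp add: algebra_simps)
    also have "\<dots> < \<epsilon>" using \<eta>\<epsilon> J(3) assms(1) by linarith
    finally show ?thesis .
  qed
  show ?thesis
  proof (rule ccontr)
    assume no: "\<not> ?thesis"
    \<comment> \<open>One index controls both the size and the life span of the solution, so
      countably many classes cover all sets \<open>S\<close>.\<close>
    define \<A> where "\<A> = (\<lambda>n. {S. \<exists>U. csol \<alpha> \<beta> \<mu> (k - 1) (real (Suc n)) (1 / real (Suc n)) U \<and> U 0 0 = ph S})"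
    have cover: "\<exists>n. S \<in> \<A> n" for S
    proof -
      obtain \<delta> \<phi> where \<delta>: "0 < \<delta>" "is_Linf_Ck_solution \<alpha> \<beta> \<mu> k \<delta> (ph S) \<phi>"
        using no smooth[of S] small[of S] unfolding k_def by blast
      obtain U M where U: "csol \<alpha> \<beta> \<mu> (k - 1) M \<delta> U" "U 0 0 = ph S"
        using solution_is_classical[OF \<delta>(2) k4 \<delta>(1)] by blast
      obtain n :: nat where n: "max M (1 / \<delta>) \<le> real n" using real_arch_simple by blast
      have "M \<le> real (Suc n)" using n by simp
      moreover have "1 / real (Suc n) \<le> \<delta>"
      proof -
        have "1 / \<delta> \<le> real (Suc n)" using n by simp
        then have "1 \<le> real (Suc n) * \<delta>" using \<delta>(1) by (simp add: divide_le_eq)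
        then show ?thesis by (simp add: divide_le_eq mult.commute)
      qed
      ultimately have "csol \<alpha> \<beta> \<mu> (k - 1) (real (Suc n)) (1 / real (Suc n)) U" by (rule csol_mono[OF U(1)])
      then show ?thesis using U(2) by (auto simp: \<A>_def)
    qed
    have fin: "finite (\<A> n)" for n
    proof -
      have par': "parameters \<alpha> \<beta> \<sigma> \<eta> (real (Suc n)) k" by (rule par) simp
      define D where "D = max (decay_const 0 2 * (8 / 8 ^ J)) (2 * (decay_const 0 k * (8 / 8 ^ J)))"
      obtain \<nu>0 where \<nu>0: "\<And>\<nu> U V tail. \<nu>0 \<le> \<nu> \<Longrightarrow> csol \<alpha> \<beta> \<mu> (k - 1) (real (Suc n)) (1 / real (Suc n)) U \<Longrightarrow>
          csol \<alpha> \<beta> \<mu> (k - 1) (real (Suc n)) (1 / real (Suc n)) V \<Longrightarrow>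
          (\<forall>x. 0 \<le> sin x \<longrightarrow> norm (U 0 0 x - of_real (\<eta> * sin x)) \<le> \<eta> / 10 * sin x) \<Longrightarrow>
          (\<forall>x. 0 \<le> sin x \<longrightarrow> norm (V 0 0 x - of_real (\<eta> * sin x)) \<le> \<eta> / 10 * sin x) \<Longrightarrow>
          (\<forall>x. norm (U 0 0 x - of_real (\<eta> * sin x)) \<le> D * (sin x)\<^sup>2) \<Longrightarrow>
          (\<forall>x. norm (V 0 0 x - of_real (\<eta> * sin x)) \<le> D * (sin x)\<^sup>2) \<Longrightarrow>
          (\<forall>x. norm (V 0 0 x - U 0 0 x) \<le> D * \<bar>sin x\<bar> ^ k) \<Longrightarrow>
          (\<forall>x. 0 < sin x \<longrightarrow> V 0 0 x - U 0 0 x = of_real (exp (- \<nu>)) * packet \<sigma> (\<nu> ^ 5) x + tail x) \<Longrightarrow>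
          (\<forall>x. 0 < sin x \<longrightarrow> cmod (tail x) \<le> (exp (- \<nu>))\<^sup>2 * sin x ^ k) \<Longrightarrow> False"
        using parameters.solutions_determined[OF par', of "1 / real (Suc n)" \<mu>] by (metis of_nat_0_less_iff zero_less_Suc zero_less_divide_1_iff)
      obtain m0 :: nat where m0: "\<nu>0 \<le> real m0" using real_arch_simple by blast
      have d1: "norm (ph S x - of_real (\<eta> * sin x)) \<le> \<eta> / 10 * sin x" if "0 \<le> sin x" for S x
      proof -
        have "norm (bumps J S 0 x) \<le> (decay_const 0 1 * (8 / 8 ^ J)) * sin x" using norm_bumps_le[of J S 0 x 1] that by simp
        also have "\<dots> \<le> \<eta> / 10 * sin x" using J(2) that by (intro mult_right_mono)
        finally show ?thesis by (simp add: phx)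
      qed
      have d2: "norm (ph S x - of_real (\<eta> * sin x)) \<le> D * (sin x)\<^sup>2" for S x
      proof -
        have "norm (bumps J S 0 x) \<le> (decay_const 0 2 * (8 / 8 ^ J)) * (sin x)\<^sup>2" using norm_bumps_le[of J S 0 x 2] by simp
        also have "\<dots> \<le> D * (sin x)\<^sup>2" by (intro mult_right_mono) (auto simp: D_def)
        finally show ?thesis by (simp add: phx)
      qed
      have d3: "norm (ph S' x - ph S x) \<le> D * \<bar>sin x\<bar> ^ k" for S S' x
      proof -
        have "norm (bumps J S' 0 x - bumps J S 0 x) \<le> (2 * (decay_const 0 k * (8 / 8 ^ J))) * \<bar>sin x\<bar> ^ k"
          using norm_triangle_ineq4[of "bumps J S' 0 x" "bumps J S 0 x"] norm_bumps_le[of J S 0 x k] norm_bumps_le[of J S' 0 x k]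
          by (simp only: mult.assoc mult_2 distrib_right)
        also have "\<dots> \<le> D * \<bar>sin x\<bar> ^ k" by (intro mult_right_mono) (auto simp: D_def)
        finally show ?thesis by (simp add: phx)
      qed
      \<comment> \<open>Two members of a class cannot first differ at an index
        \<open>m \<ge> m0\<close>. The set containing \<open>m\<close> supplies the second solution,
        so the claim is applied below in both orders.\<close>
      have key: False if S: "S \<in> \<A> n" "S' \<in> \<A> n" and eq: "\<And>j. j < m \<Longrightarrow> j \<in> S \<longleftrightarrow> j \<in> S'"
        and m: "m0 \<le> m" "m \<in> S'" "m \<notin> S" for S S' m
      proof -
        obtain U where U: "csol \<alpha> \<beta> \<mu> (k - 1) (real (Suc n)) (1 / real (Suc n)) U" "U 0 0 = ph S" using S(1) by (auto simp: \<A>_def)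
        obtain V where V: "csol \<alpha> \<beta> \<mu> (k - 1) (real (Suc n)) (1 / real (Suc n)) V" "V 0 0 = ph S'" using S(2) by (auto simp: \<A>_def)
        let ?\<nu> = "freq J m"
        define tail where "tail = (\<lambda>x. ph S' x - ph S x - of_real (exp (- ?\<nu>)) * packet \<sigma> (?\<nu> ^ 5) x)"
        have "real m0 \<le> ?\<nu>"
        proof -
          have "real m0 \<le> real (m + J)" using m by simp
          also have "\<dots> \<le> 2 ^ (m + J)" using of_nat_less_two_power[of "m + J", where ?'a=real] by linarith
          also have "\<dots> \<le> ?\<nu>" unfolding freq_def by (intro power_mono) auto
          finally show ?thesis .
        qed
        then have \<nu>: "\<nu>0 \<le> ?\<nu>" using m0 by linarith
        have tl: "cmod (tail x) \<le> (exp (- ?\<nu>))\<^sup>2 * sin x ^ k" if x: "0 < sin x" for x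
        proof -
          have "tail x = bumps J S' 0 x - bumps J S 0 x - exp (- ?\<nu>) *\<^sub>R F 0 ?\<nu> x"
            using x by (simp add: tail_def phx F_0 scaleR_conv_of_real)
          then have "cmod (tail x) \<le> decay_const 0 k * exp (- 2 * ?\<nu>) * (8 / 8 ^ J) * \<bar>sin x\<bar> ^ k"
            using bumps_first_difference[OF eq m(2,3), of J x k] by simp
          also have "\<dots> = (decay_const 0 k * (8 / 8 ^ J)) * (exp (- 2 * ?\<nu>) * sin x ^ k)" using x by (simp add: mult_ac)
          also have "\<dots> \<le> 1 * (exp (- 2 * ?\<nu>) * sin x ^ k)" using J(1) x by (intro mult_right_mono) auto
          also have "exp (- 2 * ?\<nu>) = (exp (- ?\<nu>))\<^sup>2" unfolding power2_eq_square exp_add[symmetric] by simp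
          finally show ?thesis by simp
        qed
        show False
          by (rule \<nu>0[OF \<nu> U(1) V(1), of tail]) (use d1 d2 d3 tl in \<open>auto simp: U(2) V(2) tail_def\<close>)
      qed
      \<comment> \<open>Members of a class are determined by their elements below \<open>m0\<close>,
        so the class embeds into a finite power set.\<close>
      have "inj_on (\<lambda>S. S \<inter> {..<m0}) (\<A> n)"
      proof (rule inj_onI, rule ccontr)
        fix S S' assume S: "S \<in> \<A> n" "S' \<in> \<A> n" and e: "S \<inter> {..<m0} = S' \<inter> {..<m0}" and "S \<noteq> S'"
        then have ex: "\<exists>j. (j \<in> S) \<noteq> (j \<in> S')" by blast
        define m where "m = (LEAST j. (j \<in> S) \<noteq> (j \<in> S'))"
        have m: "(m \<in> S) \<noteq> (m \<in> S')" unfolding m_def by (rule LeastI_ex[OF ex])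
        have lt: "(j \<in> S) = (j \<in> S')" if "j < m" for j using not_less_Least[of j] that unfolding m_def by blast
        have "m0 \<le> m"
        proof (rule ccontr)
          assume "\<not> m0 \<le> m"
          then have "m \<in> {..<m0}" by simp
          then show False using m e by blast
        qed
        then show False using key[OF S, of m] key[OF S(2,1), of m] lt m by blast
      qed
      moreover have "finite ((\<lambda>S. S \<inter> {..<m0}) ` \<A> n)"
        by (rule finite_subset[of _ "Pow {..<m0}"]) auto
      ultimately show ?thesis using finite_imageD by blast
    qed
    have "countable (\<Union>n. \<A> n)" using fin by (intro countable_UN) (auto intro: countable_finite)
    moreover have "(\<Union>n. \<A> n) = UNIV" using cover by blast
    ultimately have "countable (UNIV :: nat set set)" by simp
    \<comment> \<open>An enumeration of all sets of naturals would be a surjection from the naturals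
      onto their power set.\<close>
    then have "range (from_nat_into (UNIV :: nat set set)) = UNIV" by (intro range_from_nat_into) auto
    then show False using Cantors_theorem[of "UNIV :: nat set"] by (metis Pow_UNIV)
  qed
qed

end
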